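(* Let $\Lambda\subseteq\mathbb R^d$ be a lattice and let $P:\mathbb R^d\to\mathbb C$ be a polynomial of degree $m$. Then for $\nu\in\mathbb C$ with $\operatorname{Re}\nu>d+m$, the Hadamard sum-integral equals its associated Dirichlet series, $$\lim_{\beta\to0}\mathrm{HSI}_{\boldsymbol z\in\mathbb R^d,\Lambda}\ \hat\chi_\beta(\boldsymbol z)\frac{P(\boldsymbol z)}{|\boldsymbol z|^\nu}=\sum_{\boldsymbol z\in\Lambda\setminus\{\boldsymbol 0\}}\frac{P(\boldsymbol z)}{|\boldsymbol z|^\nu}.$$ The left-hand side forms, as a function of $\nu$, the meromorphic continuation of the Dirichlet series to $\nu\in\mathbb C$, whose simple poles lie at $\nu=d+2k$, $k\in\mathbb N$, with residues $$\frac{\omega_d}{V_\Lambda}\,\frac{(1/2)_k}{(2k)!\,(d/2)_k}\,\Delta^kP(\boldsymbol 0)$$ (where a vanishing residue means that there is no pole at that point).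
   Context: $d\ge1$, $\mathbb N=\{0,1,2,\dots\}$. A lattice is $\Lambda=M\mathbb Z^d$ with $M\in\mathbb R^{d\times d}$ invertible; $V_\Lambda=|\det M|$. $B_r$ is the open ball of radius $r$ about $\boldsymbol0$; $\omega_d$ is the surface area of the unit sphere in $\mathbb R^d$; $(x)_k=x(x+1)\cdots(x+k-1)$ is the Pochhammer symbol. Smooth cutoff functions: $\chi\in C_0^\infty(B_1)$, $\chi\ge0$, rotationally invariant, $\int\chi=1$, $\chi_\beta=\beta^{-d}\chi(\cdot/\beta)$ for $\beta>0$, $\hat\chi_\beta(\boldsymbol\xi)=\int e^{-2\pi i\langle\boldsymbol\xi,\boldsymbol x\rangle}\chi_\beta(\boldsymbol x)\,d\boldsymbol x$ (a Schwartz function). Hadamard integral: with $\ell_{\nu,d}=\lfloor\operatorname{Re}\nu-d\rfloor$ and $g\in C^\infty(\mathbb R^d)$ rapidly decaying, $$\mathrm{f.p.}\!\int_{\mathbb R^d}\frac{g(\boldsymbol z)}{|\boldsymbol z|^\nu}\,d\boldsymbol z=\lim_{\varepsilon\to0}\Big(\int_{\mathbb R^d\setminus B_\varepsilon}\frac{g(\boldsymbol z)}{|\boldsymbol z|^\nu}\,d\boldsymbol z-(\mathcal H_{\nu,\varepsilon}g)(\boldsymbol 0)\Big),$$ with, for $\nu\notin d+\mathbb N$, $\mathcal H_{\nu,\varepsilon}=\sum_{k=0}^{\ell_{\nu,d}}\frac1{k!}\int_{\mathbb R^d\setminus B_\varepsilon}\frac{\langle\boldsymbol y,\nabla\rangle^k}{|\boldsymbol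 y|^\nu}\,d\boldsymbol y$ (empty sum if $\ell_{\nu,d}<0$), and for $\nu\in d+\mathbb N$ the same expression except that in the term $k=\ell_{\nu,d}$ the integration region is $B_1\setminus B_\varepsilon$. If $\nu\notin\mathbb R$ and $\operatorname{Re}\nu-d\in\mathbb N$, the radial integral in the term $k=\ell_{\nu,d}$ is understood by analytic continuation in $\nu$, i.e. $\int_\varepsilon^\infty r^{k+d-1-\nu}\,dr:=\varepsilon^{k+d-\nu}/(\nu-k-d)$. For $\nu\in d+2\mathbb N$ the Hadamard integral is only defined up to the choice of the neighbourhood $B_1$, and these are the possible poles. Hadamard sum-integral: $$\mathrm{HSI}_{\boldsymbol z\in\mathbb R^d,\Lambda}\frac{g(\boldsymbol z)}{|\boldsymbol z|^\nu}=\sum_{\boldsymbol z\in\Lambda\setminus\{\boldsymbol0\}}\frac{g(\boldsymbol z)}{|\boldsymbol z|^\nu}-\frac1{V_\Lambda}\,\mathrm{f.p.}\!\int_{\mathbb R^d}\frac{g(\boldsymbol z)}{|\boldsymbol z|^\nu}\,d\boldsymbol z .$$ *)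

theory Defs
  imports "HOL-Complex_Analysis.Complex_Analysis" "HOL-Library.Poly_Mapping"
begin

section \<open>Differential operators\<close>

definition partial_deriv :: "'n \<Rightarrow> (real^'n \<Rightarrow> 'b) \<Rightarrow> real^'n \<Rightarrow> 'b::real_normed_vector" where
  "partial_deriv i f x = vector_derivative (\<lambda>t. f (x + t *\<^sub>R axis i 1)) (at 0)"

text \<open>The operator \<open>\<langle>y, \<nabla>\<rangle>\<close>; its powers are iterates of \<open>dir_nabla y\<close> with \<open>y\<close> held constant.\<close>

definition dir_nabla :: "real^'n \<Rightarrow> (real^'n \<Rightarrow> complex) \<Rightarrow> real^'n \<Rightarrow> complex" where
  "dir_nabla y f x = (\<Sum>i\<in>UNIV. of_real (y $ i) * partial_deriv i f x)"

definition laplacian :: "(real^'n \<Rightarrow> complex) \<Rightarrow> real^'n \<Rightarrow> complex" where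
  "laplacian f x = (\<Sum>i\<in>UNIV. partial_deriv i (partial_deriv i f) x)"

text \<open>\<open>C\<^sup>\<infinity>\<close>: all iterated partial derivatives are (Frechet) differentiable everywhere, which also
  makes all of them continuous.\<close>

definition smooth :: "(real^'n \<Rightarrow> real) \<Rightarrow> bool" where
  "smooth f \<longleftrightarrow> (\<forall>js. foldr partial_deriv js f differentiable_on UNIV)"


section \<open>Polynomials in several variables with complex coefficients\<close>

text \<open>Monomials are exponent vectors; a polynomial is a finitely supported map from monomials to
  coefficients. The zero polynomial is given degree 0.\<close>

definition poly_fun :: "(('n \<Rightarrow> nat) \<Rightarrow>\<^sub>0 complex) \<Rightarrow> real^'n \<Rightarrow> complex" where
  "poly_fun p z = (\<Sum>\<alpha>\<in>Poly_Mapping.keys p.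
      Poly_Mapping.lookup p \<alpha> * (\<Prod>i\<in>UNIV. of_real (z $ i) ^ \<alpha> i))"

definition total_degree :: "(('n::finite \<Rightarrow> nat) \<Rightarrow>\<^sub>0 complex) \<Rightarrow> nat" where
  "total_degree p = Max (insert 0 ((\<lambda>\<alpha>. \<Sum>i\<in>UNIV. \<alpha> i) ` Poly_Mapping.keys p))"


section \<open>Lattices\<close>

definition lattice_of :: "real^'n^'n \<Rightarrow> (real^'n) set" where
  "lattice_of M = {M *v x | x. \<forall>i. x $ i \<in> \<int>}"


section \<open>Surface measure of the unit sphere\<close>

text \<open>\<open>\<sigma>(E) = d \<cdot> vol {r\<theta> | \<theta> \<in> E, 0 < r < 1}\<close>. This is the measure for which
  \<open>\<integral> f dy = \<integral>\<^sub>0\<^sup>\<infinity> \<integral> f(r\<theta>) r\<^sup>d\<^sup>-\<^sup>1 d\<sigma>(\<theta>) dr\<close>; it lives on the type of all vectors and is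
  concentrated on the unit sphere.\<close>

definition sphere_measure :: "(real^'n) measure" where
  "sphere_measure = scale_measure (of_nat CARD('n))
     (distr (restrict_space lborel (ball 0 1)) borel sgn)"


section \<open>Smooth cutoff functions\<close>

text \<open>Rotational invariance is invariance under all linear isometries, so that it means that
  \<open>\<phi> x\<close> depends on the norm of \<open>x\<close> only, in dimension 1 as well.\<close>

definition smooth_cutoff :: "(real^'n \<Rightarrow> real) \<Rightarrow> bool" where
  "smooth_cutoff \<phi> \<longleftrightarrow> smooth \<phi> \<and> closure {x. \<phi> x \<noteq> 0} \<subseteq> ball 0 1 \<and> (\<forall>x. \<phi> x \<ge> 0) \<and>
     (\<forall>f x. orthogonal_transformation f \<longrightarrow> \<phi> (f x) = \<phi> x) \<and>
     integral\<^sup>L lborel \<phi> = 1"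

definition scaled :: "(real^'n \<Rightarrow> real) \<Rightarrow> real \<Rightarrow> real^'n \<Rightarrow> real" where
  "scaled \<phi> \<beta> x = \<phi> (x /\<^sub>R \<beta>) / \<beta> ^ CARD('n)"

definition fourier :: "(real^'n \<Rightarrow> real) \<Rightarrow> real^'n \<Rightarrow> complex" where
  "fourier f \<xi> = (\<integral>x. exp (- 2 * of_real pi * \<i> * of_real (\<xi> \<bullet> x)) * of_real (f x) \<partial>lborel)"


section \<open>Hadamard integral and Hadamard sum-integral\<close>

text \<open>The summand of index \<open>k\<close> in \<open>(\<H>\<^sub>\<nu>\<^sub>,\<^sub>\<epsilon> g)(0)\<close>. Within the range of summation the first two
  cases can occur for \<open>k = \<lfloor>Re \<nu> - d\<rfloor>\<close> only. In the second one \<open>\<nu>\<close> is not real, and the radial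
  factor of the integral is the analytic continuation of \<open>\<integral>\<^sub>\<epsilon>\<^sup>\<infinity> r\<^sup>k\<^sup>+\<^sup>d\<^sup>-\<^sup>1\<^sup>-\<^sup>\<nu> dr\<close>.\<close>

definition hadamard_term :: "complex \<Rightarrow> real \<Rightarrow> (real^'n \<Rightarrow> complex) \<Rightarrow> nat \<Rightarrow> complex" where
  "hadamard_term \<nu> \<epsilon> g k = 1 / fact k *
     (if \<nu> = of_nat (CARD('n) + k) then
        (LINT y : ball 0 1 - ball 0 \<epsilon> | lborel. (dir_nabla y ^^ k) g 0 / of_real (norm y) powr \<nu>)
      else if Re \<nu> = of_nat (CARD('n) + k) then
        (\<integral>\<theta>. (dir_nabla \<theta> ^^ k) g 0 \<partial>sphere_measure) *
        (of_real \<epsilon> powr (of_nat (CARD('n) + k) - \<nu>) / (\<nu> - of_nat (CARD('n) + k)))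
      else
        (LINT y : - ball 0 \<epsilon> | lborel. (dir_nabla y ^^ k) g 0 / of_real (norm y) powr \<nu>))"

definition hadamard_op :: "complex \<Rightarrow> real \<Rightarrow> (real^'n \<Rightarrow> complex) \<Rightarrow> complex" where
  "hadamard_op \<nu> \<epsilon> g =
     (\<Sum>k | int k \<le> \<lfloor>Re \<nu> - of_nat CARD('n)\<rfloor>. hadamard_term \<nu> \<epsilon> g k)"

definition fp_integral :: "complex \<Rightarrow> (real^'n \<Rightarrow> complex) \<Rightarrow> complex" where
  "fp_integral \<nu> g = Lim (at_right 0) (\<lambda>\<epsilon>.
     (LINT z : - ball 0 \<epsilon> | lborel. g z / of_real (norm z) powr \<nu>) - hadamard_op \<nu> \<epsilon> g)"

definition HSI :: "real^'n^'n \<Rightarrow> complex \<Rightarrow> (real^'n \<Rightarrow> complex) \<Rightarrow> complex" where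
  "HSI M \<nu> g = (\<Sum>\<^sub>\<infinity>z\<in>lattice_of M - {0}. g z / of_real (norm z) powr \<nu>)
     - 1 / of_real \<bar>det M\<bar> * fp_integral \<nu> g"


section \<open>The residues\<close>

definition dirichlet_residue :: "real^'n^'n \<Rightarrow> (real^'n \<Rightarrow> complex) \<Rightarrow> nat \<Rightarrow> complex" where
  "dirichlet_residue M P k =
     of_real (measure (sphere_measure :: (real^'n) measure) UNIV / \<bar>det M\<bar>) *
     of_real (pochhammer (1/2) k / (fact (2 * k) * pochhammer (of_nat CARD('n) / 2) k)) *
     (laplacian ^^ k) P 0"

end

theory Submission
  imports Defs "HOL-Probability.Distributions"
begin

text \<open>
  Write \<open>g = \<phi>\<^sub>\<beta>\<^sup>\<and> P\<close> and \<open>d\<close> for the dimension. After multiplication by \<open>\<Gamma>(\<nu>/2) \<pi>\<^bsup>-\<nu>/2\<^esup>\<close> the lattice sum and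
  the integral become Mellin transforms, at \<open>\<nu>/2\<close>, of \<open>S(t) = \<Sum>\<^bsub>z \<noteq> 0\<^esub> g(z) e\<^bsup>-\<pi>t|z|\<^sup>2\<^esup>\<close> and of
  \<open>I(t) = \<integral> g(z) e\<^bsup>-\<pi>t|z|\<^sup>2\<^esup> dz\<close>. By Poisson summation, and because the scaled cutoff is supported away from the
  non-zero dual lattice points when \<open>\<beta>\<close> is small, \<open>P(0) + S - I/V\<close> vanishes to all orders at \<open>t = 0\<close>, uniformly in
  \<open>\<beta>\<close>, while \<open>S\<close> decays exponentially at infinity. Splitting the integrals at \<open>t = 1\<close> therefore leaves, up
  to entire functions of \<open>\<nu>\<close> that are continuous at \<open>\<beta> = 0\<close>, only the Mellin integral of \<open>I\<close> over \<open>t > 1\<close>.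

  The Fourier transform of \<open>P(z) e\<^bsup>-\<pi>t|z|\<^sup>2\<^esup>\<close> is a Gaussian times a polynomial in \<open>1/t\<close>; averaging it against
  \<open>\<phi>\<^sub>\<beta>\<close> gives \<open>I(t) = t\<^bsup>-d/2\<^esup> (\<Sum>\<^bsub>n<N\<^esub> b\<^sub>n(\<beta>) t\<^bsup>-n\<^esup> + O(t\<^bsup>-N\<^esup>))\<close>, hence simple poles at \<open>d + 2n\<close>, and
  \<open>b\<^sub>n(0) = \<Delta>\<^sup>nP(0) / (n! (4\<pi>)\<^sup>n)\<close> by the heat equation. For \<open>\<beta> > 0\<close> the Hadamard integral is, off its poles,
  the analytic continuation of the ordinary integral, so the identity theorem extends the resulting formula for
  the sum-integral from \<open>0 < Re \<nu> < d\<close> to all \<open>\<nu>\<close>. At \<open>\<nu> = d + 2n\<close> the finite parts differ by a multiple of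
  \<open>b\<^sub>n(\<beta>)\<close>, which tends to zero exactly when there is no residue.
\<close>

section \<open>Polar coordinates\<close>

text \<open>Without the cutoff there is in general no exponent at which series and integral both
  converge: the series asks for Re \<nu> > d + m, the integral near the origin for Re \<nu> < d.
  Hence the identity for \<beta> > 0 is obtained in one strip and the identity for \<beta> = 0 in a
  half-plane to its right; they meet only because both are values of one expression,
  \<open>continuation N \<beta> \<nu>\<close>, in which \<beta> can tend to 0 at fixed \<nu>. The
  polar terms match because a power with exponent s - 1 integrates to 1/s over (0,1) and to -1/s
  over (1,\<infinity>), in complementary ranges of s.

  Sums of terms c/(x - \<nu>) are read with the convention that division by zero gives zero. A term
  thus drops out at its own pole, which is exactly the finite part selected by Hadamard's definition
  with the unit ball as neighbourhood, so one formula covers poles and regular points. The two sides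
  nevertheless differ at a pole x: Hadamard's polar terms have constant numerators, those of the
  continuation have numerator c G(\<nu>) with G a reciprocal Gamma factor. The discrepancy is c
  times the derivative of G at x.\<close>

lemma measurable_sgn_vec [measurable]: "(sgn :: real^'n \<Rightarrow> real^'n) \<in> borel_measurable borel"
proof -
  have "(sgn :: real^'n \<Rightarrow> real^'n) = (\<lambda>x. inverse (norm x) *\<^sub>R x)"
    by (rule ext) (simp add: sgn_div_norm)
  then show ?thesis by simp
qed

lemma sets_sphere_measure [measurable_cong, simp]: "sets sphere_measure = sets borel"
  by (simp add: sphere_measure_def)

lemma space_sphere_measure [simp]: "space sphere_measure = UNIV"
  unfolding sphere_measure_def by (simp add: space_scale_measure)

text \<open>Removing the origin, where \<open>sgn\<close> vanishes, changes the preimage by a null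
  set. What remains is the cone over \<open>A\<close> cut off at radius 1, whose dilations are the
  cones cut off at other radii.\<close>

lemma emeasure_sphere_measure:
  assumes [measurable]: "A \<in> sets borel"
  shows "emeasure (sphere_measure :: (real^'n) measure) A
    = of_nat CARD('n) * emeasure lborel {y. 0 < norm y \<and> norm y < 1 \<and> sgn y \<in> A}"
proof -
  have "emeasure (sphere_measure :: (real^'n) measure) A
     = of_nat CARD('n) * emeasure lborel (sgn -` A \<inter> ball 0 1)"
    unfolding sphere_measure_def
    by (subst emeasure_scale_measure, subst emeasure_distr)
      (auto simp: emeasure_restrict_space space_restrict_space measurable_restrict_space1)
  also have "emeasure lborel (sgn -` A \<inter> ball 0 1) = emeasure lborel {y. 0 < norm y \<and> norm y < 1 \<and> sgn y \<in> A}"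
  proof (rule emeasure_eq_AE)
    show "AE x in lborel. (x \<in> sgn -` A \<inter> ball 0 1) = (x \<in> {y. 0 < norm y \<and> norm y < 1 \<and> sgn y \<in> A})"
      using AE_lborel_singleton[of "0::real^'n"] by eventually_elim auto
    have "sgn -` A \<in> sets borel" by (rule measurable_sets_borel[OF measurable_sgn_vec]) simp
    then show "sgn -` A \<inter> ball 0 1 \<in> sets lborel" by simp
  qed measurable
  finally show ?thesis .
qed

lemma finite_measure_sphere_measure: "finite_measure (sphere_measure :: (real^'n) measure)"
proof
  have "emeasure lborel {y::real^'n. 0 < norm y \<and> norm y < 1 \<and> sgn y \<in> UNIV} \<le> emeasure lborel (ball (0::real^'n) 1)"
    by (rule emeasure_mono) auto
  also have "\<dots> < \<infinity>" using emeasure_bounded_finite[OF bounded_ball] by simp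
  finally show "emeasure (sphere_measure :: (real^'n) measure) (space sphere_measure) \<noteq> \<infinity>"
    by (auto simp: emeasure_sphere_measure ennreal_mult_eq_top_iff)
qed

lemma emeasure_lborel_scaleR_vimage:
  assumes "R > 0" and [measurable]: "S \<in> sets (borel :: (real^'n) measure)"
  shows "emeasure lborel S = ennreal (R ^ CARD('n)) * emeasure lborel ((\<lambda>x. R *\<^sub>R x) -` S)"
proof -
  have "emeasure lborel S = emeasure (density (distr lborel borel (\<lambda>x. 0 + R *\<^sub>R x))
      (\<lambda>_. ennreal (\<bar>R\<bar> ^ DIM(real^'n)))) S"
    using assms by (subst lborel_affine[of R 0]) auto
  also have "\<dots> = ennreal (R ^ CARD('n)) * emeasure lborel ((\<lambda>x. R *\<^sub>R x) -` S)"
    using assms by (subst emeasure_density)  (auto simp: emeasure_distr nn_integral_cmult_indicator)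
  finally show ?thesis .
qed

definition radial_measure :: "nat \<Rightarrow> real measure" where
  "radial_measure d = density lborel (\<lambda>r. ennreal (indicator {0<..} r * r ^ (d - 1)))"

lemma sets_radial_measure [measurable_cong, simp]: "sets (radial_measure d) = sets borel"
  and space_radial_measure [simp]: "space (radial_measure d) = UNIV"
  by (simp_all add: radial_measure_def)

lemma emeasure_radial_lessThan:
  assumes "d > 0"
  shows "emeasure (radial_measure d) {..<R} = ennreal (if R > 0 then R ^ d / d else 0)"
proof (cases "R > 0")
  case True
  have "emeasure (radial_measure d) {..<R} = (\<integral>\<^sup>+r. ennreal (r ^ (d - 1)) * indicator {0..R} r \<partial>lborel)"
    unfolding radial_measure_def
    by (subst emeasure_density, simp, simp, rule nn_integral_cong_AE)
      (use AE_lborel_singleton[of "0::real"] AE_lborel_singleton[of R] in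
        \<open>eventually_elim, auto simp: indicator_def\<close>)
  also have "\<dots> = ennreal (R ^ d / d - 0 ^ d / d)"
  proof (rule nn_integral_FTC_Icc)
    fix x :: real assume "x \<in> {0..R}"
    then have "0 \<le> x" by simp
    show "((\<lambda>x. x ^ d / d) has_real_derivative x ^ (d - 1)) (at x)"
      using assms by (auto intro!: derivative_eq_intros)
    show "0 \<le> x ^ (d - 1)" using \<open>0 \<le> x\<close> by simp
  qed (use True in auto)
  finally show ?thesis using True assms by (simp add: zero_power)
next
  case False
  have "emeasure (radial_measure d) {..<R} = (\<integral>\<^sup>+r. 0 \<partial>(lborel :: real measure))"
    unfolding radial_measure_def using False
    by (subst emeasure_density, simp, simp) (intro nn_integral_cong, auto simp: indicator_def)
  then show ?thesis using False by simp
qed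

lemma sigma_finite_radial_measure: "sigma_finite_measure (radial_measure d)"
  unfolding radial_measure_def
  by (subst sigma_finite_measure.sigma_finite_iff_density_finite[OF sigma_finite_lborel]) auto

text \<open>Rectangles suffice because both factors are sigma-finite. With the set of directions
  fixed, both sides are measures in the radius alone, and on a half-line \<open>{..<R}\<close> they
  agree since dilation by R multiplies Lebesgue measure by the d-th power of R.\<close>

theorem polar_coordinates:
  "radial_measure CARD('n) \<Otimes>\<^sub>M (sphere_measure :: (real^'n) measure)
    = distr lborel (borel \<Otimes>\<^sub>M borel) (\<lambda>y. (norm y, sgn y))"
proof (rule pair_measure_eqI)
  show "sigma_finite_measure (radial_measure CARD('n))" by (rule sigma_finite_radial_measure)
  interpret sph: finite_measure "sphere_measure :: (real^'n) measure"
    by (rule finite_measure_sphere_measure)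
  show "sigma_finite_measure (sphere_measure :: (real^'n) measure)" ..
  show "sets (radial_measure CARD('n) \<Otimes>\<^sub>M (sphere_measure :: (real^'n) measure)) =
    sets (distr lborel (borel \<Otimes>\<^sub>M borel) (\<lambda>y::real^'n. (norm y, sgn y)))"
    by (simp cong: sets_pair_measure_cong)
  fix B :: "real set" and A :: "(real^'n) set"
  assume "B \<in> sets (radial_measure CARD('n))" "A \<in> sets sphere_measure"
  then have [measurable]: "B \<in> sets borel" "A \<in> sets borel" by auto
  define N1 where "N1 = scale_measure (emeasure sphere_measure A) (radial_measure CARD('n))"
  define N2 where "N2 = distr (density lborel (indicator {y. y \<noteq> 0 \<and> sgn y \<in> A})) borel (norm :: real^'n \<Rightarrow> real)"
  have N2: "emeasure N2 C = emeasure lborel {y. y \<noteq> 0 \<and> sgn y \<in> A \<and> norm y \<in> C}"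
    if [measurable]: "C \<in> sets borel" for C
  proof -
    have "norm -` C \<in> sets (borel :: (real^'n) measure)"
      by (rule measurable_sets_borel[where M = borel]) auto
    then have "emeasure N2 C = (\<integral>\<^sup>+y. indicator {y. y \<noteq> 0 \<and> sgn y \<in> A \<and> norm y \<in> C} y \<partial>lborel)"
      unfolding N2_def
      by (subst emeasure_distr, simp, simp, subst emeasure_density, simp, simp)
        (intro nn_integral_cong, auto simp: indicator_def)
    then show ?thesis by (subst (asm) nn_integral_indicator) simp_all
  qed
  have N12: "emeasure N1 {..<R} = emeasure N2 {..<R}" for R
  proof (cases "R > 0")
    case True
    have "emeasure N2 {..<R} = emeasure lborel {y. 0 < norm y \<and> norm y < R \<and> sgn y \<in> A}"
      by (subst N2, simp, rule arg_cong[where f = "emeasure lborel"]) auto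
    also have "\<dots> = ennreal (R ^ CARD('n)) *
        emeasure lborel ((\<lambda>x. R *\<^sub>R x) -` {y. 0 < norm y \<and> norm y < R \<and> sgn y \<in> A})"
      by (rule emeasure_lborel_scaleR_vimage[OF True]) measurable
    also have "(\<lambda>x. R *\<^sub>R x) -` {y. 0 < norm y \<and> norm y < R \<and> sgn y \<in> A}
        = {y. 0 < norm y \<and> norm y < 1 \<and> sgn y \<in> A}"
      using True by (auto simp: sgn_scaleR)
    finally have 1: "emeasure N2 {..<R} = ennreal (R ^ CARD('n)) *
        emeasure lborel {y. 0 < norm y \<and> norm y < 1 \<and> sgn y \<in> A}" .
    have "emeasure N1 {..<R} = (ennreal (R ^ CARD('n) / CARD('n)) * of_nat CARD('n)) *
         emeasure lborel {y. 0 < norm y \<and> norm y < 1 \<and> sgn y \<in> A}"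
      unfolding N1_def using True
      by (simp add: emeasure_radial_lessThan emeasure_sphere_measure mult_ac)
    also have "ennreal (R ^ CARD('n) / CARD('n)) * of_nat CARD('n) = ennreal (R ^ CARD('n))"
      using True by (simp add: ennreal_of_nat_eq_real_of_nat flip: ennreal_mult)
    finally show ?thesis using 1 by simp
  next
    case False
    have e: "{y::real^'n. y \<noteq> 0 \<and> sgn y \<in> A \<and> norm y < R} = {}"
    proof -
      have "\<not> norm y < R" for y :: "real^'n" using False norm_ge_zero[of y] by linarith
      then show ?thesis by auto
    qed
    have "emeasure N2 {..<R} = 0"
      by (subst N2, simp) (simp only: lessThan_iff e emeasure_empty)
    then show ?thesis using False
      by (simp add: N1_def emeasure_radial_lessThan)
  qed
  have "N1 = N2"
  proof (rule measure_eqI_generator_eq[where E = "range lessThan" and \<Omega> = UNIV and A = "\<lambda>i. {..<real i}"])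
    show "Int_stable (range (lessThan :: real \<Rightarrow> _))"
      unfolding Int_stable_def
    proof safe
      fix a b :: real
      have "{..<a} \<inter> {..<b} = {..<min a b}" by auto
      then show "{..<a} \<inter> {..<b} \<in> range lessThan" by blast
    qed
    show "sets N1 = sigma_sets UNIV (range lessThan)" "sets N2 = sigma_sets UNIV (range lessThan)"
      unfolding N1_def N2_def by (simp_all add: borel_Iio)
    show "(\<Union>i. {..<real i}) = UNIV" using reals_Archimedean2 by auto
    show "emeasure N1 {..<real i} \<noteq> \<infinity>" for i
      unfolding N1_def using sph.emeasure_finite[of A]
      by (auto simp: emeasure_radial_lessThan ennreal_mult_eq_top_iff)
  qed (use N12 in auto)
  then have "emeasure N1 B = emeasure N2 B" by simp
  also have "\<dots> = emeasure lborel {y. y \<noteq> 0 \<and> sgn y \<in> A \<and> norm y \<in> B}" by (rule N2) simp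
  also have "\<dots> = emeasure lborel {y. sgn y \<in> A \<and> norm y \<in> B}"
    by (rule emeasure_eq_AE, use AE_lborel_singleton[of "0::real^'n"] in eventually_elim) auto
  finally show "emeasure (radial_measure CARD('n)) B * emeasure sphere_measure A =
      emeasure (distr lborel (borel \<Otimes>\<^sub>M borel) (\<lambda>y. (norm y, sgn y))) (B \<times> A)"
    unfolding N1_def
    by (subst emeasure_distr) (auto simp: mult_ac vimage_def conj_commute intro!: arg_cong[where f = "emeasure lborel"])
qed

lemma nn_integral_radial:
  assumes [measurable]: "f \<in> borel_measurable borel"
  shows "(\<integral>\<^sup>+y. f (norm (y::real^'n)) \<partial>lborel) =
     emeasure (sphere_measure :: (real^'n) measure) UNIV * (\<integral>\<^sup>+r. ennreal (indicator {0<..} r * r ^ (CARD('n) - 1)) * f r \<partial>lborel)"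
proof -
  interpret sph: finite_measure "sphere_measure :: (real^'n) measure"
    by (rule finite_measure_sphere_measure)
  have "(\<integral>\<^sup>+y. f (norm (y::real^'n)) \<partial>lborel)
    = (\<integral>\<^sup>+p. f (fst p) \<partial>distr lborel (borel \<Otimes>\<^sub>M borel) (\<lambda>y::real^'n. (norm y, sgn y)))"
    by (subst nn_integral_distr) auto
  also have "\<dots> = (\<integral>\<^sup>+r. \<integral>\<^sup>+\<theta>. f r \<partial>(sphere_measure :: (real^'n) measure) \<partial>radial_measure CARD('n))"
    unfolding polar_coordinates[symmetric] by (subst sph.nn_integral_fst[symmetric]) auto
  also have "\<dots> = emeasure (sphere_measure :: (real^'n) measure) UNIV * (\<integral>\<^sup>+r. f r \<partial>radial_measure CARD('n))"
    by (simp add: nn_integral_multc mult.commute)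
  also have "(\<integral>\<^sup>+r. f r \<partial>radial_measure CARD('n)) = (\<integral>\<^sup>+r. ennreal (indicator {0<..} r * r ^ (CARD('n) - 1)) * f r \<partial>lborel)"
    unfolding radial_measure_def by (subst nn_integral_density) auto
  finally show ?thesis .
qed

text \<open>In polar coordinates a function homogeneous of degree k is the k-th power of the radius
  times its value on the sphere, so Fubini separates the variables. The exponent
  \<open>k + CARD('n) - 1\<close> combines this power with the radial density.\<close>

lemma integral_homogeneous_radial:
  fixes h :: "real^'n \<Rightarrow> complex" and f :: "real \<Rightarrow> complex"
  assumes hom: "\<And>r y. r > 0 \<Longrightarrow> h (r *\<^sub>R y) = of_real r ^ k * h y"
    and hc: "continuous_on UNIV h"
    and [measurable]: "f \<in> borel_measurable borel"
    and int: "integrable lborel (\<lambda>r. indicator {0<..} r *\<^sub>R (f r * of_real r ^ (k + CARD('n) - 1)))"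
  shows "integrable lborel (\<lambda>y. h y * f (norm y))"
    and "(\<integral>y. h y * f (norm y) \<partial>lborel) =
       (\<integral>\<theta>. h \<theta> \<partial>sphere_measure) * (\<integral>r. indicator {0<..} r *\<^sub>R (f r * of_real r ^ (k + CARD('n) - 1)) \<partial>lborel)"
proof -
  have [measurable]: "h \<in> borel_measurable borel" using hc by (rule borel_measurable_continuous_onI)
  interpret sph: finite_measure "sphere_measure :: (real^'n) measure"
    by (rule finite_measure_sphere_measure)
  interpret R: sigma_finite_measure "radial_measure CARD('n)" by (rule sigma_finite_radial_measure)
  interpret P: pair_sigma_finite "radial_measure CARD('n)" "sphere_measure :: (real^'n) measure" ..
  let ?f = "\<lambda>r. f r * of_real r ^ k"
  have "compact (h ` cball 0 1)"
    by (intro compact_continuous_image continuous_on_subset[OF hc]) auto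
  then obtain B where B: "\<And>y. norm y \<le> 1 \<Longrightarrow> norm (h y) \<le> B"
    by (force dest!: compact_imp_bounded simp: bounded_iff)
  \<comment> \<open>\<open>sphere_measure\<close> is a measure on all vectors, while
    \<open>h\<close> is only known to be bounded on the closed unit ball; the vectors outside have
    to be discarded first.\<close>
  have "{\<theta>::real^'n. norm \<theta> > 1} \<in> null_sets sphere_measure"
  proof
    have "{y::real^'n. 0 < norm y \<and> norm y < 1 \<and> sgn y \<in> {\<theta>. norm \<theta> > 1}} = {}"
      by (auto simp: norm_sgn)
    then show "emeasure sphere_measure {\<theta>::real^'n. norm \<theta> > 1} = 0"
      by (subst emeasure_sphere_measure) (simp, simp only: emeasure_empty mult_zero_right)
  qed auto
  then have aeB: "AE y in sphere_measure. norm (h y) \<le> B"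
    by (rule AE_I') (use B in force)
  have ih: "integrable sphere_measure h"
    by (rule sph.integrable_const_bound[OF aeB]) simp
  have ir: "integrable (radial_measure CARD('n)) ?f"
    and er: "integral\<^sup>L (radial_measure CARD('n)) ?f = (\<integral>r. indicator {0<..} r *\<^sub>R (f r * of_real r ^ (k + CARD('n) - 1)) \<partial>lborel)"
  proof -
    have eq: "(indicator {0<..} r * r ^ (CARD('n) - 1)) *\<^sub>R ?f r
       = indicator {0<..} r *\<^sub>R (f r * of_real r ^ (k + CARD('n) - 1))" for r :: real
    proof -
      have "k + CARD('n) - 1 = k + (CARD('n) - 1)"
        using zero_less_card_finite[where 'a='n] by linarith
      then show ?thesis by (simp only: scaleR_conv_of_real power_add of_real_mult of_real_power mult_ac)
    qed
    have nn: "AE r in lborel. 0 \<le> indicator {0<..} (r::real) * r ^ (CARD('n) - 1)"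
      by (auto simp: indicator_def)
    show "integrable (radial_measure CARD('n)) ?f"
      unfolding radial_measure_def
      by (subst integrable_density) (use int nn in \<open>auto simp: eq simp del: One_nat_def\<close>)
    show "integral\<^sup>L (radial_measure CARD('n)) ?f = (\<integral>r. indicator {0<..} r *\<^sub>R (f r * of_real r ^ (k + CARD('n) - 1)) \<partial>lborel)"
      unfolding radial_measure_def
      by (subst integral_density) (use nn in \<open>auto simp: eq simp del: One_nat_def\<close>)
  qed
  have ip: "integrable (radial_measure CARD('n) \<Otimes>\<^sub>M sphere_measure) (\<lambda>(r, \<theta>). ?f r * h \<theta>)"
    by (rule P.Fubini_integrable) (use ir ih integrable_norm[OF ir, unfolded norm_mult] in \<open>auto simp: norm_mult\<close>)
  let ?G = "\<lambda>(r, \<theta>). ?f r * h \<theta>"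
  have hs: "AE y in lborel. h y * f (norm y) = ?G (norm y, sgn y)"
    using AE_lborel_singleton[of "0::real^'n"]
  proof eventually_elim
    case (elim y)
    then have "h y = h (norm y *\<^sub>R sgn y)" by (simp add: sgn_div_norm)
    also have "\<dots> = of_real (norm y) ^ k * h (sgn y)" using elim by (subst hom) auto
    finally show ?case by simp
  qed
  have iG: "integrable lborel (\<lambda>y::real^'n. ?G (norm y, sgn y))"
    using ip unfolding polar_coordinates by (subst (asm) integrable_distr_eq) auto
  show "integrable lborel (\<lambda>y. h y * f (norm y))"
    using integrable_cong_AE[THEN iffD2, OF _ _ hs iG] by simp
  have "(\<integral>y. h y * f (norm y) \<partial>lborel) = (\<integral>y. ?G (norm y, sgn y) \<partial>lborel)"
    by (rule integral_cong_AE) (use hs in auto)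
  also have "\<dots> = integral\<^sup>L (radial_measure CARD('n) \<Otimes>\<^sub>M sphere_measure) ?G"
    unfolding polar_coordinates by (subst integral_distr) auto
  also have "\<dots> = (\<integral>r. \<integral>\<theta>. ?f r * h \<theta> \<partial>sphere_measure \<partial>radial_measure CARD('n))"
    using P.integral_fst'[OF ip] by simp
  also have "\<dots> = (\<integral>\<theta>. h \<theta> \<partial>sphere_measure) * integral\<^sup>L (radial_measure CARD('n)) ?f"
    by (simp only: integral_mult_right_zero integral_mult_left_zero) (simp only: mult.commute)
  finally show "(\<integral>y. h y * f (norm y) \<partial>lborel) =
       (\<integral>\<theta>. h \<theta> \<partial>sphere_measure) * (\<integral>r. indicator {0<..} r *\<^sub>R (f r * of_real r ^ (k + CARD('n) - 1)) \<partial>lborel)"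
    by (simp add: er)
qed

section \<open>Integrals depending holomorphically on a parameter\<close>

text \<open>Limits within a set of a first countable space are sequential, which reduces the claim
  to dominated convergence for sequences. It serves for complex derivatives as well as for the
  one-sided limits in \<epsilon> and \<beta>.\<close>

lemma integral_dominated_convergence_within:
  fixes f :: "'b::first_countable_topology \<Rightarrow> 'a \<Rightarrow> 'c::{banach, second_countable_topology}"
  assumes "\<And>y. y \<in> S - {x} \<Longrightarrow> f y \<in> borel_measurable M" "g \<in> borel_measurable M"
    and "integrable M w" "\<And>y. y \<in> S - {x} \<Longrightarrow> AE z in M. norm (f y z) \<le> w z"
    and lim: "AE z in M. ((\<lambda>y. f y z) \<longlongrightarrow> g z) (at x within S)"
  shows "((\<lambda>y. integral\<^sup>L M (f y)) \<longlongrightarrow> integral\<^sup>L M g) (at x within S)"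
  unfolding tendsto_at_iff_sequentially comp_def
proof safe
  fix X assume X: "\<forall>i::nat. X i \<in> S - {x}" "X \<longlonglongrightarrow> x"
  show "(\<lambda>i. integral\<^sup>L M (f (X i))) \<longlonglongrightarrow> integral\<^sup>L M g"
  proof (rule integral_dominated_convergence[where w = w])
    show "AE z in M. (\<lambda>i. f (X i) z) \<longlonglongrightarrow> g z"
      using lim
    proof eventually_elim
      case (elim z)
      then show ?case using X unfolding tendsto_at_iff_sequentially comp_def by blast
    qed
  qed (use assms X in auto)
qed

lemma norm_exp_minus_one_le:
  fixes z :: complex
  shows "norm (exp z - 1) \<le> norm z * exp (norm z)"
proof -
  have "norm (exp z - exp 0) \<le> exp (norm z) * norm (z - 0)"
  proof (rule field_differentiable_bound[where S = "cball 0 (norm z)"])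
    show "(exp has_field_derivative exp w) (at w within cball 0 (norm z))" for w :: complex
      by (auto intro!: derivative_eq_intros)
    show "norm (exp w) \<le> exp (norm z)" if "w \<in> cball 0 (norm z)" for w :: complex
      using that complex_Re_le_cmod[of w] by (auto simp: norm_exp_eq_Re)
  qed auto
  then show ?thesis by (simp add: mult.commute)
qed

text \<open>Integrability at each point of \<open>U\<close> is enough and no majorant has to be
  supplied: a difference quotient with increment below \<delta> is at most |b| exp(\<delta>|b|)
  times the integrand, and this is dominated by the integrands at the two shifted exponents \<nu> +
  2\<delta> and \<nu> - 2\<delta>. The parameter integrals below are brought into the form a
  exp(\<nu> b) with b real in order to use it.\<close>

lemma has_field_derivative_integral_exp:
  fixes a :: "'a \<Rightarrow> complex" and b :: "'a \<Rightarrow> real"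
  assumes U: "open U" "\<nu> \<in> U"
    and [measurable]: "a \<in> borel_measurable M" "b \<in> borel_measurable M"
    and int: "\<And>\<nu>. \<nu> \<in> U \<Longrightarrow> integrable M (\<lambda>x. a x * exp (\<nu> * of_real (b x)))"
  shows "integrable M (\<lambda>x. a x * of_real (b x) * exp (\<nu> * of_real (b x)))"
    and "((\<lambda>\<nu>. \<integral>x. a x * exp (\<nu> * of_real (b x)) \<partial>M) has_field_derivative
       (\<integral>x. a x * of_real (b x) * exp (\<nu> * of_real (b x)) \<partial>M)) (at \<nu>)"
proof -
  obtain e where e: "e > 0" "cball \<nu> e \<subseteq> U" using U open_contains_cball by metis
  define \<delta> where "\<delta> = e / 2"
  have \<delta>: "\<delta> > 0" "\<nu> + of_real (2 * \<delta>) \<in> U" "\<nu> - of_real (2 * \<delta>) \<in> U"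
    using e by (auto simp: \<delta>_def subset_iff dist_norm)
  \<comment> \<open>One exponential exp(\<delta>|b|) comes from the difference quotient, a second
    one together with the division by \<delta> pays for the factor |b|; adding both shifts covers
    both signs of b.\<close>
  define w where "w x = (norm (a x * exp ((\<nu> + of_real (2 * \<delta>)) * of_real (b x))) +
      norm (a x * exp ((\<nu> - of_real (2 * \<delta>)) * of_real (b x)))) / \<delta>" for x
  have w_int: "integrable M w"
    unfolding w_def by (intro integrable_divide Bochner_Integration.integrable_add integrable_norm int \<delta>)
  have key: "norm (a x * exp (\<nu> * of_real (b x)) * (\<bar>b x\<bar> * exp (\<delta> * \<bar>b x\<bar>))) \<le> w x" for x
  proof -
    have "\<delta> * \<bar>b x\<bar> \<le> exp (\<delta> * \<bar>b x\<bar>)" using exp_ge_add_one_self[of "\<delta> * \<bar>b x\<bar>"] by linarith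
    then have "\<bar>b x\<bar> \<le> exp (\<delta> * \<bar>b x\<bar>) / \<delta>" using \<delta> by (simp add: field_simps)
    then have "\<bar>b x\<bar> * exp (\<delta> * \<bar>b x\<bar>) \<le> (exp (\<delta> * \<bar>b x\<bar>) / \<delta>) * exp (\<delta> * \<bar>b x\<bar>)"
      by (intro mult_right_mono) auto
    also have "\<dots> = exp (2 * \<delta> * \<bar>b x\<bar>) / \<delta>" by (simp add: mult_exp_exp)
    also have "\<dots> \<le> (exp (2 * \<delta> * b x) + exp (- (2 * \<delta> * b x))) / \<delta>"
      using \<delta> by (intro divide_right_mono) (auto simp: abs_if)
    finally have "norm (a x * exp (\<nu> * of_real (b x))) * (\<bar>b x\<bar> * exp (\<delta> * \<bar>b x\<bar>))
      \<le> norm (a x * exp (\<nu> * of_real (b x))) * ((exp (2 * \<delta> * b x) + exp (- (2 * \<delta> * b x))) / \<delta>)"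
      by (intro mult_left_mono) auto
    also have "\<dots> = w x"
    proof -
      have "norm (exp ((\<nu> + of_real (2 * \<delta>)) * of_real (b x))) = norm (exp (\<nu> * of_real (b x))) * exp (2 * \<delta> * b x)"
        "norm (exp ((\<nu> - of_real (2 * \<delta>)) * of_real (b x))) = norm (exp (\<nu> * of_real (b x))) * exp (- (2 * \<delta> * b x))"
        by (simp_all add: norm_exp_eq_Re distrib_right left_diff_distrib flip: exp_add)
      then show ?thesis
        unfolding w_def norm_mult by (simp only:) (simp add: distrib_left mult_ac)
    qed
    finally show ?thesis by (simp add: norm_mult)
  qed
  show I: "integrable M (\<lambda>x. a x * of_real (b x) * exp (\<nu> * of_real (b x)))"
  proof (rule Bochner_Integration.integrable_bound[OF w_int])
    show "AE x in M. norm (a x * of_real (b x) * exp (\<nu> * of_real (b x))) \<le> norm (w x)"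
    proof (rule AE_I2)
      fix x
      have "norm (a x * of_real (b x) * exp (\<nu> * of_real (b x))) =
          norm (a x * exp (\<nu> * of_real (b x))) * (\<bar>b x\<bar> * 1)" by (simp add: norm_mult)
      also have "\<dots> \<le> norm (a x * exp (\<nu> * of_real (b x))) * (\<bar>b x\<bar> * exp (\<delta> * \<bar>b x\<bar>))"
        using \<delta> by (intro mult_left_mono) auto
      also have "\<dots> \<le> norm (w x)" using key[of x] by (simp add: norm_mult)
      finally show "norm (a x * of_real (b x) * exp (\<nu> * of_real (b x))) \<le> norm (w x)" .
    qed
  qed measurable
  have "((\<lambda>h. \<integral>x. a x * exp (\<nu> * of_real (b x)) * ((exp (h * of_real (b x)) - 1) / h) \<partial>M) \<longlongrightarrow>
     (\<integral>x. a x * of_real (b x) * exp (\<nu> * of_real (b x)) \<partial>M)) (at 0 within ball 0 \<delta>)"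
  proof (rule integral_dominated_convergence_within[where w = w])
    show "AE x in M. ((\<lambda>h. a x * exp (\<nu> * of_real (b x)) * ((exp (h * of_real (b x)) - 1) / h))
      \<longlongrightarrow> a x * of_real (b x) * exp (\<nu> * of_real (b x))) (at 0 within ball 0 \<delta>)"
    proof (rule AE_I2)
      fix x
      have "((\<lambda>h. exp (h * complex_of_real (b x))) has_field_derivative of_real (b x)) (at 0)"
        by (auto intro!: derivative_eq_intros)
      then have "((\<lambda>h. (exp (h * of_real (b x)) - 1) / h) \<longlongrightarrow> complex_of_real (b x)) (at 0)"
        by (simp add: has_field_derivative_iff)
      then have "((\<lambda>h. (exp (h * of_real (b x)) - 1) / h) \<longlongrightarrow> complex_of_real (b x)) (at 0 within ball 0 \<delta>)"
        by (rule tendsto_within_subset) simp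
      from tendsto_mult_left[OF this, of "a x * exp (\<nu> * of_real (b x))"]
      show "((\<lambda>h. a x * exp (\<nu> * of_real (b x)) * ((exp (h * of_real (b x)) - 1) / h))
        \<longlongrightarrow> a x * of_real (b x) * exp (\<nu> * of_real (b x))) (at 0 within ball 0 \<delta>)"
        by (simp add: mult_ac)
    qed
    fix h :: complex assume h: "h \<in> ball 0 \<delta> - {0}"
    show "AE x in M. norm (a x * exp (\<nu> * of_real (b x)) * ((exp (h * of_real (b x)) - 1) / h)) \<le> w x"
    proof (rule AE_I2)
      fix x
      have "norm (exp (h * complex_of_real (b x)) - 1) \<le> norm h * \<bar>b x\<bar> * exp (norm h * \<bar>b x\<bar>)"
        using norm_exp_minus_one_le[of "h * complex_of_real (b x)"] by (simp add: norm_mult)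
      also have "\<dots> \<le> norm h * \<bar>b x\<bar> * exp (\<delta> * \<bar>b x\<bar>)"
        using h by (intro mult_left_mono) (auto intro!: mult_right_mono)
      finally have "norm ((exp (h * of_real (b x)) - 1) / h) \<le> \<bar>b x\<bar> * exp (\<delta> * \<bar>b x\<bar>)"
        using h by (simp add: norm_divide field_simps)
      then have "norm (a x * exp (\<nu> * of_real (b x)) * ((exp (h * of_real (b x)) - 1) / h))
         \<le> norm (a x * exp (\<nu> * of_real (b x))) * (\<bar>b x\<bar> * exp (\<delta> * \<bar>b x\<bar>))"
        by (simp only: norm_mult) (intro mult_left_mono, auto)
      then show "norm (a x * exp (\<nu> * of_real (b x)) * ((exp (h * of_real (b x)) - 1) / h)) \<le> w x"
        using key[of x] by (simp add: norm_mult)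
    qed
  qed (use w_int in measurable)
  then have L: "((\<lambda>h. \<integral>x. a x * exp (\<nu> * of_real (b x)) * ((exp (h * of_real (b x)) - 1) / h) \<partial>M) \<longlongrightarrow>
     (\<integral>x. a x * of_real (b x) * exp (\<nu> * of_real (b x)) \<partial>M)) (at 0)"
    using \<delta> by (subst (asm) at_within_open) auto
  show "((\<lambda>\<nu>. \<integral>x. a x * exp (\<nu> * of_real (b x)) \<partial>M) has_field_derivative
       (\<integral>x. a x * of_real (b x) * exp (\<nu> * of_real (b x)) \<partial>M)) (at \<nu>)"
    unfolding DERIV_def
  proof (rule Lim_transform_eventually[OF L])
    have "\<forall>\<^sub>F h in at 0. h \<in> ball 0 e - {0::complex}"
      using e by (intro eventually_at_in_open) auto
    then show "\<forall>\<^sub>F h in at 0. (\<integral>x. a x * exp (\<nu> * of_real (b x)) * ((exp (h * of_real (b x)) - 1) / h) \<partial>M) =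
       ((\<integral>x. a x * exp ((\<nu> + h) * of_real (b x)) \<partial>M) - (\<integral>x. a x * exp (\<nu> * of_real (b x)) \<partial>M)) / h"
    proof eventually_elim
      case (elim h)
      have "\<nu> + h \<in> U" using elim e by (auto simp: subset_iff dist_norm)
      then have "((\<integral>x. a x * exp ((\<nu> + h) * of_real (b x)) \<partial>M) - (\<integral>x. a x * exp (\<nu> * of_real (b x)) \<partial>M)) / h
        = (\<integral>x. (a x * exp ((\<nu> + h) * of_real (b x)) - a x * exp (\<nu> * of_real (b x))) / h \<partial>M)"
        using int U by (subst Bochner_Integration.integral_diff[symmetric]) auto
      also have "\<dots> = (\<integral>x. a x * exp (\<nu> * of_real (b x)) * ((exp (h * of_real (b x)) - 1) / h) \<partial>M)"
        by (intro Bochner_Integration.integral_cong) (auto simp: distrib_right exp_add field_simps)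
      finally show ?case by (rule sym)
    qed
  qed
qed

lemma holomorphic_on_integral_exp:
  fixes a :: "'a \<Rightarrow> complex" and b :: "'a \<Rightarrow> real"
  assumes "open U" "a \<in> borel_measurable M" "b \<in> borel_measurable M"
    and "\<And>\<nu>. \<nu> \<in> U \<Longrightarrow> integrable M (\<lambda>x. a x * exp (\<nu> * of_real (b x)))"
  shows "(\<lambda>\<nu>. \<integral>x. a x * exp (\<nu> * of_real (b x)) \<partial>M) holomorphic_on U"
  using has_field_derivative_integral_exp(2)[OF assms(1) _ assms(2-4)] assms(1)
  by (auto simp: holomorphic_on_open)

section \<open>Complex powers of positive reals, and integrals of product functions\<close>

lemma of_real_powr_eq_exp:
  "x > 0 \<Longrightarrow> complex_of_real x powr s = exp (s * of_real (ln x))"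
  by (simp add: powr_def Ln_of_real)

lemma norm_of_real_powr: "x > 0 \<Longrightarrow> norm (complex_of_real x powr s) = x powr Re s"
  by (simp add: of_real_powr_eq_exp norm_exp_eq_Re powr_def)

text \<open>Lebesgue measure on \<open>real^'n\<close> is the image of a product measure indexed by
  \<open>Basis\<close>, so the factors, which are indexed by coordinates, are first re-indexed by
  basis vectors.\<close>

lemma lebesgue_integral_vec_prod:
  fixes f :: "'n::finite \<Rightarrow> real \<Rightarrow> complex"
  assumes "\<And>i. integrable lborel (f i)"
  shows "integrable lborel (\<lambda>x::real^'n. \<Prod>i\<in>UNIV. f i (x $ i))"
    and "(\<integral>x. (\<Prod>i\<in>UNIV. f i ((x::real^'n) $ i)) \<partial>lborel) = (\<Prod>i\<in>UNIV. integral\<^sup>L lborel (f i))"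
proof -
  interpret P: product_sigma_finite "\<lambda>_ :: real^'n. lborel :: real measure" ..
  define g where "g b = f (THE i. b = axis i (1::real))" for b :: "real^'n"
  have g: "g (axis i 1) = f i" for i
    unfolding g_def by (auto simp: axis_eq_axis intro!: arg_cong[where f = f])
  have B: "(Basis :: (real^'n) set) = (\<lambda>i. axis i 1) ` UNIV" by (auto simp: Basis_vec_def)
  have inj: "inj (\<lambda>i. axis i (1::real) :: real^'n)" by (auto simp: inj_on_def axis_eq_axis)
  have prodB: "(\<Prod>b\<in>Basis. G b) = (\<Prod>i\<in>UNIV. G (axis i 1))" for G :: "real^'n \<Rightarrow> complex"
    unfolding B by (subst prod.reindex[OF inj]) simp
  have nth: "(\<Sum>b\<in>Basis. h b *\<^sub>R b) $ i = h (axis i 1)" for h and i :: 'n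
  proof -
    have "(\<Sum>b\<in>Basis. h b *\<^sub>R b) $ i = (\<Sum>j\<in>UNIV. h (axis j (1::real)) * (axis j 1 :: real^'n) $ i)"
      unfolding B by (subst sum.reindex[OF inj]) (simp add: sum_component)
    also have "\<dots> = (\<Sum>j\<in>UNIV. if j = i then h (axis j 1) else 0)"
      by (intro sum.cong) (auto simp: axis_def)
    finally show ?thesis by simp
  qed
  have fin: "finite (Basis :: (real^'n) set)" by simp
  have gi: "b \<in> Basis \<Longrightarrow> integrable lborel (g b)" for b
    unfolding B using assms by (auto simp: g)
  have eq: "(\<Prod>i\<in>UNIV. f i ((\<Sum>b\<in>Basis. h b *\<^sub>R b) $ i)) = (\<Prod>b\<in>Basis. g b (h b))" for h
    by (subst prodB) (simp only: nth g)
  have [measurable]: "f i \<in> borel_measurable borel" for i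
    using borel_measurable_integrable[OF assms[of i]] by simp
  have m: "(\<lambda>h. \<Sum>b\<in>Basis. h b *\<^sub>R b) \<in> (\<Pi>\<^sub>M b\<in>(Basis :: (real^'n) set). lborel) \<rightarrow>\<^sub>M borel"
    by measurable
  have ip: "integrable (\<Pi>\<^sub>M b\<in>(Basis :: (real^'n) set). lborel)
      (\<lambda>h. \<Prod>i\<in>UNIV. f i ((\<Sum>b\<in>Basis. h b *\<^sub>R b) $ i))"
    unfolding eq by (rule P.product_integrable_prod[OF fin gi])
  show "integrable lborel (\<lambda>x::real^'n. \<Prod>i\<in>UNIV. f i (x $ i))"
    by (subst lborel_eq, subst integrable_distr_eq[OF m]) (measurable, rule ip)
  have "(\<integral>x. (\<Prod>i\<in>UNIV. f i ((x::real^'n) $ i)) \<partial>lborel) =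
      (\<integral>h. (\<Prod>b\<in>Basis. g b (h b)) \<partial>(\<Pi>\<^sub>M b\<in>(Basis :: (real^'n) set). lborel))"
    by (subst lborel_eq, subst integral_distr[OF m]) (measurable, simp only: eq)
  also have "\<dots> = (\<Prod>b\<in>Basis. integral\<^sup>L lborel (g b))"
    by (rule P.product_integral_prod[OF fin gi])
  also have "\<dots> = (\<Prod>i\<in>UNIV. integral\<^sup>L lborel (f i))" by (simp add: prodB g)
  finally show "(\<integral>x. (\<Prod>i\<in>UNIV. f i ((x::real^'n) $ i)) \<partial>lborel) = (\<Prod>i\<in>UNIV. integral\<^sup>L lborel (f i))" .
qed

section \<open>The Mellin transform of the Gaussian\<close>

text \<open>Completing the square turns the integrand into a multiple of a normal density with mean
  \<nu>/(2 pi t) and variance 1/(2 pi t).\<close>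

lemma gaussian_integral_real:
  fixes t \<nu> :: real
  assumes "t > 0"
  shows "has_bochner_integral lborel (\<lambda>z. exp (- pi * t * z\<^sup>2 + \<nu> * z)) (exp (\<nu>\<^sup>2 / (4 * pi * t)) / sqrt t)"
proof -
  define \<sigma> where "\<sigma> = 1 / sqrt (2 * pi * t)"
  have \<sigma>: "\<sigma> > 0" "\<sigma>\<^sup>2 = 1 / (2 * pi * t)" using assms by (auto simp: \<sigma>_def power_divide)
  define \<mu> where "\<mu> = \<nu> / (2 * pi * t)"
  have eq: "exp (\<nu>\<^sup>2 / (4 * pi * t)) / sqrt t * normal_density \<mu> \<sigma> z = exp (- pi * t * z\<^sup>2 + \<nu> * z)" for z
  proof -
    have "sqrt (2 * pi * \<sigma>\<^sup>2) = 1 / sqrt t"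
      using assms by (simp add: \<sigma> real_sqrt_divide)
    moreover have "- (z - \<mu>)\<^sup>2 / (2 * \<sigma>\<^sup>2) = - pi * t * z\<^sup>2 + \<nu> * z - \<nu>\<^sup>2 / (4 * pi * t)"
    proof -
      have "- (z - \<mu>)\<^sup>2 / (2 * \<sigma>\<^sup>2) = - (z - \<mu>)\<^sup>2 * (pi * t)" by (simp add: \<sigma>)
      also have "\<dots> = - pi * t * z\<^sup>2 + \<nu> * z - \<nu>\<^sup>2 / (4 * pi * t)"
        using assms by (simp add: \<mu>_def power2_eq_square field_simps)
      finally show ?thesis .
    qed
    ultimately show ?thesis
      using assms by (simp add: normal_density_def exp_diff)
  qed
  have "has_bochner_integral lborel (\<lambda>z. exp (\<nu>\<^sup>2 / (4 * pi * t)) / sqrt t * normal_density \<mu> \<sigma> z)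
     (exp (\<nu>\<^sup>2 / (4 * pi * t)) / sqrt t * 1)"
    using \<sigma> by (intro has_bochner_integral_mult_right)
      (simp add: has_bochner_integral_iff integrable_normal_density integral_normal_density)
  then show ?thesis unfolding eq by simp
qed

text \<open>Differentiation in \<nu> raises k by one, and \<nu> = -2 pi i y gives the Fourier
  transform at y of the k-th power times the Gaussian. A complex argument makes both available at
  once.\<close>

definition gauss_int :: "nat \<Rightarrow> real \<Rightarrow> complex \<Rightarrow> complex" where
  "gauss_int k t \<nu> = (\<integral>z. of_real (z ^ k * exp (- pi * t * z\<^sup>2)) * exp (\<nu> * of_real z) \<partial>lborel)"

lemma gauss_int_aux:
  assumes "t > 0"
  shows "integrable lborel (\<lambda>z. of_real (z ^ k * exp (- pi * t * z\<^sup>2)) * exp (\<nu> * of_real z))"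
    and "(gauss_int k t has_field_derivative gauss_int (Suc k) t \<nu>) (at \<nu>)"
proof -
  have base: "integrable lborel (\<lambda>z. of_real (z ^ 0 * exp (- pi * t * z\<^sup>2)) * exp (\<nu> * of_real z))" for \<nu> :: complex
  proof (rule Bochner_Integration.integrable_bound)
    show "integrable lborel (\<lambda>z. exp (- pi * t * z\<^sup>2 + Re \<nu> * z))"
      using gaussian_integral_real[OF assms] by (auto simp: has_bochner_integral_iff)
  qed (auto simp: norm_mult norm_exp_eq_Re exp_add exp_diff divide_inverse exp_minus norm_inverse)
  have step: "integrable lborel (\<lambda>z. of_real (z ^ Suc k * exp (- pi * t * z\<^sup>2)) * exp (\<nu> * of_real z))"
    "(gauss_int k t has_field_derivative gauss_int (Suc k) t \<nu>) (at \<nu>)"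
    if "\<And>\<nu>::complex. integrable lborel (\<lambda>z. of_real (z ^ k * exp (- pi * t * z\<^sup>2)) * exp (\<nu> * of_real z))" for k and \<nu> :: complex
  proof -
    have eq: "complex_of_real (z ^ Suc k * exp (- pi * t * z\<^sup>2)) * exp (\<nu> * of_real z) =
      of_real (z ^ k * exp (- pi * t * z\<^sup>2)) * of_real z * exp (\<nu> * of_real z)" for z and \<nu> :: complex by simp
    show "integrable lborel (\<lambda>z. of_real (z ^ Suc k * exp (- pi * t * z\<^sup>2)) * exp (\<nu> * of_real z))"
      unfolding eq by (rule has_field_derivative_integral_exp(1)[OF open_UNIV UNIV_I])
        (use that in auto)
    show "(gauss_int k t has_field_derivative gauss_int (Suc k) t \<nu>) (at \<nu>)"
      unfolding gauss_int_def eq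
      by (rule has_field_derivative_integral_exp(2)[OF open_UNIV UNIV_I]) (use that in auto)
  qed
  have int: "integrable lborel (\<lambda>z. of_real (z ^ k * exp (- pi * t * z\<^sup>2)) * exp (\<nu> * of_real z))" for k and \<nu> :: complex
  proof (induction k arbitrary: \<nu>)
    case 0 show ?case by (rule base)
  next
    case (Suc k) show ?case by (rule step(1)) (rule Suc.IH)
  qed
  show "integrable lborel (\<lambda>z. of_real (z ^ k * exp (- pi * t * z\<^sup>2)) * exp (\<nu> * of_real z))" by (rule int)
  show "(gauss_int k t has_field_derivative gauss_int (Suc k) t \<nu>) (at \<nu>)"
    by (rule step(2)) (rule int)
qed

text \<open>Both sides are entire and agree on the real axis by
  \<open>gaussian_integral_real\<close>, so the identity theorem applies.\<close>

lemma gauss_int_0: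
  assumes "t > 0"
  shows "gauss_int 0 t \<nu> = exp (\<nu>\<^sup>2 / of_real (4 * pi * t)) / of_real (sqrt t)"
proof -
  define f where "f \<nu> = gauss_int 0 t \<nu> - exp (\<nu>\<^sup>2 / of_real (4 * pi * t)) / of_real (sqrt t)" for \<nu>
  have "f \<nu> = 0"
  proof (rule analytic_continuation[of f UNIV "range of_real" 0])
    have "gauss_int 0 t holomorphic_on UNIV"
      using gauss_int_aux(2)[OF assms] by (auto simp: holomorphic_on_open)
    then show "f holomorphic_on UNIV"
      unfolding f_def by (intro holomorphic_intros) (use assms in auto)
    show "(0::complex) islimpt range of_real"
      unfolding islimpt_approachable
    proof safe
      fix e :: real assume "e > 0"
      then show "\<exists>x'\<in>range complex_of_real. x' \<noteq> 0 \<and> dist x' 0 < e"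
        by (intro bexI[of _ "of_real (e/2)"]) (auto simp del: of_real_divide)
    qed
    fix z assume "z \<in> range complex_of_real"
    then obtain x where z: "z = of_real x" by auto
    have "gauss_int 0 t z = (\<integral>y. complex_of_real (exp (- pi * t * y\<^sup>2 + x * y)) \<partial>lborel)"
      unfolding gauss_int_def z by (intro Bochner_Integration.integral_cong) (auto simp: exp_add exp_diff exp_minus exp_of_real[symmetric] divide_inverse)
    also have "\<dots> = of_real (exp (x\<^sup>2 / (4 * pi * t)) / sqrt t)"
      using gaussian_integral_real[OF assms, of x] by (subst integral_complex_of_real) (auto simp: has_bochner_integral_iff)
    also have "\<dots> = exp (z\<^sup>2 / of_real (4 * pi * t)) / of_real (sqrt t)"
      by (simp add: z exp_of_real[symmetric])
    finally show "f z = 0" by (simp add: f_def)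
  qed auto
  then show ?thesis by (simp add: f_def)
qed

text \<open>Differentiating the closed form of \<open>gauss_int_0\<close> gives the first equation;
  differentiating an equation already obtained gives the next one. Uniqueness of derivatives takes
  the place of integration by parts.\<close>

lemma gauss_int_rec:
  assumes "t > 0"
  shows "gauss_int (Suc 0) t \<nu> = \<nu> * gauss_int 0 t \<nu> / of_real (2 * pi * t)"
    and "gauss_int (Suc (Suc k)) t \<nu> = (\<nu> * gauss_int (Suc k) t \<nu> + of_nat (Suc k) * gauss_int k t \<nu>) / of_real (2 * pi * t)"
proof -
  have t: "complex_of_real (2 * pi * t) \<noteq> 0" "complex_of_real (4 * pi * t) \<noteq> 0" using assms by auto
  have one: "gauss_int (Suc 0) t \<nu> = \<nu> * gauss_int 0 t \<nu> / of_real (2 * pi * t)" for \<nu>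
  proof -
    have "gauss_int 0 t = (\<lambda>\<nu>. exp (\<nu>\<^sup>2 / of_real (4 * pi * t)) / of_real (sqrt t))"
      using gauss_int_0[OF assms] by auto
    moreover have "((\<lambda>\<nu>. exp (\<nu>\<^sup>2 / of_real (4 * pi * t)) / of_real (sqrt t)) has_field_derivative
       (2 * \<nu> / of_real (4 * pi * t)) * (exp (\<nu>\<^sup>2 / of_real (4 * pi * t)) / of_real (sqrt t))) (at \<nu>)"
      using t assms by (auto intro!: derivative_eq_intros simp: field_simps)
    ultimately have "(gauss_int 0 t has_field_derivative
        (2 * \<nu> / of_real (4 * pi * t)) * gauss_int 0 t \<nu>) (at \<nu>)" by simp
    from DERIV_unique[OF this gauss_int_aux(2)[OF assms]]
    show ?thesis using t by (simp add: field_simps)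
  qed
  then show "gauss_int (Suc 0) t \<nu> = \<nu> * gauss_int 0 t \<nu> / of_real (2 * pi * t)" .
  show "gauss_int (Suc (Suc k)) t \<nu> = (\<nu> * gauss_int (Suc k) t \<nu> + of_nat (Suc k) * gauss_int k t \<nu>) / of_real (2 * pi * t)"
  proof (induction k arbitrary: \<nu>)
    case 0
    have "gauss_int (Suc 0) t = (\<lambda>\<nu>. \<nu> * gauss_int 0 t \<nu> / of_real (2 * pi * t))" using one by auto
    moreover have "((\<lambda>\<nu>. \<nu> * gauss_int 0 t \<nu> / of_real (2 * pi * t)) has_field_derivative
      (1 * gauss_int 0 t \<nu> + gauss_int (Suc 0) t \<nu> * \<nu>) / of_real (2 * pi * t)) (at \<nu>)"
      by (intro DERIV_cdivide DERIV_mult DERIV_ident gauss_int_aux(2)[OF assms])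
    ultimately have "(gauss_int (Suc 0) t has_field_derivative
      (1 * gauss_int 0 t \<nu> + gauss_int (Suc 0) t \<nu> * \<nu>) / of_real (2 * pi * t)) (at \<nu>)" by simp
    from DERIV_unique[OF gauss_int_aux(2)[OF assms] this]
    show ?case by (simp add: add.commute mult.commute)
  next
    case (Suc k)
    have "gauss_int (Suc (Suc k)) t = (\<lambda>\<nu>. (\<nu> * gauss_int (Suc k) t \<nu> + of_nat (Suc k) * gauss_int k t \<nu>) / of_real (2 * pi * t))"
      using Suc.IH by auto
    moreover have "((\<lambda>\<nu>. (\<nu> * gauss_int (Suc k) t \<nu> + of_nat (Suc k) * gauss_int k t \<nu>) / of_real (2 * pi * t)) has_field_derivative
      ((1 * gauss_int (Suc k) t \<nu> + gauss_int (Suc (Suc k)) t \<nu> * \<nu>) + of_nat (Suc k) * gauss_int (Suc k) t \<nu>) / of_real (2 * pi * t)) (at \<nu>)"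
      by (intro DERIV_cdivide DERIV_add DERIV_cmult DERIV_mult DERIV_ident gauss_int_aux(2)[OF assms])
    ultimately have "(gauss_int (Suc (Suc k)) t has_field_derivative
      ((1 * gauss_int (Suc k) t \<nu> + gauss_int (Suc (Suc k)) t \<nu> * \<nu>) + of_nat (Suc k) * gauss_int (Suc k) t \<nu>) / of_real (2 * pi * t)) (at \<nu>)" by simp
    from DERIV_unique[OF gauss_int_aux(2)[OF assms] this]
    show ?case by (simp add: algebra_simps)
  qed
qed

text \<open>Euler's integral for Gamma at \<nu>/2 after rescaling t by pi times the square of
  q.\<close>

lemma mellin_gaussian:
  assumes "q > 0" "Re \<nu> > 0"
  shows "has_bochner_integral lborel (\<lambda>t. indicator {0<..} t *\<^sub>R (of_real t powr (\<nu> / 2 - 1) * of_real (exp (- pi * t * q\<^sup>2))))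
     (Gamma (\<nu> / 2) * of_real pi powr (- \<nu> / 2) / of_real q powr \<nu>)"
proof -
  define c where "c = pi * q\<^sup>2"
  have c: "c > 0" using assms by (simp add: c_def)
  have s: "Re (\<nu> / 2) > 0" using assms by simp
  define f where "f = (\<lambda>t. complex_of_real t powr (\<nu> / 2 - 1) / of_real (exp t))"
  have "set_integrable lebesgue {0<..} f"
    using absolutely_integrable_Gamma_integral'[OF s] by (simp add: f_def)
  moreover have "set_borel_measurable lborel {0<..} f"
    unfolding set_borel_measurable_def f_def by measurable
  ultimately have i: "integrable lborel (\<lambda>t. indicator {0<..} t *\<^sub>R f t)"
    unfolding set_integrable_def set_borel_measurable_def by (subst (asm) integrable_completion) auto
  have "integral\<^sup>L lborel (\<lambda>t. indicator {0<..} t *\<^sub>R f t) = Gamma (\<nu> / 2)"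
  proof -
    have eq: "(\<lambda>t. if t \<in> {0<..} then f t else 0) = (\<lambda>t. indicator {0<..} t *\<^sub>R f t)" by auto
    have "((\<lambda>t. if t \<in> {0<..} then f t else 0) has_integral (\<integral>t. indicator {0<..} t *\<^sub>R f t \<partial>lborel)) UNIV"
      unfolding eq by (rule has_integral_integral_lborel[OF i])
    then have "(f has_integral (\<integral>t. indicator {0<..} t *\<^sub>R f t \<partial>lborel)) {0<..}"
      by (simp only: has_integral_restrict_UNIV)
    with Gamma_integral_complex'[OF s] show ?thesis
      unfolding f_def by (rule has_integral_unique[rotated])
  qed
  moreover have "(\<integral>t. indicator {0<..} (0 + c * t) *\<^sub>R f (0 + c * t) \<partial>lborel) = (\<integral>t. indicator {0<..} t *\<^sub>R f t \<partial>lborel) /\<^sub>R c"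
    using c lborel_integral_real_affine[of c "\<lambda>t. indicator {0<..} t *\<^sub>R f t" 0] by simp
  ultimately have "has_bochner_integral lborel (\<lambda>t. indicator {0<..} (0 + c * t) *\<^sub>R f (0 + c * t)) (Gamma (\<nu> / 2) /\<^sub>R c)"
    using c i
    by (simp add: has_bochner_integral_iff lborel_integrable_real_affine_iff[of c "\<lambda>t. indicator {0<..} t *\<^sub>R f t" 0, simplified])
  then have "has_bochner_integral lborel (\<lambda>t. of_real c powr (1 - \<nu> / 2) * (indicator {0<..} (0 + c * t) *\<^sub>R f (0 + c * t)))
     (of_real c powr (1 - \<nu> / 2) * (Gamma (\<nu> / 2) /\<^sub>R c))"
    by (rule has_bochner_integral_mult_right)
  moreover have "of_real c powr (1 - \<nu> / 2) * (indicator {0<..} (0 + c * t) *\<^sub>R f (0 + c * t)) =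
    indicator {0<..} t *\<^sub>R (of_real t powr (\<nu> / 2 - 1) * of_real (exp (- pi * t * q\<^sup>2)))" for t
  proof (cases "t > 0")
    case True
    have "complex_of_real (c * t) powr (\<nu> / 2 - 1) = of_real c powr (\<nu> / 2 - 1) * of_real t powr (\<nu> / 2 - 1)"
      using c True by (simp only: of_real_powr_eq_exp mult_pos_pos ln_mult) (simp add: algebra_simps flip: exp_add)
    moreover have "complex_of_real c powr (1 - \<nu> / 2) * of_real c powr (\<nu> / 2 - 1) = 1"
      using c by (simp add: powr_add[symmetric])
    moreover have "exp (- pi * t * q\<^sup>2) = inverse (exp (c * t))"
      by (simp add: c_def mult_ac flip: exp_minus)
    then have "complex_of_real (exp (- pi * t * q\<^sup>2)) = inverse (complex_of_real (exp (c * t)))"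
      by (simp only: of_real_inverse)
    moreover have "A * (B * T / E) = T * inverse E" if "A * B = 1" for A B T E :: complex
    proof -
      have "A * (B * T / E) = (A * B) * T * inverse E" by (simp only: divide_inverse mult_ac)
      with that show ?thesis by simp
    qed
    ultimately show ?thesis using c True by (simp add: f_def)
  next
    case False
    then have "\<not> c * t > 0" using c by (simp add: zero_less_mult_iff)
    with False show ?thesis by simp
  qed
  moreover have "of_real c powr (1 - \<nu> / 2) * (Gamma (\<nu> / 2) /\<^sub>R c) = Gamma (\<nu> / 2) * of_real pi powr (- \<nu> / 2) / of_real q powr \<nu>"
  proof -
    have "complex_of_real c powr (1 - \<nu> / 2) = of_real c * of_real c powr (- \<nu> / 2)"
      using powr_add[of "complex_of_real c" 1 "- \<nu> / 2"] c by simp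
    moreover have "complex_of_real c powr (- \<nu> / 2) = of_real pi powr (- \<nu> / 2) / of_real q powr \<nu>"
    proof -
      have lnc: "ln c = ln pi + 2 * ln q" using assms by (simp add: c_def ln_mult ln_realpow)
      show ?thesis
        unfolding of_real_powr_eq_exp[OF c] of_real_powr_eq_exp[OF pi_gt_zero]
          of_real_powr_eq_exp[OF assms(1)] exp_diff[symmetric]
        by (rule arg_cong[where f = exp]) (simp add: lnc field_simps)
    qed
    ultimately show ?thesis using c by (simp add: scaleR_conv_of_real field_simps)
  qed
  ultimately show ?thesis by simp
qed

text \<open>Fubini in x and t. The absolute value of the inner integrand is the same integrand with
  \<nu> replaced by its real part, so its t-integral is a constant times |a / \<open>q x\<close>
  powr \<nu>|, and integrability of that quotient is all that is required. The measure is kept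
  general because it will be Lebesgue measure for the integral and counting measure for the lattice
  sum.\<close>

lemma mellin_transform:
  fixes a :: "'a \<Rightarrow> complex" and q :: "'a \<Rightarrow> real"
  assumes sf: "sigma_finite_measure M"
    and [measurable]: "a \<in> borel_measurable M" "q \<in> borel_measurable M"
    and q: "AE x in M. q x > 0" and \<nu>: "Re \<nu> > 0"
    and int: "integrable M (\<lambda>x. a x / of_real (q x) powr \<nu>)"
  shows "has_bochner_integral lborel
    (\<lambda>t. indicator {0<..} t *\<^sub>R (of_real t powr (\<nu> / 2 - 1) * (\<integral>x. a x * of_real (exp (- pi * t * (q x)\<^sup>2)) \<partial>M)))
    (Gamma (\<nu> / 2) * of_real pi powr (- \<nu> / 2) * (\<integral>x. a x / of_real (q x) powr \<nu> \<partial>M))"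
proof -
  interpret M: sigma_finite_measure M by (rule sf)
  interpret P: pair_sigma_finite M "lborel :: real measure" ..
  define F where "F x t = a x * (indicator {0<..} t *\<^sub>R (of_real t powr (\<nu> / 2 - 1) * of_real (exp (- pi * t * (q x)\<^sup>2))))" for x t
  have [measurable]: "case_prod F \<in> borel_measurable (M \<Otimes>\<^sub>M lborel)"
    unfolding F_def by measurable
  have nF: "norm (F x t) = norm (a x) * norm (indicator {0<..} t *\<^sub>R (complex_of_real t powr (of_real (Re \<nu>) / 2 - 1) * of_real (exp (- pi * t * (q x)\<^sup>2))))" for x t
    by (cases "t > 0") (simp_all add: F_def norm_mult norm_of_real_powr)
  have Fi: "AE x in M. has_bochner_integral lborel (F x) (a x * (Gamma (\<nu> / 2) * of_real pi powr (- \<nu> / 2) / of_real (q x) powr \<nu>))"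
    using q unfolding F_def by eventually_elim (intro has_bochner_integral_mult_right mellin_gaussian \<nu>)
  have Fn: "AE x in M. (\<integral>t. norm (F x t) \<partial>lborel) = norm (a x / of_real (q x) powr \<nu>) * norm (Gamma (of_real (Re \<nu>) / 2) * complex_of_real pi powr (- of_real (Re \<nu>) / 2))"
    using q
  proof eventually_elim
    case (elim x)
    let ?g = "\<lambda>t. indicator {0<..} t *\<^sub>R (complex_of_real t powr (of_real (Re \<nu>) / 2 - 1) * of_real (exp (- pi * t * (q x)\<^sup>2)))"
    have m: "has_bochner_integral lborel ?g (Gamma (of_real (Re \<nu>) / 2) * of_real pi powr (- of_real (Re \<nu>) / 2) / of_real (q x) powr of_real (Re \<nu>))"
      by (rule mellin_gaussian) (use elim \<nu> in auto)
    have "(\<integral>t. norm (?g t) \<partial>lborel) = norm (\<integral>t. ?g t \<partial>lborel)"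
    proof -
      have g: "?g t = of_real (norm (?g t))" for t
      proof (cases "t > 0")
        case True
        then have "complex_of_real t powr (of_real (Re \<nu>) / 2 - 1) = of_real (t powr (Re \<nu> / 2 - 1))"
          using powr_of_real[of t "Re \<nu> / 2 - 1"] by simp
        then show ?thesis using True by (simp add: norm_mult)
      qed simp
      have "(\<integral>t. ?g t \<partial>lborel) = (\<integral>t. of_real (norm (?g t)) \<partial>lborel)"
        by (rule Bochner_Integration.integral_cong[OF refl g])
      also have "\<dots> = of_real (\<integral>t. norm (?g t) \<partial>lborel)" by (rule integral_complex_of_real)
      finally show ?thesis by (simp add: integral_nonneg_AE)
    qed
    also have "(\<integral>t. ?g t \<partial>lborel) = Gamma (of_real (Re \<nu>) / 2) * of_real pi powr (- of_real (Re \<nu>) / 2) / of_real (q x) powr of_real (Re \<nu>)"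
      using m by (simp add: has_bochner_integral_iff)
    finally show ?case
      unfolding nF using elim by (simp add: norm_mult norm_divide norm_of_real_powr)
  qed
  have "integrable (M \<Otimes>\<^sub>M lborel) (case_prod F)"
  proof (rule P.Fubini_integrable)
    show "integrable M (\<lambda>x. \<integral>t. norm (case_prod F (x, t)) \<partial>lborel)"
      by (rule integrable_cong_AE[THEN iffD2, OF _ _ _ integrable_mult_left[OF integrable_norm[OF int]]])
        (use Fn in auto)
    show "AE x in M. integrable lborel (\<lambda>t. case_prod F (x, t))"
      using Fi by eventually_elim (auto simp: has_bochner_integral_iff)
  qed simp
  note FF = this
  have "integrable lborel (\<lambda>t. \<integral>x. F x t \<partial>M)"
    using P.integrable_snd[OF FF] by simp
  moreover have "(\<integral>t. \<integral>x. F x t \<partial>M \<partial>lborel) = (\<integral>x. \<integral>t. F x t \<partial>lborel \<partial>M)"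
    by (rule P.Fubini_integral[OF FF])
  moreover have "(\<integral>x. \<integral>t. F x t \<partial>lborel \<partial>M) = (\<integral>x. Gamma (\<nu> / 2) * of_real pi powr (- \<nu> / 2) * (a x / of_real (q x) powr \<nu>) \<partial>M)"
    by (rule integral_cong_AE) (use Fi in \<open>auto elim!: eventually_mono simp: has_bochner_integral_iff mult_ac\<close>)
  moreover have "\<dots> = Gamma (\<nu> / 2) * of_real pi powr (- \<nu> / 2) * (\<integral>x. a x / of_real (q x) powr \<nu> \<partial>M)"
    by (rule integral_mult_right_zero)
  moreover have "(\<integral>x. F x t \<partial>M) = indicator {0<..} t *\<^sub>R (of_real t powr (\<nu> / 2 - 1) * (\<integral>x. a x * of_real (exp (- pi * t * (q x)\<^sup>2)) \<partial>M))" for t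
  proof -
    have "(\<integral>x. F x t \<partial>M) = (\<integral>x. (of_real (indicator {0<..} t) * of_real t powr (\<nu> / 2 - 1)) * (a x * of_real (exp (- pi * t * (q x)\<^sup>2))) \<partial>M)"
      unfolding F_def by (intro Bochner_Integration.integral_cong) (auto simp: scaleR_conv_of_real mult_ac)
    then show ?thesis by (simp add: scaleR_conv_of_real mult.assoc)
  qed
  ultimately show ?thesis by (simp add: has_bochner_integral_iff)
qed

section \<open>Poisson summation\<close>

definition echar :: "real \<Rightarrow> complex" where "echar x = cis (2 * pi * x)"

lemma echar_0 [simp]: "echar 0 = 1" by (simp add: echar_def)
lemma echar_add: "echar (x + y) = echar x * echar y" by (simp add: echar_def cis_mult distrib_left)
lemma norm_echar [simp]: "norm (echar x) = 1" by (simp add: echar_def)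
lemma echar_int: "x \<in> \<int> \<Longrightarrow> echar x = 1"
  by (auto simp: echar_def elim!: Ints_cases)
lemma echar_exp: "echar x = exp (2 * of_real pi * \<i> * of_real x)"
  by (simp add: echar_def cis_conv_exp mult_ac)
lemma continuous_on_echar [continuous_intros]: "continuous_on S f \<Longrightarrow> continuous_on S (\<lambda>x. echar (f x))"
  unfolding echar_exp by (intro continuous_intros)
lemma measurable_echar [measurable]: "echar \<in> borel_measurable borel"
  by (intro borel_measurable_continuous_onI continuous_intros)

lemma cos_sq_echar: "complex_of_real ((cos (pi * y))\<^sup>2) = (2 + echar y + echar (- y)) / 4"
proof -
  have "(cos (pi * y))\<^sup>2 = (1 + cos (2 * (pi * y))) / 2"
    by (subst cos_double_cos) simp
  then show ?thesis
    by (simp add: echar_def complex_eq_iff mult_ac)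
qed

definition int_vecs :: "(real^'n) set" where "int_vecs = {x. \<forall>i. x $ i \<in> \<int>}"

text \<open>Half-open, so that the integer translates tile space without overlap, and centred, so
  that 0 is an interior point and every factor cos(pi x_i) is non-negative on it with its maximum at
  0.\<close>

definition unit_cube :: "(real^'n) set" where "unit_cube = {x. \<forall>i. - (1/2) \<le> x $ i \<and> x $ i < 1/2}"

lemma countable_int_vecs: "countable (int_vecs :: (real^'n) set)"
proof -
  have "int_vecs \<subseteq> range (\<lambda>f :: 'n \<Rightarrow> int. \<chi> i. of_int (f i))"
  proof
    fix x :: "real^'n" assume "x \<in> int_vecs"
    then have "x = (\<chi> i. of_int \<lfloor>x $ i\<rfloor>)" by (auto simp: int_vecs_def vec_eq_iff)
    then show "x \<in> range (\<lambda>f :: 'n \<Rightarrow> int. \<chi> i. of_int (f i))" by (rule range_eqI[where x = "\<lambda>i. \<lfloor>x $ i\<rfloor>"])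
  qed
  then show ?thesis by (rule countable_subset) (rule countable_image, rule countableI_type)
qed

lemma int_vecs_0 [simp]: "0 \<in> int_vecs" by (simp add: int_vecs_def)
lemma int_vecs_add: "x \<in> int_vecs \<Longrightarrow> y \<in> int_vecs \<Longrightarrow> x + y \<in> int_vecs" by (simp add: int_vecs_def)
lemma int_vecs_diff: "x \<in> int_vecs \<Longrightarrow> y \<in> int_vecs \<Longrightarrow> x - y \<in> int_vecs" by (simp add: int_vecs_def)
lemma int_vecs_axis: "axis i 1 \<in> int_vecs" by (simp add: int_vecs_def axis_def)
lemma int_vecs_inner: "x \<in> int_vecs \<Longrightarrow> y \<in> int_vecs \<Longrightarrow> x \<bullet> y \<in> \<int>"
  by (auto simp: int_vecs_def inner_vec_def intro!: Ints_sum Ints_mult)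

lemma sigma_finite_int_vecs: "sigma_finite_measure (count_space (int_vecs :: (real^'n) set))"
  by (rule sigma_finite_measure_count_space_countable[OF countable_int_vecs])

lemma measurable_unit_cube [measurable]: "unit_cube \<in> sets (borel :: (real^'n) measure)"
  unfolding unit_cube_def by measurable

lemma norm_unit_cube_le: "x \<in> (unit_cube :: (real^'n) set) \<Longrightarrow> norm x \<le> CARD('n)"
proof -
  assume x: "x \<in> (unit_cube :: (real^'n) set)"
  have "norm x \<le> (\<Sum>i\<in>UNIV. \<bar>x $ i\<bar>)" by (rule norm_le_l1_cart)
  also have "\<dots> \<le> (\<Sum>i\<in>(UNIV::'n set). 1)"
  proof (rule sum_mono)
    fix i
    have "- (1/2) \<le> x $ i" "x $ i < 1/2" using x by (auto simp: unit_cube_def)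
    then show "\<bar>x $ i\<bar> \<le> 1" by linarith
  qed
  finally show ?thesis by simp
qed

lemma unit_cube_tiling: "\<exists>k\<in>int_vecs. \<forall>l\<in>int_vecs. x - l \<in> unit_cube \<longleftrightarrow> l = (k :: real^'n)"
proof -
  define k :: "real^'n" where "k = (\<chi> i. of_int \<lfloor>x $ i + 1/2\<rfloor>)"
  have "x - l \<in> unit_cube \<longleftrightarrow> l = k" if "l \<in> int_vecs" for l
  proof -
    have "(- (1/2) \<le> x $ i - l $ i \<and> x $ i - l $ i < 1/2) \<longleftrightarrow> l $ i = of_int \<lfloor>x $ i + 1/2\<rfloor>" for i
    proof -
      have "l $ i \<in> \<int>" using that by (simp add: int_vecs_def)
      then obtain j :: int where "l $ i = of_int j" by (rule Ints_cases)
      then have "l $ i = of_int \<lfloor>x $ i + 1/2\<rfloor> \<longleftrightarrow> \<lfloor>x $ i + 1/2\<rfloor> = j" by auto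
      also have "\<dots> \<longleftrightarrow> of_int j \<le> x $ i + 1/2 \<and> x $ i + 1/2 < of_int j + 1" by (rule floor_eq_iff)
      also have "\<dots> \<longleftrightarrow> - (1/2) \<le> x $ i - l $ i \<and> x $ i - l $ i < 1/2"
        unfolding \<open>l $ i = of_int j\<close> by linarith
      finally show ?thesis by blast
    qed
    then show ?thesis by (auto simp: unit_cube_def k_def vec_eq_iff)
  qed
  moreover have "k \<in> int_vecs" by (simp add: k_def int_vecs_def)
  ultimately show ?thesis by blast
qed

lemma measurable_count_int_vecs:
  assumes "\<And>k. k \<in> int_vecs \<Longrightarrow> f k \<in> N \<rightarrow>\<^sub>M K"
  shows "(\<lambda>(k, x). f k x) \<in> count_space (int_vecs :: (real^'n) set) \<Otimes>\<^sub>M N \<rightarrow>\<^sub>M K"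
  by (rule measurable_pair_measure_countable1[OF countable_int_vecs]) (use assms in simp)

lemma nn_integral_translate:
  fixes f :: "real^'n \<Rightarrow> ennreal"
  assumes [measurable]: "f \<in> borel_measurable borel"
  shows "(\<integral>\<^sup>+x. f (x + c) \<partial>lborel) = (\<integral>\<^sup>+x. f x \<partial>lborel)"
  by (subst lborel_distr_plus[of c, symmetric], subst nn_integral_distr) (auto simp: add.commute)

lemma integral_translate:
  fixes f :: "real^'n \<Rightarrow> complex"
  assumes [measurable]: "f \<in> borel_measurable borel"
  shows "(\<integral>x. f (x + c) \<partial>lborel) = (\<integral>x. f x \<partial>lborel)"
  by (subst (2) lborel_distr_plus[of c, symmetric], subst integral_distr) (auto simp: add.commute)

text \<open>Translation invariance moves the shift from the function to the cube; by
  \<open>unit_cube_tiling\<close> exactly one of the shifted cubes contains a given point.\<close>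

lemma nn_integral_unfold:
  fixes f :: "real^'n \<Rightarrow> ennreal"
  assumes [measurable]: "f \<in> borel_measurable borel"
  shows "(\<integral>\<^sup>+k. \<integral>\<^sup>+x. indicator unit_cube x * f (x + k) \<partial>lborel \<partial>count_space int_vecs) = (\<integral>\<^sup>+x. f x \<partial>lborel)"
proof -
  interpret K: sigma_finite_measure "count_space (int_vecs :: (real^'n) set)" by (rule sigma_finite_int_vecs)
  interpret P: pair_sigma_finite "count_space (int_vecs :: (real^'n) set)" "lborel :: (real^'n) measure" ..
  have "(\<integral>\<^sup>+x. indicator unit_cube x * f (x + k) \<partial>lborel) = (\<integral>\<^sup>+x. indicator unit_cube (x - k) * f x \<partial>lborel)" for k
    using nn_integral_translate[of "\<lambda>x. indicator unit_cube (x - k) * f x" k] by simp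
  then have "(\<integral>\<^sup>+k. \<integral>\<^sup>+x. indicator unit_cube x * f (x + k) \<partial>lborel \<partial>count_space int_vecs)
     = (\<integral>\<^sup>+k. \<integral>\<^sup>+x. indicator unit_cube (x - k) * f x \<partial>lborel \<partial>count_space int_vecs)" by simp
  also have "\<dots> = (\<integral>\<^sup>+x. \<integral>\<^sup>+k. indicator unit_cube (x - k) * f x \<partial>count_space int_vecs \<partial>lborel)"
    by (rule P.Fubini'[symmetric], rule measurable_count_int_vecs) measurable
  also have "\<dots> = (\<integral>\<^sup>+x. f x \<partial>lborel)"
  proof (rule nn_integral_cong)
    fix x :: "real^'n"
    obtain k where k: "k \<in> int_vecs" "\<And>l. l \<in> int_vecs \<Longrightarrow> x - l \<in> unit_cube \<longleftrightarrow> l = k"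
      using unit_cube_tiling by metis
    have "(\<integral>\<^sup>+k. indicator unit_cube (x - k) * f x \<partial>count_space int_vecs) =
      (\<integral>\<^sup>+l. f x * indicator {k} l \<partial>count_space int_vecs)"
      using k by (intro nn_integral_cong) (auto simp: indicator_def)
    also have "\<dots> = f x" using k by (subst nn_integral_cmult_indicator) auto
    finally show "(\<integral>\<^sup>+k. indicator unit_cube (x - k) * f x \<partial>count_space int_vecs) = f x" .
  qed
  finally show ?thesis .
qed

lemma integral_unfold:
  fixes f :: "real^'n \<Rightarrow> complex"
  assumes f: "integrable lborel f"
  shows "integrable (count_space int_vecs \<Otimes>\<^sub>M lborel) (\<lambda>(k, x). indicator unit_cube x *\<^sub>R f (x + k))"
    and "(\<integral>k. \<integral>x. indicator unit_cube x *\<^sub>R f (x + k) \<partial>lborel \<partial>count_space int_vecs) = integral\<^sup>L lborel f"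
proof -
  interpret K: sigma_finite_measure "count_space (int_vecs :: (real^'n) set)" by (rule sigma_finite_int_vecs)
  interpret P: pair_sigma_finite "count_space (int_vecs :: (real^'n) set)" "lborel :: (real^'n) measure" ..
  have [measurable]: "f \<in> borel_measurable borel" using borel_measurable_integrable[OF f] by simp
  \<comment> \<open>One criterion for two integrands: the function shifted with the cube fixed, and
    the cube shifted with the function fixed. For each k the norms have the same integral.\<close>
  have int: "integrable (count_space int_vecs \<Otimes>\<^sub>M lborel) G"
    if G: "\<And>k. k \<in> int_vecs \<Longrightarrow> (\<lambda>x. G (k, x)) \<in> borel_measurable borel"
      "\<And>k. k \<in> int_vecs \<Longrightarrow> (\<integral>\<^sup>+x. norm (G (k, x)) \<partial>lborel) = (\<integral>\<^sup>+x. indicator unit_cube x * ennreal (norm (f (x + k))) \<partial>lborel)"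
    for G :: "(real^'n) \<times> (real^'n) \<Rightarrow> complex"
  proof (rule integrableI_bounded)
    have "(\<lambda>(k, x). G (k, x)) \<in> borel_measurable (count_space int_vecs \<Otimes>\<^sub>M lborel)"
      by (rule measurable_count_int_vecs) (simp add: G(1))
    then show m: "G \<in> borel_measurable (count_space int_vecs \<Otimes>\<^sub>M lborel)" by simp
    have m': "(\<lambda>p. ennreal (norm (G p))) \<in> borel_measurable (count_space int_vecs \<Otimes>\<^sub>M lborel)"
      by (rule measurable_compose[OF m]) simp
    have "(\<integral>\<^sup>+p. norm (G p) \<partial>(count_space int_vecs \<Otimes>\<^sub>M lborel)) = (\<integral>\<^sup>+k. \<integral>\<^sup>+x. norm (G (k, x)) \<partial>lborel \<partial>count_space int_vecs)"
      by (rule lborel.nn_integral_fst[symmetric, OF m'])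
    also have "\<dots> = (\<integral>\<^sup>+k. \<integral>\<^sup>+x. indicator unit_cube x * ennreal (norm (f (x + k))) \<partial>lborel \<partial>count_space int_vecs)"
      by (intro nn_integral_cong G(2)) simp
    also have "\<dots> = (\<integral>\<^sup>+x. norm (f x) \<partial>lborel)"
      by (rule nn_integral_unfold) measurable
    also have "\<dots> < \<infinity>" using f by (simp add: integrable_iff_bounded)
    finally show "(\<integral>\<^sup>+p. norm (G p) \<partial>(count_space int_vecs \<Otimes>\<^sub>M lborel)) < \<infinity>" .
  qed
  show "integrable (count_space int_vecs \<Otimes>\<^sub>M lborel) (\<lambda>(k, x). indicator unit_cube x *\<^sub>R f (x + k))"
    by (rule int) (auto simp: indicator_def intro!: nn_integral_cong)
  have iG: "integrable (count_space int_vecs \<Otimes>\<^sub>M lborel) (\<lambda>(k, x). indicator unit_cube (x - k) *\<^sub>R f x)"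
  proof (rule int)
    fix k :: "real^'n"
    have "(\<integral>\<^sup>+x. norm ((\<lambda>(k, x). indicator unit_cube (x - k) *\<^sub>R f x) (k, x)) \<partial>lborel)
      = (\<integral>\<^sup>+x. (\<lambda>x. indicator unit_cube (x - k) * ennreal (norm (f x))) x \<partial>lborel)"
      by (intro nn_integral_cong) (auto simp: indicator_def)
    also have "\<dots> = (\<integral>\<^sup>+x. (\<lambda>x. indicator unit_cube (x - k) * ennreal (norm (f x))) (x + k) \<partial>lborel)"
      by (rule nn_integral_translate[symmetric]) measurable
    finally show "(\<integral>\<^sup>+x. norm ((\<lambda>(k, x). indicator unit_cube (x - k) *\<^sub>R f x) (k, x)) \<partial>lborel)
       = (\<integral>\<^sup>+x. indicator unit_cube x * ennreal (norm (f (x + k))) \<partial>lborel)" by simp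
  qed auto
  have "(\<integral>k. \<integral>x. indicator unit_cube x *\<^sub>R f (x + k) \<partial>lborel \<partial>count_space int_vecs)
     = (\<integral>k. \<integral>x. indicator unit_cube (x - k) *\<^sub>R f x \<partial>lborel \<partial>count_space int_vecs)"
  proof (rule Bochner_Integration.integral_cong[OF refl])
    fix k :: "real^'n"
    show "(\<integral>x. indicator unit_cube x *\<^sub>R f (x + k) \<partial>lborel) = (\<integral>x. indicator unit_cube (x - k) *\<^sub>R f x \<partial>lborel)"
      using integral_translate[of "\<lambda>x. indicator unit_cube (x - k) *\<^sub>R f x" k] by simp
  qed
  also have "\<dots> = (\<integral>x. \<integral>k. indicator unit_cube (x - k) *\<^sub>R f x \<partial>count_space int_vecs \<partial>lborel)"
    by (rule P.Fubini_integral[OF iG, symmetric])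
  also have "\<dots> = integral\<^sup>L lborel f"
  proof (rule Bochner_Integration.integral_cong[OF refl])
    fix x :: "real^'n"
    obtain k where k: "k \<in> int_vecs" "\<And>l. l \<in> int_vecs \<Longrightarrow> x - l \<in> unit_cube \<longleftrightarrow> l = k"
      using unit_cube_tiling by metis
    have "(\<integral>k. indicator unit_cube (x - k) *\<^sub>R f x \<partial>count_space int_vecs) =
      (\<integral>l. indicator {k} l *\<^sub>R f x \<partial>count_space int_vecs)"
      using k by (intro Bochner_Integration.integral_cong) (auto simp: indicator_def)
    also have "\<dots> = f x" using k by simp
    finally show "(\<integral>k. indicator unit_cube (x - k) *\<^sub>R f x \<partial>count_space int_vecs) = f x" .
  qed
  finally show "(\<integral>k. \<integral>x. indicator unit_cube x *\<^sub>R f (x + k) \<partial>lborel \<partial>count_space int_vecs) = integral\<^sup>L lborel f" .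
qed

text \<open>Orthogonality of characters, one coordinate at a time: for a non-zero integer frequency
  the antiderivative takes equal values at -1/2 and 1/2.\<close>

lemma unit_cube_char:
  assumes "m \<in> int_vecs"
  shows "(\<integral>x. indicator unit_cube x *\<^sub>R echar (m \<bullet> x) \<partial>lborel) = (if m = (0 :: real^'n) then 1 else 0)"
    and "integrable lborel (\<lambda>x::real^'n. indicator unit_cube x :: real)"
proof -
  define f where "f i y = indicator {- (1/2)..<1/2} y *\<^sub>R echar (m $ i * y)" for i and y :: real
  have eq: "indicator unit_cube x *\<^sub>R echar (m \<bullet> x) = (\<Prod>i\<in>UNIV. f i (x $ i))" for x
  proof -
    have "(\<Prod>i\<in>I. f i (x $ i)) = (if \<forall>i\<in>I. x $ i \<in> {- (1/2)..<1/2} then echar (\<Sum>i\<in>I. m $ i * x $ i) else 0)"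
      if "finite I" for I
      using that by (induction I) (auto simp: f_def echar_add)
    from this[OF finite_class.finite_UNIV] show ?thesis
      by (simp add: unit_cube_def indicator_def inner_vec_def)
  qed
  have [measurable]: "f i \<in> borel_measurable borel" for i unfolding f_def by measurable
  have fc: "has_bochner_integral lborel (f i) (if m $ i = 0 then 1 else 0)" for i
  proof -
    let ?g = "\<lambda>y. indicator {- (1/2)..1/2} y *\<^sub>R echar (m $ i * y)"
    have "has_bochner_integral lborel ?g (if m $ i = 0 then 1 else 0)"
    proof -
      have ci: "integrable lborel ?g"
        by (rule borel_integrable_atLeastAtMost'[unfolded set_integrable_def]) (intro continuous_intros)
      show ?thesis
      proof (cases "m $ i = 0")
        case True
        then show ?thesis using ci
          by (simp add: has_bochner_integral_iff scaleR_conv_of_real)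
      next
        case False
        let ?c = "2 * of_real pi * \<i> * complex_of_real (m $ i)"
        have "(\<integral>y. ?g y \<partial>lborel) = echar (m $ i * (1/2)) / ?c - echar (m $ i * (- (1/2))) / ?c"
        proof (rule integral_FTC_atLeastAtMost)
          fix y :: real
          have "((\<lambda>y. exp (?c * y) / ?c) has_field_derivative exp (?c * of_real y)) (at (of_real y))"
            using False by (auto intro!: derivative_eq_intros)
          from has_field_derivative_at_within[OF this]
          have "((\<lambda>y. exp (?c * of_real y) / ?c) has_vector_derivative exp (?c * of_real y)) (at y)"
            by (intro has_vector_derivative_real_field) (use \<open>((\<lambda>y. exp (?c * y) / ?c) has_field_derivative exp (?c * of_real y)) (at (of_real y))\<close> in auto)
          then show "((\<lambda>y. echar (m $ i * y) / ?c) has_vector_derivative echar (m $ i * y)) (at y within {- (1/2)..1/2})"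
            unfolding echar_exp by (simp add: mult_ac has_vector_derivative_at_within)
        qed (auto intro!: continuous_intros)
        also have "\<dots> = 0"
        proof -
          have "m $ i \<in> \<int>" using assms by (simp add: int_vecs_def)
          have "echar (m $ i * (1/2)) = echar (m $ i * (- (1/2)) + m $ i)" by (rule arg_cong[where f = echar]) simp
          also have "\<dots> = echar (m $ i * (- (1/2)))" unfolding echar_add using \<open>m $ i \<in> \<int>\<close> by (simp add: echar_int)
          finally show ?thesis by simp
        qed
        finally show ?thesis using ci False by (simp add: has_bochner_integral_iff)
      qed
    qed
    moreover have "AE y in lborel. ?g y = f i y"
      using AE_lborel_singleton[of "1/2::real"] by eventually_elim (auto simp: f_def indicator_def)
    ultimately show ?thesis
      by (subst has_bochner_integral_cong_AE[symmetric]) auto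
  qed
  have fi: "\<And>i. integrable lborel (f i)" using fc by (simp add: has_bochner_integral_iff)
  have "(\<integral>x. indicator unit_cube x *\<^sub>R echar (m \<bullet> x) \<partial>lborel) = (\<Prod>i\<in>UNIV. if m $ i = 0 then 1 else 0)"
    unfolding eq lebesgue_integral_vec_prod(2)[OF fi] using fc by (simp add: has_bochner_integral_iff)
  also have "\<dots> = (if m = 0 then 1 else 0)" by (auto simp: vec_eq_iff prod_zero_iff)
  finally show "(\<integral>x. indicator unit_cube x *\<^sub>R echar (m \<bullet> x) \<partial>lborel) = (if m = (0 :: real^'n) then 1 else 0)" .
  show "integrable lborel (\<lambda>x::real^'n. indicator unit_cube x :: real)"
  proof (rule integrable_real_indicator)
    have "emeasure lborel (unit_cube :: (real^'n) set) \<le> emeasure lborel (cball (0::real^'n) CARD('n))"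
      by (rule emeasure_mono) (use norm_unit_cube_le in auto)
    also have "\<dots> < \<infinity>" by (rule emeasure_bounded_finite) simp
    finally show "emeasure lborel (unit_cube :: (real^'n) set) < \<infinity>" .
  qed measurable
qed

section \<open>Uniqueness of Fourier coefficients on the unit cube\<close>

lemma integrable_unit_cube_bounded:
  fixes h :: "real^'n \<Rightarrow> complex"
  assumes [measurable]: "h \<in> borel_measurable borel" and b: "\<And>x. x \<in> unit_cube \<Longrightarrow> norm (h x) \<le> B"
  shows "integrable lborel (\<lambda>x. indicator unit_cube x *\<^sub>R h x)"
proof (rule Bochner_Integration.integrable_bound)
  show "integrable lborel (\<lambda>x::real^'n. indicator unit_cube x * B)"
    by (intro integrable_mult_left unit_cube_char(2)[OF int_vecs_0])
  show "AE x in lborel. norm (indicator unit_cube x *\<^sub>R h x) \<le> norm (indicator unit_cube x * B)"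
    using b by (intro AE_I2) (force simp: indicator_def)
qed measurable

text \<open>The kernel K(x), the product of the squares of cos(pi x_i), is a trigonometric
  polynomial with values in [0,1] that peaks at 0. All powers of K integrate to zero against h. If
  h(0) were non-zero, the part of cnj (h 0) * h near 0 would contribute at least a multiple of the
  N-th power of \<kappa>', the rest of the cube at most a multiple of the N-th power of \<kappa> <
  \<kappa>' in absolute value, which is impossible for large N.\<close>

theorem fourier_uniqueness:
  fixes h :: "real^'n \<Rightarrow> complex"
  assumes [measurable]: "h \<in> borel_measurable borel" and b: "\<And>x. x \<in> unit_cube \<Longrightarrow> norm (h x) \<le> B"
    and cont: "isCont h 0"
    and zero: "\<And>m. m \<in> int_vecs \<Longrightarrow> (\<integral>x. indicator unit_cube x *\<^sub>R (h x * echar (m \<bullet> x)) \<partial>lborel) = 0"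
  shows "h 0 = 0"
proof (rule ccontr)
  assume h0: "h 0 \<noteq> 0"
  \<comment> \<open>Multipliers that keep all Fourier coefficients of h zero. By
    \<open>cos_sq_echar\<close>, multiplying by a squared cosine only shifts frequencies by a unit
    vector, so the class is closed under it.\<close>
  define good where "good T \<longleftrightarrow> T \<in> borel_measurable borel \<and> (\<forall>x. \<bar>T x\<bar> \<le> 1) \<and>
    (\<forall>m\<in>int_vecs. (\<integral>x. indicator unit_cube x *\<^sub>R (h x * of_real (T x) * echar (m \<bullet> x)) \<partial>lborel) = 0)"
    for T :: "real^'n \<Rightarrow> real"
  have step: "good (\<lambda>x. T x * (cos (pi * x $ i))\<^sup>2)" if "good T" for T i
    unfolding good_def
  proof (intro conjI ballI allI)
    have [measurable]: "T \<in> borel_measurable borel" and T1: "\<bar>T x\<bar> \<le> 1" for x using that by (auto simp: good_def)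
    show "(\<lambda>x. T x * (cos (pi * x $ i))\<^sup>2) \<in> borel_measurable borel" by measurable
    show "\<bar>T x * (cos (pi * x $ i))\<^sup>2\<bar> \<le> 1" for x
      unfolding abs_mult using T1[of x] by (intro mult_le_one) (auto simp: abs_square_le_1)
    fix m :: "real^'n" assume m: "m \<in> int_vecs"
    define F where "F m x = indicator unit_cube x *\<^sub>R (h x * of_real (T x) * echar (m \<bullet> x))" for m x :: "real^'n"
    have Fi: "integrable lborel (F m)" for m
      unfolding F_def
    proof (rule integrable_unit_cube_bounded)
      fix x :: "real^'n" assume "x \<in> unit_cube"
      then have "norm (h x) * \<bar>T x\<bar> \<le> B * 1"
        using b[of x] T1[of x] order_trans[OF norm_ge_zero b[of x]] by (intro mult_mono) auto
      then show "norm (h x * of_real (T x) * echar (m \<bullet> x)) \<le> B" by (simp add: norm_mult)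
    qed measurable
    have F0: "integral\<^sup>L lborel (F m) = 0" if "m \<in> int_vecs" for m
      using \<open>good T\<close> that unfolding good_def F_def by blast
    have "indicator unit_cube x *\<^sub>R (h x * of_real (T x * (cos (pi * x $ i))\<^sup>2) * echar (m \<bullet> x)) =
      (2 * F m x + F (m + axis i 1) x + F (m - axis i 1) x) / 4" for x
    proof -
      have "echar ((m + axis i 1) \<bullet> x) = echar (m \<bullet> x) * echar (x $ i)"
        "echar ((m - axis i 1) \<bullet> x) = echar (m \<bullet> x) * echar (- x $ i)"
        by (simp_all add: echar_add[symmetric] inner_add_left inner_diff_left inner_axis')
      then show ?thesis
        unfolding F_def of_real_mult cos_sq_echar
        by (cases "x \<in> unit_cube") (simp_all add: field_simps)
    qed
    then have "(\<integral>x. indicator unit_cube x *\<^sub>R (h x * of_real (T x * (cos (pi * x $ i))\<^sup>2) * echar (m \<bullet> x)) \<partial>lborel)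
      = (\<integral>x. (2 * F m x + F (m + axis i 1) x + F (m - axis i 1) x) / 4 \<partial>lborel)" by (simp only:)
    also have "\<dots> = (2 * integral\<^sup>L lborel (F m) + integral\<^sup>L lborel (F (m + axis i 1)) + integral\<^sup>L lborel (F (m - axis i 1))) / 4"
      using Fi by simp
    also have "\<dots> = 0" using m by (simp add: F0 int_vecs_add int_vecs_diff int_vecs_axis)
    finally show "(\<integral>x. indicator unit_cube x *\<^sub>R (h x * of_real (T x * (cos (pi * x $ i))\<^sup>2) * echar (m \<bullet> x)) \<partial>lborel) = 0" .
  qed
  define K where "K x = (\<Prod>i\<in>UNIV. (cos (pi * x $ i))\<^sup>2)" for x :: "real^'n"
  have g1: "good (\<lambda>x. T x * (\<Prod>i\<in>I. (cos (pi * x $ i))\<^sup>2))" if "finite I" "good T" for I T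
    using that
  proof (induction I)
    case (insert i I)
    from step[OF insert.IH[OF insert.prems], of i] insert.hyps show ?case by (simp add: mult_ac)
  qed simp
  have gK: "good (\<lambda>x. K x ^ N)" for N
  proof (induction N)
    case 0 show ?case using zero by (simp add: good_def)
  next
    case (Suc N)
    from g1[OF finite_class.finite_UNIV Suc.IH] show ?case by (simp add: K_def mult_ac)
  qed
  have K01: "0 \<le> K x" "K x \<le> 1" for x
    unfolding K_def by (auto intro!: prod_nonneg prod_le_1 simp: abs_square_le_1)
  define \<phi> where "\<phi> x = Re (cnj (h 0) * h x)" for x
  define r where "r = (norm (h 0))\<^sup>2"
  have r: "r > 0" "\<phi> 0 = r"
    subgoal using h0 by (simp add: r_def)
    subgoal by (simp add: r_def \<phi>_def cmod_power2) (simp add: power2_eq_square)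
    done
  have [measurable]: "\<phi> \<in> borel_measurable borel" unfolding \<phi>_def by measurable
  define M where "M = norm (h 0) * B"
  have \<phi>M: "\<bar>\<phi> x\<bar> \<le> M" if "x \<in> unit_cube" for x
  proof -
    have "\<bar>\<phi> x\<bar> \<le> norm (cnj (h 0) * h x)" unfolding \<phi>_def by (rule abs_Re_le_cmod)
    also have "\<dots> = norm (h 0) * norm (h x)" by (simp add: norm_mult)
    also have "\<dots> \<le> M" unfolding M_def by (intro mult_left_mono b that) auto
    finally show ?thesis .
  qed
  have "isCont \<phi> 0" unfolding \<phi>_def using cont by simp
  then obtain \<delta>0 where \<delta>0: "\<delta>0 > 0" "\<And>x. norm x < \<delta>0 \<Longrightarrow> \<bar>\<phi> x - r\<bar> < r / 2"
  proof -
    have "\<forall>e>0. \<exists>d>0. \<forall>x. norm x < d \<longrightarrow> \<bar>\<phi> x - r\<bar> < e"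
      using \<open>isCont \<phi> 0\<close> r(2) unfolding continuous_at_eps_delta dist_norm by simp
    from this[rule_format, of "r / 2"] r(1) show ?thesis using that by auto
  qed
  define \<delta> where "\<delta> = min \<delta>0 (1/4)"
  have \<delta>: "\<delta> > 0" "\<delta> \<le> 1/4" using \<delta>0 unfolding \<delta>_def by simp_all
  have \<delta>\<phi>: "\<phi> x \<ge> r / 2" if "norm x < \<delta>" for x
  proof -
    have "\<bar>\<phi> x - r\<bar> < r / 2" using that by (intro \<delta>0) (simp add: \<delta>_def)
    then show ?thesis by linarith
  qed
  \<comment> \<open>The norm is at most the sum of the d absolute coordinates, so a point of norm at
    least \<delta> has a coordinate of absolute value at least \<delta>/d. In the cube its cosine
    then lies between 0 and cos(pi \<eta>).\<close>
  define \<eta> where "\<eta> = \<delta> / CARD('n)"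
  have \<eta>: "\<eta> > 0" "\<eta> \<le> 1/4"
  proof -
    have "1 \<le> real CARD('n)" by (simp add: Suc_leI)
    then have "\<delta> / CARD('n) \<le> \<delta> / 1" using \<delta> by (intro divide_left_mono) auto
    then show "\<eta> > 0" "\<eta> \<le> 1/4"
      unfolding \<eta>_def using \<delta> by (simp, linarith)
  qed
  define \<kappa> where "\<kappa> = (cos (pi * \<eta>))\<^sup>2"
  have cpos: "0 < cos (pi * \<eta>)" using \<eta> by (intro cos_gt_zero) auto
  have clt: "cos (pi * \<eta>) < 1" using \<eta> cos_monotone_0_pi[of 0 "pi * \<eta>"] by simp
  have \<kappa>: "0 < \<kappa>" "\<kappa> < 1" using cpos clt by (auto simp: \<kappa>_def power_less_one_iff abs_square_less_1)
  have Kout: "K x \<le> \<kappa>" if x: "x \<in> unit_cube" "\<not> norm x < \<delta>" for x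
  proof -
    have "\<exists>i. \<eta> \<le> \<bar>x $ i\<bar>"
    proof (rule ccontr)
      assume "\<nexists>i. \<eta> \<le> \<bar>x $ i\<bar>"
      then have "norm x < (\<Sum>i\<in>(UNIV::'n set). \<eta>)"
        by (intro order_le_less_trans[OF norm_le_l1_cart] sum_strict_mono) (auto simp: not_le)
      also have "\<dots> = \<delta>" by (simp add: \<eta>_def)
      finally show False using x by simp
    qed
    then obtain i where i: "\<eta> \<le> \<bar>x $ i\<bar>" by blast
    have "- (1/2) \<le> x $ i" "x $ i < 1/2" using x(1) by (auto simp: unit_cube_def)
    then have "\<bar>x $ i\<bar> \<le> 1/2" by linarith
    then have "0 \<le> cos (pi * \<bar>x $ i\<bar>)"
      by (intro cos_ge_zero order_trans[of "- (pi / 2)" 0 "pi * \<bar>x $ i\<bar>"]) (auto simp: field_simps)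
    moreover have "cos (pi * \<bar>x $ i\<bar>) \<le> cos (pi * \<eta>)"
      using i \<eta> \<open>\<bar>x $ i\<bar> \<le> 1/2\<close> by (intro cos_monotone_0_pi_le) auto
    moreover have "cos (pi * x $ i) = cos (pi * \<bar>x $ i\<bar>)" by (auto simp: abs_if)
    ultimately have "(cos (pi * x $ i))\<^sup>2 \<le> \<kappa>" unfolding \<kappa>_def by (simp add: power_mono)
    moreover have "K x = (cos (pi * x $ i))\<^sup>2 * (\<Prod>j\<in>UNIV - {i}. (cos (pi * x $ j))\<^sup>2)"
      unfolding K_def by (simp add: prod.remove[of UNIV i])
    moreover have "\<dots> \<le> (cos (pi * x $ i))\<^sup>2 * 1"
      by (intro mult_left_mono prod_le_1) (auto simp: abs_square_le_1)
    ultimately show ?thesis by simp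
  qed
  \<comment> \<open>Any value strictly between \<kappa> and 1 will do: by continuity K exceeds it on
    a small ball, whose volume v is the weight of the dominating contribution.\<close>
  define \<kappa>' where "\<kappa>' = (1 + \<kappa>) / 2"
  have \<kappa>': "\<kappa> < \<kappa>'" "\<kappa>' < 1" using \<kappa> by (auto simp: \<kappa>'_def)
  have "isCont K 0" unfolding K_def by (intro continuous_intros)
  moreover have "K 0 = 1" by (simp add: K_def)
  ultimately obtain \<delta>1 where \<delta>1: "\<delta>1 > 0" "\<And>x. norm x < \<delta>1 \<Longrightarrow> \<bar>K x - 1\<bar> < 1 - \<kappa>'"
  proof -
    have "\<forall>e>0. \<exists>d>0. \<forall>x. norm x < d \<longrightarrow> \<bar>K x - 1\<bar> < e"
      using \<open>isCont K 0\<close> \<open>K 0 = 1\<close> unfolding continuous_at_eps_delta dist_norm by simp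
    from this[rule_format, of "1 - \<kappa>'"] \<kappa>' show ?thesis using that by auto
  qed
  define \<delta>' where "\<delta>' = min \<delta> \<delta>1"
  have \<delta>': "\<delta>' > 0" "\<delta>' \<le> \<delta>" using \<delta> \<delta>1 by (auto simp: \<delta>'_def)
  have \<delta>K: "\<kappa>' \<le> K x" if "norm x < \<delta>'" for x
  proof -
    have "\<bar>K x - 1\<bar> < 1 - \<kappa>'" using that by (intro \<delta>1) (simp add: \<delta>'_def)
    then show ?thesis by linarith
  qed
  define v where "v = measure lborel (ball (0::real^'n) \<delta>')"
  have v: "v > 0" unfolding v_def using \<delta>' by simp
  have ineq: "r / 2 * \<kappa>' ^ N * v \<le> M * \<kappa> ^ N * measure lborel (unit_cube :: (real^'n) set)" for N
  proof -
    have mc: "emeasure lborel (unit_cube :: (real^'n) set) < \<infinity>"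
      using unit_cube_char(2)[OF int_vecs_0] by (simp add: integrable_indicator_iff)
    have hK: "integrable lborel (\<lambda>x. indicator unit_cube x *\<^sub>R (h x * of_real (K x ^ N)))"
    proof (rule integrable_unit_cube_bounded)
      show "(\<lambda>x. h x * of_real (K x ^ N)) \<in> borel_measurable borel" unfolding K_def by measurable
      fix x :: "real^'n" assume "x \<in> unit_cube"
      then have "norm (h x) * (K x ^ N) \<le> B * 1"
        using b[of x] K01[of x] order_trans[OF norm_ge_zero b[of x]] by (intro mult_mono power_le_one) auto
      then show "norm (h x * of_real (K x ^ N)) \<le> B" using K01[of x] by (simp add: norm_mult norm_power)
    qed
    have "(\<integral>x. indicator unit_cube x *\<^sub>R (h x * of_real (K x ^ N)) \<partial>lborel) = 0"
      using gK[of N] unfolding good_def by (auto dest: bspec[OF _ int_vecs_0])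
    then have "0 = Re (cnj (h 0) * (\<integral>x. indicator unit_cube x *\<^sub>R (h x * of_real (K x ^ N)) \<partial>lborel))" by simp
    also have "\<dots> = Re (\<integral>x. cnj (h 0) * (indicator unit_cube x *\<^sub>R (h x * of_real (K x ^ N))) \<partial>lborel)" by (simp only: integral_mult_right_zero)
    also have "\<dots> = (\<integral>x. Re (cnj (h 0) * (indicator unit_cube x *\<^sub>R (h x * of_real (K x ^ N)))) \<partial>lborel)"
      by (rule integral_Re[symmetric]) (intro integrable_mult_right hK)
    also have "\<dots> = (\<integral>x. indicator unit_cube x * (\<phi> x * K x ^ N) \<partial>lborel)"
      by (intro Bochner_Integration.integral_cong) (auto simp: \<phi>_def algebra_simps simp flip: of_real_power)
    also have "\<dots> \<ge> (\<integral>x. r / 2 * \<kappa>' ^ N * indicator (ball (0::real^'n) \<delta>') x - M * \<kappa> ^ N * indicator unit_cube x \<partial>lborel)"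
    proof (rule integral_mono)
      show "integrable lborel (\<lambda>x. r / 2 * \<kappa>' ^ N * indicator (ball (0::real^'n) \<delta>') x - M * \<kappa> ^ N * indicator unit_cube x)"
        by (intro Bochner_Integration.integrable_diff integrable_mult_right integrable_real_indicator mc emeasure_bounded_finite) auto
      have "integrable lborel (\<lambda>x. Re (cnj (h 0) * (indicator unit_cube x *\<^sub>R (h x * of_real (K x ^ N)))))"
        by (intro integrable_Re integrable_mult_right hK)
      then show "integrable lborel (\<lambda>x. indicator unit_cube x * (\<phi> x * K x ^ N))"
        by (rule Bochner_Integration.integrable_cong[THEN iffD1, OF refl, rotated]) (auto simp: \<phi>_def algebra_simps simp flip: of_real_power)
      fix x :: "real^'n"
      have bc: "x \<in> unit_cube" if "norm x < \<delta>" for x :: "real^'n"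
      proof -
        have "- (1/2) \<le> x $ i \<and> x $ i < 1/2" for i using component_le_norm_cart[of x i] that \<delta> by linarith
        then show ?thesis unfolding unit_cube_def by simp
      qed
      have Mpos: "0 \<le> M" using \<phi>M[of 0] bc[of 0] \<delta> by simp
      consider "x \<notin> unit_cube" | "x \<in> unit_cube" "\<not> norm x < \<delta>" | "x \<in> unit_cube" "norm x < \<delta>" by blast
      then show "r / 2 * \<kappa>' ^ N * indicator (ball (0::real^'n) \<delta>') x - M * \<kappa> ^ N * indicator unit_cube x
         \<le> indicator unit_cube x * (\<phi> x * K x ^ N)"
      proof cases
        case 1
        then have "\<not> norm x < \<delta>'" using bc \<delta>' by force
        with 1 show ?thesis by simp
      next
        case 2
        then have "\<not> norm x < \<delta>'" using \<delta>' by force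
        moreover have "\<bar>\<phi> x\<bar> * K x ^ N \<le> M * \<kappa> ^ N"
          using \<phi>M[OF 2(1)] Kout[OF 2] K01[of x] Mpos by (intro mult_mono power_mono) auto
        moreover have "\<bar>\<phi> x * K x ^ N\<bar> = \<bar>\<phi> x\<bar> * K x ^ N" using K01[of x] by (simp add: abs_mult)
        ultimately show ?thesis using 2 by simp
      next
        case 3
        have a: "0 \<le> M * \<kappa> ^ N" using Mpos \<kappa> by simp
        show ?thesis
        proof (cases "norm x < \<delta>'")
          case True
          have "r / 2 * \<kappa>' ^ N \<le> \<phi> x * K x ^ N"
            using \<delta>\<phi>[OF 3(2)] \<delta>K[OF True] r \<kappa>' \<kappa> by (intro mult_mono power_mono) auto
          then show ?thesis using 3 True a by simp
        next
          case False
          have "0 \<le> \<phi> x * K x ^ N" using \<delta>\<phi>[OF 3(2)] r K01[of x] by simp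
          then show ?thesis using 3 False a by simp
        qed
      qed
    qed
    also have "(\<integral>x. r / 2 * \<kappa>' ^ N * indicator (ball (0::real^'n) \<delta>') x - M * \<kappa> ^ N * indicator unit_cube x \<partial>lborel)
       = r / 2 * \<kappa>' ^ N * v - M * \<kappa> ^ N * measure lborel (unit_cube :: (real^'n) set)"
      unfolding v_def
      by (subst Bochner_Integration.integral_diff)
       (auto intro!: integrable_mult_right integrable_real_indicator mc emeasure_bounded_finite)
    finally show ?thesis by simp
  qed
  define c where "c = M * measure lborel (unit_cube :: (real^'n) set) / (r / 2 * v)"
  have "(\<kappa>' / \<kappa>) ^ N \<le> c" for N
    using ineq[of N] r v \<kappa> by (simp add: c_def power_divide field_simps)
  moreover obtain N where "c < (\<kappa>' / \<kappa>) ^ N"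
    using real_arch_pow[of "\<kappa>' / \<kappa>" c] \<kappa> \<kappa>' by auto
  ultimately show False by (meson not_le)
qed

section \<open>Integrals and lattice sums of powers of 1 + |x|\<close>

lemma nn_integral_one_plus_powr:
  fixes a :: real
  assumes "a > 1"
  shows "(\<integral>\<^sup>+r. ennreal ((1 + r) powr (-a)) * indicator {0..} r \<partial>lborel) < \<infinity>"
proof -
  have "(\<integral>\<^sup>+r. ennreal ((1 + r) powr (-a)) * indicator {0..} r \<partial>lborel) = ennreal (0 - (1 + 0) powr (1 - a) / (1 - a))"
  proof (rule nn_integral_FTC_atLeast)
    show "((\<lambda>r. (1 + r) powr (1 - a) / (1 - a)) has_real_derivative (1 + r) powr (- a)) (at r)" if "0 \<le> r" for r
    proof -
      have "((\<lambda>r. (1 + r) powr (1 - a) / (1 - a)) has_real_derivative ((1 - a) * (1 + r) powr (1 - a - 1) * 1) / (1 - a)) (at r)"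
        using that by (intro DERIV_cdivide DERIV_chain2[OF has_real_derivative_powr])
          (auto intro!: derivative_eq_intros)
      then show ?thesis using assms by simp
    qed
    show "((\<lambda>r. (1 + r) powr (1 - a) / (1 - a)) \<longlongrightarrow> 0) at_top"
      using assms by real_asymp
  qed auto
  then show ?thesis by simp
qed

lemma integrable_decay:
  assumes "s > real CARD('n)"
  shows "integrable lborel (\<lambda>x::real^'n. (1 + norm x) powr (- s))"
proof (rule integrableI_bounded)
  have "(\<integral>\<^sup>+x. ennreal (norm ((1 + norm (x::real^'n)) powr (- s))) \<partial>lborel) =
     (\<integral>\<^sup>+x. (\<lambda>r. ennreal ((1 + r) powr (- s))) (norm (x::real^'n)) \<partial>lborel)" by simp
  also have "\<dots> = emeasure (sphere_measure :: (real^'n) measure) UNIV *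
      (\<integral>\<^sup>+r. ennreal (indicator {0<..} r * r ^ (CARD('n) - 1)) * ennreal ((1 + r) powr (- s)) \<partial>lborel)"
    by (rule nn_integral_radial) measurable
  also have "\<dots> < \<infinity>"
  proof -
    have "(\<integral>\<^sup>+r. ennreal (indicator {0<..} r * r ^ (CARD('n) - 1)) * ennreal ((1 + r) powr (- s)) \<partial>lborel)
      \<le> (\<integral>\<^sup>+r. ennreal ((1 + r) powr (-(s - (real CARD('n) - 1)))) * indicator {0..} r \<partial>lborel)"
    proof (rule nn_integral_mono)
      fix r :: real
      show "ennreal (indicator {0<..} r * r ^ (CARD('n) - 1)) * ennreal ((1 + r) powr (- s))
        \<le> ennreal ((1 + r) powr (-(s - (real CARD('n) - 1)))) * indicator {0..} r"
      proof (cases "r > 0")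
        case True
        have "r ^ (CARD('n) - 1) * (1 + r) powr (- s) \<le> (1 + r) ^ (CARD('n) - 1) * (1 + r) powr (- s)"
          using True by (intro mult_right_mono power_mono) auto
        also have "\<dots> = (1 + r) powr (-(s - (real CARD('n) - 1)))"
          using True by (simp add: powr_realpow[symmetric] powr_add[symmetric] of_nat_diff Suc_leI algebra_simps)
        finally show ?thesis using True by (simp add: ennreal_mult[symmetric] ennreal_leI)
      qed (simp add: indicator_def)
    qed
    also have "\<dots> < \<infinity>" by (rule nn_integral_one_plus_powr) (use assms in simp)
    finally show ?thesis
      using finite_measure.emeasure_finite[OF finite_measure_sphere_measure[where 'n='n], of UNIV]
      by (simp add: ennreal_mult_less_top top.not_eq_extremum)
  qed
  finally show "(\<integral>\<^sup>+x. ennreal (norm ((1 + norm (x::real^'n)) powr (- s))) \<partial>lborel) < \<infinity>" .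
qed measurable

lemma emeasure_unit_cube: "emeasure lborel (unit_cube :: (real^'n) set) = 1"
proof -
  have i: "integrable lborel (\<lambda>x::real^'n. indicator unit_cube x :: real)" by (rule unit_cube_char(2)[OF int_vecs_0])
  have "(\<integral>x. complex_of_real (indicator unit_cube (x::real^'n)) \<partial>lborel) = 1"
    using unit_cube_char(1)[OF int_vecs_0] by (simp add: scaleR_conv_of_real)
  then have "measure lborel (unit_cube :: (real^'n) set) = 1"
    by (subst (asm) integral_complex_of_real) simp
  moreover have "emeasure lborel (unit_cube :: (real^'n) set) < \<infinity>"
    using i by (simp add: integrable_indicator_iff)
  ultimately show ?thesis by (simp add: measure_def)
qed

text \<open>An elementary form of Peetre's inequality. In both directions it trades decay at an
  integer vector for decay at a point at bounded distance from it.\<close>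

lemma one_plus_norm_shift:
  fixes x k :: "'a::real_normed_vector"
  assumes "norm x \<le> R"
  shows "1 + norm (x + k) \<le> (1 + R) * (1 + norm k)" "1 + norm k \<le> (1 + R) * (1 + norm (x + k))"
proof -
  have R: "0 \<le> R" using assms norm_ge_zero order_trans by blast
  have "norm (x + k) \<le> norm x + norm k" by (rule norm_triangle_ineq)
  moreover have "norm k \<le> norm (x + k) + norm x" using norm_triangle_ineq4[of "x + k" x] by simp
  moreover have "0 \<le> R * norm k" "0 \<le> R * norm (x + k)" using R by auto
  ultimately show "1 + norm (x + k) \<le> (1 + R) * (1 + norm k)" "1 + norm k \<le> (1 + R) * (1 + norm (x + k))"
    using assms by (simp_all only: distrib_left distrib_right mult_1_left mult_1_right)
qed

lemma powr_neg_le: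
  fixes a b c s :: real
  assumes "0 < a" "0 < c" "a \<le> c * b" "0 \<le> s"
  shows "b powr (- s) \<le> c powr s * a powr (- s)"
proof -
  have b: "0 < b" using assms by (smt (verit) zero_less_mult_pos)
  have "(c * b) powr (- s) \<le> a powr (- s)" using assms by (intro powr_mono2') auto
  then have "c powr s * ((c * b) powr (- s)) \<le> c powr s * a powr (- s)" by (intro mult_left_mono) auto
  moreover have "c powr s * ((c * b) powr (- s)) = b powr (- s)"
    using assms b by (simp add: powr_mult powr_minus)
  ultimately show ?thesis by simp
qed

text \<open>Each term is compared with its average over the unit cell around k, and unfolding turns
  the sum of these averages into the integral over the whole space.\<close>

lemma integrable_decay_int_vecs:
  assumes s: "s > real CARD('n)"
  shows "integrable (count_space (int_vecs :: (real^'n) set)) (\<lambda>k. (1 + norm k) powr (- s))"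
proof (rule integrableI_bounded)
  define c where "c = (1 + real CARD('n)) powr s"
  have c: "0 \<le> c" "c < \<infinity>" by (auto simp: c_def)
  have "(\<integral>\<^sup>+k. ennreal (norm ((1 + norm (k::real^'n)) powr (- s))) \<partial>count_space int_vecs)
    \<le> (\<integral>\<^sup>+k. \<integral>\<^sup>+x. indicator unit_cube x * ennreal (c * (1 + norm (x + k)) powr (- s)) \<partial>lborel \<partial>count_space (int_vecs :: (real^'n) set))"
  proof (rule nn_integral_mono)
    fix k :: "real^'n"
    have "ennreal (norm ((1 + norm k) powr (- s))) = (\<integral>\<^sup>+x. ennreal ((1 + norm k) powr (- s)) * indicator (unit_cube :: (real^'n) set) x \<partial>lborel)"
      by (subst nn_integral_cmult_indicator) (auto simp: emeasure_unit_cube)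
    also have "\<dots> \<le> (\<integral>\<^sup>+x. indicator unit_cube x * ennreal (c * (1 + norm (x + k)) powr (- s)) \<partial>lborel)"
    proof (rule nn_integral_mono)
      fix x :: "real^'n"
      show "ennreal ((1 + norm k) powr (- s)) * indicator unit_cube x \<le> indicator unit_cube x * ennreal (c * (1 + norm (x + k)) powr (- s))"
      proof (cases "x \<in> unit_cube")
        case True
        from one_plus_norm_shift(1)[OF norm_unit_cube_le[OF True], of k]
        have "(1 + norm k) powr (- s) \<le> c * (1 + norm (x + k)) powr (- s)"
          unfolding c_def using s by (intro powr_neg_le) (auto simp: add_pos_nonneg)
        then show ?thesis using True by (simp add: ennreal_leI)
      qed simp
    qed
    finally show "ennreal (norm ((1 + norm k) powr (- s))) \<le> (\<integral>\<^sup>+x. indicator unit_cube x * ennreal (c * (1 + norm (x + k)) powr (- s)) \<partial>lborel)" .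
  qed
  also have "\<dots> = (\<integral>\<^sup>+x. ennreal (c * (1 + norm (x::real^'n)) powr (- s)) \<partial>lborel)"
    by (rule nn_integral_unfold) measurable
  also have "\<dots> < \<infinity>"
  proof -
    have "(\<integral>\<^sup>+x. ennreal (norm (c * (1 + norm (x::real^'n)) powr (- s))) \<partial>lborel) < \<infinity>"
      using integrable_mult_right[OF integrable_decay[OF s], of c] unfolding integrable_iff_bounded by blast
    then show ?thesis using c by (simp add: abs_mult)
  qed
  finally show "(\<integral>\<^sup>+k. ennreal (norm ((1 + norm (k::real^'n)) powr (- s))) \<partial>count_space int_vecs) < \<infinity>" .
qed simp

lemma measurable_count_int_vecs':
  assumes "\<And>k. k \<in> int_vecs \<Longrightarrow> f k \<in> N \<rightarrow>\<^sub>M K"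
  shows "(\<lambda>(x, k). f k x) \<in> N \<Otimes>\<^sub>M count_space (int_vecs :: (real^'n) set) \<rightarrow>\<^sub>M K"
  by (subst measurable_pair_swap_iff) (use measurable_count_int_vecs[of f N K] assms in simp)

text \<open>The periodisation f and the Fourier series f' with coefficients \<open>gh\<close> are
  both bounded on the cube and continuous at 0, and integrating either against the m-th character
  gives \<open>gh (- m)\<close>. Their difference therefore vanishes at 0 by
  \<open>fourier_uniqueness\<close>, which is the claim.\<close>

theorem poisson_summation:
  fixes g :: "real^'n \<Rightarrow> complex"
  assumes cont: "continuous_on UNIV g" and s: "s > real CARD('n)"
    and bnd: "\<And>x. norm (g x) \<le> B * (1 + norm x) powr (- s)"
    and ghat: "integrable (count_space int_vecs) (\<lambda>m. \<integral>x. g x * echar (- (m \<bullet> x)) \<partial>lborel)"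
  shows "(\<integral>k. g k \<partial>count_space int_vecs) = (\<integral>m. \<integral>x. g x * echar (- (m \<bullet> x)) \<partial>lborel \<partial>count_space int_vecs)"
proof -
  interpret K: sigma_finite_measure "count_space (int_vecs :: (real^'n) set)" by (rule sigma_finite_int_vecs)
  interpret P: pair_sigma_finite "count_space (int_vecs :: (real^'n) set)" "lborel :: (real^'n) measure" ..
  have [measurable]: "g \<in> borel_measurable borel" by (rule borel_measurable_continuous_onI[OF cont])
  define gh where "gh m = (\<integral>x. g x * echar (- (m \<bullet> x)) \<partial>lborel)" for m
  have B0: "0 \<le> B" using order_trans[OF norm_ge_zero bnd[of 0]] by simp
  have gi: "integrable lborel g"
    by (rule Bochner_Integration.integrable_bound[OF integrable_mult_right[OF integrable_decay[OF s], of B]])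
      (use bnd B0 in auto)
  define w where "w R k = B * ((1 + R) powr s * (1 + norm k) powr (- s))" for R and k :: "real^'n"
  have wi: "integrable (count_space int_vecs) (w R)" for R
    unfolding w_def by (intro integrable_mult_right integrable_decay_int_vecs s)
  \<comment> \<open>Uniform decay for shifts of norm at most R: R = d gives boundedness of f on the
    cube, R = 1 gives continuity at 0.\<close>
  have gw: "norm (g (x + k)) \<le> w R k" if "norm x \<le> R" for x k R
  proof -
    have R: "0 \<le> R" using that norm_ge_zero order_trans by blast
    have "norm (g (x + k)) \<le> B * (1 + norm (x + k)) powr (- s)" by (rule bnd)
    also have "\<dots> \<le> w R k" unfolding w_def
      using one_plus_norm_shift(2)[OF that, of k] s R B0 by (intro mult_left_mono powr_neg_le) (auto simp: add_pos_nonneg)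
    finally show ?thesis .
  qed
  define f where "f x = (\<integral>k. g (x + k) \<partial>count_space int_vecs)" for x
  define f' where "f' x = (\<integral>m. gh m * echar (m \<bullet> x) \<partial>count_space int_vecs)" for x
  have ghi: "integrable (count_space int_vecs) gh" unfolding gh_def by (rule ghat)
  have fm [measurable]: "f \<in> borel_measurable borel"
  proof -
    have "(\<lambda>(x, k). g (x + k)) \<in> borel_measurable (lborel \<Otimes>\<^sub>M count_space int_vecs)"
      by (rule measurable_count_int_vecs') measurable
    then show ?thesis unfolding f_def using K.borel_measurable_lebesgue_integral[of "\<lambda>x k. g (x + k)" lborel] by simp
  qed
  have f'm [measurable]: "f' \<in> borel_measurable borel"
  proof -
    have "(\<lambda>(x, m). gh m * echar (m \<bullet> x)) \<in> borel_measurable (lborel \<Otimes>\<^sub>M count_space int_vecs)"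
      by (rule measurable_count_int_vecs') measurable
    then show ?thesis unfolding f'_def using K.borel_measurable_lebesgue_integral[of "\<lambda>x m. gh m * echar (m \<bullet> x)" lborel] by simp
  qed
  have "f 0 - f' 0 = 0"
  proof (rule fourier_uniqueness)
    show "(\<lambda>x. f x - f' x) \<in> borel_measurable borel" by measurable
    let ?n = "real CARD('n)"
    show "norm (f x - f' x) \<le> integral\<^sup>L (count_space int_vecs) (w ?n) + (\<integral>m. norm (gh m) \<partial>count_space int_vecs)"
      if "x \<in> unit_cube" for x
    proof -
      have "norm (f x) \<le> integral\<^sup>L (count_space int_vecs) (w ?n)"
        unfolding f_def
        by (rule Bochner_Integration.integral_norm_bound_integral)
          (auto intro!: wi gw norm_unit_cube_le that Bochner_Integration.integrable_bound[OF wi[of ?n]] AE_I2 order_trans[OF gw abs_ge_self])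
      moreover have "norm (f' x) \<le> (\<integral>m. norm (gh m) \<partial>count_space int_vecs)"
        unfolding f'_def
        by (rule Bochner_Integration.integral_norm_bound_integral)
          (auto intro!: ghi integrable_norm Bochner_Integration.integrable_bound[OF ghi] simp: norm_mult)
      ultimately show ?thesis using norm_triangle_ineq4[of "f x" "f' x"] by linarith
    qed
    have "(f \<longlongrightarrow> f 0) (at 0 within ball 0 1)"
      unfolding f_def
    proof (rule integral_dominated_convergence_within)
      show "integrable (count_space int_vecs) (w 1)" by (rule wi)
      show "AE k in count_space int_vecs. norm (g (y + k)) \<le> w 1 k" if "y \<in> ball 0 1 - {0}" for y
        using that by (intro AE_I2 gw) auto
      have "isCont g z" for z using cont by (simp add: continuous_on_eq_continuous_at)
      then have "isCont (\<lambda>y. g (y + k)) 0" for k by (intro isCont_o2[where g = g and f = "\<lambda>y. y + k"]) auto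
      then show "AE k in count_space int_vecs. ((\<lambda>y. g (y + k)) \<longlongrightarrow> g (0 + k)) (at 0 within ball 0 1)"
        by (intro AE_I2) (auto simp: isCont_def intro: tendsto_within_subset)
    qed auto
    then have 1: "isCont f 0" unfolding isCont_def by (subst (asm) at_within_open) auto
    have "(f' \<longlongrightarrow> f' 0) (at 0 within ball 0 1)"
      unfolding f'_def
    proof (rule integral_dominated_convergence_within)
      show "integrable (count_space int_vecs) (\<lambda>m. norm (gh m))" using ghi by simp
      have "continuous_on UNIV (\<lambda>y. gh k * echar (k \<bullet> y))" for k by (intro continuous_intros)
      then have "isCont (\<lambda>y. gh k * echar (k \<bullet> y)) 0" for k by (simp add: continuous_on_eq_continuous_at)
      then show "AE k in count_space int_vecs. ((\<lambda>y. gh k * echar (k \<bullet> y)) \<longlongrightarrow> gh k * echar (k \<bullet> 0)) (at 0 within ball 0 1)"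
        by (intro AE_I2) (auto simp: isCont_def intro: tendsto_within_subset)
    qed (auto simp: norm_mult)
    then have 2: "isCont f' 0" unfolding isCont_def by (subst (asm) at_within_open) auto
    show "isCont (\<lambda>x. f x - f' x) 0" by (intro continuous_intros 1 2)
    fix m :: "real^'n" assume m: "m \<in> int_vecs"
    have m': "- m \<in> int_vecs" using int_vecs_diff[OF int_vecs_0 m] by simp
    \<comment> \<open>The character has period one in every integer direction. It can thus be
      multiplied in before unfolding, and a coefficient of the periodisation becomes a single
      integral over the whole space.\<close>
    let ?F = "\<lambda>x. g x * echar (m \<bullet> x)"
    have Fi: "integrable lborel ?F"
      by (rule Bochner_Integration.integrable_bound[OF gi]) (auto simp: norm_mult)
    note U = integral_unfold[OF Fi]
    have per: "echar (m \<bullet> (x + k)) = echar (m \<bullet> x)" if "k \<in> int_vecs" for x k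
      unfolding inner_add_right echar_add using int_vecs_inner[OF m that] by (simp add: echar_int)
    have A: "integrable lborel (\<lambda>x. \<integral>k. indicator unit_cube x *\<^sub>R ?F (x + k) \<partial>count_space int_vecs)"
      using P.integrable_snd[OF U(1)] by simp
    have A': "(\<integral>k. indicator unit_cube x *\<^sub>R ?F (x + k) \<partial>count_space int_vecs) = indicator unit_cube x *\<^sub>R (f x * echar (m \<bullet> x))" for x
    proof -
      have "(\<integral>k. indicator unit_cube x *\<^sub>R ?F (x + k) \<partial>count_space int_vecs)
        = (\<integral>k. (of_real (indicator unit_cube x) * echar (m \<bullet> x)) * g (x + k) \<partial>count_space int_vecs)"
        by (rule Bochner_Integration.integral_cong[OF refl]) (simp add: per scaleR_conv_of_real)
      also have "\<dots> = indicator unit_cube x *\<^sub>R (f x * echar (m \<bullet> x))"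
        by (subst integral_mult_right_zero) (simp only: f_def scaleR_conv_of_real mult_ac)
      finally show ?thesis .
    qed
    have fA: "(\<integral>x. indicator unit_cube x *\<^sub>R (f x * echar (m \<bullet> x)) \<partial>lborel) = gh (- m)"
    proof -
      have "(\<integral>x. indicator unit_cube x *\<^sub>R (f x * echar (m \<bullet> x)) \<partial>lborel)
        = (\<integral>k. \<integral>x. indicator unit_cube x *\<^sub>R ?F (x + k) \<partial>lborel \<partial>count_space int_vecs)"
        unfolding A'[symmetric] by (rule P.Fubini_integral[OF U(1)])
      also have "\<dots> = gh (- m)" unfolding U(2) gh_def by simp
      finally show ?thesis .
    qed
    let ?H = "\<lambda>(l, x). gh l * (indicator unit_cube x *\<^sub>R echar ((l + m) \<bullet> x))"
    have Hi: "integrable (count_space int_vecs \<Otimes>\<^sub>M lborel) ?H"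
    proof (rule P.Fubini_integrable)
      show "?H \<in> borel_measurable (count_space int_vecs \<Otimes>\<^sub>M lborel)"
        by (rule measurable_count_int_vecs) measurable
      have "(\<integral>y. norm (?H (l, y)) \<partial>lborel) = norm (gh l)" for l
      proof -
        have "(\<integral>y. norm (?H (l, y)) \<partial>lborel) = (\<integral>y. norm (gh l) * indicator (unit_cube :: (real^'n) set) y \<partial>lborel)"
          by (rule Bochner_Integration.integral_cong[OF refl]) (simp add: norm_mult indicator_def)
        also have "\<dots> = norm (gh l)" by (simp add: measure_def emeasure_unit_cube)
        finally show ?thesis .
      qed
      then show "integrable (count_space int_vecs) (\<lambda>l. \<integral>y. norm (?H (l, y)) \<partial>lborel)"
        using ghi by simp
      show "AE l in count_space int_vecs. integrable lborel (\<lambda>y. ?H (l, y))"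
        by (intro AE_I2) (simp only: split_conv, intro integrable_mult_right integrable_unit_cube_bounded[where B = 1], auto)
    qed
    have B': "(\<integral>l. ?H (l, x) \<partial>count_space int_vecs) = indicator unit_cube x *\<^sub>R (f' x * echar (m \<bullet> x))" for x
    proof -
      have "(\<integral>l. ?H (l, x) \<partial>count_space int_vecs)
        = (\<integral>l. (of_real (indicator unit_cube x) * echar (m \<bullet> x)) * (gh l * echar (l \<bullet> x)) \<partial>count_space int_vecs)"
        by (rule Bochner_Integration.integral_cong[OF refl]) (simp add: inner_add_left echar_add scaleR_conv_of_real)
      also have "\<dots> = indicator unit_cube x *\<^sub>R (f' x * echar (m \<bullet> x))"
        by (subst integral_mult_right_zero) (simp only: f'_def scaleR_conv_of_real mult_ac)
      finally show ?thesis .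
    qed
    have B: "integrable lborel (\<lambda>x. indicator unit_cube x *\<^sub>R (f' x * echar (m \<bullet> x)))"
      using P.integrable_snd[OF Hi] unfolding B'[symmetric] by simp
    have fB: "(\<integral>x. indicator unit_cube x *\<^sub>R (f' x * echar (m \<bullet> x)) \<partial>lborel) = gh (- m)"
    proof -
      have "(\<integral>x. indicator unit_cube x *\<^sub>R (f' x * echar (m \<bullet> x)) \<partial>lborel)
        = (\<integral>l. \<integral>x. ?H (l, x) \<partial>lborel \<partial>count_space int_vecs)"
        unfolding B'[symmetric] using P.Fubini_integral[of "\<lambda>l x. ?H (l, x)"] Hi by simp
      also have "\<dots> = (\<integral>l. gh l * indicator {- m} l \<partial>count_space int_vecs)"
      proof (rule Bochner_Integration.integral_cong[OF refl])
        fix l :: "real^'n" assume "l \<in> space (count_space int_vecs)"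
        then have "l + m \<in> int_vecs" using m by (simp add: int_vecs_add)
        then have "(\<integral>x. ?H (l, x) \<partial>lborel) = gh l * (if l + m = 0 then 1 else 0)"
          by (simp only: split_conv integral_mult_right_zero unit_cube_char(1))
        then show "(\<integral>x. ?H (l, x) \<partial>lborel) = gh l * indicator {- m} l"
          by (simp add: indicator_def eq_neg_iff_add_eq_0)
      qed
      also have "\<dots> = (\<integral>l. indicator {- m} l *\<^sub>R gh (- m) \<partial>count_space int_vecs)"
        by (rule Bochner_Integration.integral_cong[OF refl]) (auto simp: indicator_def)
      also have "\<dots> = gh (- m)" using m' by simp
      finally show ?thesis .
    qed
    have "(\<integral>x. indicator unit_cube x *\<^sub>R ((f x - f' x) * echar (m \<bullet> x)) \<partial>lborel)
      = (\<integral>x. indicator unit_cube x *\<^sub>R (f x * echar (m \<bullet> x)) - indicator unit_cube x *\<^sub>R (f' x * echar (m \<bullet> x)) \<partial>lborel)"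
      by (rule Bochner_Integration.integral_cong[OF refl]) (simp add: left_diff_distrib scaleR_diff_right)
    also have "\<dots> = 0"
      using A B unfolding A' by (subst Bochner_Integration.integral_diff) (simp_all add: fA fB)
    finally show "(\<integral>x. indicator unit_cube x *\<^sub>R ((f x - f' x) * echar (m \<bullet> x)) \<partial>lborel) = 0" .
  qed
  then show ?thesis by (simp add: f_def f'_def gh_def)
qed

lemma integrable_decay_bound:
  fixes g :: "real^'n \<Rightarrow> complex"
  assumes "s > real CARD('n)" "g \<in> borel_measurable borel" "\<And>x. norm (g x) \<le> B * (1 + norm x) powr (- s)"
  shows "integrable lborel g"
  by (rule Bochner_Integration.integrable_bound[OF integrable_mult_right[OF integrable_decay[OF assms(1)], of B]])
    (use assms in \<open>auto intro: order_trans[OF assms(3) abs_ge_self]\<close>)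

section \<open>Lattices\<close>

lemma
  fixes M :: "real^'n^'n"
  assumes "invertible M"
  shows matrix_inv_right: "M ** matrix_inv M = mat 1"
    and matrix_inv_left: "matrix_inv M ** M = mat 1"
proof -
  have "M ** matrix_inv M = mat 1 \<and> matrix_inv M ** M = mat 1"
    using assms unfolding matrix_inv_def invertible_def by (rule someI_ex)
  then show "M ** matrix_inv M = mat 1" "matrix_inv M ** M = mat 1" by auto
qed

section \<open>Linear changes of variables for Lebesgue measure\<close>

lemma borel_measurable_linear_vec: "linear (f :: real^'n \<Rightarrow> real^'m) \<Longrightarrow> f \<in> borel_measurable borel"
  by (intro borel_measurable_continuous_onI linear_continuous_on) (simp add: linear_conv_bounded_linear)

lemma nn_integral_shear:
  fixes F :: "real^'n \<Rightarrow> ennreal"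
  assumes mn: "m \<noteq> n" and [measurable]: "F \<in> borel_measurable borel"
  shows "(\<integral>\<^sup>+x. F (x + (x $ n) *\<^sub>R axis m 1) \<partial>lborel) = (\<integral>\<^sup>+x. F x \<partial>lborel)"
proof -
  interpret P: product_sigma_finite "\<lambda>_ :: real^'n. lborel :: real measure" ..
  let ?b = "axis m 1 :: real^'n"
  define I where "I = Basis - {?b}"
  have bB: "axis i (1::real) \<in> Basis" for i :: 'n by (simp add: axis_in_Basis_iff)
  have I: "finite I" "?b \<notin> I" "insert ?b I = Basis" using bB by (auto simp: I_def)
  define vec where "vec h = (\<Sum>b\<in>Basis. h b *\<^sub>R b)" for h :: "real^'n \<Rightarrow> real"
  have vec: "vec (x(?b := y)) = y *\<^sub>R ?b + (\<Sum>b\<in>I. x b *\<^sub>R b)" for x y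
    unfolding vec_def I(3)[symmetric] using I(1,2) by (simp add: sum.insert) (intro sum.cong, auto)
  have nth: "vec h $ i = h (axis i 1)" for h i
  proof -
    have "vec h $ i = vec h \<bullet> axis i 1" by (simp add: inner_axis)
    also have "\<dots> = h (axis i 1)" unfolding vec_def by (rule inner_sum_left_Basis[OF bB])
    finally show ?thesis .
  qed
  have ne: "axis n 1 \<noteq> ?b" using mn by (simp add: axis_eq_axis)
  have [measurable]: "vec \<in> (\<Pi>\<^sub>M b\<in>(Basis :: (real^'n) set). lborel) \<rightarrow>\<^sub>M borel"
    unfolding vec_def by measurable
  have lb: "(\<integral>\<^sup>+x. G x \<partial>lborel) = (\<integral>\<^sup>+x. \<integral>\<^sup>+y. G (vec (x(?b := y))) \<partial>lborel \<partial>Pi\<^sub>M I (\<lambda>_. lborel))"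
    if [measurable]: "G \<in> borel_measurable borel" for G :: "real^'n \<Rightarrow> ennreal"
  proof -
    have "(\<integral>\<^sup>+x. G x \<partial>lborel) = (\<integral>\<^sup>+h. G (vec h) \<partial>(\<Pi>\<^sub>M b\<in>Basis. lborel))"
      unfolding vec_def by (subst lborel_eq, subst nn_integral_distr) auto
    also have "\<dots> = (\<integral>\<^sup>+x. \<integral>\<^sup>+y. G (vec (x(?b := y))) \<partial>lborel \<partial>Pi\<^sub>M I (\<lambda>_. lborel))"
      unfolding I(3)[symmetric] by (rule P.product_nn_integral_insert[OF I(1,2)]) (simp add: I(3))
    finally show ?thesis .
  qed
  have "(\<integral>\<^sup>+x. F (x + (x $ n) *\<^sub>R ?b) \<partial>lborel) = (\<integral>\<^sup>+x. \<integral>\<^sup>+y. F (vec (x(?b := y))) \<partial>lborel \<partial>Pi\<^sub>M I (\<lambda>_. lborel))"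
  proof (subst lb, simp, rule nn_integral_cong)
    fix x :: "real^'n \<Rightarrow> real"
    have eq: "vec (x(?b := y)) + (vec (x(?b := y)) $ n) *\<^sub>R ?b = vec (x(?b := x (axis n 1) + 1 * y))" for y
      unfolding nth using ne by (simp add: vec algebra_simps)
    have m: "(\<lambda>y. F (vec (x(?b := y)))) \<in> borel_measurable borel"
      unfolding vec by measurable
    show "(\<integral>\<^sup>+y. F (vec (x(?b := y)) + (vec (x(?b := y)) $ n) *\<^sub>R ?b) \<partial>lborel) = (\<integral>\<^sup>+y. F (vec (x(?b := y))) \<partial>lborel)"
      unfolding eq using nn_integral_real_affine[OF m, of 1 "x (axis n 1)"] by simp
  qed
  also have "\<dots> = (\<integral>\<^sup>+x. F x \<partial>lborel)" by (rule lb[symmetric]) simp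
  finally show ?thesis .
qed

lemma prod_Basis_vec: "(\<Prod>b\<in>(Basis :: (real^'n) set). f b) = (\<Prod>i\<in>UNIV. f (axis i 1))"
proof -
  have B: "(Basis :: (real^'n) set) = (\<lambda>i. axis i 1) ` UNIV" by (auto simp: Basis_vec_def)
  have inj: "inj (\<lambda>i. axis i (1::real) :: real^'n)" by (auto simp: inj_on_def axis_eq_axis)
  show ?thesis unfolding B by (subst prod.reindex[OF inj]) simp
qed

text \<open>Linear maps are composed of shears, coordinate swaps, diagonal maps and maps with a
  vanishing coordinate, and the formula survives composition because determinants multiply. The
  hypothesis det \<noteq> 0 is carried inside the predicate \<open>Q\<close>, so singular building
  blocks satisfy it vacuously.\<close>

lemma nn_integral_linear:
  fixes f :: "real^'n \<Rightarrow> real^'n" and F :: "real^'n \<Rightarrow> ennreal"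
  assumes "linear f" "det (matrix f) \<noteq> 0" and F: "F \<in> borel_measurable borel"
  shows "(\<integral>\<^sup>+x. F x \<partial>lborel) = ennreal \<bar>det (matrix f)\<bar> * (\<integral>\<^sup>+x. F (f x) \<partial>lborel)"
proof -
  define Q where "Q f \<longleftrightarrow> (det (matrix f) \<noteq> 0 \<longrightarrow> (\<forall>F\<in>borel_measurable borel.
     (\<integral>\<^sup>+x. F x \<partial>lborel) = ennreal \<bar>det (matrix f)\<bar> * (\<integral>\<^sup>+x. F (f x) \<partial>lborel)))" for f :: "real^'n \<Rightarrow> real^'n"
  have "Q f"
    using \<open>linear f\<close>
  proof (rule induct_linear_elementary)
    fix f g :: "real^'n \<Rightarrow> real^'n" assume fg: "linear f" "linear g" "Q f" "Q g"
    have det: "det (matrix (f \<circ> g)) = det (matrix f) * det (matrix g)"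
      using fg by (simp add: matrix_compose det_mul)
    have [measurable]: "f \<in> borel_measurable borel" using fg by (rule_tac borel_measurable_linear_vec)
    show "Q (f \<circ> g)"
      unfolding Q_def
    proof safe
      fix F :: "real^'n \<Rightarrow> ennreal" assume [measurable]: "F \<in> borel_measurable borel"
      assume "det (matrix (f \<circ> g)) \<noteq> 0"
      then have nz: "det (matrix f) \<noteq> 0" "det (matrix g) \<noteq> 0" by (auto simp: det)
      have "(\<integral>\<^sup>+x. F x \<partial>lborel) = ennreal \<bar>det (matrix f)\<bar> * (\<integral>\<^sup>+x. F (f x) \<partial>lborel)"
        by (rule fg(3)[unfolded Q_def, rule_format, OF nz(1)]) measurable
      also have "(\<integral>\<^sup>+x. F (f x) \<partial>lborel) = ennreal \<bar>det (matrix g)\<bar> * (\<integral>\<^sup>+x. F (f (g x)) \<partial>lborel)"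
        by (rule fg(4)[unfolded Q_def, rule_format, OF nz(2)]) measurable
      finally show "(\<integral>\<^sup>+x. F x \<partial>lborel) = ennreal \<bar>det (matrix (f \<circ> g))\<bar> * (\<integral>\<^sup>+x. F ((f \<circ> g) x) \<partial>lborel)"
        by (simp add: det abs_mult ennreal_mult mult.assoc)
    qed
  next
    fix f :: "real^'n \<Rightarrow> real^'n" and i assume f: "linear f" "\<And>x. f x $ i = 0"
    have "row i (matrix f) = 0" using f by (simp add: row_def matrix_def vec_eq_iff)
    then show "Q f" by (simp add: Q_def det_zero_row)
  next
    fix c :: "'n \<Rightarrow> real"
    let ?T = "\<lambda>x::real^'n. \<chi> i. c i * x $ i"
    have det: "det (matrix ?T) = (\<Prod>i\<in>UNIV. c i)"
      by (subst det_diagonal) (auto simp: matrix_def axis_def)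
    have [measurable]: "?T \<in> borel_measurable borel"
      by (rule borel_measurable_linear_vec) (auto intro!: linearI simp: vec_eq_iff algebra_simps)
    show "Q ?T"
      unfolding Q_def det
    proof safe
      fix F :: "real^'n \<Rightarrow> ennreal" assume [measurable]: "F \<in> borel_measurable borel"
      assume nz: "(\<Prod>i\<in>UNIV. c i) \<noteq> 0"
      define c' where "c' b = (\<Sum>i\<in>UNIV. c i * b $ i)" for b :: "real^'n"
      have c': "c' (axis i 1) = c i" for i
      proof -
        have "c' (axis i 1) = (\<Sum>j\<in>UNIV. if j = i then c i else 0)"
          unfolding c'_def by (rule sum.cong) (auto simp: axis_def)
        then show ?thesis by simp
      qed
      have T: "0 + (\<Sum>b\<in>Basis. (c' b * (x \<bullet> b)) *\<^sub>R b) = ?T x" for x :: "real^'n"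
      proof -
        have "(0 + (\<Sum>b\<in>Basis. (c' b * (x \<bullet> b)) *\<^sub>R b)) $ i = ?T x $ i" for i
        proof -
          have "(\<Sum>b\<in>Basis. (c' b * (x \<bullet> b)) *\<^sub>R b) \<bullet> axis i 1 = c' (axis i 1) * (x \<bullet> axis i 1)"
            by (rule inner_sum_left_Basis) (simp add: axis_in_Basis_iff)
          then show ?thesis by (simp add: inner_axis c')
        qed
        then show ?thesis by (simp add: vec_eq_iff)
      qed
      have "lborel = density (distr lborel borel (\<lambda>x. 0 + (\<Sum>b\<in>Basis. (c' b * (x \<bullet> b)) *\<^sub>R b))) (\<lambda>_. ennreal (\<Prod>b\<in>(Basis :: (real^'n) set). \<bar>c' b\<bar>))"
        by (rule lborel_affine_euclidean) (use nz in \<open>auto simp: Basis_vec_def c'\<close>)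
      then have "lborel = density (distr lborel borel ?T) (\<lambda>_. ennreal \<bar>\<Prod>i\<in>UNIV. c i\<bar>)"
        unfolding T by (simp add: prod_Basis_vec c' abs_prod)
      then have "(\<integral>\<^sup>+x. F x \<partial>lborel) = (\<integral>\<^sup>+x. F x \<partial>density (distr lborel borel ?T) (\<lambda>_. ennreal \<bar>\<Prod>i\<in>UNIV. c i\<bar>))"
        by simp
      also have "\<dots> = ennreal \<bar>\<Prod>i\<in>UNIV. c i\<bar> * (\<integral>\<^sup>+x. F (?T x) \<partial>lborel)"
        by (subst nn_integral_density) (auto simp: nn_integral_distr nn_integral_cmult)
      finally show "(\<integral>\<^sup>+x. F x \<partial>lborel) = ennreal \<bar>\<Prod>i\<in>UNIV. c i\<bar> * (\<integral>\<^sup>+x. F (?T x) \<partial>lborel)" .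
    qed
  next
    fix m n :: 'n
    let ?p = "Transposition.transpose m n"
    let ?T = "\<lambda>x::real^'n. \<chi> i. x $ ?p i"
    have "matrix ?T = (\<chi> i. mat 1 $ ?p i)"
      by (auto simp: matrix_def mat_def axis_def vec_eq_iff)
    then have det: "\<bar>det (matrix ?T)\<bar> = 1"
      by (simp add: det_permute_rows permutes_swap_id sign_swap_id abs_mult)
    have [measurable]: "?T \<in> borel_measurable borel"
      by (rule borel_measurable_linear_vec) (auto intro!: linearI simp: vec_eq_iff)
    have "lborel = distr lborel borel ?T"
    proof (rule lborel_eqI)
      fix l u :: "real^'n" assume le: "\<And>b. b \<in> Basis \<Longrightarrow> l \<bullet> b \<le> u \<bullet> b"
      have le': "l $ i \<le> u $ i" for i using le[of "axis i 1"] by (simp add: inner_axis axis_in_Basis_iff)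
      have "?T -` box l u = box (?T l) (?T u)"
        by (auto simp: mem_box_cart) (metis transpose_involutory)+
      then have "emeasure (distr lborel borel ?T) (box l u) = emeasure lborel (box (?T l) (?T u))"
        by (simp add: emeasure_distr)
      also have "\<dots> = ennreal (\<Prod>b\<in>Basis. (?T u - ?T l) \<bullet> b)"
        by (subst emeasure_lborel_box) (auto simp: Basis_vec_def inner_axis le')
      also have "(\<Prod>b\<in>Basis. (?T u - ?T l) \<bullet> b) = (\<Prod>i\<in>UNIV. (u - l) $ ?p i)"
        by (simp add: prod_Basis_vec inner_axis)
      also have "\<dots> = (\<Prod>i\<in>UNIV. (u - l) $ i)"
        using prod.permute[OF permutes_swap_id[of m UNIV n], of "\<lambda>i. (u - l) $ i"] by (simp add: o_def)
      also have "\<dots> = (\<Prod>b\<in>Basis. (u - l) \<bullet> b)" by (simp add: prod_Basis_vec inner_axis)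
      finally show "emeasure (distr lborel borel ?T) (box l u) = ennreal (\<Prod>b\<in>Basis. (u - l) \<bullet> b)" .
    qed simp
    then have eq: "(\<integral>\<^sup>+x. F x \<partial>lborel) = (\<integral>\<^sup>+x. F x \<partial>distr lborel borel ?T)" for F by simp
    show "Q ?T"
      unfolding Q_def det
    proof safe
      fix F :: "real^'n \<Rightarrow> ennreal" assume [measurable]: "F \<in> borel_measurable borel"
      show "(\<integral>\<^sup>+x. F x \<partial>lborel) = ennreal 1 * (\<integral>\<^sup>+x. F (?T x) \<partial>lborel)"
        unfolding eq[of F] by (subst nn_integral_distr) auto
    qed
  next
    fix m n :: 'n assume mn: "m \<noteq> n"
    let ?T = "\<lambda>x::real^'n. \<chi> i. if i = m then x $ m + x $ n else x $ i"
    have "matrix ?T = (\<chi> k. if k = m then row m (mat 1) + 1 *s row n (mat 1) else row k (mat 1))"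
      by (auto simp: matrix_def mat_def axis_def row_def vec_eq_iff)
    then have det: "det (matrix ?T) = 1" using det_row_operation[OF mn, where c = 1 and A = "mat 1"] by simp
    have "?T x = x + (x $ n) *\<^sub>R axis m 1" for x by (auto simp: vec_eq_iff axis_def)
    then show "Q ?T" unfolding Q_def det using nn_integral_shear[OF mn] by simp
  qed
  then show ?thesis using assms unfolding Q_def by blast
qed

lemma lborel_linear_density:
  fixes M :: "real^'n^'n"
  assumes M: "invertible M"
  shows "lborel = density (distr lborel borel ((*v) M)) (\<lambda>_. ennreal \<bar>det M\<bar>)"
proof (rule measure_eqI)
  have [measurable]: "(*v) M \<in> borel_measurable borel" by (rule borel_measurable_linear_vec) simp
  fix A assume "A \<in> sets (lborel :: (real^'n) measure)"
  then have [measurable]: "A \<in> sets borel" by simp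
  have "emeasure lborel A = (\<integral>\<^sup>+x. indicator A x \<partial>lborel)" by simp
  also have "\<dots> = ennreal \<bar>det M\<bar> * (\<integral>\<^sup>+x. indicator A (M *v x) \<partial>lborel)"
    by (subst nn_integral_linear[of "(*v) M"]) (use M in \<open>auto simp: invertible_det_nz\<close>)
  also have "(\<integral>\<^sup>+x. indicator A (M *v x) \<partial>lborel) = (\<integral>\<^sup>+x. indicator A x \<partial>distr lborel borel ((*v) M))"
    by (subst nn_integral_distr) auto
  also have "ennreal \<bar>det M\<bar> * \<dots> = emeasure (density (distr lborel borel ((*v) M)) (\<lambda>_. ennreal \<bar>det M\<bar>)) A"
    by (simp add: emeasure_density nn_integral_cmult)
  finally show "emeasure lborel A = emeasure (density (distr lborel borel ((*v) M)) (\<lambda>_. ennreal \<bar>det M\<bar>)) A" .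
qed simp

lemma integral_lborel_linear:
  fixes M :: "real^'n^'n" and f :: "real^'n \<Rightarrow> complex"
  assumes M: "invertible M" and [measurable]: "f \<in> borel_measurable borel"
  shows "(\<integral>x. f x \<partial>lborel) = \<bar>det M\<bar> *\<^sub>R (\<integral>x. f (M *v x) \<partial>lborel)"
proof -
  have [measurable]: "(*v) M \<in> borel_measurable borel" by (rule borel_measurable_linear_vec) simp
  show ?thesis
    by (subst lborel_linear_density[OF M], subst integral_density) (auto simp: integral_distr)
qed

section \<open>Lattices as linear images of the integer vectors\<close>

lemma lattice_of_eq_image: "lattice_of M = (*v) M ` int_vecs"
  by (auto simp: lattice_of_def int_vecs_def)

lemma inj_matrix_vector_mult: "invertible M \<Longrightarrow> inj ((*v) (M :: real^'n^'n))"
proof (rule injI)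
  fix x y :: "real^'n" assume M: "invertible M" and eq: "M *v x = M *v y"
  have "matrix_inv M *v (M *v x) = matrix_inv M *v (M *v y)" by (simp only: eq)
  then show "x = y" by (simp add: matrix_vector_mul_assoc matrix_inv_left[OF M])
qed

lemma bij_betw_lattice: "invertible M \<Longrightarrow> bij_betw ((*v) M) int_vecs (lattice_of M)"
  unfolding lattice_of_eq_image by (rule inj_on_imp_bij_betw) (rule inj_on_subset[OF inj_matrix_vector_mult], auto)

lemma countable_lattice_of: "countable (lattice_of (M :: real^'n^'n))"
  unfolding lattice_of_eq_image by (intro countable_image countable_int_vecs)

text \<open>With L at least 1 the same constant serves in 1 + |x| \<le> L (1 + |M x|), the form
  needed for decay estimates.\<close>

lemma matrix_inv_bound:
  fixes M :: "real^'n^'n"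
  assumes M: "invertible M"
  obtains L where "L \<ge> 1" "\<And>x. norm x \<le> L * norm (M *v x)"
proof -
  obtain K where K: "K > 0" "\<And>x. norm (matrix_inv M *v x) \<le> norm x * K"
    using bounded_linear.pos_bounded[OF matrix_vector_mul_bounded_linear[of "matrix_inv M"]] by auto
  have "norm x \<le> max 1 K * norm (M *v x)" for x
  proof -
    have "norm x = norm (matrix_inv M *v (M *v x))" by (simp add: matrix_vector_mul_assoc matrix_inv_left[OF M])
    also have "\<dots> \<le> norm (M *v x) * K" by (rule K)
    also have "\<dots> \<le> norm (M *v x) * max 1 K" by (intro mult_left_mono) auto
    finally show ?thesis by (simp add: mult.commute)
  qed
  then show thesis by (intro that[of "max 1 K"]) auto
qed

lemma int_vecs_norm_ge_1:
  assumes "k \<in> int_vecs" "k \<noteq> 0"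
  shows "1 \<le> norm (k :: real^'n)"
proof -
  obtain i where i: "k $ i \<noteq> 0" using assms by (auto simp: vec_eq_iff)
  have "k $ i \<in> \<int>" using assms by (simp add: int_vecs_def)
  with i have "1 \<le> \<bar>k $ i\<bar>" by (rule Ints_nonzero_abs_ge1[rotated])
  also have "\<dots> \<le> norm k" by (rule component_le_norm_cart)
  finally show ?thesis .
qed

lemma lattice_of_norm_ge:
  fixes M :: "real^'n^'n"
  assumes M: "invertible M"
  obtains c where "c > 0" "\<And>z. z \<in> lattice_of M \<Longrightarrow> z \<noteq> 0 \<Longrightarrow> c \<le> norm z"
proof -
  obtain L where L: "L \<ge> 1" "\<And>x. norm x \<le> L * norm (M *v x)" by (metis matrix_inv_bound[OF M])
  have "1 / L \<le> norm z" if z: "z \<in> lattice_of M" "z \<noteq> 0" for z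
  proof -
    obtain k where k: "k \<in> int_vecs" "z = M *v k" using z(1) unfolding lattice_of_eq_image by blast
    then have "k \<noteq> 0" using z by auto
    have "1 \<le> norm k" by (rule int_vecs_norm_ge_1) fact+
    also have "\<dots> \<le> L * norm z" using L k by simp
    finally show ?thesis using L by (simp add: field_simps)
  qed
  then show thesis using L by (intro that[of "1 / L"]) auto
qed

lemma inner_matrix_inv: 
  fixes M :: "real^'n^'n"
  shows "k \<bullet> (A *v z) = (transpose A *v k) \<bullet> (z :: real^'n)"
  by (metis dot_lmul_matrix inner_commute transpose_transpose vector_transpose_matrix)

section \<open>Fourier transforms of cutoff functions\<close>

text \<open>Pulling back along \<open>M\<close> reduces the claim to the integer vectors. The
  substitution produces the factor 1/|det M| and replaces an integer frequency k by its image under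
  the inverse transpose of \<open>M\<close>, a point of the dual lattice.\<close>

theorem poisson_summation_lattice:
  fixes M :: "real^'n^'n" and G :: "real^'n \<Rightarrow> complex"
  assumes M: "invertible M" and cont: "continuous_on UNIV G" and s: "s > real CARD('n)"
    and bnd: "\<And>z. norm (G z) \<le> B * (1 + norm z) powr (- s)"
    and Ghat: "integrable (count_space int_vecs) (\<lambda>k. \<integral>z. G z * echar (- (z \<bullet> (transpose (matrix_inv M) *v k))) \<partial>lborel)"
  shows "(\<integral>z. G z \<partial>count_space (lattice_of M)) =
    (\<integral>k. \<integral>z. G z * echar (- (z \<bullet> (transpose (matrix_inv M) *v k))) \<partial>lborel \<partial>count_space int_vecs) / of_real \<bar>det M\<bar>"
proof -
  have det: "\<bar>det M\<bar> > 0" using M by (simp add: invertible_det_nz)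
  have lin: "linear ((*v) M)" by simp
  have [measurable]: "G \<in> borel_measurable borel" by (rule borel_measurable_continuous_onI[OF cont])
  define g where "g x = G (M *v x)" for x
  obtain L where L: "L \<ge> 1" "\<And>x. norm x \<le> L * norm (M *v x)" by (metis matrix_inv_bound[OF M])
  have B: "0 \<le> B" using order_trans[OF norm_ge_zero bnd[of 0]] by simp
  have ft: "(\<integral>x. g x * echar (- (k \<bullet> x)) \<partial>lborel) = (\<integral>z. G z * echar (- (z \<bullet> (transpose (matrix_inv M) *v k))) \<partial>lborel) / of_real \<bar>det M\<bar>" for k
  proof -
    have "(\<integral>z. G z * echar (- (z \<bullet> (transpose (matrix_inv M) *v k))) \<partial>lborel)
      = \<bar>det M\<bar> *\<^sub>R (\<integral>x. G (M *v x) * echar (- ((M *v x) \<bullet> (transpose (matrix_inv M) *v k))) \<partial>lborel)"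
      by (rule integral_lborel_linear[OF M]) measurable
    moreover have "(M *v x) \<bullet> (transpose (matrix_inv M) *v k) = k \<bullet> x" for x
      by (subst inner_commute, subst inner_matrix_inv[symmetric])
        (simp add: matrix_vector_mul_assoc matrix_inv_left[OF M])
    ultimately show ?thesis using det by (simp add: g_def scaleR_conv_of_real)
  qed
  have "(\<integral>z. G z \<partial>count_space (lattice_of M)) = (\<integral>k. g k \<partial>count_space int_vecs)"
    unfolding g_def by (rule integral_bij_count_space[OF bij_betw_lattice[OF M], symmetric])
  also have "\<dots> = (\<integral>m. \<integral>x. g x * echar (- (m \<bullet> x)) \<partial>lborel \<partial>count_space int_vecs)"
  proof (rule poisson_summation[OF _ s])
    show "continuous_on UNIV g" unfolding g_def
      by (intro continuous_on_compose2[OF cont] linear_continuous_on) (auto simp: linear_conv_bounded_linear[symmetric])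
    show "norm (g x) \<le> (B * L powr s) * (1 + norm x) powr (- s)" for x
    proof -
      have "norm (g x) \<le> B * (1 + norm (M *v x)) powr (- s)" unfolding g_def by (rule bnd)
      also have "\<dots> \<le> B * (L powr s * (1 + norm x) powr (- s))"
      proof (intro mult_left_mono powr_neg_le B)
        show "1 + norm x \<le> L * (1 + norm (M *v x))" using L(1) L(2)[of x] by (simp add: distrib_left)
      qed (use L s in \<open>auto simp: add_pos_nonneg\<close>)
      finally show ?thesis by (simp add: mult.assoc)
    qed
    show "integrable (count_space int_vecs) (\<lambda>m. \<integral>x. g x * echar (- (m \<bullet> x)) \<partial>lborel)"
      unfolding ft using Ghat by simp
  qed
  also have "\<dots> = (\<integral>k. \<integral>z. G z * echar (- (z \<bullet> (transpose (matrix_inv M) *v k))) \<partial>lborel \<partial>count_space int_vecs) / of_real \<bar>det M\<bar>"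
    unfolding ft by simp
  finally show ?thesis .
qed

lemma integrable_decay_lattice:
  fixes M :: "real^'n^'n"
  assumes M: "invertible M" and s: "s > real CARD('n)"
  shows "integrable (count_space (lattice_of M)) (\<lambda>z. (1 + norm z) powr (- s))"
proof -
  obtain L where L: "L \<ge> 1" "\<And>x. norm x \<le> L * norm (M *v x)" by (metis matrix_inv_bound[OF M])
  have "integrable (count_space int_vecs) (\<lambda>x. (1 + norm (M *v x)) powr (- s))"
  proof (rule Bochner_Integration.integrable_bound)
    show "integrable (count_space int_vecs) (\<lambda>x::real^'n. L powr s * (1 + norm x) powr (- s))"
      by (intro integrable_mult_right integrable_decay_int_vecs s)
    have "(1 + norm (M *v x)) powr (- s) \<le> L powr s * (1 + norm x) powr (- s)" for x
    proof (intro powr_neg_le)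
      show "1 + norm x \<le> L * (1 + norm (M *v x))" using L(1) L(2)[of x] by (simp add: distrib_left)
    qed (use L s in \<open>auto simp: add_pos_nonneg\<close>)
    then show "AE x in count_space int_vecs. norm ((1 + norm (M *v x)) powr (- s)) \<le> norm (L powr s * (1 + norm x) powr (- s))"
      by (intro AE_I2) simp
  qed simp
  then show ?thesis
    using integrable_bij_count_space[OF bij_betw_lattice[OF M], of "\<lambda>z. (1 + norm z) powr (- s)"] by simp
qed

text \<open>Translation invariance makes every difference quotient integrate to zero, and dominated
  convergence passes this on to the derivative. This supplies the integration by parts behind
  \<open>FT_partial_deriv\<close>.\<close>

lemma integral_derivative_eq_0:
  fixes h h' :: "real^'n \<Rightarrow> complex"
  assumes supp: "\<And>x. 1 \<le> norm x \<Longrightarrow> h x = 0"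
    and der: "\<And>x. ((\<lambda>t. h (x + t *\<^sub>R axis i 1)) has_vector_derivative h' x) (at 0)"
    and hm [measurable]: "h \<in> borel_measurable borel" "h' \<in> borel_measurable borel"
    and bnd: "\<And>x. norm (h x) \<le> B0" "\<And>x. norm (h' x) \<le> B"
  shows "(\<integral>x. h' x \<partial>lborel) = 0"
proof -
  let ?e = "axis i 1 :: real^'n"
  have B: "0 \<le> B" "0 \<le> B0" using order_trans[OF norm_ge_zero] bnd by blast+
  have der': "((\<lambda>t. h (x + t *\<^sub>R ?e)) has_vector_derivative h' (x + t *\<^sub>R ?e)) (at t)" for x t
  proof -
    have "((\<lambda>s. h ((x + t *\<^sub>R ?e) + s *\<^sub>R ?e)) has_vector_derivative h' (x + t *\<^sub>R ?e)) (at (t - t))"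
      using der[of "x + t *\<^sub>R ?e"] by simp
    moreover have "((\<lambda>s. s - t) has_vector_derivative 1) (at t)"
      by (auto intro!: derivative_eq_intros)
    ultimately have "((\<lambda>s. h ((x + t *\<^sub>R ?e) + s *\<^sub>R ?e)) \<circ> (\<lambda>s. s - t) has_vector_derivative 1 *\<^sub>R h' (x + t *\<^sub>R ?e)) (at t)"
      by (intro vector_diff_chain_at)
    then show ?thesis by (simp add: o_def algebra_simps)
  qed
  have lip: "norm (h (x + t *\<^sub>R ?e) - h x) \<le> B * \<bar>t\<bar>" for x t
  proof -
    have "norm ((\<lambda>s. h (x + s *\<^sub>R ?e)) t - (\<lambda>s. h (x + s *\<^sub>R ?e)) 0) \<le> B * norm (t - 0)"
    proof (rule differentiable_bound[where S = UNIV])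
      show "((\<lambda>s. h (x + s *\<^sub>R ?e)) has_derivative (\<lambda>r. r *\<^sub>R h' (x + s *\<^sub>R ?e))) (at s within UNIV)" for s
        using der'[of x s] by (simp add: has_vector_derivative_def)
      show "onorm (\<lambda>r. r *\<^sub>R h' (x + s *\<^sub>R ?e)) \<le> B" for s
      proof (rule onorm_le)
        fix r :: real
        show "norm (r *\<^sub>R h' (x + s *\<^sub>R ?e)) \<le> B * norm r"
          using mult_right_mono[OF bnd(2)[of "x + s *\<^sub>R ?e"], of "\<bar>r\<bar>"] by (simp add: mult.commute)
      qed
    qed auto
    then show ?thesis by simp
  qed
  have hi: "integrable lborel h"
  proof (rule Bochner_Integration.integrable_bound)
    show "integrable lborel (\<lambda>x::real^'n. indicator (ball 0 1) x * B0)"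
      by (intro integrable_mult_left integrable_real_indicator emeasure_bounded_finite) auto
    show "AE x in lborel. norm (h x) \<le> norm (indicator (ball 0 1) x * B0)"
      using bnd(1) supp B by (intro AE_I2) (auto simp: indicator_def)
  qed simp
  have "((\<lambda>t. \<integral>x. (h (x + t *\<^sub>R ?e) - h x) /\<^sub>R t \<partial>lborel) \<longlongrightarrow> (\<integral>x. h' x \<partial>lborel)) (at 0 within ball 0 1)"
  proof (rule integral_dominated_convergence_within)
    \<comment> \<open>For |t| < 1 the quotient vanishes outside the ball of radius 2, and inside it
      is bounded by the mean value inequality \<open>lip\<close>.\<close>
    show "integrable lborel (\<lambda>x::real^'n. indicator (ball 0 2) x * B)"
      by (intro integrable_mult_left integrable_real_indicator emeasure_bounded_finite) auto
    fix t :: real assume t: "t \<in> ball 0 1 - {0}"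
    show "AE x in lborel. norm ((h (x + t *\<^sub>R ?e) - h x) /\<^sub>R t) \<le> indicator (ball 0 2) x * B"
    proof (rule AE_I2)
      fix x :: "real^'n"
      show "norm ((h (x + t *\<^sub>R ?e) - h x) /\<^sub>R t) \<le> indicator (ball 0 2) x * B"
      proof (cases "norm x < 2")
        case True
        have "norm ((h (x + t *\<^sub>R ?e) - h x) /\<^sub>R t) = norm (h (x + t *\<^sub>R ?e) - h x) / \<bar>t\<bar>"
          by (simp only: norm_scaleR abs_inverse divide_inverse mult.commute)
        also have "\<dots> \<le> B" using lip[of x t] t by (simp add: pos_divide_le_eq)
        finally show ?thesis using True by simp
      next
        case False
        have "norm x \<le> norm (x + t *\<^sub>R ?e) + norm (t *\<^sub>R ?e)" using norm_triangle_ineq4[of "x + t *\<^sub>R ?e" "t *\<^sub>R ?e"] by simp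
        then have "1 \<le> norm (x + t *\<^sub>R ?e)" using False t by (simp add: norm_axis_1)
        then show ?thesis using False supp by simp
      qed
    qed
  next
    show "AE x in lborel. ((\<lambda>t. (h (x + t *\<^sub>R ?e) - h x) /\<^sub>R t) \<longlongrightarrow> h' x) (at 0 within ball 0 1)"
    proof (rule AE_I2)
      fix x
      have "((\<lambda>t. norm (h (x + t *\<^sub>R ?e) - h x - t *\<^sub>R h' x) / norm t) \<longlongrightarrow> 0) (at 0)"
        using der[of x] unfolding has_vector_derivative_def has_derivative_iff_norm by simp
      then have "((\<lambda>t. norm ((h (x + t *\<^sub>R ?e) - h x) /\<^sub>R t - h' x)) \<longlongrightarrow> 0) (at 0)"
      proof (rule Lim_transform_eventually)
        have "norm (h (x + t *\<^sub>R ?e) - h x - t *\<^sub>R h' x) / norm t = norm ((h (x + t *\<^sub>R ?e) - h x) /\<^sub>R t - h' x)"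
          if "t \<noteq> 0" for t
        proof -
          have "(h (x + t *\<^sub>R ?e) - h x) /\<^sub>R t - h' x = (h (x + t *\<^sub>R ?e) - h x - t *\<^sub>R h' x) /\<^sub>R t"
            using that by (simp add: scaleR_diff_right)
          then show ?thesis by (simp only: norm_scaleR) (simp add: divide_inverse mult.commute)
        qed
        then show "\<forall>\<^sub>F t in at 0. norm (h (x + t *\<^sub>R ?e) - h x - t *\<^sub>R h' x) / norm t = norm ((h (x + t *\<^sub>R ?e) - h x) /\<^sub>R t - h' x)"
          by (auto simp: eventually_at_filter)
      qed
      then have "((\<lambda>t. (h (x + t *\<^sub>R ?e) - h x) /\<^sub>R t) \<longlongrightarrow> h' x) (at 0)"
        unfolding tendsto_norm_zero_iff by (rule LIM_zero_cancel)
      then show "((\<lambda>t. (h (x + t *\<^sub>R ?e) - h x) /\<^sub>R t) \<longlongrightarrow> h' x) (at 0 within ball 0 1)"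
        by (rule tendsto_within_subset) simp
    qed
  qed measurable
  moreover have "(\<integral>x. (h (x + t *\<^sub>R ?e) - h x) /\<^sub>R t \<partial>lborel) = 0" for t
  proof -
    have "integrable lborel (\<lambda>x. h (x + t *\<^sub>R ?e))"
      using hi by (subst (asm) lborel_distr_plus[of "t *\<^sub>R ?e", symmetric], subst (asm) integrable_distr_eq) (auto simp: add.commute)
    then have "(\<integral>x. h (x + t *\<^sub>R ?e) - h x \<partial>lborel) = 0"
      using hi integral_translate[OF hm(1), of "t *\<^sub>R ?e"] by simp
    then show ?thesis by simp
  qed
  ultimately have "((\<lambda>t::real. 0) \<longlongrightarrow> (\<integral>x. h' x \<partial>lborel)) (at 0 within ball 0 1)" by (simp only:)
  moreover have "at (0::real) within ball 0 1 = at 0" by (rule at_within_open) auto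
  ultimately show ?thesis by (simp add: tendsto_const_iff)
qed

section \<open>Decay of Fourier transforms of smooth functions supported in the unit ball\<close>

definition FT :: "(real^'n \<Rightarrow> real) \<Rightarrow> real^'n \<Rightarrow> complex" where
  "FT f z = (\<integral>x. of_real (f x) * echar (- (z \<bullet> x)) \<partial>lborel)"

text \<open>The properties of a cutoff that pass to its partial derivatives, so that the induction
  in \<open>FT_decay\<close> can run over this class.\<close>

definition cc_smooth :: "(real^'n \<Rightarrow> real) \<Rightarrow> bool" where
  "cc_smooth f \<longleftrightarrow> smooth f \<and> closure {x. f x \<noteq> 0} \<subseteq> ball 0 1"

lemma cc_smooth_cont: "cc_smooth f \<Longrightarrow> continuous_on UNIV f"
  unfolding cc_smooth_def smooth_def by (drule conjunct1, drule spec[of _ "[]"]) (simp add: differentiable_imp_continuous_on)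

lemma cc_smooth_supp: "cc_smooth f \<Longrightarrow> 1 \<le> norm x \<Longrightarrow> f x = 0"
  unfolding cc_smooth_def using closure_subset[of "{x. f x \<noteq> 0}"] by force

lemma cc_smooth_has_derivative:
  fixes f :: "real^'n \<Rightarrow> real"
  assumes "cc_smooth f"
  shows "((\<lambda>t. f (x + t *\<^sub>R axis i 1)) has_vector_derivative partial_deriv i f x) (at 0)"
proof -
  have "f differentiable (at x)"
    using assms unfolding cc_smooth_def smooth_def by (elim conjE allE[of _ "[]"]) (simp add: differentiable_on_def)
  then have "f differentiable (at (x + 0 *\<^sub>R axis i 1))" by simp
  moreover have "(\<lambda>t. x + t *\<^sub>R axis i (1::real)) differentiable (at 0)" by simp
  ultimately have "f \<circ> (\<lambda>t. x + t *\<^sub>R axis i 1) differentiable (at 0)" by (intro differentiable_chain_at)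
  then show ?thesis unfolding partial_deriv_def by (simp add: vector_derivative_works o_def)
qed

lemma cc_smooth_partial_deriv:
  fixes f :: "real^'n \<Rightarrow> real"
  assumes "cc_smooth f"
  shows "cc_smooth (partial_deriv i f)"
proof -
  have "smooth (partial_deriv i f)"
    unfolding smooth_def
  proof
    fix js
    have "foldr partial_deriv (js @ [i]) f differentiable_on UNIV"
      using assms unfolding cc_smooth_def smooth_def by blast
    then show "foldr partial_deriv js (partial_deriv i f) differentiable_on UNIV" by simp
  qed
  moreover have "{x. partial_deriv i f x \<noteq> 0} \<subseteq> closure {x. f x \<noteq> 0}"
  proof (rule subsetI, rule ccontr)
    fix x assume x: "x \<in> {x. partial_deriv i f x \<noteq> 0}" "x \<notin> closure {x. f x \<noteq> 0}"
    then have "x \<in> - closure {x. f x \<noteq> 0}" by simp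
    moreover have "((\<lambda>t. x + t *\<^sub>R axis i (1::real)) \<longlongrightarrow> x + 0 *\<^sub>R axis i 1) (at 0)" by (intro tendsto_intros)
    ultimately have "\<forall>\<^sub>F t in at 0. x + t *\<^sub>R axis i (1::real) \<in> - closure {x. f x \<noteq> 0}"
      by (intro topological_tendstoD) auto
    then have "\<forall>\<^sub>F t in nhds 0. f (x + t *\<^sub>R axis i (1::real)) = 0"
      unfolding eventually_nhds_conv_at using x(2) closure_subset[of "{x. f x \<noteq> 0}"]
      by (auto elim!: eventually_mono)
    then have e: "\<forall>\<^sub>F t in at 0. 0 = f (x + t *\<^sub>R axis i (1::real))" and z: "0 = f (x + 0 *\<^sub>R axis i 1)"
      unfolding eventually_nhds_conv_at by (auto elim: eventually_mono)
    have "((\<lambda>t. f (x + t *\<^sub>R axis i 1)) has_vector_derivative 0) (at 0)"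
      unfolding has_vector_derivative_def
      by (rule has_derivative_transform_eventually[OF _ e z UNIV_I]) simp
    with cc_smooth_has_derivative[OF assms, of x i] have "partial_deriv i f x = 0"
      by (rule vector_derivative_unique_at)
    then show False using x by simp
  qed
  then have "closure {x. partial_deriv i f x \<noteq> 0} \<subseteq> closure {x. f x \<noteq> 0}" by (rule closure_minimal) simp
  ultimately show ?thesis using assms unfolding cc_smooth_def by blast
qed

lemma cc_smooth_bounded:
  assumes "cc_smooth f"
  obtains B where "\<And>x. \<bar>f x\<bar> \<le> B"
proof -
  have "compact (f ` cball 0 1)"
    by (intro compact_continuous_image continuous_on_subset[OF cc_smooth_cont[OF assms]]) auto
  then obtain B where B: "\<And>x. x \<in> cball 0 1 \<Longrightarrow> \<bar>f x\<bar> \<le> B" by (force dest!: compact_imp_bounded simp: bounded_iff)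
  have "\<bar>f x\<bar> \<le> max B 0" for x
    using B[of x] cc_smooth_supp[OF assms, of x] by (cases "norm x \<le> 1") (auto simp: le_max_iff_disj)
  then show thesis by (rule that)
qed

lemma cc_smooth_measurable [measurable (raw)]: "cc_smooth f \<Longrightarrow> f \<in> borel_measurable borel"
  by (intro borel_measurable_continuous_onI cc_smooth_cont)

lemma cc_smooth_integrable:
  assumes f: "cc_smooth f" and [measurable]: "g \<in> borel_measurable borel" and g: "\<And>x. norm (g x) \<le> 1"
  shows "integrable lborel (\<lambda>x. of_real (f x) * (g x :: complex))"
proof -
  obtain B where B: "\<And>x. \<bar>f x\<bar> \<le> B" using cc_smooth_bounded[OF f] by blast
  have [measurable]: "f \<in> borel_measurable borel" by (rule cc_smooth_measurable[OF f])
  show ?thesis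
  proof (rule Bochner_Integration.integrable_bound)
    show "integrable lborel (\<lambda>x::real^'a. indicator (ball 0 1) x * B)"
      by (intro integrable_mult_left integrable_real_indicator emeasure_bounded_finite) auto
    show "AE x in lborel. norm (of_real (f x) * g x) \<le> norm (indicator (ball 0 1) x * B)"
    proof (rule AE_I2)
      fix x
      have "\<bar>f x\<bar> * norm (g x) \<le> \<bar>f x\<bar> * 1" by (intro mult_left_mono g) auto
      then show "norm (of_real (f x) * g x) \<le> norm (indicator (ball 0 1) x * B)"
        using B[of x] cc_smooth_supp[OF f, of x] by (cases "norm x < 1") (auto simp: norm_mult)
    qed
  qed measurable
qed

text \<open>The derivative of f times the character integrates to zero; the product rule splits it
  into the two transforms.\<close>

lemma FT_partial_deriv:
  fixes f :: "real^'n \<Rightarrow> real"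
  assumes f: "cc_smooth f"
  shows "FT (partial_deriv i f) z = 2 * of_real pi * \<i> * of_real (z $ i) * FT f z"
proof -
  let ?h = "\<lambda>x. of_real (f x) * echar (- (z \<bullet> x))"
  let ?h' = "\<lambda>x. of_real (partial_deriv i f x) * echar (- (z \<bullet> x)) - 2 * of_real pi * \<i> * of_real (z $ i) * (of_real (f x) * echar (- (z \<bullet> x)))"
  note f' = cc_smooth_partial_deriv[OF f, of i]
  have [measurable]: "f \<in> borel_measurable borel" "partial_deriv i f \<in> borel_measurable borel"
    using f f' by (auto intro: cc_smooth_measurable)
  obtain B1 where B1: "\<And>x. \<bar>f x\<bar> \<le> B1" using cc_smooth_bounded[OF f] by blast
  obtain B2 where B2: "\<And>x. \<bar>partial_deriv i f x\<bar> \<le> B2" using cc_smooth_bounded[OF f'] by blast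
  have "(\<integral>x. ?h' x \<partial>lborel) = 0"
  proof (rule integral_derivative_eq_0[where h = ?h and i = i])
    show "?h x = 0" if "1 \<le> norm x" for x using cc_smooth_supp[OF f that] by simp
    show "((\<lambda>t. ?h (x + t *\<^sub>R axis i 1)) has_vector_derivative ?h' x) (at 0)" for x
    proof -
      have 1: "((\<lambda>t. complex_of_real (f (x + t *\<^sub>R axis i 1))) has_vector_derivative of_real (partial_deriv i f x)) (at 0)"
        using has_vector_derivative_of_real[OF cc_smooth_has_derivative[OF f, of x i, folded has_real_derivative_iff_has_vector_derivative]] by simp
      have 2: "((\<lambda>t. echar (- (z \<bullet> (x + t *\<^sub>R axis i 1)))) has_vector_derivative - (2 * of_real pi * \<i> * of_real (z $ i)) * echar (- (z \<bullet> x))) (at 0)"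
      proof -
        have "((\<lambda>t. exp (2 * of_real pi * \<i> * (- of_real (z \<bullet> x) - t * of_real (z $ i)))) has_field_derivative
           (- (2 * of_real pi * \<i> * of_real (z $ i))) * exp (2 * of_real pi * \<i> * (- of_real (z \<bullet> x) - of_real 0 * of_real (z $ i)))) (at (of_real 0))"
          by (auto intro!: derivative_eq_intros)
        from has_vector_derivative_real_field[OF this] show ?thesis
          by (simp add: echar_exp inner_add_right inner_axis algebra_simps)
      qed
      from has_vector_derivative_mult[OF 1 2] show ?thesis by (simp add: algebra_simps)
    qed
    show "norm (?h x) \<le> B1" for x using B1 by (simp add: norm_mult)
    show "norm (?h' x) \<le> B2 + 2 * pi * \<bar>z $ i\<bar> * B1" for x
      by (rule order_trans[OF norm_triangle_ineq4] add_mono)+ (use B1[of x] B2[of x] in \<open>auto simp: norm_mult intro!: mult_left_mono\<close>)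
  qed measurable
  moreover have "(\<integral>x. ?h' x \<partial>lborel) = FT (partial_deriv i f) z - 2 * of_real pi * \<i> * of_real (z $ i) * FT f z"
    unfolding FT_def
    by (subst Bochner_Integration.integral_diff) (auto intro!: integrable_mult_right cc_smooth_integrable f f')
  ultimately show ?thesis by simp
qed

lemma FT_bounded:
  fixes f :: "real^'n \<Rightarrow> real"
  assumes f: "cc_smooth f"
  shows "norm (FT f z) \<le> (\<integral>x. \<bar>f x\<bar> \<partial>lborel)"
  unfolding FT_def by (rule integral_norm_bound[THEN order_trans]) (simp add: norm_mult)

text \<open>Each derivative of f gains one factor |z_i| by \<open>FT_partial_deriv\<close>, so every
  power of a single coordinate is controlled; the largest coordinate then controls the norm up to
  the factor d.\<close>

lemma FT_decay:
  fixes f :: "real^'n \<Rightarrow> real"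
  assumes f: "cc_smooth f"
  obtains C where "\<And>z. norm (FT f z) * (1 + norm z) ^ N \<le> C"
proof -
  have pow: "\<exists>C. \<forall>z. norm (FT f z) * \<bar>z $ i\<bar> ^ k \<le> C" if "cc_smooth f" for i k and f :: "real^'n \<Rightarrow> real"
    using that
  proof (induction k arbitrary: f)
    case 0
    then show ?case using FT_bounded by auto
  next
    case (Suc k)
    from Suc.IH[OF cc_smooth_partial_deriv[OF Suc.prems, of i]]
    obtain C where C: "\<And>z. norm (FT (partial_deriv i f) z) * \<bar>z $ i\<bar> ^ k \<le> C" by blast
    have "norm (FT f z) * \<bar>z $ i\<bar> ^ Suc k \<le> C / (2 * pi)" for z
      using C[of z] by (simp add: FT_partial_deriv[OF Suc.prems] norm_mult field_simps)
    then show ?case by blast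
  qed
  have "\<forall>i. \<exists>C. \<forall>z. norm (FT f z) * \<bar>z $ i\<bar> ^ N \<le> C" using pow[OF f] by blast
  then obtain C where C: "\<And>i z. norm (FT f z) * \<bar>z $ i\<bar> ^ N \<le> C i" by metis
  obtain C0 where C0: "\<And>z. norm (FT f z) \<le> C0" using FT_bounded[OF f] by blast
  define d where "d = 1 + real CARD('n)"
  have "norm (FT f z) * (1 + norm z) ^ N \<le> d ^ N * (C0 + (\<Sum>i\<in>UNIV. C i))" for z
  proof -
    obtain j where j: "\<And>i. \<bar>z $ i\<bar> \<le> \<bar>z $ j\<bar>"
    proof -
      have "Max (range (\<lambda>i. \<bar>z $ i\<bar>)) \<in> range (\<lambda>i. \<bar>z $ i\<bar>)" by (rule Max_in) auto
      then obtain j where "Max (range (\<lambda>i. \<bar>z $ i\<bar>)) = \<bar>z $ j\<bar>" by (rule imageE)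
      then have "\<bar>z $ j\<bar> = Max (range (\<lambda>i. \<bar>z $ i\<bar>))" by (rule sym)
      then show ?thesis by (intro that[of j]) (simp add: Max_ge)
    qed
    have "norm z \<le> (\<Sum>i\<in>UNIV. \<bar>z $ i\<bar>)" by (rule norm_le_l1_cart)
    also have "\<dots> \<le> (\<Sum>i\<in>(UNIV :: 'n set). \<bar>z $ j\<bar>)" by (intro sum_mono j)
    finally have nz: "norm z \<le> CARD('n) * \<bar>z $ j\<bar>" by simp
    define m where "m = max 1 \<bar>z $ j\<bar>"
    have "1 + norm z \<le> 1 * m + CARD('n) * m"
      by (intro add_mono order_trans[OF nz] mult_left_mono) (auto simp: m_def)
    then have "1 + norm z \<le> d * m" by (simp add: d_def distrib_right)
    then have "(1 + norm z) ^ N \<le> d ^ N * m ^ N" by (simp add: power_mono flip: power_mult_distrib)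
    then have "norm (FT f z) * (1 + norm z) ^ N \<le> norm (FT f z) * (d ^ N * m ^ N)" by (intro mult_left_mono) auto
    also have "\<dots> = d ^ N * (norm (FT f z) * m ^ N)" by simp
    also have "\<dots> \<le> d ^ N * (C0 + (\<Sum>i\<in>UNIV. C i))"
    proof (intro mult_left_mono)
      have Ci: "0 \<le> C i" for i using order_trans[OF _ C[of 0 i]] by (simp add: zero_le_mult_iff)
      have Cj: "C j \<le> (\<Sum>i\<in>UNIV. C i)" by (rule member_le_sum) (use Ci in auto)
      have "0 \<le> C0" using order_trans[OF norm_ge_zero C0] .
      have "0 \<le> (\<Sum>i\<in>UNIV. C i)" by (intro sum_nonneg Ci)
      show "norm (FT f z) * m ^ N \<le> C0 + (\<Sum>i\<in>UNIV. C i)"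
        using C0[of z] C[of z j] Cj \<open>0 \<le> C0\<close> \<open>0 \<le> (\<Sum>i\<in>UNIV. C i)\<close> by (cases "\<bar>z $ j\<bar> \<le> 1") (auto simp: m_def max_def)
      show "0 \<le> d ^ N" by (simp add: d_def)
    qed
    finally show ?thesis .
  qed
  then show thesis by (rule that)
qed

section \<open>Polynomials times Gaussians\<close>

definition mono_fun :: "('n::finite \<Rightarrow> nat) \<Rightarrow> real^'n \<Rightarrow> complex" where
  "mono_fun \<alpha> z = (\<Prod>i\<in>UNIV. of_real (z $ i) ^ \<alpha> i)"

lemma poly_fun_mono: "poly_fun p z = (\<Sum>\<alpha>\<in>Poly_Mapping.keys p. Poly_Mapping.lookup p \<alpha> * mono_fun \<alpha> z)"
  by (simp add: poly_fun_def mono_fun_def)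

lemma sum_le_total_degree: "\<alpha> \<in> Poly_Mapping.keys p \<Longrightarrow> (\<Sum>i\<in>UNIV. \<alpha> i) \<le> total_degree p"
  unfolding total_degree_def by (rule Max_ge) auto

lemma continuous_on_mono_fun [continuous_intros]: "continuous_on S (mono_fun \<alpha>)"
  unfolding mono_fun_def by (intro continuous_intros)

lemma continuous_on_poly_fun [continuous_intros]: "continuous_on S (poly_fun p)"
  unfolding poly_fun_mono[abs_def] by (intro continuous_intros)

lemma poly_fun_bound:
  obtains C where "C \<ge> 0" "\<And>z. norm (poly_fun p z) \<le> C * (1 + norm z) ^ total_degree p"
proof
  let ?C = "\<Sum>\<alpha>\<in>Poly_Mapping.keys p. norm (Poly_Mapping.lookup p \<alpha>)"
  show "?C \<ge> 0" by (intro sum_nonneg) auto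
  fix z
  have "norm (poly_fun p z) \<le> (\<Sum>\<alpha>\<in>Poly_Mapping.keys p. norm (Poly_Mapping.lookup p \<alpha>) * (1 + norm z) ^ total_degree p)"
    unfolding poly_fun_mono
  proof (rule order_trans[OF norm_sum], rule sum_mono)
    fix \<alpha> assume \<alpha>: "\<alpha> \<in> Poly_Mapping.keys p"
    have "norm (mono_fun \<alpha> z) = (\<Prod>i\<in>UNIV. \<bar>z $ i\<bar> ^ \<alpha> i)"
      by (simp add: mono_fun_def prod_norm[symmetric] norm_power)
    also have "\<dots> \<le> (\<Prod>i\<in>UNIV. (1 + norm z) ^ \<alpha> i)"
    proof (intro prod_mono conjI power_mono)
      show "\<bar>z $ i\<bar> \<le> 1 + norm z" for i using component_le_norm_cart[of z i] by linarith
    qed auto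
    also have "\<dots> = (1 + norm z) ^ (\<Sum>i\<in>UNIV. \<alpha> i)" by (simp add: power_sum)
    also have "\<dots> \<le> (1 + norm z) ^ total_degree p" by (intro power_increasing sum_le_total_degree \<alpha>) auto
    finally show "norm (Poly_Mapping.lookup p \<alpha> * mono_fun \<alpha> z) \<le> norm (Poly_Mapping.lookup p \<alpha>) * (1 + norm z) ^ total_degree p"
      by (simp add: norm_mult mult_left_mono)
  qed
  then show "norm (poly_fun p z) \<le> ?C * (1 + norm z) ^ total_degree p" by (simp add: sum_distrib_right)
qed

text \<open>Rescaled Hermite polynomials, regarded as polynomials in 1/t with the frequency y as a
  parameter. The recursion is \<open>gauss_int_rec\<close> at \<nu> = -2 pi i y. The variable is 1/t
  because the asymptotics for large t are to be read off from the coefficients.\<close>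

fun hermite_aux :: "nat \<Rightarrow> real \<Rightarrow> complex poly" where
  "hermite_aux 0 y = 1"
| "hermite_aux (Suc 0) y = [:0, - \<i> * of_real y:]"
| "hermite_aux (Suc (Suc k)) y = [:0, 1:] * (smult (- \<i> * of_real y) (hermite_aux (Suc k) y)
     + smult (of_real (real (Suc k) / (2 * pi))) (hermite_aux k y))"

lemma gauss_int_hermite:
  assumes t: "t > 0"
  shows "gauss_int k t (- (2 * of_real pi * \<i> * of_real y)) =
    of_real (exp (- pi * y\<^sup>2 / t) / sqrt t) * poly (hermite_aux k y) (of_real (1 / t))"
proof (induction k y rule: hermite_aux.induct)
  case (1 y)
  have "(- (2 * of_real pi * \<i> * of_real y))\<^sup>2 / of_real (4 * pi * t) = complex_of_real (- pi * y\<^sup>2 / t)"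
    using t by (simp add: power2_eq_square field_simps)
  then show ?case unfolding gauss_int_0[OF t] by (simp only: exp_of_real) simp
next
  case (2 y)
  have e: "(- (2 * of_real pi * \<i> * of_real y))\<^sup>2 / of_real (4 * pi * t) = complex_of_real (- pi * y\<^sup>2 / t)"
    using t by (simp add: power2_eq_square field_simps)
  show ?case unfolding gauss_int_rec(1)[OF t] gauss_int_0[OF t] e exp_of_real using t by (simp add: field_simps)
next
  case (3 k y)
  have t': "complex_of_real t \<noteq> 0" using t by simp
  show ?case
    unfolding gauss_int_rec(2)[OF t] 3 using t' by (simp add: field_simps)
qed

lemma degree_hermite_aux: "degree (hermite_aux k y) \<le> k"
proof (induction k y rule: hermite_aux.induct)
  case (3 k y)
  have "degree (hermite_aux (Suc (Suc k)) y) \<le> 1 + degree (smult (- \<i> * of_real y) (hermite_aux (Suc k) y)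
     + smult (of_real (real (Suc k) / (2 * pi))) (hermite_aux k y))"
    unfolding hermite_aux.simps by (rule order_trans[OF degree_mult_le]) simp
  also have "\<dots> \<le> 1 + Suc k"
    using 3 by (intro add_left_mono degree_add_le order_trans[OF degree_smult_le]) auto
  finally show ?case by simp
qed auto

lemma continuous_on_coeff_hermite: "continuous_on S f \<Longrightarrow> continuous_on S (\<lambda>x. coeff (hermite_aux k (f x)) j)"
\<comment> \<open>The \<open>0\<close> instantiates the second parameter of the rule, which leaves
  an induction on k in steps of two about all points at once.\<close>
proof (induction k "0::real" arbitrary: j rule: hermite_aux.induct)
  case 2
  have "coeff (hermite_aux (Suc 0) y) j = (if j = 1 then - \<i> * of_real y else 0)" for y
    by (auto simp: coeff_pCons split: nat.split)
  then show ?case using 2 by (cases "j = 1") (auto intro!: continuous_intros)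
next
  case (3 k)
  then show ?case by (cases j) (auto intro!: continuous_intros)
qed auto

lemma continuous_on_coeff_prod:
  fixes F :: "'i \<Rightarrow> 'a::topological_space \<Rightarrow> complex poly"
  assumes "finite I" "\<And>i j. i \<in> I \<Longrightarrow> continuous_on S (\<lambda>x. coeff (F i x) j)"
  shows "continuous_on S (\<lambda>x. coeff (\<Prod>i\<in>I. F i x) j)"
  using assms
proof (induction I arbitrary: j)
  case (insert a I)
  then show ?case by (auto simp: coeff_mult intro!: continuous_intros)
qed simp

text \<open>Each step of the recursion contributes one factor s and at most one factor |y|. The
  range s \<ge> 1 corresponds to t \<le> 1, where the dual lattice sum is estimated.\<close>

lemma norm_poly_hermite_le:
  obtains c where "c \<ge> 0" "\<And>s y. s \<ge> 1 \<Longrightarrow> norm (poly (hermite_aux k y) (of_real s)) \<le> c * (s * (1 + \<bar>y\<bar>)) ^ k"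
proof -
  have "\<exists>c\<ge>0. \<forall>s\<ge>1. \<forall>y. norm (poly (hermite_aux k y) (of_real s)) \<le> c * (s * (1 + \<bar>y\<bar>)) ^ k"
  proof (induction k "0::real" rule: hermite_aux.induct)
    case 1
    show ?case by (intro exI[of _ 1]) auto
  next
    case 2
    show ?case by (intro exI[of _ 1]) (auto simp: norm_mult mult_left_mono)
  next
    case (3 k)
    then obtain c1 c2 where c1: "c1 \<ge> 0" "\<And>s y. s \<ge> 1 \<Longrightarrow> norm (poly (hermite_aux (Suc k) y) (of_real s)) \<le> c1 * (s * (1 + \<bar>y\<bar>)) ^ Suc k"
      and c2: "c2 \<ge> 0" "\<And>s y. s \<ge> 1 \<Longrightarrow> norm (poly (hermite_aux k y) (of_real s)) \<le> c2 * (s * (1 + \<bar>y\<bar>)) ^ k" by metis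
    define d where "d = real (Suc k) / (2 * pi)"
    have d: "d \<ge> 0" by (simp add: d_def)
    have "norm (poly (hermite_aux (Suc (Suc k)) y) (of_real s)) \<le> (c1 + d * c2) * (s * (1 + \<bar>y\<bar>)) ^ Suc (Suc k)"
      if s: "s \<ge> 1" for s y
    proof -
      let ?w = "s * (1 + \<bar>y\<bar>)"
      have w: "1 * 1 \<le> ?w" using s by (intro mult_mono) auto
      have "norm (poly (hermite_aux (Suc (Suc k)) y) (of_real s)) =
        s * norm (- \<i> * of_real y * poly (hermite_aux (Suc k) y) (of_real s) + of_real d * poly (hermite_aux k y) (of_real s))"
        using s unfolding hermite_aux.simps poly_mult poly_add poly_smult d_def[symmetric] by (simp add: norm_mult)
      also have "\<dots> \<le> s * (\<bar>y\<bar> * norm (poly (hermite_aux (Suc k) y) (of_real s)) + d * norm (poly (hermite_aux k y) (of_real s)))"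
        using s d by (intro mult_left_mono order_trans[OF norm_triangle_ineq]) (auto simp: norm_mult)
      also have "\<dots> \<le> s * (\<bar>y\<bar> * (c1 * ?w ^ Suc k) + d * (c2 * ?w ^ k))"
        using s d by (intro mult_left_mono add_mono c1(2) c2(2)) auto
      also have "\<dots> = (s * \<bar>y\<bar>) * (c1 * ?w ^ Suc k) + s * (d * (c2 * ?w ^ k))" by (simp add: algebra_simps)
      also have "\<dots> \<le> ?w * (c1 * ?w ^ Suc k) + ?w * (d * (c2 * ?w ^ Suc k))"
      proof (rule add_mono)
        show "(s * \<bar>y\<bar>) * (c1 * ?w ^ Suc k) \<le> ?w * (c1 * ?w ^ Suc k)"
          using s w c1(1) by (intro mult_right_mono mult_left_mono) auto
        have "?w ^ k \<le> ?w ^ Suc k" using w by (intro power_increasing) auto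
        then show "s * (d * (c2 * ?w ^ k)) \<le> ?w * (d * (c2 * ?w ^ Suc k))"
          using s d c2(1) mult_left_mono[of 1 "1 + \<bar>y\<bar>" s] w
          by (intro mult_mono mult_left_mono) auto
      qed
      also have "\<dots> = (c1 + d * c2) * ?w ^ Suc (Suc k)" by (simp add: algebra_simps)
      finally show ?thesis .
    qed
    then show ?case using c1(1) c2(1) d by (intro exI[of _ "c1 + d * c2"]) auto
  qed
  then show thesis using that by blast
qed

text \<open>The polynomial in 1/t that accompanies the Gaussian in the Fourier transform of the
  polynomial \<open>p\<close> times a Gaussian, see \<open>fourier_poly_gauss\<close>. The frequency
  y stays a parameter because it will be averaged against the cutoff.\<close>

definition gauss_poly :: "(('n::finite \<Rightarrow> nat) \<Rightarrow>\<^sub>0 complex) \<Rightarrow> real^'n \<Rightarrow> complex poly" where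
  "gauss_poly p y = (\<Sum>\<alpha>\<in>Poly_Mapping.keys p. smult (Poly_Mapping.lookup p \<alpha>) (\<Prod>i\<in>UNIV. hermite_aux (\<alpha> i) (y $ i)))"

lemma continuous_on_gauss_poly: "continuous_on S (\<lambda>y. coeff (gauss_poly p y) j)"
  unfolding gauss_poly_def coeff_sum coeff_smult
  by (intro continuous_intros continuous_on_coeff_prod continuous_on_coeff_hermite) auto

lemma degree_gauss_poly: "degree (gauss_poly p y) \<le> total_degree p"
  unfolding gauss_poly_def
proof (rule degree_sum_le)
  fix \<alpha> assume \<alpha>: "\<alpha> \<in> Poly_Mapping.keys p"
  have "degree (\<Prod>i\<in>UNIV. hermite_aux (\<alpha> i) (y $ i)) \<le> (\<Sum>i\<in>UNIV. degree (hermite_aux (\<alpha> i) (y $ i)))"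
    using degree_prod_sum_le[of UNIV "\<lambda>i. hermite_aux (\<alpha> i) (y $ i)"] by (simp add: o_def)
  also have "\<dots> \<le> (\<Sum>i\<in>UNIV. \<alpha> i)" by (intro sum_mono degree_hermite_aux)
  also have "\<dots> \<le> total_degree p" by (rule sum_le_total_degree[OF \<alpha>])
  finally show "degree (smult (Poly_Mapping.lookup p \<alpha>) (\<Prod>i\<in>UNIV. hermite_aux (\<alpha> i) (y $ i))) \<le> total_degree p"
    using degree_smult_le order_trans by blast
qed simp

lemma poly_gauss_poly: "poly (gauss_poly p y) s = (\<Sum>j\<le>total_degree p. coeff (gauss_poly p y) j * s ^ j)"
  unfolding poly_altdef
  by (rule sum.mono_neutral_left) (use degree_gauss_poly in \<open>auto simp: coeff_eq_0\<close>)

lemma norm_gauss_poly_le: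
  fixes p :: "('n::finite \<Rightarrow> nat) \<Rightarrow>\<^sub>0 complex"
  obtains C where "C \<ge> 0" "\<And>s y. s \<ge> 1 \<Longrightarrow> norm (poly (gauss_poly p y) (of_real s)) \<le> C * (s * (1 + norm y)) ^ total_degree p"
proof -
  obtain c where c: "\<And>k. c k \<ge> 0" "\<And>k s y. s \<ge> 1 \<Longrightarrow> norm (poly (hermite_aux k y) (of_real s)) \<le> c k * (s * (1 + \<bar>y\<bar>)) ^ k"
  proof -
    have "\<forall>k. \<exists>c\<ge>0. \<forall>s\<ge>1. \<forall>y. norm (poly (hermite_aux k y) (of_real s)) \<le> c * (s * (1 + \<bar>y\<bar>)) ^ k"
      by (metis norm_poly_hermite_le)
    then show ?thesis using that by metis
  qed
  let ?C = "\<Sum>\<alpha>\<in>Poly_Mapping.keys p. norm (Poly_Mapping.lookup p \<alpha>) * (\<Prod>i\<in>UNIV. c (\<alpha> i))"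
  show thesis
  proof
    show "?C \<ge> 0" by (intro sum_nonneg mult_nonneg_nonneg prod_nonneg c) auto
    fix s :: real and y :: "real^'n" assume s: "s \<ge> 1"
    let ?w = "s * (1 + norm y)"
    have w: "1 * 1 \<le> ?w" using s by (intro mult_mono) auto
    have "norm (poly (gauss_poly p y) (of_real s)) \<le>
      (\<Sum>\<alpha>\<in>Poly_Mapping.keys p. norm (Poly_Mapping.lookup p \<alpha>) * (\<Prod>i\<in>UNIV. c (\<alpha> i)) * ?w ^ total_degree p)"
      unfolding gauss_poly_def poly_sum
    proof (rule order_trans[OF norm_sum], rule sum_mono)
      fix \<alpha> assume \<alpha>: "\<alpha> \<in> Poly_Mapping.keys p"
      have "norm (\<Prod>i\<in>UNIV. poly (hermite_aux (\<alpha> i) (y $ i)) (of_real s)) \<le> (\<Prod>i\<in>UNIV. c (\<alpha> i) * ?w ^ \<alpha> i)"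
        unfolding prod_norm[symmetric]
      proof (intro prod_mono conjI norm_ge_zero)
        fix i
        have "norm (poly (hermite_aux (\<alpha> i) (y $ i)) (of_real s)) \<le> c (\<alpha> i) * (s * (1 + \<bar>y $ i\<bar>)) ^ \<alpha> i" by (rule c(2)[OF s])
        also have "\<dots> \<le> c (\<alpha> i) * ?w ^ \<alpha> i"
          using s component_le_norm_cart[of y i] by (intro mult_left_mono power_mono c) auto
        finally show "norm (poly (hermite_aux (\<alpha> i) (y $ i)) (of_real s)) \<le> c (\<alpha> i) * ?w ^ \<alpha> i" .
      qed
      also have "\<dots> = (\<Prod>i\<in>UNIV. c (\<alpha> i)) * ?w ^ (\<Sum>i\<in>UNIV. \<alpha> i)" by (simp add: prod.distrib power_sum)
      also have "\<dots> \<le> (\<Prod>i\<in>UNIV. c (\<alpha> i)) * ?w ^ total_degree p"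
        using w by (intro mult_left_mono power_increasing sum_le_total_degree \<alpha> prod_nonneg c) auto
      finally show "norm (poly (smult (Poly_Mapping.lookup p \<alpha>) (\<Prod>i\<in>UNIV. hermite_aux (\<alpha> i) (y $ i))) (of_real s))
        \<le> norm (Poly_Mapping.lookup p \<alpha>) * (\<Prod>i\<in>UNIV. c (\<alpha> i)) * ?w ^ total_degree p"
        unfolding poly_smult poly_prod norm_mult mult.assoc by (intro mult_left_mono) auto
    qed
    then show "norm (poly (gauss_poly p y) (of_real s)) \<le> ?C * ?w ^ total_degree p" by (simp add: sum_distrib_right)
  qed
qed

text \<open>For a monomial the integrand is a product of functions of one coordinate each, and every
  factor integrates to a \<open>gauss_int\<close> at -2 pi i times a coordinate of y.\<close>

lemma fourier_poly_gauss:
  fixes p :: "('n::finite \<Rightarrow> nat) \<Rightarrow>\<^sub>0 complex"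
  assumes t: "t > 0"
  shows "has_bochner_integral lborel (\<lambda>z. poly_fun p z * of_real (exp (- pi * t * (norm z)\<^sup>2)) * echar (- (z \<bullet> y)))
     (of_real (exp (- pi * (norm y)\<^sup>2 / t) / sqrt t ^ CARD('n)) * poly (gauss_poly p y) (of_real (1 / t)))"
proof -
  have n2: "(norm (x::real^'n))\<^sup>2 = (\<Sum>i\<in>UNIV. (x $ i)\<^sup>2)" for x
    by (simp add: norm_vec_def L2_set_def sum_nonneg)
  have mono: "has_bochner_integral lborel (\<lambda>z. mono_fun \<alpha> z * of_real (exp (- pi * t * (norm z)\<^sup>2)) * echar (- (z \<bullet> y)))
     (of_real (exp (- pi * (norm y)\<^sup>2 / t) / sqrt t ^ CARD('n)) * (\<Prod>i\<in>UNIV. poly (hermite_aux (\<alpha> i) (y $ i)) (of_real (1 / t))))" for \<alpha>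
  proof -
    define f where "f i x = complex_of_real (x ^ \<alpha> i * exp (- pi * t * x\<^sup>2)) * exp (- (2 * of_real pi * \<i> * of_real (y $ i)) * of_real x)" for i x
    have eq: "mono_fun \<alpha> z * of_real (exp (- pi * t * (norm z)\<^sup>2)) * echar (- (z \<bullet> y)) = (\<Prod>i\<in>UNIV. f i (z $ i))" for z
    proof -
      have "complex_of_real (exp (- pi * t * (norm z)\<^sup>2)) = (\<Prod>i\<in>UNIV. of_real (exp (- pi * t * (z $ i)\<^sup>2)))"
        unfolding n2 sum_distrib_left by (subst exp_sum) auto
      moreover have "echar (- (z \<bullet> y)) = (\<Prod>i\<in>UNIV. exp (- (2 * of_real pi * \<i> * of_real (y $ i)) * of_real (z $ i)))"
        unfolding echar_exp inner_vec_def by (subst exp_sum[symmetric]) (auto simp: sum_distrib_left sum_negf mult_ac)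
      ultimately show ?thesis unfolding mono_fun_def f_def by (simp add: prod.distrib)
    qed
    have fi: "integrable lborel (f i)" for i unfolding f_def by (rule gauss_int_aux(1)[OF t])
    have "integral\<^sup>L lborel (f i) = of_real (exp (- pi * (y $ i)\<^sup>2 / t) / sqrt t) * poly (hermite_aux (\<alpha> i) (y $ i)) (of_real (1 / t))" for i
      using gauss_int_hermite[OF t, of "\<alpha> i" "y $ i"] unfolding f_def gauss_int_def by simp
    then have "(\<Prod>i\<in>UNIV. integral\<^sup>L lborel (f i)) = (\<Prod>i\<in>UNIV. of_real (exp (- pi * (y $ i)\<^sup>2 / t) / sqrt t)) * (\<Prod>i\<in>UNIV. poly (hermite_aux (\<alpha> i) (y $ i)) (of_real (1 / t)))"
      by (simp only: prod.distrib)
    also have "(\<Prod>i\<in>UNIV. complex_of_real (exp (- pi * (y $ i)\<^sup>2 / t) / sqrt t)) = of_real (exp (- pi * (norm y)\<^sup>2 / t) / sqrt t ^ CARD('n))"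
    proof -
      have "(\<Prod>i\<in>UNIV. exp (- pi * (y $ i)\<^sup>2 / t) / sqrt t) = exp (- pi * (norm y)\<^sup>2 / t) / sqrt t ^ CARD('n)"
        unfolding prod_dividef n2 by (simp add: exp_sum[symmetric] sum_distrib_left sum_divide_distrib sum_negf)
      then show ?thesis by (simp only: of_real_prod[symmetric])
    qed
    finally show ?thesis
      unfolding eq using lebesgue_integral_vec_prod[of f, OF fi] by (simp add: has_bochner_integral_iff)
  qed
  have "has_bochner_integral lborel (\<lambda>z. \<Sum>\<alpha>\<in>Poly_Mapping.keys p. Poly_Mapping.lookup p \<alpha> * (mono_fun \<alpha> z * of_real (exp (- pi * t * (norm z)\<^sup>2)) * echar (- (z \<bullet> y))))
    (\<Sum>\<alpha>\<in>Poly_Mapping.keys p. Poly_Mapping.lookup p \<alpha> * (of_real (exp (- pi * (norm y)\<^sup>2 / t) / sqrt t ^ CARD('n)) * (\<Prod>i\<in>UNIV. poly (hermite_aux (\<alpha> i) (y $ i)) (of_real (1 / t)))))"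
    by (intro has_bochner_integral_sum has_bochner_integral_mult_right mono)
  then show ?thesis
    by (simp add: poly_fun_mono gauss_poly_def poly_sum poly_prod sum_distrib_left sum_distrib_right mult_ac)
qed

text \<open>The polynomial F(s) is the heat flow of f for the time s/(4 pi), evaluated at the
  origin. A relation is used so that a function and its polynomial can be followed through the same
  linear operations, without recovering coefficients from a function.\<close>

inductive heat_rel :: "(real^'n \<Rightarrow> complex) \<Rightarrow> complex poly \<Rightarrow> bool" where
  mono: "heat_rel (mono_fun \<alpha>) (\<Prod>i\<in>UNIV. hermite_aux (\<alpha> i) 0)"
| zero: "heat_rel (\<lambda>_. 0) 0"
| add: "heat_rel f F \<Longrightarrow> heat_rel g G \<Longrightarrow> heat_rel (\<lambda>x. f x + g x) (F + G)"
| smult: "heat_rel f F \<Longrightarrow> heat_rel (\<lambda>x. c * f x) (smult c F)"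

lemma heat_rel_sum: "finite A \<Longrightarrow> (\<And>a. a \<in> A \<Longrightarrow> heat_rel (f a) (F a)) \<Longrightarrow> heat_rel (\<lambda>x. \<Sum>a\<in>A. f a x) (\<Sum>a\<in>A. F a)"
  by (induction A rule: finite_induct) (auto intro: heat_rel.intros)

lemma heat_rel_poly_fun: "heat_rel (poly_fun p) (gauss_poly p 0)"
  unfolding poly_fun_mono[abs_def] gauss_poly_def by (auto intro!: heat_rel_sum heat_rel.intros)

lemma poly_hermite_0: "poly (hermite_aux k 0) 0 = 0 ^ k"
  by (induction k "0::real" rule: hermite_aux.induct) auto

lemma heat_rel_0: "heat_rel f F \<Longrightarrow> coeff F 0 = f 0"
proof (induction rule: heat_rel.induct)
  case (mono \<alpha>)
  have "coeff (\<Prod>i\<in>UNIV. hermite_aux (\<alpha> i) 0) 0 = poly (\<Prod>i\<in>UNIV. hermite_aux (\<alpha> i) 0) 0" by (simp add: poly_0_coeff_0)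
  then show ?case by (simp add: poly_prod poly_hermite_0 mono_fun_def)
qed auto

text \<open>The heat equation for a monomial in one variable. The truncated \<open>k - 2\<close> is
  harmless because the factor k (k - 1) vanishes for k < 2.\<close>

lemma pderiv_hermite:
  "pderiv (hermite_aux k 0) = smult (of_nat (k * (k - 1)) / (4 * of_real pi)) (hermite_aux (k - 2) 0)"
proof (induction k rule: less_induct)
  case (less k)
  consider "k = 0" | "k = 1" | k' where "k = Suc (Suc k')" by (metis One_nat_def not0_implies_Suc)
  then show ?case
  proof cases
    case 3
    define c where "c = complex_of_real (real (Suc k') / (2 * pi))"
    have h: "hermite_aux k 0 = [:0, 1:] * smult c (hermite_aux k' 0)" by (simp add: 3 c_def)
    \<comment> \<open>Euler's identity: at y = 0 the polynomial is a multiple of the (k'/2)-th power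
      of its variable for even k' and zero for odd k'.\<close>
    have x: "[:0, 1:] * pderiv (hermite_aux k' 0) = smult (of_nat k' / 2) (hermite_aux k' 0)"
    proof (cases k')
      case (Suc k'')
      show ?thesis
      proof (cases k'')
        case (Suc j)
        have "[:0, 1:] * pderiv (hermite_aux k' 0) = smult (of_nat (k' * (k' - 1)) / (4 * of_real pi)) ([:0, 1:] * hermite_aux j 0)"
          using less.IH[of k'] 3 Suc \<open>k' = Suc k''\<close> by simp
        also have "\<dots> = smult (of_nat k' / 2) (smult (of_real (real (Suc j) / (2 * pi))) ([:0, 1:] * hermite_aux j 0))"
          using Suc \<open>k' = Suc k''\<close> by (simp add: field_simps)
        also have "smult (of_real (real (Suc j) / (2 * pi))) ([:0, 1:] * hermite_aux j 0) = hermite_aux k' 0"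
          using Suc \<open>k' = Suc k''\<close> by simp
        finally show ?thesis .
      qed (use \<open>k' = Suc k''\<close> in simp)
    qed simp
    have "pderiv (hermite_aux k 0) = smult c (hermite_aux k' 0 + [:0, 1:] * pderiv (hermite_aux k' 0))"
      unfolding h pderiv_mult pderiv_smult by (simp add: pderiv_pCons smult_add_right)
    also have "\<dots> = smult (c * (1 + of_nat k' / 2)) (hermite_aux k' 0)"
      unfolding x by (simp add: smult_add_left smult_add_right distrib_left)
    also have "c * (1 + of_nat k' / 2) = of_nat (k * (k - 1)) / (4 * of_real pi)"
      unfolding c_def 3 by (simp add: field_simps)
    finally show ?thesis using 3 by simp
  qed auto
qed

lemma mono_fun_has_deriv:
  "((\<lambda>t. mono_fun \<alpha> (x + t *\<^sub>R axis i 1)) has_vector_derivative of_nat (\<alpha> i) * mono_fun (\<alpha>(i := \<alpha> i - 1)) x) (at 0)"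
proof -
  define c where "c = (\<Prod>j\<in>UNIV - {i}. complex_of_real (x $ j) ^ \<alpha> j)"
  have m: "mono_fun \<beta> z = of_real (z $ i) ^ \<beta> i * (\<Prod>j\<in>UNIV - {i}. complex_of_real (z $ j) ^ \<beta> j)" for \<beta> z
    unfolding mono_fun_def by (rule prod.remove) auto
  have 1: "mono_fun \<alpha> (x + t *\<^sub>R axis i 1) = (of_real (x $ i) + of_real t) ^ \<alpha> i * c" for t
    unfolding m c_def by (intro arg_cong2[where f = "(*)"] prod.cong) (auto simp: axis_def)
  have 2: "mono_fun (\<alpha>(i := \<alpha> i - 1)) x = of_real (x $ i) ^ (\<alpha> i - 1) * c"
    unfolding m c_def by (intro arg_cong2[where f = "(*)"] prod.cong) auto
  have "((\<lambda>t. (of_real (x $ i) + t) ^ \<alpha> i * c) has_field_derivative of_nat (\<alpha> i) * (of_real (x $ i) + of_real 0) ^ (\<alpha> i - 1) * c) (at (of_real 0))"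
    by (auto intro!: derivative_eq_intros)
  from has_vector_derivative_real_field[OF this] show ?thesis unfolding 1 2 by (simp add: mult.assoc)
qed

lemma smult_sum_right: "smult c (\<Sum>i\<in>A. f i) = (\<Sum>i\<in>A. smult c (f i))"
  by (induction A rule: infinite_finite_induct) (auto simp: smult_add_right)

text \<open>The heat equation: up to the factor 4 pi, differentiating the polynomial corresponds to
  applying the Laplacian. On monomials it is the product rule together with
  \<open>pderiv_hermite\<close>.\<close>

lemma heat_rel_laplacian:
  assumes "heat_rel f F"
  shows "heat_rel (laplacian f) (smult (4 * of_real pi) (pderiv F))"
proof -
  \<comment> \<open>The induction carries the first and second partial derivatives as witnesses,
    since \<open>partial_deriv\<close> respects sums only where the derivatives are known to
    exist.\<close>
  have "\<exists>f1 f2. (\<forall>i x. ((\<lambda>t. f (x + t *\<^sub>R axis i 1)) has_vector_derivative f1 i x) (at 0)) \<and>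
     (\<forall>i x. ((\<lambda>t. f1 i (x + t *\<^sub>R axis i 1)) has_vector_derivative f2 i x) (at 0)) \<and>
     heat_rel (\<lambda>x. \<Sum>i\<in>UNIV. f2 i x) (smult (4 * of_real pi) (pderiv F))"
    using assms
  proof (induction rule: heat_rel.induct)
    case (mono \<alpha>)
    let ?f1 = "\<lambda>i x. of_nat (\<alpha> i) * mono_fun (\<alpha>(i := \<alpha> i - 1)) x"
    let ?f2 = "\<lambda>i x. of_nat (\<alpha> i * (\<alpha> i - 1)) * mono_fun (\<alpha>(i := \<alpha> i - 2)) x"
    have "((\<lambda>t. ?f1 i (x + t *\<^sub>R axis i 1)) has_vector_derivative ?f2 i x) (at 0)" for i x
    proof -
      have e: "(\<alpha>(i := \<alpha> i - 1))(i := (\<alpha>(i := \<alpha> i - 1)) i - 1) = \<alpha>(i := \<alpha> i - 2)" by (auto simp: numeral_2_eq_2)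
      show ?thesis
        using has_vector_derivative_mult_right[OF mono_fun_has_deriv[of "\<alpha>(i := \<alpha> i - 1)" x i], of "of_nat (\<alpha> i)"]
        unfolding e by (simp add: mult.assoc)
    qed
    moreover have "heat_rel (\<lambda>x. \<Sum>i\<in>UNIV. ?f2 i x) (\<Sum>i\<in>UNIV. smult (of_nat (\<alpha> i * (\<alpha> i - 1))) (\<Prod>j\<in>UNIV. hermite_aux ((\<alpha>(i := \<alpha> i - 2)) j) 0))"
      by (intro heat_rel_sum heat_rel.intros) auto
    moreover have "(\<Sum>i\<in>UNIV. smult (of_nat (\<alpha> i * (\<alpha> i - 1))) (\<Prod>j\<in>UNIV. hermite_aux ((\<alpha>(i := \<alpha> i - 2)) j) 0))
       = smult (4 * of_real pi) (pderiv (\<Prod>i\<in>UNIV. hermite_aux (\<alpha> i) 0))"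
    proof -
      have "smult (4 * of_real pi) ((\<Prod>j\<in>UNIV - {i}. hermite_aux (\<alpha> j) 0) * pderiv (hermite_aux (\<alpha> i) 0))
        = smult (of_nat (\<alpha> i * (\<alpha> i - 1))) (\<Prod>j\<in>UNIV. hermite_aux ((\<alpha>(i := \<alpha> i - 2)) j) 0)" for i
      proof -
        have "(\<Prod>j\<in>UNIV. hermite_aux ((\<alpha>(i := \<alpha> i - 2)) j) 0) = hermite_aux (\<alpha> i - 2) 0 * (\<Prod>j\<in>UNIV - {i}. hermite_aux (\<alpha> j) 0)"
          by (subst prod.remove[of _ i]) (auto intro!: arg_cong2[where f = "(*)"] prod.cong)
        then show ?thesis by (simp add: pderiv_hermite mult.commute)
      qed
      then show ?thesis by (simp add: pderiv_prod smult_sum_right)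
    qed
    ultimately show ?case using mono_fun_has_deriv[of \<alpha>]
      by (intro exI[of _ ?f1] exI[of _ ?f2]) simp
  next
    case zero
    show ?case by (intro exI[of _ "\<lambda>_ _. 0"]) (auto intro: heat_rel.intros)
  next
    case (add f F g G)
    then obtain f1 f2 g1 g2 where *: "\<And>i x. ((\<lambda>t. f (x + t *\<^sub>R axis i 1)) has_vector_derivative f1 i x) (at 0)"
     "\<And>i x. ((\<lambda>t. f1 i (x + t *\<^sub>R axis i 1)) has_vector_derivative f2 i x) (at 0)"
     "heat_rel (\<lambda>x. \<Sum>i\<in>UNIV. f2 i x) (smult (4 * of_real pi) (pderiv F))"
     "\<And>i x. ((\<lambda>t. g (x + t *\<^sub>R axis i 1)) has_vector_derivative g1 i x) (at 0)"
     "\<And>i x. ((\<lambda>t. g1 i (x + t *\<^sub>R axis i 1)) has_vector_derivative g2 i x) (at 0)"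
     "heat_rel (\<lambda>x. \<Sum>i\<in>UNIV. g2 i x) (smult (4 * of_real pi) (pderiv G))" by metis
    show ?case
      using heat_rel.add[OF *(3,6)]
      by (intro exI[of _ "\<lambda>i x. f1 i x + g1 i x"] exI[of _ "\<lambda>i x. f2 i x + g2 i x"])
        (auto intro!: has_vector_derivative_add * simp: sum.distrib pderiv_add smult_add_right)
  next
    case (smult f F c)
    then obtain f1 f2 where *: "\<And>i x. ((\<lambda>t. f (x + t *\<^sub>R axis i 1)) has_vector_derivative f1 i x) (at 0)"
     "\<And>i x. ((\<lambda>t. f1 i (x + t *\<^sub>R axis i 1)) has_vector_derivative f2 i x) (at 0)"
     "heat_rel (\<lambda>x. \<Sum>i\<in>UNIV. f2 i x) (smult (4 * of_real pi) (pderiv F))" by metis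
    show ?case
      using heat_rel.smult[OF *(3), of c]
      by (intro exI[of _ "\<lambda>i x. c * f1 i x"] exI[of _ "\<lambda>i x. c * f2 i x"])
        (auto intro!: has_vector_derivative_mult_right * simp: sum_distrib_left pderiv_smult mult.commute)
  qed
  then obtain f1 f2 where *: "\<And>i x. ((\<lambda>t. f (x + t *\<^sub>R axis i 1)) has_vector_derivative f1 i x) (at 0)"
     "\<And>i x. ((\<lambda>t. f1 i (x + t *\<^sub>R axis i 1)) has_vector_derivative f2 i x) (at 0)"
     "heat_rel (\<lambda>x. \<Sum>i\<in>UNIV. f2 i x) (smult (4 * of_real pi) (pderiv F))" by metis
  have "partial_deriv i f = f1 i" for i
    unfolding partial_deriv_def using vector_derivative_at[OF *(1)] by auto
  moreover have "partial_deriv i (f1 i) = f2 i" for i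
    unfolding partial_deriv_def using vector_derivative_at[OF *(2)] by auto
  ultimately have "laplacian f = (\<lambda>x. \<Sum>i\<in>UNIV. f2 i x)" by (auto simp: laplacian_def)
  then show ?thesis using *(3) by simp
qed

text \<open>Iterating \<open>heat_rel_laplacian\<close> and taking constant terms reads off the
  successive derivatives of F at 0.\<close>

lemma heat_rel_coeff:
  "heat_rel f F \<Longrightarrow> coeff F k * (4 * of_real pi) ^ k * fact k = (laplacian ^^ k) f 0"
proof (induction k arbitrary: f F)
  case 0
  then show ?case by (simp add: heat_rel_0)
next
  case (Suc k)
  have "(laplacian ^^ Suc k) f 0 = (laplacian ^^ k) (laplacian f) 0" by (simp add: funpow_swap1)
  also have "\<dots> = coeff (smult (4 * of_real pi) (pderiv F)) k * (4 * of_real pi) ^ k * fact k"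
    by (rule Suc.IH[symmetric]) (rule heat_rel_laplacian[OF Suc.prems])
  also have "\<dots> = coeff F (Suc k) * (4 * of_real pi) ^ Suc k * fact (Suc k)"
    by (simp add: coeff_pderiv algebra_simps)
  finally show ?case by simp
qed

lemma coeff_gauss_poly_0:
  "coeff (gauss_poly p 0) k = (laplacian ^^ k) (poly_fun p) 0 / (fact k * (4 * of_real pi) ^ k)"
  using heat_rel_coeff[OF heat_rel_poly_fun, of p k] by (simp add: field_simps)

section \<open>The Hadamard integral\<close>

lemma has_vector_derivative_of_real_powr:
  assumes "r > 0"
  shows "((\<lambda>r. complex_of_real r powr s) has_vector_derivative s * of_real r powr (s - 1)) (at r)"
  by (rule has_vector_derivative_real_field, rule has_field_derivative_powr)
    (use assms in \<open>auto simp: complex_nonpos_Reals_iff\<close>)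

lemma integral_powr_finite:
  assumes \<epsilon>: "0 < \<epsilon>" "\<epsilon> \<le> b"
  shows "has_bochner_integral lborel (\<lambda>r. indicator {\<epsilon>..b} r *\<^sub>R complex_of_real r powr (s - 1))
    (if s = 0 then of_real (ln b - ln \<epsilon>) else (of_real b powr s - of_real \<epsilon> powr s) / s)"
proof -
  have c: "continuous_on {\<epsilon>..b} (\<lambda>r. complex_of_real r powr (s - 1))"
    using \<epsilon> by (intro continuous_on_powr_complex continuous_intros) (auto simp: complex_nonpos_Reals_iff)
  have "integrable lborel (\<lambda>r. indicator {\<epsilon>..b} r *\<^sub>R complex_of_real r powr (s - 1))"
    by (rule borel_integrable_atLeastAtMost'[OF c, unfolded set_integrable_def])
  moreover have "(\<integral>r. indicator {\<epsilon>..b} r *\<^sub>R complex_of_real r powr (s - 1) \<partial>lborel) =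
     (if s = 0 then of_real (ln b - ln \<epsilon>) else (of_real b powr s - of_real \<epsilon> powr s) / s)"
  proof (cases "s = 0")
    case True
    have "(\<integral>r. indicator {\<epsilon>..b} r *\<^sub>R complex_of_real r powr (s - 1) \<partial>lborel) = of_real (ln b) - of_real (ln \<epsilon>)"
    proof (rule integral_FTC_atLeastAtMost[OF \<epsilon>(2) _ c])
      fix r assume r: "\<epsilon> \<le> r" "r \<le> b"
      have "(ln has_real_derivative inverse r) (at r)" using r \<epsilon> by (auto intro!: derivative_eq_intros simp: inverse_eq_divide)
      from has_vector_derivative_of_real[OF this]
      have "((\<lambda>r. complex_of_real (ln r)) has_vector_derivative of_real (inverse r)) (at r)" .
      then show "((\<lambda>r. complex_of_real (ln r)) has_vector_derivative of_real r powr (s - 1)) (at r within {\<epsilon>..b})"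
        using r \<epsilon> True by (auto simp: powr_minus intro: has_vector_derivative_at_within)
    qed
    then show ?thesis using True by simp
  next
    case False
    have "(\<integral>r. indicator {\<epsilon>..b} r *\<^sub>R complex_of_real r powr (s - 1) \<partial>lborel) = of_real b powr s / s - of_real \<epsilon> powr s / s"
    proof (rule integral_FTC_atLeastAtMost[OF \<epsilon>(2) _ c])
      fix r assume r: "\<epsilon> \<le> r" "r \<le> b"
      have "((\<lambda>r. complex_of_real r powr s / s) has_vector_derivative s * of_real r powr (s - 1) / s) (at r)"
        using r \<epsilon> by (intro has_vector_derivative_divide has_vector_derivative_of_real_powr) auto
      then show "((\<lambda>r. complex_of_real r powr s / s) has_vector_derivative of_real r powr (s - 1)) (at r within {\<epsilon>..b})"
        using False by (auto intro: has_vector_derivative_at_within)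
    qed
    then show ?thesis using False by (simp add: diff_divide_distrib)
  qed
  ultimately show ?thesis by (simp add: has_bochner_integral_iff)
qed

lemma tendsto_of_real_powr_at_right_0:
  assumes "Re s > 0"
  shows "((\<lambda>\<epsilon>. complex_of_real \<epsilon> powr s) \<longlongrightarrow> 0) (at_right 0)"
proof (rule tendsto_norm_zero_cancel, rule Lim_transform_eventually)
  show "((\<lambda>\<epsilon>. \<epsilon> powr Re s) \<longlongrightarrow> 0) (at_right 0)"
    using assms by real_asymp
  show "\<forall>\<^sub>F \<epsilon> in at_right 0. \<epsilon> powr Re s = norm (complex_of_real \<epsilon> powr s)"
    by (auto simp: eventually_at_filter norm_of_real_powr)
qed

lemma integral_powr_0_1:
  assumes s: "Re s > 0"
  shows "has_bochner_integral lborel (\<lambda>r. indicator {0<..1} r *\<^sub>R complex_of_real r powr (s - 1)) (1 / s)"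
proof -
  have i: "integrable lborel (\<lambda>r. indicator {0<..1} r *\<^sub>R complex_of_real r powr (s - 1))"
  proof (rule Bochner_Integration.integrable_bound)
    \<comment> \<open>The Mellin integral of the Gaussian at exponent 2s with q = 1 serves as a
      majorant, because exp(pi) exp(-pi r) \<ge> 1 for r \<le> 1.\<close>
    have "integrable lborel (\<lambda>t. indicator {0<..} t *\<^sub>R (complex_of_real t powr (2 * s / 2 - 1) * of_real (exp (- pi * t * 1\<^sup>2))))"
      using mellin_gaussian[of 1 "2 * s"] s by (auto simp: has_bochner_integral_iff)
    then show "integrable lborel (\<lambda>t. exp pi *\<^sub>R (indicator {0<..} t *\<^sub>R (complex_of_real t powr (2 * s / 2 - 1) * of_real (exp (- pi * t * 1\<^sup>2)))))"
      by (rule integrable_scaleR_right)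
    show "AE r in lborel. norm (indicator {0<..1} r *\<^sub>R complex_of_real r powr (s - 1)) \<le>
      norm (exp pi *\<^sub>R (indicator {0<..} r *\<^sub>R (complex_of_real r powr (2 * s / 2 - 1) * of_real (exp (- pi * r * 1\<^sup>2)))))"
    proof (rule AE_I2)
      fix r :: real
      show "norm (indicator {0<..1} r *\<^sub>R complex_of_real r powr (s - 1)) \<le>
        norm (exp pi *\<^sub>R (indicator {0<..} r *\<^sub>R (complex_of_real r powr (2 * s / 2 - 1) * of_real (exp (- pi * r * 1\<^sup>2)))))"
      proof (cases "0 < r \<and> r \<le> 1")
        case True
        have "1 \<le> exp pi * exp (- pi * r)" using True by (simp flip: exp_add)
        then have "norm (complex_of_real r powr (s - 1)) * 1 \<le> norm (complex_of_real r powr (s - 1)) * (exp pi * exp (- pi * r))"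
          by (intro mult_left_mono) auto
        then show ?thesis using True by (simp add: norm_mult mult_ac)
      qed (auto simp: indicator_def)
    qed
  qed measurable
  let ?F = "\<lambda>\<epsilon> r. indicator {\<epsilon>..1} r *\<^sub>R complex_of_real r powr (s - 1)"
  have "((\<lambda>\<epsilon>. \<integral>r. ?F \<epsilon> r \<partial>lborel) \<longlongrightarrow> (\<integral>r. indicator {0<..1} r *\<^sub>R complex_of_real r powr (s - 1) \<partial>lborel)) (at_right 0)"
  proof (rule integral_dominated_convergence_within[where w = "\<lambda>r. norm (indicator {0<..1} r *\<^sub>R complex_of_real r powr (s - 1))"])
    show "AE r in lborel. ((\<lambda>\<epsilon>. ?F \<epsilon> r) \<longlongrightarrow> indicator {0<..1} r *\<^sub>R complex_of_real r powr (s - 1)) (at_right 0)"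
    proof (rule AE_I2, rule tendsto_eventually)
      fix r :: real
      show "\<forall>\<^sub>F \<epsilon> in at_right 0. ?F \<epsilon> r = indicator {0<..1} r *\<^sub>R complex_of_real r powr (s - 1)"
      proof (cases "r > 0")
        case True
        then have "\<forall>\<^sub>F \<epsilon> in at_right 0. \<epsilon> < r" by (auto simp: eventually_at_right_field intro: exI[of _ r])
        then show ?thesis by eventually_elim (use True in \<open>auto simp: indicator_def\<close>)
      next
        case False
        have "\<forall>\<^sub>F \<epsilon> in at_right 0. (0::real) < \<epsilon>" by (rule eventually_at_right_less)
        then show ?thesis by eventually_elim (use False in \<open>auto simp: indicator_def\<close>)
      qed
    qed
  qed (use integrable_norm[OF i] in \<open>auto simp: indicator_def\<close>)
  moreover have "((\<lambda>\<epsilon>. \<integral>r. ?F \<epsilon> r \<partial>lborel) \<longlongrightarrow> 1 / s) (at_right 0)"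
  proof (rule Lim_transform_eventually)
    have "s \<noteq> 0" using s by auto
    show "((\<lambda>\<epsilon>. (1 - complex_of_real \<epsilon> powr s) / s) \<longlongrightarrow> 1 / s) (at_right 0)"
      using tendsto_divide[OF tendsto_diff[OF tendsto_const tendsto_of_real_powr_at_right_0[OF s]] tendsto_const, of s 1] \<open>s \<noteq> 0\<close> by simp
    have "\<forall>\<^sub>F \<epsilon> in at_right 0. 0 < \<epsilon> \<and> \<epsilon> < (1::real)" by (auto simp: eventually_at_right_field intro: exI[of _ 1])
    then show "\<forall>\<^sub>F \<epsilon> in at_right 0. (1 - complex_of_real \<epsilon> powr s) / s = (\<integral>r. ?F \<epsilon> r \<partial>lborel)"
      by eventually_elim (use integral_powr_finite[of _ 1 s] \<open>s \<noteq> 0\<close> in \<open>auto simp: has_bochner_integral_iff\<close>)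
  qed
  ultimately have "(\<integral>r. indicator {0<..1} r *\<^sub>R complex_of_real r powr (s - 1) \<partial>lborel) = 1 / s"
    by (rule tendsto_unique[rotated]) simp
  with i show ?thesis by (simp add: has_bochner_integral_iff)
qed

lemma integral_powr_at_top:
  assumes s: "Re s < 0" and \<epsilon>: "\<epsilon> > 0"
  shows "has_bochner_integral lborel (\<lambda>r. indicator {\<epsilon>..} r *\<^sub>R complex_of_real r powr (s - 1)) (- (of_real \<epsilon> powr s) / s)"
proof -
  have s0: "s \<noteq> 0" using s by auto
  have i: "integrable lborel (\<lambda>r. indicator {\<epsilon>..} r *\<^sub>R complex_of_real r powr (s - 1))"
  proof (rule integrableI_bounded)
    have "(\<integral>\<^sup>+r. norm (indicator {\<epsilon>..} r *\<^sub>R complex_of_real r powr (s - 1)) \<partial>lborel) =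
       (\<integral>\<^sup>+r. ennreal (r powr (Re s - 1)) * indicator {\<epsilon>..} r \<partial>lborel)"
      using \<epsilon> by (intro nn_integral_cong) (auto simp: indicator_def norm_of_real_powr)
    also have "\<dots> = ennreal (0 - \<epsilon> powr Re s / Re s)"
    proof (rule nn_integral_FTC_atLeast)
      fix r assume "\<epsilon> \<le> r"
      then have "((\<lambda>r. r powr Re s / Re s) has_real_derivative (Re s * r powr (Re s - 1)) / Re s) (at r)"
        using \<epsilon> by (intro DERIV_cdivide has_real_derivative_powr) auto
      then show "((\<lambda>r. r powr Re s / Re s) has_real_derivative r powr (Re s - 1)) (at r)" using s by simp
    next
      show "((\<lambda>r. r powr Re s / Re s) \<longlongrightarrow> 0) at_top" using s by real_asymp
    qed auto
    finally show "(\<integral>\<^sup>+r. norm (indicator {\<epsilon>..} r *\<^sub>R complex_of_real r powr (s - 1)) \<partial>lborel) < \<infinity>" by simp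
  qed measurable
  have "((\<lambda>b. \<integral>r. indicator {..b} r *\<^sub>R (indicator {\<epsilon>..} r *\<^sub>R complex_of_real r powr (s - 1)) \<partial>lborel) \<longlongrightarrow>
     (\<integral>r. indicator {\<epsilon>..} r *\<^sub>R complex_of_real r powr (s - 1) \<partial>lborel)) at_top"
    by (rule tendsto_integral_at_top[OF _ i]) simp
  moreover have "((\<lambda>b. \<integral>r. indicator {..b} r *\<^sub>R (indicator {\<epsilon>..} r *\<^sub>R complex_of_real r powr (s - 1)) \<partial>lborel) \<longlongrightarrow>
     (0 - of_real \<epsilon> powr s) / s) at_top"
  proof (rule Lim_transform_eventually)
    have "((\<lambda>b. complex_of_real b powr s) \<longlongrightarrow> 0) at_top"
    proof (rule tendsto_norm_zero_cancel, rule Lim_transform_eventually)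
      show "((\<lambda>b. b powr Re s) \<longlongrightarrow> 0) at_top" using s by real_asymp
      show "\<forall>\<^sub>F b in at_top. b powr Re s = norm (complex_of_real b powr s)"
        using eventually_gt_at_top[of 0] by eventually_elim (simp add: norm_of_real_powr)
    qed
    then show "((\<lambda>b. (complex_of_real b powr s - of_real \<epsilon> powr s) / s) \<longlongrightarrow> (0 - of_real \<epsilon> powr s) / s) at_top"
      by (intro tendsto_intros s0)
    show "\<forall>\<^sub>F b in at_top. (complex_of_real b powr s - of_real \<epsilon> powr s) / s =
       (\<integral>r. indicator {..b} r *\<^sub>R (indicator {\<epsilon>..} r *\<^sub>R complex_of_real r powr (s - 1)) \<partial>lborel)"
      using eventually_ge_at_top[of \<epsilon>]
    proof eventually_elim
      case (elim b)
      have "(\<integral>r. indicator {..b} r *\<^sub>R (indicator {\<epsilon>..} r *\<^sub>R complex_of_real r powr (s - 1)) \<partial>lborel)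
        = (\<integral>r. indicator {\<epsilon>..b} r *\<^sub>R complex_of_real r powr (s - 1) \<partial>lborel)"
        by (rule Bochner_Integration.integral_cong[OF refl]) (auto simp: indicator_def)
      then show ?case using integral_powr_finite[OF \<epsilon> elim, of s] s0 by (simp add: has_bochner_integral_iff)
    qed
  qed
  ultimately have "(\<integral>r. indicator {\<epsilon>..} r *\<^sub>R complex_of_real r powr (s - 1) \<partial>lborel) = (0 - of_real \<epsilon> powr s) / s"
    by (rule tendsto_unique[rotated]) simp
  with i show ?thesis by (simp add: has_bochner_integral_iff)
qed

text \<open>A class of smooth functions that contains the cutoff Fourier transforms times polynomials and
  is closed under partial derivatives, so that Taylor's formula along rays is available to every order.\<close>

inductive taylor_class :: "(real^'n \<Rightarrow> complex) \<Rightarrow> bool" where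
  base: "w \<in> borel_measurable borel \<Longrightarrow> (\<And>x. norm (w x) \<le> B) \<Longrightarrow> (\<And>x. 1 \<le> norm x \<Longrightarrow> w x = 0) \<Longrightarrow>
    taylor_class (\<lambda>z. \<integral>x. w x * echar (- (z \<bullet> x)) \<partial>lborel)"
| zero: "taylor_class (\<lambda>z. 0)"
| add: "taylor_class f \<Longrightarrow> taylor_class g \<Longrightarrow> taylor_class (\<lambda>z. f z + g z)"
| cmult: "taylor_class g \<Longrightarrow> taylor_class (\<lambda>z. c * g z)"
| coord: "taylor_class g \<Longrightarrow> taylor_class (\<lambda>z. of_real (z $ i) * g z)"

lemma integrable_bounded_support:
  fixes w :: "real^'n \<Rightarrow> complex"
  assumes "w \<in> borel_measurable borel" "\<And>x. norm (w x) \<le> B" "\<And>x. 1 \<le> norm x \<Longrightarrow> w x = 0"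
  shows "integrable lborel w"
proof (rule Bochner_Integration.integrable_bound)
  show "integrable lborel (\<lambda>x::real^'n. indicator (ball 0 1) x * B)"
    by (intro integrable_mult_left integrable_real_indicator emeasure_bounded_finite) auto
  show "AE x in lborel. norm (w x) \<le> norm (indicator (ball 0 1) x * B)"
  proof (rule AE_I2)
    fix x
    show "norm (w x) \<le> norm (indicator (ball 0 1) x * B)"
      using assms(2,3)[of x] by (cases "norm x < 1") auto
  qed
qed (use assms in simp)

text \<open>The partial derivatives are carried as a witness D, which at the same time provides
  differentiability along every line. In the base case the line parameter is made complex, so that
  \<open>has_field_derivative_integral_exp\<close> differentiates under the integral; the support in
  the unit ball makes all the exponentials integrable. Multiplication by a coordinate adds a
  product-rule term to D.\<close>

lemma taylor_class_deriv:
  assumes "taylor_class g"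
  shows "\<exists>D. (\<forall>i. taylor_class (D i)) \<and>
    (\<forall>z y. ((\<lambda>t. g (z + t *\<^sub>R y)) has_vector_derivative (\<Sum>i\<in>UNIV. of_real (y $ i) * D i z)) (at 0))"
  using assms
proof (induction rule: taylor_class.induct)
  case (base w B)
  note [measurable] = base(1)
  define D where "D i z = (\<integral>x. (- (2 * of_real pi * \<i>) * of_real (x $ i) * w x) * echar (- (z \<bullet> x)) \<partial>lborel)" for i z
  have B: "0 \<le> B" using order_trans[OF norm_ge_zero base(2)] .
  have bD: "norm (- (2 * of_real pi * \<i>) * of_real (x $ i) * w x) \<le> 2 * pi * B" for x i
  proof (cases "norm x < 1")
    case True
    then have "\<bar>x $ i\<bar> \<le> 1" using component_le_norm_cart[of x i] by linarith
    then have "\<bar>x $ i\<bar> * norm (w x) \<le> 1 * B" using base(2) by (intro mult_mono) auto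
    then show ?thesis by (simp add: norm_mult)
  qed (use base(3)[of x] B in simp)
  have Dc: "taylor_class (D i)" for i
    unfolding D_def by (rule taylor_class.base[OF _ bD]) (use base(3) in auto)
  have "((\<lambda>t. \<integral>x. w x * echar (- ((z + t *\<^sub>R y) \<bullet> x)) \<partial>lborel) has_vector_derivative (\<Sum>i\<in>UNIV. of_real (y $ i) * D i z)) (at 0)" for z y
  proof -
    let ?a = "\<lambda>x. w x * echar (- (z \<bullet> x))" and ?b = "\<lambda>x. y \<bullet> x"
    have int: "integrable lborel (\<lambda>x. ?a x * exp (\<nu> * of_real (?b x)))" for \<nu>
    proof (rule integrable_bounded_support)
      fix x
      show "norm (?a x * exp (\<nu> * of_real (?b x))) \<le> B * exp (norm \<nu> * norm y)"
      proof (cases "norm x < 1")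
        case True
        have "\<bar>y \<bullet> x\<bar> \<le> norm y * norm x" by (rule Cauchy_Schwarz_ineq2)
        also have "\<dots> \<le> norm y" using True by (simp add: mult_left_le)
        finally have "\<bar>Re \<nu>\<bar> * \<bar>y \<bullet> x\<bar> \<le> norm \<nu> * norm y"
          using abs_Re_le_cmod[of \<nu>] by (intro mult_mono) auto
        then have "Re \<nu> * (y \<bullet> x) \<le> norm \<nu> * norm y"
          by (metis abs_ge_self abs_mult order_trans)
        then have "norm (w x) * exp (Re \<nu> * (y \<bullet> x)) \<le> B * exp (norm \<nu> * norm y)"
          using base(2)[of x] B by (intro mult_mono) auto
        then show ?thesis by (simp add: norm_mult norm_exp_eq_Re)
      qed (use base(3)[of x] B in simp)
    qed (use base(3) in auto)
    have d: "((\<lambda>\<nu>. \<integral>x. ?a x * exp (\<nu> * of_real (?b x)) \<partial>lborel) has_field_derivative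
       (\<integral>x. ?a x * of_real (?b x) * exp (- (2 * of_real pi * \<i>) * of_real 0 * of_real (?b x)) \<partial>lborel)) (at (- (2 * of_real pi * \<i>) * of_real 0))"
      by (rule has_field_derivative_integral_exp(2)[OF open_UNIV UNIV_I]) (use int in auto)
    have "((\<lambda>\<tau>. \<integral>x. ?a x * exp (- (2 * of_real pi * \<i>) * \<tau> * of_real (?b x)) \<partial>lborel) has_field_derivative
       (\<integral>x. ?a x * of_real (?b x) * exp (- (2 * of_real pi * \<i>) * of_real 0 * of_real (?b x)) \<partial>lborel) * (- (2 * of_real pi * \<i>))) (at (of_real 0))"
      by (rule DERIV_chain2[where g = "\<lambda>\<tau>. - (2 * of_real pi * \<i>) * \<tau>" and x = "of_real 0", OF d]) (auto intro!: derivative_eq_intros)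
    from has_vector_derivative_real_field[OF this]
    have "((\<lambda>t. \<integral>x. ?a x * exp (- (2 * of_real pi * \<i>) * of_real t * of_real (?b x)) \<partial>lborel) has_vector_derivative
       (\<integral>x. ?a x * of_real (?b x) \<partial>lborel) * (- (2 * of_real pi * \<i>))) (at 0)" by simp
    moreover have "?a x * exp (- (2 * of_real pi * \<i>) * of_real t * of_real (?b x)) = w x * echar (- ((z + t *\<^sub>R y) \<bullet> x))" for x t
      by (simp add: echar_exp inner_add_left algebra_simps exp_add exp_minus exp_diff divide_inverse)
    moreover have "(\<integral>x. ?a x * of_real (?b x) \<partial>lborel) * (- (2 * of_real pi * \<i>)) = (\<Sum>i\<in>UNIV. of_real (y $ i) * D i z)"
    proof -
      have ii: "integrable lborel (\<lambda>x. (- (2 * of_real pi * \<i>) * of_real (x $ i) * w x) * echar (- (z \<bullet> x)))" for i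
        by (rule integrable_bounded_support[where B = "2 * pi * B"]) (use bD base(3) in \<open>auto simp: norm_mult\<close>)
      have "(\<Sum>i\<in>UNIV. of_real (y $ i) * D i z) = (\<integral>x. (\<Sum>i\<in>UNIV. of_real (y $ i) * ((- (2 * of_real pi * \<i>) * of_real (x $ i) * w x) * echar (- (z \<bullet> x)))) \<partial>lborel)"
        unfolding D_def by (subst Bochner_Integration.integral_sum[OF integrable_mult_right[OF ii]]) (simp only: integral_mult_right_zero)
      also have "\<dots> = (\<integral>x. (?a x * of_real (?b x)) * (- (2 * of_real pi * \<i>)) \<partial>lborel)"
        by (rule Bochner_Integration.integral_cong[OF refl]) (simp add: inner_vec_def sum_distrib_left sum_distrib_right mult_ac)
      also have "\<dots> = (\<integral>x. ?a x * of_real (?b x) \<partial>lborel) * (- (2 * of_real pi * \<i>))" by (rule integral_mult_left_zero)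
      finally show ?thesis by simp
    qed
    ultimately show ?thesis by (simp only:)
  qed
  then show ?case using Dc by (intro exI[of _ D]) simp
next
  case zero
  show ?case by (intro exI[of _ "\<lambda>_ _. 0"]) (auto intro: taylor_class.intros)
next
  case (add f g)
  from add.IH(1) obtain Df where f: "\<And>i. taylor_class (Df i)"
    "\<And>z y. ((\<lambda>t. f (z + t *\<^sub>R y)) has_vector_derivative (\<Sum>i\<in>UNIV. of_real (y $ i) * Df i z)) (at 0)" by blast
  from add.IH(2) obtain Dg where g: "\<And>i. taylor_class (Dg i)"
    "\<And>z y. ((\<lambda>t. g (z + t *\<^sub>R y)) has_vector_derivative (\<Sum>i\<in>UNIV. of_real (y $ i) * Dg i z)) (at 0)" by blast
  note * = f(1) g(1) f(2) g(2)
  have "((\<lambda>t. f (z + t *\<^sub>R y) + g (z + t *\<^sub>R y)) has_vector_derivative (\<Sum>i\<in>UNIV. of_real (y $ i) * (Df i z + Dg i z))) (at 0)" for z y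
    using has_vector_derivative_add[OF *(3,4)] by (simp add: distrib_left sum.distrib)
  then show ?case using * by (intro exI[of _ "\<lambda>i z. Df i z + Dg i z"]) (auto intro: taylor_class.intros)
next
  case (cmult g c)
  then obtain D where *: "\<And>i. taylor_class (D i)"
    "\<And>z y. ((\<lambda>t. g (z + t *\<^sub>R y)) has_vector_derivative (\<Sum>i\<in>UNIV. of_real (y $ i) * D i z)) (at 0)" by blast
  have "((\<lambda>t. c * g (z + t *\<^sub>R y)) has_vector_derivative (\<Sum>i\<in>UNIV. of_real (y $ i) * (c * D i z))) (at 0)" for z y
    using has_vector_derivative_mult_right[OF *(2), of c] by (simp add: sum_distrib_left mult_ac)
  then show ?case using * by (intro exI[of _ "\<lambda>i z. c * D i z"]) (auto intro: taylor_class.intros)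
next
  case (coord g j)
  then obtain D where *: "\<And>i. taylor_class (D i)"
    "\<And>z y. ((\<lambda>t. g (z + t *\<^sub>R y)) has_vector_derivative (\<Sum>i\<in>UNIV. of_real (y $ i) * D i z)) (at 0)" by blast
  let ?D = "\<lambda>i z. of_real (z $ j) * D i z + (if i = j then 1 else 0) * g z"
  have "((\<lambda>t. of_real ((z + t *\<^sub>R y) $ j) * g (z + t *\<^sub>R y)) has_vector_derivative (\<Sum>i\<in>UNIV. of_real (y $ i) * ?D i z)) (at 0)" for z y
  proof -
    have "((\<lambda>t. (z + t *\<^sub>R y) $ j) has_real_derivative y $ j) (at 0)" by (auto intro!: derivative_eq_intros)
    from has_vector_derivative_mult[OF has_vector_derivative_of_real[OF this] *(2)[of z y]]
    have "((\<lambda>t. of_real ((z + t *\<^sub>R y) $ j) * g (z + t *\<^sub>R y)) has_vector_derivative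
      of_real (z $ j) * (\<Sum>i\<in>UNIV. of_real (y $ i) * D i z) + of_real (y $ j) * g z) (at 0)" by simp
    moreover have "(\<Sum>i\<in>UNIV. of_real (y $ i) * ?D i z) = of_real (z $ j) * (\<Sum>i\<in>UNIV. of_real (y $ i) * D i z) + of_real (y $ j) * g z"
    proof -
      have "(\<Sum>i\<in>UNIV. of_real (y $ i) * ?D i z) = (\<Sum>i\<in>UNIV. of_real (z $ j) * (of_real (y $ i) * D i z) + (if i = j then of_real (y $ j) * g z else 0))"
        by (rule sum.cong) (auto simp: algebra_simps)
      then show ?thesis by (simp add: sum.distrib sum_distrib_left)
    qed
    ultimately show ?thesis by simp
  qed
  moreover have "taylor_class (?D i)" for i by (intro taylor_class.intros * coord(1))
  ultimately show ?case by (intro exI[of _ ?D] conjI allI)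
qed

lemma
  assumes "taylor_class g"
  shows taylor_class_partial_deriv: "taylor_class (partial_deriv i g)"
    and taylor_class_dir_nabla: "((\<lambda>t. g (z + t *\<^sub>R y)) has_vector_derivative dir_nabla y g z) (at 0)"
    and taylor_class_partial_derivI: "((\<lambda>t. g (z + t *\<^sub>R axis i 1)) has_vector_derivative partial_deriv i g z) (at 0)"
proof -
  obtain D where D: "\<And>i. taylor_class (D i)"
    "\<And>z y. ((\<lambda>t. g (z + t *\<^sub>R y)) has_vector_derivative (\<Sum>i\<in>UNIV. of_real (y $ i) * D i z)) (at 0)"
    using taylor_class_deriv[OF assms] by blast
  have e: "(\<Sum>k\<in>UNIV. of_real (axis i (1::real) $ k) * D k z) = D i z" for z i
  proof -
    have "(\<Sum>k\<in>UNIV. of_real (axis i (1::real) $ k) * D k z) = (\<Sum>k\<in>UNIV. if k = i then D i z else 0)"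
      by (rule sum.cong) (auto simp: axis_def)
    then show ?thesis by simp
  qed
  have p: "partial_deriv i g = D i" for i
    unfolding partial_deriv_def using vector_derivative_at[OF D(2)[of _ "axis i 1"]] by (auto simp: e)
  show "taylor_class (partial_deriv i g)" unfolding p by (rule D)
  show "((\<lambda>t. g (z + t *\<^sub>R y)) has_vector_derivative dir_nabla y g z) (at 0)"
    unfolding dir_nabla_def p by (rule D)
  show "((\<lambda>t. g (z + t *\<^sub>R axis i 1)) has_vector_derivative partial_deriv i g z) (at 0)"
    using D(2)[of z "axis i 1"] unfolding e p .
qed

lemma taylor_class_sum: "finite A \<Longrightarrow> (\<And>a. a \<in> A \<Longrightarrow> taylor_class (f a)) \<Longrightarrow> taylor_class (\<lambda>z. \<Sum>a\<in>A. f a z)"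
  by (induction A rule: finite_induct) (auto intro: taylor_class.intros)

lemma taylor_class_dir_nablaI: "taylor_class g \<Longrightarrow> taylor_class (dir_nabla y g)"
  unfolding dir_nabla_def[abs_def] by (intro taylor_class_sum taylor_class.intros taylor_class_partial_deriv) auto

lemma taylor_class_dir_nabla_pow: "taylor_class g \<Longrightarrow> taylor_class ((dir_nabla y ^^ k) g)"
  by (induction k) (auto intro: taylor_class_dir_nablaI)

lemma dir_nabla_add:
  assumes "taylor_class f" "taylor_class g"
  shows "dir_nabla y (\<lambda>z. f z + g z) = (\<lambda>z. dir_nabla y f z + dir_nabla y g z)"
proof
  fix z
  show "dir_nabla y (\<lambda>z. f z + g z) z = dir_nabla y f z + dir_nabla y g z"
    by (rule vector_derivative_unique_at[OF taylor_class_dir_nabla[OF taylor_class.add[OF assms], of z y]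
          has_vector_derivative_add[OF taylor_class_dir_nabla[OF assms(1)] taylor_class_dir_nabla[OF assms(2)]]])
qed

lemma dir_nabla_cmult:
  assumes "taylor_class g"
  shows "dir_nabla y (\<lambda>z. c * g z) = (\<lambda>z. c * dir_nabla y g z)"
proof
  fix z
  show "dir_nabla y (\<lambda>z. c * g z) z = c * dir_nabla y g z"
    by (rule vector_derivative_unique_at[OF taylor_class_dir_nabla[OF taylor_class.cmult[OF assms, of c], where z = z and y = y]
          has_vector_derivative_mult_right[OF taylor_class_dir_nabla[OF assms]]])
qed

lemma dir_nabla_pow_add:
  assumes "taylor_class f" "taylor_class g"
  shows "(dir_nabla y ^^ k) (\<lambda>z. f z + g z) = (\<lambda>z. (dir_nabla y ^^ k) f z + (dir_nabla y ^^ k) g z)"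
  by (induction k) (simp_all add: dir_nabla_add taylor_class_dir_nabla_pow assms)

lemma dir_nabla_pow_cmult:
  assumes "taylor_class g"
  shows "(dir_nabla y ^^ k) (\<lambda>z. c * g z) = (\<lambda>z. c * (dir_nabla y ^^ k) g z)"
  by (induction k) (simp_all add: dir_nabla_cmult taylor_class_dir_nabla_pow assms)

lemma dir_nabla_zero: "dir_nabla y (\<lambda>z. 0) = (\<lambda>z. 0)"
  using dir_nabla_cmult[OF taylor_class.zero, of y 0] by simp

lemma dir_nabla_pow_sum:
  assumes "finite A" "\<And>a. a \<in> A \<Longrightarrow> taylor_class (f a)"
  shows "(dir_nabla y ^^ k) (\<lambda>z. \<Sum>a\<in>A. f a z) = (\<lambda>z. \<Sum>a\<in>A. (dir_nabla y ^^ k) (f a) z)"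
  using assms
proof (induction A rule: finite_induct)
  case empty
  have "(dir_nabla y ^^ k) (\<lambda>z. 0) = (\<lambda>z. 0)" by (induction k) (simp_all add: dir_nabla_zero)
  then show ?case by simp
next
  case (insert a A)
  then show ?case by (simp add: dir_nabla_pow_add taylor_class_sum)
qed

text \<open>Splitting off the derivative that acts first, rather than last, leaves functions
  \<open>partial_deriv i g\<close> that no longer depend on y. Homogeneity, continuity and bounds in
  y then follow by induction over g.\<close>

lemma dir_nabla_pow_Suc:
  assumes "taylor_class g"
  shows "(dir_nabla y ^^ Suc k) g z = (\<Sum>i\<in>UNIV. of_real (y $ i) * (dir_nabla y ^^ k) (partial_deriv i g) z)"
proof -
  have D: "dir_nabla y g = (\<lambda>z. \<Sum>i\<in>UNIV. of_real (y $ i) * partial_deriv i g z)"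
    by (rule ext) (rule dir_nabla_def)
  have "(dir_nabla y ^^ Suc k) g = (dir_nabla y ^^ k) (\<lambda>z. \<Sum>i\<in>UNIV. of_real (y $ i) * partial_deriv i g z)"
    unfolding D[symmetric] by (simp add: funpow_swap1)
  also have "\<dots> = (\<lambda>z. \<Sum>i\<in>UNIV. (dir_nabla y ^^ k) (\<lambda>z. of_real (y $ i) * partial_deriv i g z) z)"
    by (rule dir_nabla_pow_sum) (auto intro!: taylor_class.intros taylor_class_partial_deriv assms)
  finally show ?thesis by (simp add: dir_nabla_pow_cmult taylor_class_partial_deriv assms)
qed

lemma dir_nabla_pow_scaleR:
  "taylor_class g \<Longrightarrow> (dir_nabla (r *\<^sub>R y) ^^ k) g z = of_real r ^ k * (dir_nabla y ^^ k) g z"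
proof (induction k arbitrary: g)
  case (Suc k)
  then show ?case
    by (simp only: dir_nabla_pow_Suc Suc.IH[OF taylor_class_partial_deriv])
      (simp add: sum_distrib_left mult_ac)
qed simp

lemma continuous_on_dir_nabla_pow:
  "taylor_class g \<Longrightarrow> continuous_on UNIV (\<lambda>y. (dir_nabla y ^^ k) g z)"
proof (induction k arbitrary: g)
  case (Suc k)
  then show ?case
    by (simp only: dir_nabla_pow_Suc) (intro continuous_intros Suc.IH taylor_class_partial_deriv)
qed simp

lemma taylor_class_bounded: "taylor_class g \<Longrightarrow> \<exists>C\<ge>0. \<forall>z. norm z \<le> 1 \<longrightarrow> norm (g z) \<le> C"
proof (induction rule: taylor_class.induct)
  case (base w B)
  have "norm (\<integral>x. w x * echar (- (z \<bullet> x)) \<partial>lborel) \<le> (\<integral>x. norm (w x) \<partial>lborel)" for z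
    by (rule order_trans[OF integral_norm_bound]) (simp add: norm_mult)
  then show ?case by (intro exI[of _ "\<integral>x. norm (w x) \<partial>lborel"]) auto
next
  case (add f g)
  then obtain C1 C2 where "C1 \<ge> 0" "C2 \<ge> 0" "\<forall>z. norm z \<le> 1 \<longrightarrow> norm (f z) \<le> C1" "\<forall>z. norm z \<le> 1 \<longrightarrow> norm (g z) \<le> C2" by blast
  then show ?case by (intro exI[of _ "C1 + C2"]) (auto intro!: order_trans[OF norm_triangle_ineq] add_mono)
next
  case (cmult g c)
  then obtain C where "C \<ge> 0" "\<forall>z. norm z \<le> 1 \<longrightarrow> norm (g z) \<le> C" by blast
  then show ?case by (intro exI[of _ "norm c * C"]) (auto simp: norm_mult intro!: mult_left_mono)
next
  case (coord g i)
  then obtain C where C: "C \<ge> 0" "\<forall>z. norm z \<le> 1 \<longrightarrow> norm (g z) \<le> C" by blast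
  have "\<bar>z $ i\<bar> * norm (g z) \<le> 1 * C" if "norm z \<le> 1" for z
    using that C component_le_norm_cart[of z i] by (intro mult_mono) auto
  then show ?case using C by (intro exI[of _ C]) (auto simp: norm_mult)
qed auto

lemma dir_nabla_pow_bound:
  "taylor_class g \<Longrightarrow> \<exists>C\<ge>0. \<forall>y z. norm z \<le> 1 \<longrightarrow> norm ((dir_nabla y ^^ k) g z) \<le> C * norm y ^ k"
proof (induction k arbitrary: g)
  case 0
  then show ?case using taylor_class_bounded[of g] by auto
next
  case (Suc k)
  have "\<forall>i. \<exists>C\<ge>0. \<forall>y z. norm z \<le> 1 \<longrightarrow> norm ((dir_nabla y ^^ k) (partial_deriv i g) z) \<le> C * norm y ^ k"
    using Suc.IH taylor_class_partial_deriv[OF Suc.prems] by blast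
  then obtain C where C: "\<And>i. C i \<ge> 0" "\<And>i y z. norm z \<le> 1 \<Longrightarrow> norm ((dir_nabla y ^^ k) (partial_deriv i g) z) \<le> C i * norm y ^ k" by metis
  have "norm ((dir_nabla y ^^ Suc k) g z) \<le> (\<Sum>i\<in>UNIV. C i) * norm y ^ Suc k" if "norm z \<le> 1" for y z
  proof -
    have "norm ((dir_nabla y ^^ Suc k) g z) \<le> (\<Sum>i\<in>UNIV. norm y * (C i * norm y ^ k))"
      unfolding dir_nabla_pow_Suc[OF Suc.prems]
      by (rule order_trans[OF norm_sum], rule sum_mono)
        (use C(2)[OF that] component_le_norm_cart[of y] in \<open>auto simp: norm_mult intro!: mult_mono\<close>)
    also have "\<dots> = (\<Sum>i\<in>UNIV. C i) * norm y ^ Suc k" by (simp add: sum_distrib_right sum_distrib_left mult_ac)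
    finally show ?thesis .
  qed
  then show ?case using C(1) by (intro exI[of _ "\<Sum>i\<in>UNIV. C i"]) (auto intro: sum_nonneg)
qed

text \<open>Taylor's formula on [0,1] for t \<mapsto> g (t z), whose derivatives are the iterates of
  \<open>dir_nabla z\<close>. Real and imaginary parts are expanded separately, which doubles the
  constant.\<close>

lemma taylor_class_taylor:
  assumes g: "taylor_class g"
  obtains C where "C \<ge> 0"
    "\<And>z. norm z \<le> 1 \<Longrightarrow> norm (g z - (\<Sum>k\<le>N. (dir_nabla z ^^ k) g 0 / fact k)) \<le> C * norm z ^ Suc N"
proof -
  obtain C where C: "C \<ge> 0" "\<And>y z. norm z \<le> 1 \<Longrightarrow> norm ((dir_nabla y ^^ Suc N) g z) \<le> C * norm y ^ Suc N"
    using dir_nabla_pow_bound[OF g, of "Suc N"] by blast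
  have "norm (g z - (\<Sum>k\<le>N. (dir_nabla z ^^ k) g 0 / fact k)) \<le> (2 * C) * norm z ^ Suc N" if z: "norm z \<le> 1" for z
  proof -
    define f where "f k t = (dir_nabla z ^^ k) g (t *\<^sub>R z)" for k and t :: real
    have der: "(f k has_vector_derivative f (Suc k) t) (at t)" for k t
    proof -
      have "((\<lambda>s. (dir_nabla z ^^ k) g (t *\<^sub>R z + s *\<^sub>R z)) has_vector_derivative f (Suc k) t) (at (t - t))"
        using taylor_class_dir_nabla[OF taylor_class_dir_nabla_pow[where y = z and k = k, OF g], where z = "t *\<^sub>R z" and y = z] by (simp add: f_def)
      moreover have "((\<lambda>s. s - t) has_vector_derivative 1) (at t)"
        by (auto intro!: derivative_eq_intros)
      ultimately have "((\<lambda>s. (dir_nabla z ^^ k) g (t *\<^sub>R z + s *\<^sub>R z)) \<circ> (\<lambda>s. s - t) has_vector_derivative 1 *\<^sub>R f (Suc k) t) (at t)"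
        by (intro vector_diff_chain_at)
      then show ?thesis by (simp add: o_def f_def[abs_def] algebra_simps)
    qed
    have bd: "norm (f (Suc N) t) \<le> C * norm z ^ Suc N" if "t \<in> {0..1}" for t
      unfolding f_def using that z by (intro C) (auto simp: mult_le_one)
    have T: "norm (h (f 0 1) - (\<Sum>k\<le>N. h (f k 0) * (1 - 0) ^ k / fact k)) \<le> (C * norm z ^ Suc N) * norm (1 - 0 :: real) ^ Suc N / fact N"
      if h: "\<And>k t. ((\<lambda>t. h (f k t)) has_real_derivative h (f (Suc k) t)) (at t within {0..1})" "\<And>w. \<bar>h w\<bar> \<le> norm w" for h :: "complex \<Rightarrow> real"
    proof (rule field_Taylor[where S = "{0..1}" and f = "\<lambda>k t. h (f k t)"])
      show "norm (h (f (Suc N) t)) \<le> C * norm z ^ Suc N" if "t \<in> {0..1}" for t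
        using order_trans[OF h(2) bd[OF that]] by simp
    qed (use h(1) in auto)
    have 1: "\<bar>Re (f 0 1) - (\<Sum>k\<le>N. Re (f k 0) / fact k)\<bar> \<le> C * norm z ^ Suc N / fact N"
    proof -
      have "((\<lambda>t. Re (f k t)) has_real_derivative Re (f (Suc k) t)) (at t within {0..1})" for k t
        by (rule has_field_derivative_Re, rule has_vector_derivative_at_within, rule der)
      from T[of Re, OF this abs_Re_le_cmod] show ?thesis by simp
    qed
    have 2: "\<bar>Im (f 0 1) - (\<Sum>k\<le>N. Im (f k 0) / fact k)\<bar> \<le> C * norm z ^ Suc N / fact N"
    proof -
      have "((\<lambda>t. Im (f k t)) has_real_derivative Im (f (Suc k) t)) (at t within {0..1})" for k t
        by (rule has_field_derivative_Im, rule has_vector_derivative_at_within, rule der)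
      from T[of Im, OF this abs_Im_le_cmod] show ?thesis by simp
    qed
    have 3: "C * norm z ^ Suc N / fact N \<le> C * norm z ^ Suc N"
      using C(1) mult_left_mono[OF fact_ge_1[of N, where 'a=real], of "C * norm z ^ Suc N"] by (simp add: divide_le_eq)
    have fk: "(fact k :: complex) = of_real (fact k)" for k by simp
    let ?w = "f 0 1 - (\<Sum>k\<le>N. f k 0 / fact k)"
    have "norm ?w \<le> \<bar>Re ?w\<bar> + \<bar>Im ?w\<bar>" by (rule cmod_le)
    also have "Re ?w = Re (f 0 1) - (\<Sum>k\<le>N. Re (f k 0) / fact k)"
      by (simp only: minus_complex.sel Re_sum fk Re_divide_of_real)
    also have "Im ?w = Im (f 0 1) - (\<Sum>k\<le>N. Im (f k 0) / fact k)"
      by (simp only: minus_complex.sel Im_sum fk Im_divide_of_real)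
    finally have "norm ?w \<le> 2 * C * norm z ^ Suc N" using 1 2 3 by linarith
    then show ?thesis by (simp add: f_def)
  qed
  then show thesis using C(1) by (intro that[of "2 * C"]) auto
qed

section \<open>Homogeneous Taylor parts and their radial integrals\<close>

definition hom_part :: "(real^'n \<Rightarrow> complex) \<Rightarrow> nat \<Rightarrow> real^'n \<Rightarrow> complex" where
  "hom_part g k y = (dir_nabla y ^^ k) g 0 / fact k"

definition sphere_moment :: "(real^'n \<Rightarrow> complex) \<Rightarrow> nat \<Rightarrow> complex" where
  "sphere_moment g k = (\<integral>\<theta>. hom_part g k \<theta> \<partial>sphere_measure)"

lemma continuous_on_hom_part: "taylor_class g \<Longrightarrow> continuous_on UNIV (hom_part g k)"
  unfolding hom_part_def[abs_def] by (intro continuous_intros continuous_on_dir_nabla_pow) auto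

lemma hom_part_scaleR: "taylor_class g \<Longrightarrow> hom_part g k (r *\<^sub>R y) = of_real r ^ k * hom_part g k y"
  by (simp add: hom_part_def dir_nabla_pow_scaleR)

lemma of_real_powr_mult_power:
  assumes "r > 0" "d > 0"
  shows "complex_of_real r powr (- \<nu>) * of_real r ^ (k + d - 1) = of_real r powr ((of_nat (d + k) - \<nu>) - 1)"
proof -
  have "complex_of_real r ^ (k + d - 1) = of_real r powr of_nat (k + d - 1)"
    unfolding powr_nat using assms by simp
  also have "of_nat (k + d - 1) = (of_nat (d + k) - 1 :: complex)"
    using assms by (simp add: of_nat_diff add.commute)
  finally have "complex_of_real r powr (- \<nu>) * of_real r ^ (k + d - 1) = of_real r powr (- \<nu> + (of_nat (d + k) - 1))"
    by (simp only: powr_add)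
  also have "- \<nu> + (of_nat (d + k) - 1) = (of_nat (d + k) - \<nu>) - 1" by simp
  finally show ?thesis .
qed

text \<open>The case of \<open>integral_homogeneous_radial\<close> with a power of the radius
  restricted to a set \<open>A\<close> of radii. The value of the radial integral is left as a
  parameter, so that shells, punctured balls and exteriors of balls are treated alike.\<close>

lemma homogeneous_set_integral:
  fixes h :: "real^'n \<Rightarrow> complex"
  assumes hom: "\<And>r y. r > 0 \<Longrightarrow> h (r *\<^sub>R y) = of_real r ^ k * h y"
    and hc: "continuous_on UNIV h" and [measurable]: "A \<in> sets borel" and A: "A \<subseteq> {0<..}"
    and I: "has_bochner_integral lborel (\<lambda>r. indicator A r *\<^sub>R complex_of_real r powr ((of_nat (CARD('n) + k) - \<nu>) - 1)) I"
  shows "has_bochner_integral lborel (\<lambda>y. indicator {y. norm y \<in> A} y *\<^sub>R (h y / of_real (norm y) powr \<nu>))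
    ((\<integral>\<theta>. h \<theta> \<partial>sphere_measure) * I)"
proof -
  let ?f = "\<lambda>r. indicator A r *\<^sub>R complex_of_real r powr (- \<nu>)"
  have eq: "(\<lambda>r. indicator {0<..} r *\<^sub>R (?f r * of_real r ^ (k + CARD('n) - 1)))
    = (\<lambda>r. indicator A r *\<^sub>R complex_of_real r powr ((of_nat (CARD('n) + k) - \<nu>) - 1))"
  proof
    fix r
    show "indicator {0<..} r *\<^sub>R (?f r * of_real r ^ (k + CARD('n) - 1)) = indicator A r *\<^sub>R complex_of_real r powr ((of_nat (CARD('n) + k) - \<nu>) - 1)"
    proof (cases "r \<in> A")
      case True
      then have "r > 0" using A by auto
      with True show ?thesis using of_real_powr_mult_power[of r "CARD('n)" \<nu> k] by simp
    qed simp
  qed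
  have [measurable]: "?f \<in> borel_measurable borel" by measurable
  have int: "integrable lborel (\<lambda>r. indicator {0<..} r *\<^sub>R (?f r * of_real r ^ (k + CARD('n) - 1)))"
    unfolding eq using I by (simp add: has_bochner_integral_iff)
  have e2: "h y * ?f (norm y) = indicator {y. norm y \<in> A} y *\<^sub>R (h y / of_real (norm y) powr \<nu>)" for y
    by (simp add: indicator_def powr_minus divide_inverse)
  show ?thesis
    using integral_homogeneous_radial[OF hom hc _ int] I unfolding eq e2
    by (simp add: has_bochner_integral_iff)
qed

lemma integrable_norm_powr_ball:
  assumes "a + real CARD('n) > 0"
  shows "integrable lborel (\<lambda>y::real^'n. indicator (ball 0 1) y * norm y powr a)"
proof -
  have [measurable]: "ball (0::real^'n) 1 \<in> sets borel" by simp
  let ?s = "of_nat (CARD('n) + 0) - complex_of_real (- a)"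
  have I: "has_bochner_integral lborel (\<lambda>r. indicator {0<..1} r *\<^sub>R complex_of_real r powr (?s - 1)) (1 / ?s)"
    by (rule integral_powr_0_1) (use assms in simp)
  have "integrable lborel (\<lambda>y::real^'n. indicator {y. norm y \<in> {0<..1}} y *\<^sub>R (1 / complex_of_real (norm y) powr (complex_of_real (- a))))"
  proof -
    have sub: "{0<..(1::real)} \<subseteq> {0<..}" and sets: "{0<..(1::real)} \<in> sets borel" by auto
    have hom: "1 = complex_of_real r ^ 0 * 1" for r by simp
    show ?thesis
      using homogeneous_set_integral[where h = "\<lambda>_::real^'n. 1", OF hom continuous_on_const sets sub I]
      by (simp only: has_bochner_integral_iff)
  qed
  then have "integrable lborel (\<lambda>y::real^'n. norm (indicator {y. norm y \<in> {0<..1}} y *\<^sub>R (1 / complex_of_real (norm y) powr (complex_of_real (- a)))))"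
    by (rule integrable_norm)
  then show ?thesis
  proof (rule Bochner_Integration.integrable_bound)
    show "AE y in lborel. norm (indicator (ball 0 1) (y::real^'n) * norm y powr a)
      \<le> norm (norm (indicator {y. norm y \<in> {0<..1}} y *\<^sub>R (1 / complex_of_real (norm y) powr (complex_of_real (- a)))))"
    proof (rule AE_I2)
      fix y :: "real^'n"
      show "norm (indicator (ball 0 1) y * norm y powr a)
        \<le> norm (norm (indicator {y. norm y \<in> {0<..1}} y *\<^sub>R (1 / complex_of_real (norm y) powr (complex_of_real (- a)))))"
        by (cases "y = 0") (auto simp: indicator_def norm_divide norm_of_real_powr powr_minus divide_inverse)
    qed
  qed measurable
qed

section \<open>Rapid decay and the resulting integrability\<close>

definition rapidly_decaying :: "(real^'n \<Rightarrow> complex) \<Rightarrow> bool" where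
  "rapidly_decaying g \<longleftrightarrow> (\<forall>N. \<exists>C. \<forall>z. norm (g z) * (1 + norm z) ^ N \<le> C)"

lemma rapidly_decayingD:
  assumes "rapidly_decaying g"
  obtains C where "C \<ge> 0" "\<And>z. norm (g z) \<le> C * (1 + norm z) powr (- s)"
proof -
  obtain C where C: "\<And>z. norm (g z) * (1 + norm z) ^ (nat \<lceil>s\<rceil>) \<le> C"
    using assms unfolding rapidly_decaying_def by blast
  have C0: "C \<ge> 0" using order_trans[OF _ C[of 0]] by simp
  have "norm (g z) \<le> C * (1 + norm z) powr (- s)" for z
  proof -
    have "(1 + norm z) powr s \<le> (1 + norm z) powr real (nat \<lceil>s\<rceil>)" by (intro powr_mono real_nat_ceiling_ge) simp
    also have "\<dots> = (1 + norm z) ^ nat \<lceil>s\<rceil>" by (rule powr_realpow) (simp add: add_pos_nonneg)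
    finally have "norm (g z) * (1 + norm z) powr s \<le> C"
      by (intro order_trans[OF mult_left_mono C]) auto
    moreover have "(1 + norm z) powr s > 0" by (simp add: add_nonneg_eq_0_iff)
    ultimately show ?thesis by (simp add: powr_minus field_simps)
  qed
  with C0 show thesis by (rule that)
qed

text \<open>A factor (1 + |z|) powr |Re \<nu>| of the decay of w is spent to absorb growth of the
  quotient at infinity when Re \<nu> < 0; the constant (2/c) powr |Re \<nu>| absorbs the size of the
  quotient at |z| near c when Re \<nu> > 0.\<close>

lemma norm_divide_powr_le:
  fixes z :: "'a::real_normed_vector"
  assumes c: "0 < c" "c \<le> 1" and z: "c \<le> norm z"
    and g: "norm (w :: complex) \<le> C * (1 + norm z) powr (- (s + \<bar>Re \<nu>\<bar>))" "0 \<le> C"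
  shows "norm (w / of_real (norm z) powr \<nu>) \<le> C * (2 / c) powr \<bar>Re \<nu>\<bar> * (1 + norm z) powr (- s)"
proof -
  have z0: "0 < norm z" using c z by linarith
  have "norm z powr (- Re \<nu>) \<le> (2 / c) powr \<bar>Re \<nu>\<bar> * (1 + norm z) powr \<bar>Re \<nu>\<bar>"
  proof (cases "Re \<nu> \<ge> 0")
    case True
    have "1 \<le> (2 / c) * (1 + norm z) * norm z"
    proof -
      have "1 \<le> norm z / c" using c z by simp
      also have "\<dots> \<le> (norm z / c) * (2 * (1 + norm z))"
        using z0 c mult_left_mono[of 1 "2 * (1 + norm z)" "norm z / c"] by simp
      finally show ?thesis by (simp add: mult_ac)
    qed
    then have "1 powr Re \<nu> \<le> ((2 / c) * (1 + norm z) * norm z) powr Re \<nu>" using True by (intro powr_mono2) auto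
    also have "\<dots> = (2 / c) powr Re \<nu> * (1 + norm z) powr Re \<nu> * norm z powr Re \<nu>"
    proof -
      have "0 \<le> 2 / c" "0 \<le> 1 + norm z" "0 \<le> (2 / c) * (1 + norm z)" using c by auto
      then show ?thesis using z0 by (simp only: powr_mult norm_ge_zero)
    qed
    finally have "1 \<le> (2 / c) powr Re \<nu> * (1 + norm z) powr Re \<nu> * norm z powr Re \<nu>" by simp
    then show ?thesis using True z0 by (simp add: powr_minus field_simps)
  next
    case False
    have "norm z powr (- Re \<nu>) \<le> (1 + norm z) powr (- Re \<nu>)" using False by (intro powr_mono2) auto
    moreover have "1 \<le> (2 / c) powr \<bar>Re \<nu>\<bar>" using c by (intro ge_one_powr_ge_zero) (auto simp: field_simps)
    then have "1 * (1 + norm z) powr (- Re \<nu>) \<le> (2 / c) powr \<bar>Re \<nu>\<bar> * (1 + norm z) powr (- Re \<nu>)"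
      by (intro mult_right_mono) auto
    ultimately show ?thesis using False by simp
  qed
  then have "norm w * norm z powr (- Re \<nu>) \<le> (C * (1 + norm z) powr (- (s + \<bar>Re \<nu>\<bar>))) * ((2 / c) powr \<bar>Re \<nu>\<bar> * (1 + norm z) powr \<bar>Re \<nu>\<bar>)"
    using g by (intro mult_mono) auto
  also have "\<dots> = C * (2 / c) powr \<bar>Re \<nu>\<bar> * ((1 + norm z) powr (- (s + \<bar>Re \<nu>\<bar>)) * (1 + norm z) powr \<bar>Re \<nu>\<bar>)" by (simp add: mult_ac)
  also have "(1 + norm z) powr (- (s + \<bar>Re \<nu>\<bar>)) * (1 + norm z) powr \<bar>Re \<nu>\<bar> = (1 + norm z) powr (- s)"
    by (simp flip: powr_add)
  finally show ?thesis using z0 by (simp add: norm_divide norm_mult norm_inverse norm_of_real_powr powr_minus divide_inverse)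
qed

lemma integrable_outside_ball:
  fixes g :: "real^'n \<Rightarrow> complex"
  assumes g: "rapidly_decaying g" and [measurable]: "g \<in> borel_measurable borel"
  shows "integrable lborel (\<lambda>z. indicator (- ball 0 1) z *\<^sub>R (g z / of_real (norm z) powr \<nu>))"
proof -
  let ?s = "real CARD('n) + 1"
  obtain C where C: "C \<ge> 0" "\<And>z. norm (g z) \<le> C * (1 + norm z) powr (- (?s + \<bar>Re \<nu>\<bar>))"
    using rapidly_decayingD[OF g] by blast
  show ?thesis
  proof (rule Bochner_Integration.integrable_bound)
    show "integrable lborel (\<lambda>z::real^'n. (C * 2 powr \<bar>Re \<nu>\<bar>) * (1 + norm z) powr (- ?s))"
      by (intro integrable_mult_right integrable_decay) simp
    show "AE z in lborel. norm (indicator (- ball 0 1) z *\<^sub>R (g z / of_real (norm z) powr \<nu>)) \<le> norm ((C * 2 powr \<bar>Re \<nu>\<bar>) * (1 + norm z) powr (- ?s))"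
    proof (rule AE_I2)
      fix z :: "real^'n"
      show "norm (indicator (- ball 0 1) z *\<^sub>R (g z / of_real (norm z) powr \<nu>)) \<le> norm ((C * 2 powr \<bar>Re \<nu>\<bar>) * (1 + norm z) powr (- ?s))"
        using norm_divide_powr_le[of 1 z "g z" C ?s \<nu>] C by (cases "1 \<le> norm z") auto
    qed
  qed measurable
qed

section \<open>The Hadamard integral in closed form\<close>

definition taylor_rem :: "(real^'n \<Rightarrow> complex) \<Rightarrow> nat \<Rightarrow> real^'n \<Rightarrow> complex" where
  "taylor_rem g N z = g z - (\<Sum>k\<le>N. hom_part g k z)"

lemma measurable_hom_part [measurable (raw)]: "taylor_class g \<Longrightarrow> hom_part g k \<in> borel_measurable borel"
  by (intro borel_measurable_continuous_onI continuous_on_hom_part)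

lemma integrable_taylor_rem:
  fixes g :: "real^'n \<Rightarrow> complex"
  assumes g: "taylor_class g" and [measurable]: "g \<in> borel_measurable borel" and \<nu>: "Re \<nu> < real (CARD('n) + Suc N)"
  shows "integrable lborel (\<lambda>z. indicator (ball 0 1) z *\<^sub>R (taylor_rem g N z / of_real (norm z) powr \<nu>))"
proof -
  have [measurable]: "taylor_rem g N \<in> borel_measurable borel"
    unfolding taylor_rem_def[abs_def] using measurable_hom_part[OF g] by measurable
  have [measurable]: "ball (0::real^'n) 1 \<in> sets borel" by simp
  obtain C where C: "C \<ge> 0" "\<And>z. norm z \<le> 1 \<Longrightarrow> norm (taylor_rem g N z) \<le> C * norm z ^ Suc N"
    using taylor_class_taylor[OF g, of N] unfolding taylor_rem_def hom_part_def by blast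
  show ?thesis
  proof (rule Bochner_Integration.integrable_bound)
    show "integrable lborel (\<lambda>z::real^'n. C * (indicator (ball 0 1) z * norm z powr (real (Suc N) - Re \<nu>)))"
      by (intro integrable_mult_right integrable_norm_powr_ball) (use \<nu> in simp)
    show "AE z in lborel. norm (indicator (ball 0 1) z *\<^sub>R (taylor_rem g N z / of_real (norm z) powr \<nu>))
      \<le> norm (C * (indicator (ball 0 1) z * norm z powr (real (Suc N) - Re \<nu>)))"
    proof (rule AE_I2)
      fix z :: "real^'n"
      show "norm (indicator (ball 0 1) z *\<^sub>R (taylor_rem g N z / of_real (norm z) powr \<nu>))
        \<le> norm (C * (indicator (ball 0 1) z * norm z powr (real (Suc N) - Re \<nu>)))"
      proof (cases "z \<noteq> 0 \<and> norm z < 1")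
        case True
        have "norm (taylor_rem g N z / of_real (norm z) powr \<nu>) \<le> C * norm z ^ Suc N / norm z powr Re \<nu>"
          using C(2)[of z] True by (simp add: norm_divide norm_of_real_powr divide_right_mono)
        also have "norm z ^ Suc N = norm z powr real (Suc N)" using True by (subst powr_realpow) auto
        finally show ?thesis using True C(1) by (simp add: powr_diff)
      qed auto
    qed
  qed measurable
qed

text \<open>The convergent contributions once the Taylor polynomial of degree N is split off inside
  the unit ball. The radius is the one fixed in \<open>hadamard_term\<close>, which is why no
  logarithm of a radius survives in \<open>fp_integral_eq\<close>.\<close>

definition fp_regular :: "(real^'n \<Rightarrow> complex) \<Rightarrow> nat \<Rightarrow> complex \<Rightarrow> complex" where
  "fp_regular g N \<nu> = (\<integral>z. indicator (- ball 0 1) z *\<^sub>R (g z / of_real (norm z) powr \<nu>) \<partial>lborel)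
     + (\<integral>z. indicator (ball 0 1) z *\<^sub>R (taylor_rem g N z / of_real (norm z) powr \<nu>) \<partial>lborel)"

lemma holomorphic_on_integral_norm_powr:
  fixes a :: "real^'n \<Rightarrow> complex"
  assumes "open U" and [measurable]: "a \<in> borel_measurable borel"
    and int: "\<And>\<nu>. \<nu> \<in> U \<Longrightarrow> integrable lborel (\<lambda>z. a z / of_real (norm z) powr \<nu>)"
  shows "(\<lambda>\<nu>. \<integral>z. a z / of_real (norm z) powr \<nu> \<partial>lborel) holomorphic_on U"
proof -
  have eq: "AE z in lborel. a z / of_real (norm z) powr \<nu> = a z * exp (\<nu> * of_real (- ln (norm z)))" for \<nu>
    using AE_lborel_singleton[of "0::real^'n"]
    by eventually_elim (simp add: of_real_powr_eq_exp exp_minus divide_inverse)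
  have "(\<lambda>\<nu>. \<integral>z. a z * exp (\<nu> * of_real (- ln (norm z))) \<partial>lborel) holomorphic_on U"
  proof (rule holomorphic_on_integral_exp[OF assms(1)])
    fix \<nu> assume "\<nu> \<in> U"
    from int[OF this] show "integrable lborel (\<lambda>z. a z * exp (\<nu> * of_real (- ln (norm z))))"
      by (rule integrable_cong_AE[THEN iffD1, OF _ _ eq, rotated 2]) measurable
  qed measurable
  moreover have "(\<integral>z. a z / of_real (norm z) powr \<nu> \<partial>lborel) = (\<integral>z. a z * exp (\<nu> * of_real (- ln (norm z))) \<partial>lborel)" for \<nu>
    by (rule integral_cong_AE[OF _ _ eq]) measurable
  ultimately show ?thesis by simp
qed

lemma holomorphic_fp_regular:
  fixes g :: "real^'n \<Rightarrow> complex"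
  assumes g: "taylor_class g" "rapidly_decaying g" and [measurable]: "g \<in> borel_measurable borel"
  shows "fp_regular g N holomorphic_on {\<nu>. Re \<nu> < real (CARD('n) + Suc N)}"
proof -
  have [measurable]: "taylor_rem g N \<in> borel_measurable borel"
    unfolding taylor_rem_def[abs_def] using measurable_hom_part[OF g(1)] by measurable
  have op: "open {\<nu>. Re \<nu> < real (CARD('n) + Suc N)}" by (rule open_halfspace_Re_lt)
  have [measurable]: "ball (0::real^'n) 1 \<in> sets borel" by simp
  have e: "indicator S z *\<^sub>R w / of_real (norm z) powr \<nu> = indicator S z *\<^sub>R (w / of_real (norm z) powr \<nu>)"
    for S and z :: "real^'n" and w \<nu> :: complex by (simp add: scaleR_conv_of_real)
  have "(\<lambda>\<nu>. \<integral>z. (indicator (- ball 0 1) z *\<^sub>R g z) / of_real (norm z) powr \<nu> \<partial>lborel) holomorphic_on {\<nu>. Re \<nu> < real (CARD('n) + Suc N)}"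
    by (rule holomorphic_on_integral_norm_powr[OF op]) (measurable, unfold e, rule integrable_outside_ball[OF g(2)], simp)
  moreover have "(\<lambda>\<nu>. \<integral>z. (indicator (ball 0 1) z *\<^sub>R taylor_rem g N z) / of_real (norm z) powr \<nu> \<partial>lborel) holomorphic_on {\<nu>. Re \<nu> < real (CARD('n) + Suc N)}"
    by (rule holomorphic_on_integral_norm_powr[OF op]) (measurable, unfold e, rule integrable_taylor_rem[OF g(1)], simp_all)
  ultimately have "(\<lambda>\<nu>. (\<integral>z. (indicator (- ball 0 1) z *\<^sub>R g z) / of_real (norm z) powr \<nu> \<partial>lborel)
     + (\<integral>z. (indicator (ball 0 1) z *\<^sub>R taylor_rem g N z) / of_real (norm z) powr \<nu> \<partial>lborel)) holomorphic_on {\<nu>. Re \<nu> < real (CARD('n) + Suc N)}"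
    by (rule holomorphic_on_add)
  then show ?thesis unfolding fp_regular_def[abs_def] e .
qed

lemma hom_part_integrals:
  fixes g :: "real^'n \<Rightarrow> complex"
  assumes g: "taylor_class g" and \<epsilon>: "0 < \<epsilon>" "\<epsilon> < 1"
  defines "s \<equiv> \<lambda>k \<nu>. of_nat (CARD('n) + k) - \<nu>"
  shows "has_bochner_integral lborel (\<lambda>z. indicator (ball 0 1 - ball 0 \<epsilon>) z *\<^sub>R (hom_part g k z / of_real (norm z) powr \<nu>))
      (sphere_moment g k * (if \<nu> = of_nat (CARD('n) + k) then - of_real (ln \<epsilon>) else (1 - of_real \<epsilon> powr s k \<nu>) / s k \<nu>))"
    and "Re \<nu> > real (CARD('n) + k) \<Longrightarrow>
      has_bochner_integral lborel (\<lambda>z. indicator (- ball 0 \<epsilon>) z *\<^sub>R (hom_part g k z / of_real (norm z) powr \<nu>))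
      (sphere_moment g k * (- (of_real \<epsilon> powr s k \<nu>) / s k \<nu>))"
proof -
  have s0: "s k \<nu> = 0 \<longleftrightarrow> \<nu> = of_nat (CARD('n) + k)" by (auto simp: s_def)
  have "has_bochner_integral lborel (\<lambda>r. indicator {\<epsilon>..<1} r *\<^sub>R complex_of_real r powr (s k \<nu> - 1))
     (if s k \<nu> = 0 then of_real (ln 1 - ln \<epsilon>) else (of_real 1 powr s k \<nu> - of_real \<epsilon> powr s k \<nu>) / s k \<nu>)"
  proof (rule has_bochner_integral_cong_AE[THEN iffD1])
    show "has_bochner_integral lborel (\<lambda>r. indicator {\<epsilon>..1} r *\<^sub>R complex_of_real r powr (s k \<nu> - 1))
     (if s k \<nu> = 0 then of_real (ln 1 - ln \<epsilon>) else (of_real 1 powr s k \<nu> - of_real \<epsilon> powr s k \<nu>) / s k \<nu>)"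
      using integral_powr_finite[of \<epsilon> 1 "s k \<nu>"] \<epsilon> by simp
    show "AE r in lborel. indicator {\<epsilon>..1} r *\<^sub>R complex_of_real r powr (s k \<nu> - 1) = indicator {\<epsilon>..<1} r *\<^sub>R complex_of_real r powr (s k \<nu> - 1)"
      using AE_lborel_singleton[of "1::real"] by eventually_elim (auto simp: indicator_def)
  qed measurable
  note I1 = this[unfolded s_def]
  have sub: "{\<epsilon>..<1} \<subseteq> {0<..}" "{\<epsilon>..} \<subseteq> {0<..}" and sets: "{\<epsilon>..<1} \<in> sets borel" "{\<epsilon>..} \<in> sets borel" using \<epsilon> by auto
  from homogeneous_set_integral[OF hom_part_scaleR[OF g] continuous_on_hom_part[OF g] sets(1) sub(1) I1]
  have 1: "has_bochner_integral lborel (\<lambda>y. indicator {y. norm y \<in> {\<epsilon>..<1}} y *\<^sub>R (hom_part g k y / of_real (norm y) powr \<nu>))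
    (sphere_moment g k * (if s k \<nu> = 0 then of_real (ln 1 - ln \<epsilon>) else (of_real 1 powr s k \<nu> - of_real \<epsilon> powr s k \<nu>) / s k \<nu>))"
    unfolding sphere_moment_def s_def .
  have "{y::real^'n. norm y \<in> {\<epsilon>..<1}} = ball 0 1 - ball 0 \<epsilon>" by auto
  with 1 show "has_bochner_integral lborel (\<lambda>z. indicator (ball 0 1 - ball 0 \<epsilon>) z *\<^sub>R (hom_part g k z / of_real (norm z) powr \<nu>))
      (sphere_moment g k * (if \<nu> = of_nat (CARD('n) + k) then - of_real (ln \<epsilon>) else (1 - of_real \<epsilon> powr s k \<nu>) / s k \<nu>))"
    by (simp only: s0) (simp split: if_splits)
  assume "Re \<nu> > real (CARD('n) + k)"
  then have "has_bochner_integral lborel (\<lambda>r. indicator {\<epsilon>..} r *\<^sub>R complex_of_real r powr (s k \<nu> - 1)) (- (of_real \<epsilon> powr s k \<nu>) / s k \<nu>)"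
    using \<epsilon> by (intro integral_powr_at_top) (auto simp: s_def)
  note I2 = this[unfolded s_def]
  from homogeneous_set_integral[OF hom_part_scaleR[OF g] continuous_on_hom_part[OF g] sets(2) sub(2) I2]
  have 2: "has_bochner_integral lborel (\<lambda>y. indicator {y. norm y \<in> {\<epsilon>..}} y *\<^sub>R (hom_part g k y / of_real (norm y) powr \<nu>))
    (sphere_moment g k * (- (of_real \<epsilon> powr s k \<nu>) / s k \<nu>))"
    unfolding sphere_moment_def s_def .
  have "{y::real^'n. norm y \<in> {\<epsilon>..}} = - ball 0 \<epsilon>" by auto
  with 2 show "has_bochner_integral lborel (\<lambda>z. indicator (- ball 0 \<epsilon>) z *\<^sub>R (hom_part g k z / of_real (norm z) powr \<nu>))
      (sphere_moment g k * (- (of_real \<epsilon> powr s k \<nu>) / s k \<nu>))" by (simp only:)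
qed

text \<open>The three cases of \<open>hadamard_term\<close> give the same closed form, independent
  of \<epsilon>: the powers of \<epsilon> cancel between the shell and the subtracted term. When
  \<nu> equals d + k the two integrals over the shell are equal, and the right-hand side is zero
  because the division is by zero.\<close>

lemma hadamard_term_eq:
  fixes g :: "real^'n \<Rightarrow> complex"
  assumes g: "taylor_class g" and \<epsilon>: "0 < \<epsilon>" "\<epsilon> < 1" and k: "real (CARD('n) + k) \<le> Re \<nu>"
  shows "(\<integral>z. indicator (ball 0 1 - ball 0 \<epsilon>) z *\<^sub>R (hom_part g k z / of_real (norm z) powr \<nu>) \<partial>lborel) - hadamard_term \<nu> \<epsilon> g k
     = sphere_moment g k / (of_nat (CARD('n) + k) - \<nu>)"
proof -
  define s where "s = of_nat (CARD('n) + k) - \<nu>"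
  have e: "indicator S y *\<^sub>R ((dir_nabla y ^^ k) g 0 / of_real (norm y) powr \<nu>) = fact k * (indicator S y *\<^sub>R (hom_part g k y / of_real (norm y) powr \<nu>))" for S y
    by (simp add: hom_part_def)
  note H = hom_part_integrals[OF g \<epsilon>, where k = k and \<nu> = \<nu>, folded s_def]
  have m: "(\<integral>\<theta>. (dir_nabla \<theta> ^^ k) g 0 \<partial>sphere_measure) = fact k * sphere_moment g k"
    unfolding sphere_moment_def hom_part_def by simp
  consider "\<nu> = of_nat (CARD('n) + k)" | "\<nu> \<noteq> of_nat (CARD('n) + k)" "Re \<nu> = real (CARD('n) + k)"
    | "\<nu> \<noteq> of_nat (CARD('n) + k)" "Re \<nu> > real (CARD('n) + k)" using k by linarith
  then show ?thesis
  proof cases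
    case 1
    then show ?thesis unfolding hadamard_term_def set_lebesgue_integral_def e integral_mult_right_zero by simp
  next
    case 2
    then have "s \<noteq> 0" by (auto simp: s_def)
    have d: "\<nu> - of_nat (CARD('n) + k) = - s" by (simp add: s_def)
    have "hadamard_term \<nu> \<epsilon> g k = sphere_moment g k * (of_real \<epsilon> powr s / (\<nu> - of_nat (CARD('n) + k)))"
      unfolding hadamard_term_def m s_def using 2 by simp
    then have "hadamard_term \<nu> \<epsilon> g k = - (sphere_moment g k * (of_real \<epsilon> powr s / s))"
      unfolding d by simp
    moreover have "(\<integral>z. indicator (ball 0 1 - ball 0 \<epsilon>) z *\<^sub>R (hom_part g k z / of_real (norm z) powr \<nu>) \<partial>lborel) = sphere_moment g k * ((1 - of_real \<epsilon> powr s) / s)"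
      using H(1) 2(1) by (simp add: has_bochner_integral_iff)
    ultimately show ?thesis unfolding s_def[symmetric] by (simp add: diff_divide_distrib right_diff_distrib)
  next
    case 3
    then have "s \<noteq> 0" by (auto simp: s_def)
    have "hadamard_term \<nu> \<epsilon> g k = sphere_moment g k * (- (of_real \<epsilon> powr s) / s)"
      unfolding hadamard_term_def set_lebesgue_integral_def e integral_mult_right_zero using H(2) 3 by (simp add: has_bochner_integral_iff)
    moreover have "(\<integral>z. indicator (ball 0 1 - ball 0 \<epsilon>) z *\<^sub>R (hom_part g k z / of_real (norm z) powr \<nu>) \<partial>lborel) = sphere_moment g k * ((1 - of_real \<epsilon> powr s) / s)"
      using H(1) 3(1) by (simp add: has_bochner_integral_iff)
    ultimately show ?thesis unfolding s_def[symmetric] by (simp add: diff_divide_distrib right_diff_distrib)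
  qed
qed

text \<open>Inside the unit ball g is its Taylor polynomial plus an integrable remainder. An order k
  with d + k \<le> Re \<nu> is subtracted and handled by \<open>hadamard_term_eq\<close>; for a
  larger k the shell integral converges as it stands, to the same closed form. Hence one expression
  holds in a half-plane that grows with N, and at \<nu> = d + k division by zero removes the polar
  term.\<close>

theorem fp_integral_eq:
  fixes g :: "real^'n \<Rightarrow> complex"
  assumes g: "taylor_class g" "rapidly_decaying g" and [measurable]: "g \<in> borel_measurable borel"
    and \<nu>: "Re \<nu> < real (CARD('n) + Suc N)"
  shows "fp_integral \<nu> g = fp_regular g N \<nu> + (\<Sum>k\<le>N. sphere_moment g k / (of_nat (CARD('n) + k) - \<nu>))"
proof -
  let ?d = "CARD('n)"
  have [measurable]: "taylor_rem g N \<in> borel_measurable borel"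
    unfolding taylor_rem_def[abs_def] using measurable_hom_part[OF g(1)] by measurable
  note [measurable] = measurable_hom_part[OF g(1)]
  let ?out = "\<integral>z. indicator (- ball 0 1) z *\<^sub>R (g z / of_real (norm z) powr \<nu>) \<partial>lborel"
  let ?R = "\<lambda>S. \<integral>z. indicator S z *\<^sub>R (taylor_rem g N z / of_real (norm z) powr \<nu>) \<partial>lborel"
  let ?A = "\<lambda>\<epsilon> k. \<integral>z. indicator (ball 0 1 - ball 0 \<epsilon>) z *\<^sub>R (hom_part g k z / of_real (norm z) powr \<nu>) \<partial>lborel"
  \<comment> \<open>The orders that \<open>hadamard_op\<close> really subtracts at this \<nu>; the
    sum over all k \<le> N is compared with it term by term.\<close>
  define K where "K = {k. int k \<le> \<lfloor>Re \<nu> - real ?d\<rfloor>}"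
  have Kiff: "k \<in> K \<longleftrightarrow> real (?d + k) \<le> Re \<nu>" for k unfolding K_def by (simp add: le_floor_iff algebra_simps)
  have KN: "K \<subseteq> {..N}" using \<nu> by (auto simp: Kiff)
  have finK: "finite K" using KN finite_subset by blast
  have ri: "integrable lborel (\<lambda>z. indicator (ball 0 1) z *\<^sub>R (taylor_rem g N z / of_real (norm z) powr \<nu>))"
    by (rule integrable_taylor_rem[OF g(1) _ \<nu>]) simp
  have split: "(LINT z : - ball 0 \<epsilon> | lborel. g z / of_real (norm z) powr \<nu>) - hadamard_op \<nu> \<epsilon> g
    = ?out + ?R (ball 0 1 - ball 0 \<epsilon>) + (\<Sum>k\<le>N. ?A \<epsilon> k - (if k \<in> K then hadamard_term \<nu> \<epsilon> g k else 0))"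
    if \<epsilon>: "0 < \<epsilon>" "\<epsilon> < 1" for \<epsilon>
  proof -
    have i2: "integrable lborel (\<lambda>z. indicator (ball 0 1 - ball 0 \<epsilon>) z *\<^sub>R (taylor_rem g N z / of_real (norm z) powr \<nu>))"
      by (rule Bochner_Integration.integrable_bound[OF ri]) (auto simp: indicator_def)
    have i3: "integrable lborel (\<lambda>z. indicator (ball 0 1 - ball 0 \<epsilon>) z *\<^sub>R (hom_part g k z / of_real (norm z) powr \<nu>))" for k
      using hom_part_integrals(1)[OF g(1) \<epsilon>] by (simp add: has_bochner_integral_iff)
    have "indicator (- ball 0 \<epsilon>) z *\<^sub>R (g z / of_real (norm z) powr \<nu>) =
       indicator (- ball 0 1) z *\<^sub>R (g z / of_real (norm z) powr \<nu>) +
       (indicator (ball 0 1 - ball 0 \<epsilon>) z *\<^sub>R (taylor_rem g N z / of_real (norm z) powr \<nu>) +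
       (\<Sum>k\<le>N. indicator (ball 0 1 - ball 0 \<epsilon>) z *\<^sub>R (hom_part g k z / of_real (norm z) powr \<nu>)))" for z
    proof -
      consider "1 \<le> norm z" | "norm z < 1" "\<epsilon> \<le> norm z" | "norm z < 1" "norm z < \<epsilon>" by linarith
      then show ?thesis
      proof cases
        case 2
        have "g z / of_real (norm z) powr \<nu> = taylor_rem g N z / of_real (norm z) powr \<nu> + (\<Sum>k\<le>N. hom_part g k z / of_real (norm z) powr \<nu>)"
          by (simp add: taylor_rem_def diff_divide_distrib sum_divide_distrib)
        then show ?thesis using 2 by simp
      qed (use \<epsilon> in auto)
    qed
    then have "(LINT z : - ball 0 \<epsilon> | lborel. g z / of_real (norm z) powr \<nu>) =
       (\<integral>z. indicator (- ball 0 1) z *\<^sub>R (g z / of_real (norm z) powr \<nu>) +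
       (indicator (ball 0 1 - ball 0 \<epsilon>) z *\<^sub>R (taylor_rem g N z / of_real (norm z) powr \<nu>) +
       (\<Sum>k\<le>N. indicator (ball 0 1 - ball 0 \<epsilon>) z *\<^sub>R (hom_part g k z / of_real (norm z) powr \<nu>))) \<partial>lborel)"
      unfolding set_lebesgue_integral_def by (simp only:)
    also have "\<dots> = ?out + (?R (ball 0 1 - ball 0 \<epsilon>) + (\<Sum>k\<le>N. ?A \<epsilon> k))"
      by (subst Bochner_Integration.integral_add, rule integrable_outside_ball[OF g(2)], simp,
          intro Bochner_Integration.integrable_add Bochner_Integration.integrable_sum i2 i3,
          subst Bochner_Integration.integral_add[OF i2], intro Bochner_Integration.integrable_sum i3,
          subst Bochner_Integration.integral_sum[OF i3], rule refl)
    moreover have "hadamard_op \<nu> \<epsilon> g = (\<Sum>k\<le>N. if k \<in> K then hadamard_term \<nu> \<epsilon> g k else 0)"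
    proof -
      have "hadamard_op \<nu> \<epsilon> g = (\<Sum>k\<in>K. hadamard_term \<nu> \<epsilon> g k)" unfolding hadamard_op_def K_def ..
      also have "\<dots> = (\<Sum>k\<in>{..N} \<inter> K. hadamard_term \<nu> \<epsilon> g k)" using KN by (simp add: Int_absorb1)
      also have "\<dots> = (\<Sum>k\<le>N. if k \<in> K then hadamard_term \<nu> \<epsilon> g k else 0)" by (rule sum.inter_restrict) simp
      finally show ?thesis .
    qed
    ultimately show ?thesis by (simp add: sum_subtractf)
  qed
  have ev: "\<forall>\<^sub>F \<epsilon> in at_right 0. 0 < \<epsilon> \<and> \<epsilon> < (1::real)" by (auto simp: eventually_at_right_field intro: exI[of _ 1])
  have lim1: "((\<lambda>\<epsilon>. ?A \<epsilon> k - (if k \<in> K then hadamard_term \<nu> \<epsilon> g k else 0)) \<longlongrightarrow> sphere_moment g k / (of_nat (?d + k) - \<nu>)) (at_right 0)" for k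
  proof (cases "k \<in> K")
    case True
    have "\<forall>\<^sub>F \<epsilon> in at_right 0. sphere_moment g k / (of_nat (?d + k) - \<nu>) = ?A \<epsilon> k - (if k \<in> K then hadamard_term \<nu> \<epsilon> g k else 0)"
      using ev by eventually_elim (use hadamard_term_eq[OF g(1)] True Kiff in auto)
    then show ?thesis by (rule Lim_transform_eventually[OF tendsto_const])
  next
    case False
    let ?s = "of_nat (?d + k) - \<nu>"
    have s: "Re ?s > 0" using False by (simp add: Kiff)
    then have ne: "?s \<noteq> 0" "\<nu> \<noteq> of_nat (?d + k)" by auto
    have "((\<lambda>\<epsilon>. sphere_moment g k * ((1 - complex_of_real \<epsilon> powr ?s) / ?s)) \<longlongrightarrow> sphere_moment g k * ((1 - 0) / ?s)) (at_right 0)"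
      by (intro tendsto_intros tendsto_of_real_powr_at_right_0 s ne)
    moreover have "\<forall>\<^sub>F \<epsilon> in at_right 0. sphere_moment g k * ((1 - complex_of_real \<epsilon> powr ?s) / ?s) = ?A \<epsilon> k - (if k \<in> K then hadamard_term \<nu> \<epsilon> g k else 0)"
      using ev
    proof eventually_elim
      case (elim \<epsilon>)
      then show ?case using hom_part_integrals(1)[OF g(1), of \<epsilon> k \<nu>] False ne(2) by (simp add: has_bochner_integral_iff)
    qed
    ultimately have "((\<lambda>\<epsilon>. ?A \<epsilon> k - (if k \<in> K then hadamard_term \<nu> \<epsilon> g k else 0)) \<longlongrightarrow> sphere_moment g k * ((1 - 0) / ?s)) (at_right 0)"
      by (rule Lim_transform_eventually)
    then show ?thesis by simp
  qed
  have lim2: "((\<lambda>\<epsilon>. ?R (ball 0 1 - ball 0 \<epsilon>)) \<longlongrightarrow> ?R (ball 0 1)) (at_right 0)"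
  proof (rule integral_dominated_convergence_within[OF _ _ integrable_norm[OF ri]])
    show "AE z in lborel. ((\<lambda>\<epsilon>. indicator (ball 0 1 - ball 0 \<epsilon>) z *\<^sub>R (taylor_rem g N z / of_real (norm z) powr \<nu>))
       \<longlongrightarrow> indicator (ball 0 1) z *\<^sub>R (taylor_rem g N z / of_real (norm z) powr \<nu>)) (at_right 0)"
      using AE_lborel_singleton[of "0::real^'n"]
    proof eventually_elim
      case (elim z)
      then have "\<forall>\<^sub>F \<epsilon> in at_right 0. \<epsilon> < norm z" by (auto simp: eventually_at_right_field intro: exI[of _ "norm z"])
      then have "\<forall>\<^sub>F \<epsilon> in at_right 0. indicator (ball 0 1) z *\<^sub>R (taylor_rem g N z / of_real (norm z) powr \<nu>) = indicator (ball 0 1 - ball 0 \<epsilon>) z *\<^sub>R (taylor_rem g N z / of_real (norm z) powr \<nu>)"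
        by eventually_elim (auto simp: indicator_def)
      then show ?case by (rule Lim_transform_eventually[OF tendsto_const])
    qed
  qed (auto simp: indicator_def)
  have "((\<lambda>\<epsilon>. ?out + ?R (ball 0 1 - ball 0 \<epsilon>) + (\<Sum>k\<le>N. ?A \<epsilon> k - (if k \<in> K then hadamard_term \<nu> \<epsilon> g k else 0)))
     \<longlongrightarrow> ?out + ?R (ball 0 1) + (\<Sum>k\<le>N. sphere_moment g k / (of_nat (?d + k) - \<nu>))) (at_right 0)"
    by (intro tendsto_add tendsto_const lim2 tendsto_sum lim1)
  then have "((\<lambda>\<epsilon>. (LINT z : - ball 0 \<epsilon> | lborel. g z / of_real (norm z) powr \<nu>) - hadamard_op \<nu> \<epsilon> g)
     \<longlongrightarrow> ?out + ?R (ball 0 1) + (\<Sum>k\<le>N. sphere_moment g k / (of_nat (?d + k) - \<nu>))) (at_right 0)"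
    by (rule Lim_transform_eventually) (use ev in eventually_elim, use split in auto)
  then show ?thesis unfolding fp_integral_def fp_regular_def by (intro tendsto_Lim) auto
qed

lemma fp_integral_low:
  fixes g :: "real^'n \<Rightarrow> complex"
  assumes [measurable]: "g \<in> borel_measurable borel" and \<nu>: "Re \<nu> < real CARD('n)"
    and int: "integrable lborel (\<lambda>z. g z / of_real (norm z) powr \<nu>)"
  shows "fp_integral \<nu> g = (\<integral>z. g z / of_real (norm z) powr \<nu> \<partial>lborel)"
proof -
  have op: "hadamard_op \<nu> \<epsilon> g = 0" for \<epsilon>
  proof -
    have "{k. int k \<le> \<lfloor>Re \<nu> - real CARD('n)\<rfloor>} = {}" using \<nu> by (auto simp: le_floor_iff)
    then show ?thesis unfolding hadamard_op_def by simp
  qed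
  have "((\<lambda>\<epsilon>. \<integral>z. indicator (- ball 0 \<epsilon>) z *\<^sub>R (g z / of_real (norm z) powr \<nu>) \<partial>lborel) \<longlongrightarrow> (\<integral>z. g z / of_real (norm z) powr \<nu> \<partial>lborel)) (at_right 0)"
  proof (rule integral_dominated_convergence_within[OF _ _ integrable_norm[OF int]])
    show "AE z in lborel. ((\<lambda>\<epsilon>. indicator (- ball 0 \<epsilon>) z *\<^sub>R (g z / of_real (norm z) powr \<nu>))
       \<longlongrightarrow> g z / of_real (norm z) powr \<nu>) (at_right 0)"
      using AE_lborel_singleton[of "0::real^'n"]
    proof eventually_elim
      case (elim z)
      then have "\<forall>\<^sub>F \<epsilon> in at_right 0. \<epsilon> < norm z" by (auto simp: eventually_at_right_field intro: exI[of _ "norm z"])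
      then have "\<forall>\<^sub>F \<epsilon> in at_right 0. g z / of_real (norm z) powr \<nu> = indicator (- ball 0 \<epsilon>) z *\<^sub>R (g z / of_real (norm z) powr \<nu>)"
        by eventually_elim (auto simp: indicator_def)
      then show ?case by (rule Lim_transform_eventually[OF tendsto_const])
    qed
  qed (auto simp: indicator_def)
  then show ?thesis unfolding fp_integral_def op set_lebesgue_integral_def by (intro tendsto_Lim) auto
qed

section \<open>Theta functions with a cutoff\<close>

lemma power_le_fact_exp:
  assumes "x \<ge> (0::real)"
  shows "x ^ N \<le> fact N * exp x"
proof -
  have "(\<Sum>n\<in>{N}. x ^ n /\<^sub>R fact n) \<le> suminf (\<lambda>n. x ^ n /\<^sub>R fact n)"
    by (rule sum_le_suminf) (use assms summable_exp_generic[of x] in auto)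
  then show ?thesis by (simp add: exp_def field_simps)
qed

lemma power_exp_bounded:
  assumes c: "c > 0"
  obtains B where "B > 0" "\<And>r::real. r \<ge> 0 \<Longrightarrow> r ^ N * exp (- (c * r)) \<le> B"
proof
  show "fact N / c ^ N > 0" using c by simp
  fix r :: real assume r: "r \<ge> 0"
  have "(c * r) ^ N \<le> fact N * exp (c * r)" using c r by (intro power_le_fact_exp) auto
  then show "r ^ N * exp (- (c * r)) \<le> fact N / c ^ N"
    using c by (simp add: exp_minus field_simps power_mult_distrib)
qed

lemma power_gauss_bounded:
  assumes c: "c > 0"
  obtains B where "B > 0" "\<And>r::real. r \<ge> 0 \<Longrightarrow> (1 + r) ^ N * exp (- (c * r\<^sup>2)) \<le> B"
proof -
  obtain B where B: "B > 0" "\<And>r::real. r \<ge> 0 \<Longrightarrow> r ^ N * exp (- (c * r)) \<le> B"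
    using power_exp_bounded[OF c] by blast
  show thesis
  proof
    show "2 ^ N * (1 + B) > 0" using B by simp
    fix r :: real assume r: "r \<ge> 0"
    have e: "0 \<le> c * r\<^sup>2" using c by simp
    show "(1 + r) ^ N * exp (- (c * r\<^sup>2)) \<le> 2 ^ N * (1 + B)"
    proof (cases "r \<le> 1")
      case True
      have "(1 + r) ^ N * exp (- (c * r\<^sup>2)) \<le> 2 ^ N * 1"
        using True r e by (intro mult_mono power_mono) auto
      also have "\<dots> \<le> 2 ^ N * (1 + B)" using B by (intro mult_left_mono) auto
      finally show ?thesis .
    next
      case False
      then have "1 * r \<le> r * r" by (intro mult_right_mono) auto
      then have "(1 + r) \<le> 2 * r\<^sup>2" using False unfolding power2_eq_square by linarith
      then have "(1 + r) ^ N * exp (- (c * r\<^sup>2)) \<le> (2 * r\<^sup>2) ^ N * exp (- (c * r\<^sup>2))"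
        using r by (intro mult_right_mono power_mono) auto
      also have "\<dots> = 2 ^ N * ((r\<^sup>2) ^ N * exp (- (c * r\<^sup>2)))" by (simp add: power_mult_distrib)
      also have "\<dots> \<le> 2 ^ N * (1 + B)" using B(2)[of "r\<^sup>2"] by (intro mult_left_mono) auto
      finally show ?thesis .
    qed
  qed
qed

text \<open>At y = 0 the term of the recursion that lowers k by one vanishes, so every factor 1/t
  uses up two powers. This is the reason why no poles occur beyond d + m.\<close>

lemma degree_hermite_aux_0: "2 * degree (hermite_aux k 0) \<le> k"
proof (induction k "0::real" rule: hermite_aux.induct)
  case (3 k)
  have "hermite_aux (Suc (Suc k)) 0 = [:0, 1:] * smult (of_real (real (Suc k) / (2 * pi))) (hermite_aux k 0)" by simp
  then have "degree (hermite_aux (Suc (Suc k)) 0) \<le> 1 + degree (hermite_aux k 0)"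
    using degree_mult_le[of "[:0, 1:]" "smult (of_real (real (Suc k) / (2 * pi))) (hermite_aux k 0)"]
      degree_smult_le[of "of_real (real (Suc k) / (2 * pi))" "hermite_aux k 0"] by (simp del: hermite_aux.simps degree_smult_eq)
  then show ?case using 3(2) by linarith
qed auto

lemma degree_gauss_poly_0: "2 * degree (gauss_poly p 0) \<le> total_degree p"
proof -
  have "degree (gauss_poly p 0) \<le> total_degree p div 2"
    unfolding gauss_poly_def
  proof (rule degree_sum_le)
    fix \<alpha> assume \<alpha>: "\<alpha> \<in> Poly_Mapping.keys p"
    have "2 * degree (\<Prod>i\<in>UNIV. hermite_aux (\<alpha> i) ((0::real^'a) $ i)) \<le> (\<Sum>i\<in>UNIV. 2 * degree (hermite_aux (\<alpha> i) 0))"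
      using degree_prod_sum_le[of UNIV "\<lambda>i. hermite_aux (\<alpha> i) ((0::real^'a) $ i)"] by (simp add: o_def sum_distrib_left[symmetric])
    also have "\<dots> \<le> (\<Sum>i\<in>UNIV. \<alpha> i)" by (intro sum_mono degree_hermite_aux_0)
    also have "\<dots> \<le> total_degree p" by (rule sum_le_total_degree[OF \<alpha>])
    finally have "degree (\<Prod>i\<in>UNIV. hermite_aux (\<alpha> i) ((0::real^'a) $ i)) \<le> total_degree p div 2" by linarith
    then show "degree (smult (Poly_Mapping.lookup p \<alpha>) (\<Prod>i\<in>UNIV. hermite_aux (\<alpha> i) ((0::real^'a) $ i))) \<le> total_degree p div 2"
      using degree_smult_le order_trans by blast
  qed simp
  then show ?thesis by linarith
qed

lemma integral_count_space_remove:
  fixes f :: "'a \<Rightarrow> complex"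
  assumes "a \<in> A" "integrable (count_space A) f"
  shows "integrable (count_space (A - {a})) f"
    and "(\<integral>z. f z \<partial>count_space A) = f a + (\<integral>z. f z \<partial>count_space (A - {a}))"
proof -
  have e: "(\<integral>z. f z \<partial>count_space (A - {a})) = (\<integral>z. indicator (A - {a}) z *\<^sub>R f z \<partial>count_space A)"
    "integrable (count_space (A - {a})) f \<longleftrightarrow> integrable (count_space A) (\<lambda>z. indicator (A - {a}) z *\<^sub>R f z)"
  proof -
    have "count_space (A - {a}) = restrict_space (count_space A) (A - {a})"
      by (subst restrict_count_space) (rule arg_cong[where f = count_space], auto)
    then show "(\<integral>z. f z \<partial>count_space (A - {a})) = (\<integral>z. indicator (A - {a}) z *\<^sub>R f z \<partial>count_space A)"
      "integrable (count_space (A - {a})) f \<longleftrightarrow> integrable (count_space A) (\<lambda>z. indicator (A - {a}) z *\<^sub>R f z)"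
      by (simp_all add: integral_restrict_space integrable_restrict_space)
  qed
  have i: "integrable (count_space A) (\<lambda>z. indicator (A - {a}) z *\<^sub>R f z)"
    by (rule Bochner_Integration.integrable_bound[OF assms(2)]) (auto simp: indicator_def)
  then show "integrable (count_space (A - {a})) f" using e by simp
  have "(\<integral>z. f z \<partial>count_space A) = (\<integral>z. indicator {a} z *\<^sub>R f a + indicator (A - {a}) z *\<^sub>R f z \<partial>count_space A)"
    by (rule Bochner_Integration.integral_cong[OF refl]) (auto simp: indicator_def)
  also have "\<dots> = f a + (\<integral>z. indicator (A - {a}) z *\<^sub>R f z \<partial>count_space A)"
    using assms(1) by (subst Bochner_Integration.integral_add[OF _ i]) auto
  finally show "(\<integral>z. f z \<partial>count_space A) = f a + (\<integral>z. f z \<partial>count_space (A - {a}))" using e by simp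
qed

section \<open>Polynomials damped by the cutoff and by a Gaussian\<close>

locale cutoff_lattice =
  fixes M :: "real^'n^'n" and \<phi> :: "real^'n \<Rightarrow> real" and p :: "('n \<Rightarrow> nat) \<Rightarrow>\<^sub>0 complex"
  assumes M: "invertible M" and smooth_cutoff: "smooth_cutoff \<phi>"
begin

abbreviation "P \<equiv> poly_fun p"
abbreviation "V \<equiv> \<bar>det M\<bar>"
abbreviation "punctured_lattice \<equiv> lattice_of M - {0}"

lemma V_pos: "V > 0" using M by (simp add: invertible_det_nz)

lemma cc: "cc_smooth \<phi>" and \<phi>_nonneg: "\<phi> x \<ge> 0" and \<phi>_int: "integral\<^sup>L lborel \<phi> = 1"
  using smooth_cutoff unfolding smooth_cutoff_def cc_smooth_def by auto

lemma measurable_\<phi> [measurable]: "\<phi> \<in> borel_measurable borel" by (rule cc_smooth_measurable[OF cc])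

lemma \<phi>_integrable: "integrable lborel \<phi>"
  using \<phi>_int not_integrable_integral_eq[of lborel \<phi>] by auto

text \<open>The cutoff is a probability density on the unit ball, so averaging against it preserves
  a bound valid there.\<close>

lemma \<phi>_weighted:
  fixes h :: "real^'n \<Rightarrow> complex"
  assumes [measurable]: "h \<in> borel_measurable borel" and h: "\<And>x. norm x < 1 \<Longrightarrow> norm (h x) \<le> B"
  shows "integrable lborel (\<lambda>x. of_real (\<phi> x) * h x)" "norm (\<integral>x. of_real (\<phi> x) * h x \<partial>lborel) \<le> B"
proof -
  have b: "norm (of_real (\<phi> x) * h x) \<le> B * \<phi> x" for x
    using h[of x] \<phi>_nonneg[of x] cc_smooth_supp[OF cc, of x]
    by (cases "norm x < 1") (auto simp: norm_mult mult.commute[of B] intro!: mult_left_mono)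
  have iB: "integrable lborel (\<lambda>x. B * \<phi> x)" using \<phi>_integrable by simp
  show i: "integrable lborel (\<lambda>x. of_real (\<phi> x) * h x)"
    by (rule Bochner_Integration.integrable_bound[OF iB]) (use b in \<open>auto intro: order_trans[OF _ abs_ge_self]\<close>)
  have "norm (\<integral>x. of_real (\<phi> x) * h x \<partial>lborel) \<le> (\<integral>x. B * \<phi> x \<partial>lborel)"
    by (rule Bochner_Integration.integral_norm_bound_integral[OF i iB b])
  then show "norm (\<integral>x. of_real (\<phi> x) * h x \<partial>lborel) \<le> B" using \<phi>_int by simp
qed

abbreviation "chi_hat \<equiv> FT \<phi>"

lemma norm_chi_hat_le: "norm (chi_hat z) \<le> 1"
  unfolding FT_def by (rule \<phi>_weighted) auto

lemma chi_hat_0: "chi_hat 0 = 1"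
  unfolding FT_def using \<phi>_int by simp

lemma continuous_chi_hat: "continuous_on UNIV chi_hat"
proof -
  have "(chi_hat \<longlongrightarrow> chi_hat a) (at a)" for a
    unfolding FT_def
  proof (rule integral_dominated_convergence_within[where w = \<phi>])
    have "isCont (\<lambda>z. of_real (\<phi> x) * echar (- (z \<bullet> x))) a" for x
    proof -
      have "continuous_on UNIV (\<lambda>z. of_real (\<phi> x) * echar (- (z \<bullet> x)))" by (intro continuous_intros)
      then show ?thesis by (simp add: continuous_on_eq_continuous_at)
    qed
    then show "AE x in lborel. ((\<lambda>z. of_real (\<phi> x) * echar (- (z \<bullet> x))) \<longlongrightarrow> of_real (\<phi> x) * echar (- (a \<bullet> x))) (at a)"
      by (auto simp: isCont_def)
  qed (use \<phi>_integrable \<phi>_nonneg in \<open>auto simp: norm_mult\<close>)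
  then show ?thesis by (simp add: continuous_on_def)
qed

definition cutoff_poly :: "real \<Rightarrow> real^'n \<Rightarrow> complex" where
  "cutoff_poly \<beta> z = chi_hat (\<beta> *\<^sub>R z) * P z"

lemma cutoff_poly_0 [simp]: "cutoff_poly 0 = P" by (rule ext) (simp add: cutoff_poly_def chi_hat_0)
lemma cutoff_poly_at_0 [simp]: "cutoff_poly \<beta> 0 = P 0" by (simp add: cutoff_poly_def chi_hat_0)

lemma norm_cutoff_poly_le: "norm (cutoff_poly \<beta> z) \<le> norm (P z)"
  using norm_chi_hat_le[of "\<beta> *\<^sub>R z"] by (simp add: cutoff_poly_def norm_mult mult_left_le_one_le)

lemma continuous_cutoff_poly: "continuous_on UNIV (cutoff_poly \<beta>)"
  unfolding cutoff_poly_def[abs_def]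
  by (intro continuous_intros continuous_on_compose2[OF continuous_chi_hat]) auto

lemma measurable_cutoff_poly [measurable]: "cutoff_poly \<beta> \<in> borel_measurable borel"
  by (rule borel_measurable_continuous_onI[OF continuous_cutoff_poly])

lemma measurable_P [measurable]: "P \<in> borel_measurable borel"
  by (intro borel_measurable_continuous_onI continuous_intros)

lemma cutoff_poly_tendsto: "((\<lambda>\<beta>. cutoff_poly \<beta> z) \<longlongrightarrow> cutoff_poly 0 z) (at_right 0)"
proof -
  have "isCont chi_hat 0" using continuous_chi_hat by (simp add: continuous_on_eq_continuous_at)
  moreover have "((\<lambda>\<beta>. \<beta> *\<^sub>R z) \<longlongrightarrow> 0 *\<^sub>R z) (at_right 0)" by (intro tendsto_intros)
  ultimately have "((\<lambda>\<beta>. chi_hat (\<beta> *\<^sub>R z)) \<longlongrightarrow> chi_hat 0) (at_right 0)" by (intro isCont_tendsto_compose[of 0 chi_hat]) auto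
  then show ?thesis unfolding cutoff_poly_def by (auto intro!: tendsto_intros)
qed

lemma gauss_decay:
  assumes "c > 0"
  obtains B where "B > 0" "\<And>z. norm (P z) * exp (- (c * (norm z)\<^sup>2)) \<le> B * (1 + norm z) powr (- real (CARD('n) + 1))"
proof -
  obtain C where C: "C \<ge> 0" "\<And>z. norm (P z) \<le> C * (1 + norm z) ^ total_degree p" using poly_fun_bound[of p] by blast
  obtain B where B: "B > 0" "\<And>r::real. r \<ge> 0 \<Longrightarrow> (1 + r) ^ (total_degree p + (CARD('n) + 1)) * exp (- (c * r\<^sup>2)) \<le> B"
    using power_gauss_bounded[OF assms] by blast
  \<comment> \<open>The constant is taken from C + 1 so that it is positive even for C = 0.\<close>
  have "norm (P z) * exp (- (c * (norm z)\<^sup>2)) \<le> ((C + 1) * B) * (1 + norm z) powr (- real (CARD('n) + 1))" for z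
  proof -
    have pos: "(1 + norm z) ^ (CARD('n) + 1) > 0" by (simp add: add_pos_nonneg)
    have "norm (P z) * exp (- (c * (norm z)\<^sup>2)) \<le> ((C + 1) * (1 + norm z) ^ total_degree p) * exp (- (c * (norm z)\<^sup>2))"
    proof (intro mult_right_mono)
      show "norm (P z) \<le> (C + 1) * (1 + norm z) ^ total_degree p"
      proof -
        have "0 \<le> (1 + norm z) ^ total_degree p" by simp
        then show ?thesis using C(2)[of z] unfolding distrib_right by linarith
      qed
    qed auto
    also have "\<dots> = (C + 1) * ((1 + norm z) ^ (total_degree p + (CARD('n) + 1)) * exp (- (c * (norm z)\<^sup>2))) / (1 + norm z) ^ (CARD('n) + 1)"
      using pos by (simp add: power_add field_simps)
    also have "\<dots> \<le> (C + 1) * B / (1 + norm z) ^ (CARD('n) + 1)"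
      using B(2)[of "norm z"] C(1) pos by (intro divide_right_mono mult_left_mono) auto
    also have "\<dots> = ((C + 1) * B) * (1 + norm z) powr (- real (CARD('n) + 1))"
      by (subst powr_minus, subst powr_realpow) (auto simp: add_pos_nonneg divide_inverse)
    finally show ?thesis .
  qed
  then show thesis using B(1) C(1) by (intro that[of "(C + 1) * B"]) auto
qed

lemma integrable_decay_punctured_lattice:
  assumes "s > real CARD('n)"
  shows "integrable (count_space punctured_lattice) (\<lambda>z. (1 + norm z) powr (- s))"
    and "integrable (count_space punctured_lattice) (\<lambda>z. complex_of_real ((1 + norm z) powr (- s)))"
proof -
  show *: "integrable (count_space punctured_lattice) (\<lambda>z. complex_of_real ((1 + norm z) powr (- s)))"
    by (rule integral_count_space_remove(1))
      (use integrable_decay_lattice[OF M assms] in \<open>auto simp: lattice_of_eq_image intro!: image_eqI[of _ _ 0]\<close>)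
  from integrable_norm[OF *] show "integrable (count_space punctured_lattice) (\<lambda>z. (1 + norm z) powr (- s))" by simp
qed

definition cutoff_gauss :: "real \<Rightarrow> real \<Rightarrow> real^'n \<Rightarrow> complex" where
  "cutoff_gauss \<beta> t z = cutoff_poly \<beta> z * of_real (exp (- pi * t * (norm z)\<^sup>2))"

lemma measurable_cutoff_gauss [measurable]: "cutoff_gauss \<beta> t \<in> borel_measurable borel"
  unfolding cutoff_gauss_def[abs_def] by measurable

lemma continuous_cutoff_gauss: "continuous_on UNIV (cutoff_gauss \<beta> t)"
  unfolding cutoff_gauss_def[abs_def] by (intro continuous_intros continuous_cutoff_poly)

lemma norm_cutoff_gauss_le: "norm (cutoff_gauss \<beta> t z) \<le> norm (P z) * exp (- pi * t * (norm z)\<^sup>2)"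
  unfolding cutoff_gauss_def by (auto simp: norm_mult intro!: mult_right_mono norm_cutoff_poly_le)

lemma cutoff_gauss_bound:
  assumes "t > 0"
  obtains B where "B > 0" "\<And>\<beta> z. norm (cutoff_gauss \<beta> t z) \<le> B * (1 + norm z) powr (- real (CARD('n) + 1))"
proof -
  obtain B where B: "B > 0" "\<And>z. norm (P z) * exp (- ((pi * t) * (norm z)\<^sup>2)) \<le> B * (1 + norm z) powr (- real (CARD('n) + 1))"
    using gauss_decay[of "pi * t"] assms by auto
  have "norm (cutoff_gauss \<beta> t z) \<le> B * (1 + norm z) powr (- real (CARD('n) + 1))" for \<beta> z
  proof -
    have e: "exp (- pi * t * (norm z)\<^sup>2) = exp (- ((pi * t) * (norm z)\<^sup>2))" by simp
    show ?thesis by (rule order_trans[OF norm_cutoff_gauss_le[of \<beta> t z, unfolded e] B(2)[of z]])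
  qed
  then show thesis using B(1) that by blast
qed

lemma cutoff_gauss_integrable:
  assumes "t > 0"
  shows "integrable lborel (cutoff_gauss \<beta> t)" "integrable (count_space (lattice_of M)) (cutoff_gauss \<beta> t)" "integrable (count_space punctured_lattice) (cutoff_gauss \<beta> t)"
proof -
  obtain B where B: "B > 0" "\<And>\<beta> z. norm (cutoff_gauss \<beta> t z) \<le> B * (1 + norm z) powr (- real (CARD('n) + 1))"
    using cutoff_gauss_bound[OF assms] by blast
  show "integrable lborel (cutoff_gauss \<beta> t)" by (rule integrable_decay_bound[OF _ _ B(2)]) auto
  show *: "integrable (count_space (lattice_of M)) (cutoff_gauss \<beta> t)"
    by (rule Bochner_Integration.integrable_bound[OF integrable_mult_right[OF integrable_decay_lattice[OF M, of "real (CARD('n) + 1)"], of B]])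
      (use B in \<open>auto intro: order_trans[OF B(2) abs_ge_self]\<close>)
  have "0 \<in> lattice_of M" by (auto simp: lattice_of_eq_image intro!: image_eqI[of _ _ 0])
  then show "integrable (count_space punctured_lattice) (cutoff_gauss \<beta> t)" by (rule integral_count_space_remove(1)[OF _ *])
qed

section \<open>Theta sum, theta integral and Poisson summation\<close>

definition theta_sum :: "real \<Rightarrow> real \<Rightarrow> complex" where "theta_sum \<beta> t = (\<integral>z. cutoff_gauss \<beta> t z \<partial>count_space punctured_lattice)"
definition theta_int :: "real \<Rightarrow> real \<Rightarrow> complex" where "theta_int \<beta> t = (\<integral>z. cutoff_gauss \<beta> t z \<partial>lborel)"
text \<open>By Poisson summation this is 1/V times the sum over the non-zero dual lattice points;
  see the proof of \<open>theta_diff_bound\<close>.\<close>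

definition theta_diff :: "real \<Rightarrow> real \<Rightarrow> complex" where "theta_diff \<beta> t = P 0 + theta_sum \<beta> t - theta_int \<beta> t / of_real V"
definition gauss_transform :: "real \<Rightarrow> real^'n \<Rightarrow> complex" where
  "gauss_transform t y = of_real (exp (- pi * (norm y)\<^sup>2 / t) / sqrt t ^ CARD('n)) * poly (gauss_poly p y) (of_real (1 / t))"

text \<open>Multiplication by the transform of the cutoff becomes, on the Fourier side, averaging
  over displacements \<beta> x weighted by \<phi>. Fubini applies because the Gaussian is integrable
  and \<phi> has integral one.\<close>

lemma FT_cutoff_gauss:
  assumes t: "t > 0"
  shows "(\<integral>z. cutoff_gauss \<beta> t z * echar (- (z \<bullet> y)) \<partial>lborel) = (\<integral>x. of_real (\<phi> x) * gauss_transform t (\<beta> *\<^sub>R x + y) \<partial>lborel)"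
proof -
  let ?G = "\<lambda>z. P z * of_real (exp (- pi * t * (norm z)\<^sup>2))"
  let ?F = "\<lambda>x z. of_real (\<phi> x) * (?G z * echar (- (z \<bullet> (\<beta> *\<^sub>R x + y))))"
  have Gi: "integrable lborel ?G" using cutoff_gauss_integrable(1)[OF t, of 0] by (simp add: cutoff_gauss_def[abs_def])
  have int: "integrable (lborel \<Otimes>\<^sub>M lborel) (\<lambda>(x, z). ?F x z)"
  proof (rule lborel_pair.Fubini_integrable)
    have "(\<integral>z. norm ((\<lambda>(x, z). ?F x z) (x, z)) \<partial>lborel) = \<phi> x * (\<integral>z. norm (?G z) \<partial>lborel)" for x
      using \<phi>_nonneg[of x] by (simp add: norm_mult)
    then show "integrable lborel (\<lambda>x. \<integral>z. norm ((\<lambda>(x, z). ?F x z) (x, z)) \<partial>lborel)"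
      using \<phi>_integrable by simp
    have "integrable lborel (\<lambda>z. ?F x z)" for x
      by (intro integrable_mult_right Bochner_Integration.integrable_bound[OF Gi]) (auto simp: norm_mult)
    then show "AE x in lborel. integrable lborel (\<lambda>z. (\<lambda>(x, z). ?F x z) (x, z))" by simp
  qed measurable
  have "(\<integral>z. cutoff_gauss \<beta> t z * echar (- (z \<bullet> y)) \<partial>lborel) = (\<integral>z. \<integral>x. ?F x z \<partial>lborel \<partial>lborel)"
  proof (rule Bochner_Integration.integral_cong[OF refl])
    fix z
    have "(\<integral>x. ?F x z \<partial>lborel) = (\<integral>x. (?G z * echar (- (z \<bullet> y))) * (of_real (\<phi> x) * echar (- ((\<beta> *\<^sub>R z) \<bullet> x))) \<partial>lborel)"
      by (rule Bochner_Integration.integral_cong[OF refl])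
        (simp add: inner_add_right minus_add_distrib echar_add[symmetric] mult_ac del: minus_add_distrib, simp add: echar_add add.commute mult_ac)
    also have "\<dots> = (?G z * echar (- (z \<bullet> y))) * chi_hat (\<beta> *\<^sub>R z)" unfolding FT_def by (rule integral_mult_right_zero)
    finally have X: "(\<integral>x. ?F x z \<partial>lborel) = (?G z * echar (- (z \<bullet> y))) * chi_hat (\<beta> *\<^sub>R z)" .
    show "cutoff_gauss \<beta> t z * echar (- (z \<bullet> y)) = (\<integral>x. ?F x z \<partial>lborel)" unfolding X by (simp add: cutoff_gauss_def cutoff_poly_def mult_ac)
  qed
  also have "\<dots> = (\<integral>x. \<integral>z. ?F x z \<partial>lborel \<partial>lborel)" by (rule lborel_pair.Fubini_integral[OF int])
  also have "\<dots> = (\<integral>x. of_real (\<phi> x) * gauss_transform t (\<beta> *\<^sub>R x + y) \<partial>lborel)"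
    unfolding gauss_transform_def using fourier_poly_gauss[OF t, of p] by (simp add: has_bochner_integral_iff)
  finally show ?thesis .
qed

lemma theta_int_eq: "t > 0 \<Longrightarrow> theta_int \<beta> t = (\<integral>x. of_real (\<phi> x) * gauss_transform t (\<beta> *\<^sub>R x) \<partial>lborel)"
  using FT_cutoff_gauss[of t \<beta> 0] by (simp add: theta_int_def)

lemma measurable_gauss_transform [measurable]: "gauss_transform t \<in> borel_measurable borel"
proof -
  have "(\<lambda>y. coeff (gauss_poly p y) j) \<in> borel_measurable borel" for j
    by (rule borel_measurable_continuous_onI[OF continuous_on_gauss_poly])
  then show ?thesis unfolding gauss_transform_def[abs_def] poly_gauss_poly by measurable
qed

definition dual_matrix :: "real^'n^'n" where "dual_matrix = transpose (matrix_inv M)"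

lemma dual_norm:
  obtains c where "c > 0" "\<And>k. c * norm k \<le> norm (dual_matrix *v k)"
proof -
  have "dual_matrix ** transpose M = mat 1" "transpose M ** dual_matrix = mat 1"
    unfolding dual_matrix_def matrix_transpose_mul[symmetric] by (simp_all add: matrix_inv_left[OF M] matrix_inv_right[OF M])
  then have "invertible dual_matrix" unfolding invertible_def by blast
  then obtain L where L: "L \<ge> 1" "\<And>x. norm x \<le> L * norm (dual_matrix *v x)" by (metis matrix_inv_bound)
  show thesis by (rule that[of "1 / L"]) (use L in \<open>auto simp: field_simps\<close>)
qed

text \<open>For \<open>\<beta>\<close> below \<open>\<rho>\<close> the support of the scaled cutoff stays away from the non-zero points of the
  dual lattice, on which the Gaussian \<open>e\<^bsup>-\<pi>|y|\<^sup>2/t\<^esup>\<close> is then uniformly small.\<close>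

lemma FT_cutoff_gauss_bound:
  obtains \<rho> where "0 < \<rho>" "\<rho> \<le> 1"
    "\<And>L. \<exists>C\<ge>0. \<forall>\<beta> t. \<forall>k\<in>int_vecs. 0 \<le> \<beta> \<longrightarrow> \<beta> \<le> \<rho> \<longrightarrow> 0 < t \<longrightarrow> t \<le> 1 \<longrightarrow> k \<noteq> 0 \<longrightarrow>
      norm (\<integral>z. cutoff_gauss \<beta> t z * echar (- (z \<bullet> (dual_matrix *v k))) \<partial>lborel) \<le> C * t ^ L * (1 + norm k) powr (- real (CARD('n) + 1))"
proof -
  let ?m = "total_degree p" and ?d = "CARD('n)" and ?s = "real (CARD('n) + 1)"
  obtain c where c: "c > 0" "\<And>k. c * norm k \<le> norm (dual_matrix *v k)" using dual_norm by blast
  \<comment> \<open>For an integer vector k \<noteq> 0 the dual point has norm at least c |k|, and a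
    displacement of norm at most c/2 \<le> (c/2) |k| leaves half of it.\<close>
  define \<rho> where "\<rho> = min 1 (c / 2)"
  have \<rho>: "0 < \<rho>" "\<rho> \<le> 1" "\<rho> \<le> c / 2" using c by (auto simp: \<rho>_def)
  obtain C1 where C1: "C1 \<ge> 0" "\<And>s y. s \<ge> 1 \<Longrightarrow> norm (poly (gauss_poly p y) (of_real s)) \<le> C1 * (s * (1 + norm y)) ^ ?m"
    using norm_gauss_poly_le[of p] by blast
  \<comment> \<open>One half of the Gaussian exponent absorbs the growth of degree m in y together
    with d + 1 further powers, which are kept for summability over k.\<close>
  obtain B1 where B1: "B1 > 0" "\<And>r::real. r \<ge> 0 \<Longrightarrow> (1 + r) ^ (?m + (?d + 1)) * exp (- ((pi / 2) * r\<^sup>2)) \<le> B1"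
    using power_gauss_bounded[OF pi_half_gt_zero] by blast
  \<comment> \<open>The other half of the exponent: |y| \<ge> c/2 gives (pi/2) |y|^2 / t \<ge>
    (pi/2) (c/2)^2 / t, and exp(-\<kappa>/t) beats any power of t.\<close>
  define \<kappa> where "\<kappa> = pi * c\<^sup>2 / 8"
  have \<kappa>: "\<kappa> > 0" using c by (simp add: \<kappa>_def)
  show thesis
  proof (rule that[OF \<rho>(1,2)])
    fix L
    obtain B2 where B2: "B2 > 0" "\<And>r::real. r \<ge> 0 \<Longrightarrow> r ^ (?d + ?m + L) * exp (- (\<kappa> * r)) \<le> B2"
      using power_exp_bounded[OF \<kappa>] by blast
    define K where "K = C1 * B1 * B2 * (max 1 (2 / c)) powr ?s"
    have K0: "K \<ge> 0" using C1 B1 B2 by (simp add: K_def)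
    have "norm (gauss_transform t y) \<le> K * t ^ L * (1 + norm k) powr (- ?s)"
      if t: "0 < t" "t \<le> 1" and k: "k \<in> int_vecs" "k \<noteq> 0" and y: "c / 2 * norm k \<le> norm y" for t and k y :: "real^'n"
    proof -
      define s where "s = 1 / t"
      have s: "s \<ge> 1" "s > 0" using t by (auto simp: s_def)
      have k1: "1 \<le> norm k" by (rule int_vecs_norm_ge_1[OF k])
      have yc: "c / 2 \<le> norm y" using y c mult_left_mono[OF k1, of "c / 2"] by linarith
      \<comment> \<open>A crude estimate that leaves only integer powers of s = 1/t, since t \<le>
        sqrt t for t \<le> 1.\<close>
      have sq: "1 / sqrt t ^ ?d \<le> s ^ ?d"
      proof -
        have "t * t \<le> t" using t by (simp add: mult_left_le)
        then have "t \<le> sqrt t" using t by (intro real_le_rsqrt) (simp add: power2_eq_square)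
        then have "t ^ ?d \<le> sqrt t ^ ?d" using t by (intro power_mono) auto
        then have "1 / sqrt t ^ ?d \<le> 1 / t ^ ?d" using t by (intro divide_left_mono) auto
        then show ?thesis by (simp add: s_def power_divide)
      qed
      have e: "exp (- pi * (norm y)\<^sup>2 / t) \<le> exp (- ((pi / 2) * (norm y)\<^sup>2)) * exp (- (\<kappa> * s))"
      proof -
        have y2: "(c / 2)\<^sup>2 \<le> (norm y)\<^sup>2" using yc c by (intro power_mono) auto
        have "(pi / 2) * (norm y)\<^sup>2 * 1 \<le> (pi / 2) * (norm y)\<^sup>2 * s" using s by (intro mult_left_mono) auto
        moreover have "\<kappa> * s \<le> (pi / 2) * (norm y)\<^sup>2 * s"
          using mult_left_mono[OF y2, of "pi / 2"] s by (intro mult_right_mono) (auto simp: \<kappa>_def power_divide)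
        ultimately have "(pi / 2) * (norm y)\<^sup>2 + \<kappa> * s \<le> pi * (norm y)\<^sup>2 * s" by linarith
        moreover have "- pi * (norm y)\<^sup>2 / t = - (pi * (norm y)\<^sup>2 * s)" by (simp add: s_def)
        ultimately have "- pi * (norm y)\<^sup>2 / t \<le> - ((pi / 2) * (norm y)\<^sup>2) + - (\<kappa> * s)" by linarith
        then show ?thesis by (subst exp_add[symmetric]) simp
      qed
      have "s ^ (?d + ?m) * exp (- (\<kappa> * s)) = (s ^ (?d + ?m + L) * exp (- (\<kappa> * s))) * t ^ L"
        using t by (simp add: s_def power_add power_divide)
      also have "\<dots> \<le> B2 * t ^ L" using B2(2)[of s] s t by (intro mult_right_mono) auto
      finally have f1: "s ^ (?d + ?m) * exp (- (\<kappa> * s)) \<le> B2 * t ^ L" .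
      have p1: "(1 + norm y) ^ (?d + 1) > 0" by (simp add: add_pos_nonneg)
      have "(1 + norm y) ^ ?m * exp (- ((pi / 2) * (norm y)\<^sup>2)) = ((1 + norm y) ^ (?m + (?d + 1)) * exp (- ((pi / 2) * (norm y)\<^sup>2))) / (1 + norm y) ^ (?d + 1)"
        using p1 by (simp add: power_add field_simps)
      also have "\<dots> \<le> B1 / (1 + norm y) ^ (?d + 1)" using B1(2)[of "norm y"] p1 by (intro divide_right_mono) auto
      also have "\<dots> = B1 * (1 + norm y) powr (- ?s)"
        by (subst powr_minus, subst powr_realpow) (auto simp: add_pos_nonneg divide_inverse)
      also have "\<dots> \<le> B1 * ((max 1 (2 / c)) powr ?s * (1 + norm k) powr (- ?s))"
      proof (intro mult_left_mono powr_neg_le)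
        have "norm k \<le> (2 / c) * norm y" using y c by (simp add: field_simps)
        also have "\<dots> \<le> max 1 (2 / c) * norm y" by (intro mult_right_mono) auto
        finally show "1 + norm k \<le> max 1 (2 / c) * (1 + norm y)" by (simp add: distrib_left add_mono)
      qed (use B1 c in \<open>auto simp: add_pos_nonneg\<close>)
      finally have f2: "(1 + norm y) ^ ?m * exp (- ((pi / 2) * (norm y)\<^sup>2)) \<le> B1 * ((max 1 (2 / c)) powr ?s * (1 + norm k) powr (- ?s))" .
      have "norm (gauss_transform t y) = exp (- pi * (norm y)\<^sup>2 / t) * (1 / sqrt t ^ ?d) * norm (poly (gauss_poly p y) (of_real s))"
        using t by (simp add: gauss_transform_def norm_mult norm_divide norm_power s_def)
      also have "\<dots> \<le> (exp (- ((pi / 2) * (norm y)\<^sup>2)) * exp (- (\<kappa> * s))) * s ^ ?d * (C1 * (s * (1 + norm y)) ^ ?m)"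
        using C1 s t by (intro mult_mono e sq C1(2)) auto
      also have "\<dots> = C1 * (s ^ (?d + ?m) * exp (- (\<kappa> * s))) * ((1 + norm y) ^ ?m * exp (- ((pi / 2) * (norm y)\<^sup>2)))"
        by (simp add: power_add power_mult_distrib mult_ac)
      also have "\<dots> \<le> C1 * (B2 * t ^ L) * (B1 * ((max 1 (2 / c)) powr ?s * (1 + norm k) powr (- ?s)))"
        using s t B2 C1 by (intro mult_mono[OF mult_left_mono[OF f1 C1(1)] f2]) auto
      also have "\<dots> = K * t ^ L * (1 + norm k) powr (- ?s)" by (simp add: K_def mult_ac)
      finally show ?thesis .
    qed
    note Jb = this
    have "norm (\<integral>z. cutoff_gauss \<beta> t z * echar (- (z \<bullet> (dual_matrix *v k))) \<partial>lborel) \<le> K * t ^ L * (1 + norm k) powr (- ?s)"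
      if \<beta>: "0 \<le> \<beta>" "\<beta> \<le> \<rho>" and t: "0 < t" "t \<le> 1" and k: "k \<in> int_vecs" "k \<noteq> 0" for \<beta> t k
      unfolding FT_cutoff_gauss[OF t(1)]
    proof (rule \<phi>_weighted(2))
      fix x :: "real^'n" assume x: "norm x < 1"
      have "c * norm k \<le> norm (dual_matrix *v k)" by (rule c)
      also have "\<dots> \<le> norm (\<beta> *\<^sub>R x + dual_matrix *v k) + norm (\<beta> *\<^sub>R x)"
        using norm_triangle_ineq4[of "\<beta> *\<^sub>R x + dual_matrix *v k" "\<beta> *\<^sub>R x"] by simp
      also have "norm (\<beta> *\<^sub>R x) \<le> c / 2 * norm k"
      proof -
        have "norm (\<beta> *\<^sub>R x) \<le> (c / 2) * 1" using \<beta> \<rho> x c by (simp add: mult_mono[of \<beta> "c/2" "norm x" 1, simplified])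
        also have "\<dots> \<le> c / 2 * norm k" using int_vecs_norm_ge_1[OF k] c by (intro mult_left_mono) auto
        finally show ?thesis .
      qed
      finally have "c / 2 * norm k \<le> norm (\<beta> *\<^sub>R x + dual_matrix *v k)" by (simp add: field_simps)
      then show "norm (gauss_transform t (\<beta> *\<^sub>R x + dual_matrix *v k)) \<le> K * t ^ L * (1 + norm k) powr (- ?s)" by (rule Jb[OF t k])
    qed measurable
    then show "\<exists>C\<ge>0. \<forall>\<beta> t. \<forall>k\<in>int_vecs. 0 \<le> \<beta> \<longrightarrow> \<beta> \<le> \<rho> \<longrightarrow> 0 < t \<longrightarrow> t \<le> 1 \<longrightarrow> k \<noteq> 0 \<longrightarrow>
      norm (\<integral>z. cutoff_gauss \<beta> t z * echar (- (z \<bullet> (dual_matrix *v k))) \<partial>lborel) \<le> C * t ^ L * (1 + norm k) powr (- ?s)"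
      using K0 by blast
  qed
qed

text \<open>The lattice point 0 contributes P(0) on one side of Poisson summation and the dual point
  0 contributes \<open>theta_int\<close> on the other; after removing both, only dual terms with k
  \<noteq> 0 remain, each of which is small by \<open>FT_cutoff_gauss_bound\<close>. The range of
  \<beta> is fixed before the order L, so it serves all orders.\<close>

lemma theta_diff_bound:
  obtains \<rho> where "0 < \<rho>" "\<rho> \<le> 1"
    "\<And>L. \<exists>C\<ge>0. \<forall>\<beta> t. 0 \<le> \<beta> \<longrightarrow> \<beta> \<le> \<rho> \<longrightarrow> 0 < t \<longrightarrow> t \<le> 1 \<longrightarrow> norm (theta_diff \<beta> t) \<le> C * t ^ L"
proof -
  let ?s = "real (CARD('n) + 1)"
  obtain \<rho> where \<rho>: "0 < \<rho>" "\<rho> \<le> 1"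
    "\<And>L. \<exists>C\<ge>0. \<forall>\<beta> t. \<forall>k\<in>int_vecs. 0 \<le> \<beta> \<longrightarrow> \<beta> \<le> \<rho> \<longrightarrow> 0 < t \<longrightarrow> t \<le> 1 \<longrightarrow> k \<noteq> 0 \<longrightarrow>
      norm (\<integral>z. cutoff_gauss \<beta> t z * echar (- (z \<bullet> (dual_matrix *v k))) \<partial>lborel) \<le> C * t ^ L * (1 + norm k) powr (- ?s)"
    using FT_cutoff_gauss_bound by blast
  show thesis
  proof (rule that[OF \<rho>(1,2)])
    fix L
    from \<rho>(3)[of L] obtain C where C: "C \<ge> 0" "\<And>\<beta> t k. k \<in> int_vecs \<Longrightarrow> 0 \<le> \<beta> \<Longrightarrow> \<beta> \<le> \<rho> \<Longrightarrow> 0 < t \<Longrightarrow> t \<le> 1 \<Longrightarrow> k \<noteq> 0 \<Longrightarrow>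
      norm (\<integral>z. cutoff_gauss \<beta> t z * echar (- (z \<bullet> (dual_matrix *v k))) \<partial>lborel) \<le> C * t ^ L * (1 + norm k) powr (- ?s)" by blast
    define Z where "Z = (\<integral>k. (1 + norm k) powr (- ?s) \<partial>count_space (int_vecs :: (real^'n) set))"
    have Z: "Z \<ge> 0" unfolding Z_def by (intro integral_nonneg_AE) auto
    have wi: "integrable (count_space (int_vecs :: (real^'n) set)) (\<lambda>k. (1 + norm k) powr (- ?s))"
      by (rule integrable_decay_int_vecs) simp
    have "norm (theta_diff \<beta> t) \<le> (C * Z / V) * t ^ L" if \<beta>: "0 \<le> \<beta>" "\<beta> \<le> \<rho>" and t: "0 < t" "t \<le> 1" for \<beta> t
    proof -
      define h where "h k = (\<integral>z. cutoff_gauss \<beta> t z * echar (- (z \<bullet> (dual_matrix *v k))) \<partial>lborel)" for k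
      define h' where "h' k = (if k = 0 then 0 else h k)" for k
      have h'b: "norm (h' k) \<le> C * t ^ L * (1 + norm k) powr (- ?s)" if "k \<in> int_vecs" for k
        using C(2)[OF that \<beta> t] C(1) t by (auto simp: h'_def h_def)
      have h'i: "integrable (count_space int_vecs) h'"
        by (rule Bochner_Integration.integrable_bound[OF integrable_mult_right[OF wi, of "C * t ^ L"]])
          (use h'b C(1) t in \<open>auto intro!: AE_I2\<close>)
      have hh: "h k = h' k + indicator {0} k *\<^sub>R h 0" for k by (auto simp: h'_def indicator_def)
      have i0: "integrable (count_space int_vecs) (\<lambda>k::real^'n. indicator {0} k *\<^sub>R h 0)"
        by (rule integrable_scaleR_left) (auto simp: integrable_indicator_iff)
      have hi: "integrable (count_space int_vecs) h"
        using Bochner_Integration.integrable_add[OF h'i i0] unfolding hh[symmetric] .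
      obtain B where B: "B > 0" "\<And>\<beta> z. norm (cutoff_gauss \<beta> t z) \<le> B * (1 + norm z) powr (- ?s)" using cutoff_gauss_bound[OF t(1)] by blast
      have 0: "0 \<in> lattice_of M" by (auto simp: lattice_of_eq_image intro!: image_eqI[of _ _ 0])
      have "cutoff_gauss \<beta> t 0 + theta_sum \<beta> t = (\<integral>z. cutoff_gauss \<beta> t z \<partial>count_space (lattice_of M))"
        unfolding theta_sum_def by (rule integral_count_space_remove(2)[OF 0 cutoff_gauss_integrable(2)[OF t(1)], symmetric])
      also have "\<dots> = (\<integral>k. h k \<partial>count_space int_vecs) / of_real V"
        unfolding h_def dual_matrix_def
        by (rule poisson_summation_lattice[OF M continuous_cutoff_gauss _ B(2)]) (use hi in \<open>simp_all add: h_def[abs_def] dual_matrix_def\<close>)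
      also have "(\<integral>k. h k \<partial>count_space int_vecs) = (\<integral>k. h' k \<partial>count_space int_vecs) + h 0"
      proof -
        have "(\<integral>k. h k \<partial>count_space int_vecs) = (\<integral>k. h' k + indicator {0} k *\<^sub>R h 0 \<partial>count_space int_vecs)"
          by (rule Bochner_Integration.integral_cong[OF refl hh])
        also have "\<dots> = (\<integral>k. h' k \<partial>count_space int_vecs) + (\<integral>k. indicator {0} (k::real^'n) *\<^sub>R h 0 \<partial>count_space int_vecs)"
          by (rule Bochner_Integration.integral_add[OF h'i i0])
        finally show ?thesis by simp
      qed
      finally have "theta_diff \<beta> t = (\<integral>k. h' k \<partial>count_space int_vecs) / of_real V"
        by (simp add: theta_diff_def theta_int_def h_def cutoff_gauss_def cutoff_poly_at_0 add_divide_distrib)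
      moreover have "norm (\<integral>k. h' k \<partial>count_space int_vecs) \<le> (\<integral>k. C * t ^ L * (1 + norm k) powr (- ?s) \<partial>count_space (int_vecs :: (real^'n) set))"
        by (rule Bochner_Integration.integral_norm_bound_integral[OF h'i integrable_mult_right[OF wi]]) (use h'b in auto)
      ultimately show ?thesis using V_pos by (simp add: norm_divide Z_def divide_right_mono mult_ac)
    qed
    then show "\<exists>C\<ge>0. \<forall>\<beta> t. 0 \<le> \<beta> \<longrightarrow> \<beta> \<le> \<rho> \<longrightarrow> 0 < t \<longrightarrow> t \<le> 1 \<longrightarrow> norm (theta_diff \<beta> t) \<le> C * t ^ L"
      using C(1) Z V_pos by (intro exI[of _ "C * Z / V"]) auto
  qed
qed

text \<open>Half of the exponent pays for summability over the lattice, the other half for decay in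
  t, through the lower bound c for the norms of non-zero lattice vectors. The cutoff is merely
  bounded by 1, hence the uniformity in \<beta>.\<close>

lemma theta_sum_bound:
  obtains C \<kappa> where "C \<ge> 0" "\<kappa> > 0" "\<And>\<beta> t. t \<ge> 1 \<Longrightarrow> norm (theta_sum \<beta> t) \<le> C * exp (- (\<kappa> * t))"
proof -
  let ?s = "real (CARD('n) + 1)"
  obtain c where c: "c > 0" "\<And>z. z \<in> lattice_of M \<Longrightarrow> z \<noteq> 0 \<Longrightarrow> c \<le> norm z" using lattice_of_norm_ge[OF M] by blast
  obtain B where B: "B > 0" "\<And>z. norm (P z) * exp (- ((pi / 2) * (norm z)\<^sup>2)) \<le> B * (1 + norm z) powr (- ?s)"
    using gauss_decay[OF pi_half_gt_zero] by blast
  define \<kappa> where "\<kappa> = pi / 2 * c\<^sup>2"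
  define Z where "Z = (\<integral>z. (1 + norm z) powr (- ?s) \<partial>count_space punctured_lattice)"
  have wi': "integrable (count_space punctured_lattice) (\<lambda>z. (1 + norm z) powr (- ?s))"
    by (rule integrable_decay_punctured_lattice) simp
  have Z: "Z \<ge> 0" unfolding Z_def by (intro integral_nonneg_AE) auto
  have "norm (theta_sum \<beta> t) \<le> (B * Z) * exp (- (\<kappa> * t))" if t: "t \<ge> 1" for \<beta> t
  proof -
    have b: "norm (cutoff_gauss \<beta> t z) \<le> (B * exp (- (\<kappa> * t))) * (1 + norm z) powr (- ?s)" if z: "z \<in> punctured_lattice" for z
    proof -
      have cz: "c\<^sup>2 \<le> (norm z)\<^sup>2" using c z by (intro power_mono) auto
      have "(norm z)\<^sup>2 * 1 \<le> (norm z)\<^sup>2 * t" using t by (intro mult_left_mono) auto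
      moreover have "c\<^sup>2 * t \<le> (norm z)\<^sup>2 * t" using cz t by (intro mult_right_mono) auto
      ultimately have "(pi / 2) * ((norm z)\<^sup>2 + c\<^sup>2 * t) \<le> (pi / 2) * (2 * ((norm z)\<^sup>2 * t))" by (intro mult_left_mono) auto
      then have "- pi * t * (norm z)\<^sup>2 \<le> - ((pi / 2) * (norm z)\<^sup>2) + - (\<kappa> * t)"
        by (simp add: \<kappa>_def field_simps)
      then have "exp (- pi * t * (norm z)\<^sup>2) \<le> exp (- ((pi / 2) * (norm z)\<^sup>2)) * exp (- (\<kappa> * t))"
        by (subst exp_add[symmetric]) simp
      then have "norm (cutoff_gauss \<beta> t z) \<le> norm (P z) * (exp (- ((pi / 2) * (norm z)\<^sup>2)) * exp (- (\<kappa> * t)))"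
        by (intro order_trans[OF norm_cutoff_gauss_le] mult_left_mono) auto
      also have "\<dots> = (norm (P z) * exp (- ((pi / 2) * (norm z)\<^sup>2))) * exp (- (\<kappa> * t))" by simp
      also have "\<dots> \<le> (B * (1 + norm z) powr (- ?s)) * exp (- (\<kappa> * t))" by (intro mult_right_mono B) auto
      finally show ?thesis by (simp add: mult_ac)
    qed
    have "norm (theta_sum \<beta> t) \<le> (\<integral>z. (B * exp (- (\<kappa> * t))) * (1 + norm z) powr (- ?s) \<partial>count_space punctured_lattice)"
      unfolding theta_sum_def
      by (rule Bochner_Integration.integral_norm_bound_integral[OF cutoff_gauss_integrable(3) integrable_mult_right[OF wi']]) (use b t in auto)
    then show ?thesis by (simp add: Z_def mult_ac)
  qed
  then show thesis using B(1) Z c(1) by (intro that[of "B * Z" \<kappa>]) (auto simp: \<kappa>_def)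
qed

end

section \<open>Mellin integrals over part of the half-line\<close>

definition mellin_on :: "real set \<Rightarrow> (real \<Rightarrow> complex) \<Rightarrow> complex \<Rightarrow> complex" where
  "mellin_on S F \<nu> = (\<integral>t. indicator S t *\<^sub>R (of_real t powr (\<nu> / 2 - 1) * F t) \<partial>lborel)"

lemma integrable_powr_interval:
  shows "s < 0 \<Longrightarrow> integrable lborel (\<lambda>t::real. indicator {1<..} t * t powr (s - 1))"
    and "s > 0 \<Longrightarrow> integrable lborel (\<lambda>t::real. indicator {0<..1} t * t powr (s - 1))"
proof -
  assume s: "s < 0"
  have "integrable lborel (\<lambda>r. indicator {1..} r *\<^sub>R complex_of_real r powr (of_real s - 1))"
    using integral_powr_at_top[of "of_real s" 1] s by (auto simp: has_bochner_integral_iff)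
  then show "integrable lborel (\<lambda>t::real. indicator {1<..} t * t powr (s - 1))"
    by (rule Bochner_Integration.integrable_bound) (auto simp: indicator_def norm_of_real_powr)
next
  assume s: "s > 0"
  have "integrable lborel (\<lambda>r. indicator {0<..1} r *\<^sub>R complex_of_real r powr (of_real s - 1))"
    using integral_powr_0_1[of "of_real s"] s by (auto simp: has_bochner_integral_iff)
  then show "integrable lborel (\<lambda>t::real. indicator {0<..1} t * t powr (s - 1))"
    by (rule Bochner_Integration.integrable_bound) (auto simp: indicator_def norm_of_real_powr)
qed

text \<open>One shape of bound serves both ends: a large on {1<..}, a very negative on {0<..1}. This
  explains the double minus in \<open>theta_diff_powr\<close>.\<close>

lemma mellin_on_bound:
  assumes "S \<subseteq> {0<..}" "\<And>t. t \<in> S \<Longrightarrow> norm (F t) \<le> C * t powr (- a)"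
  shows "norm (indicator S t *\<^sub>R (of_real t powr (\<nu> / 2 - 1) * F t)) \<le> C * (indicator S t * t powr (Re \<nu> / 2 - a - 1))"
proof (cases "t \<in> S")
  case True
  then have t: "t > 0" using assms by auto
  have "norm (of_real t powr (\<nu> / 2 - 1) * F t) \<le> t powr (Re \<nu> / 2 - 1) * (C * t powr (- a))"
    using t True by (auto simp: norm_mult norm_of_real_powr intro!: mult_left_mono assms(2))
  also have "\<dots> = C * t powr (Re \<nu> / 2 - a - 1)"
    by (simp add: powr_add[symmetric] algebra_simps)
  finally show ?thesis using True by simp
qed simp

lemma mellin_on_integrable:
  assumes S: "S \<in> sets borel" "S \<subseteq> {0<..}" and [measurable]: "F \<in> borel_measurable borel"
    and b: "\<And>t. t \<in> S \<Longrightarrow> norm (F t) \<le> C * t powr (- a)"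
    and i: "integrable lborel (\<lambda>t. indicator S t * t powr (Re \<nu> / 2 - a - 1))"
  shows "integrable lborel (\<lambda>t. indicator S t *\<^sub>R (of_real t powr (\<nu> / 2 - 1) * F t))"
proof (rule Bochner_Integration.integrable_bound[OF integrable_mult_right[OF i, of C]])
  have [measurable]: "S \<in> sets borel" by (rule S)
  show "(\<lambda>t. indicator S t *\<^sub>R (of_real t powr (\<nu> / 2 - 1) * F t)) \<in> borel_measurable lborel" by measurable
qed (intro AE_I2 order_trans[OF mellin_on_bound[OF S(2) b]], auto)

lemma mellin_on_holomorphic:
  assumes S: "S \<in> sets borel" "S \<subseteq> {0<..}" and [measurable]: "F \<in> borel_measurable borel"
    and b: "\<And>t. t \<in> S \<Longrightarrow> norm (F t) \<le> C * t powr (- a)"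
    and U: "open U" "\<And>\<nu>. \<nu> \<in> U \<Longrightarrow> integrable lborel (\<lambda>t. indicator S t * t powr (Re \<nu> / 2 - a - 1))"
  shows "mellin_on S F holomorphic_on U"
proof -
  have [measurable]: "S \<in> sets borel" by (rule S)
  have e: "indicator S t *\<^sub>R (of_real t powr (\<nu> / 2 - 1) * F t) =
    (indicator S t *\<^sub>R (of_real t powr (- 1) * F t)) * exp (\<nu> * of_real (ln t / 2))" for t \<nu>
  proof (cases "t \<in> S")
    case True
    then have "t > 0" using S(2) by auto
    then have "of_real t powr (\<nu> / 2 - 1) = of_real t powr (- 1) * exp (\<nu> * of_real (ln t / 2))"
      by (simp only: of_real_powr_eq_exp exp_add[symmetric]) (simp add: algebra_simps)
    then show ?thesis by simp
  qed simp
  have "(\<lambda>\<nu>. \<integral>t. (indicator S t *\<^sub>R (of_real t powr (- 1) * F t)) * exp (\<nu> * of_real (ln t / 2)) \<partial>lborel) holomorphic_on U"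
    by (rule holomorphic_on_integral_exp[OF U(1)]) (use mellin_on_integrable[OF S _ b U(2)] in \<open>simp_all only: e[symmetric] assms, measurable\<close>)
  then show ?thesis by (simp add: mellin_on_def[abs_def] e)
qed

lemma mellin_on_tendsto:
  fixes F :: "real \<Rightarrow> real \<Rightarrow> complex"
  assumes S: "S \<in> sets borel" "S \<subseteq> {0<..}" and m: "\<And>\<beta>. F \<beta> \<in> borel_measurable borel" and \<rho>: "\<rho> > 0"
    and b: "\<And>\<beta> t. 0 \<le> \<beta> \<Longrightarrow> \<beta> \<le> \<rho> \<Longrightarrow> t \<in> S \<Longrightarrow> norm (F \<beta> t) \<le> C * t powr (- a)"
    and i: "integrable lborel (\<lambda>t. indicator S t * t powr (Re \<nu> / 2 - a - 1))"
    and l: "\<And>t. t \<in> S \<Longrightarrow> ((\<lambda>\<beta>. F \<beta> t) \<longlongrightarrow> F 0 t) (at_right 0)"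
  shows "((\<lambda>\<beta>. mellin_on S (F \<beta>) \<nu>) \<longlongrightarrow> mellin_on S (F 0) \<nu>) (at_right 0)"
proof -
  have [measurable]: "S \<in> sets borel" by (rule S)
  \<comment> \<open>The bounds hold for 0 \<le> \<beta> \<le> \<rho> only, so the one-sided limit is
    taken within that interval.\<close>
  have r: "at_right 0 = at 0 within {0..\<rho>}" using \<rho> by (rule at_within_Icc_at_right[symmetric])
  show ?thesis
    unfolding mellin_on_def r
  proof (rule integral_dominated_convergence_within[where w = "\<lambda>t. C * (indicator S t * t powr (Re \<nu> / 2 - a - 1))"])
    show "integrable lborel (\<lambda>t. C * (indicator S t * t powr (Re \<nu> / 2 - a - 1)))" by (rule integrable_mult_right[OF i])
    show "AE t in lborel. ((\<lambda>\<beta>. indicator S t *\<^sub>R (of_real t powr (\<nu> / 2 - 1) * F \<beta> t)) \<longlongrightarrow>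
      indicator S t *\<^sub>R (of_real t powr (\<nu> / 2 - 1) * F 0 t)) (at 0 within {0..\<rho>})"
      unfolding r[symmetric]
    proof (rule AE_I2)
      fix t :: real
      show "((\<lambda>\<beta>. indicator S t *\<^sub>R (of_real t powr (\<nu> / 2 - 1) * F \<beta> t)) \<longlongrightarrow>
        indicator S t *\<^sub>R (of_real t powr (\<nu> / 2 - 1) * F 0 t)) (at_right 0)"
        using l by (cases "t \<in> S") (auto intro!: tendsto_intros)
    qed
    fix \<beta> assume "\<beta> \<in> {0..\<rho>} - {0::real}"
    then show "AE t in lborel. norm (indicator S t *\<^sub>R (of_real t powr (\<nu> / 2 - 1) * F \<beta> t)) \<le> C * (indicator S t * t powr (Re \<nu> / 2 - a - 1))"
      by (intro AE_I2 mellin_on_bound[OF S(2) b]) auto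
  qed (use m in measurable)
qed

lemma exp_decay_powr:
  assumes "\<kappa> > 0"
  obtains C where "C \<ge> 0" "\<And>t::real. t > 1 \<Longrightarrow> exp (- (\<kappa> * t)) \<le> C * t powr (- real L)"
proof -
  obtain B where B: "B > 0" "\<And>r::real. r \<ge> 0 \<Longrightarrow> r ^ L * exp (- (\<kappa> * r)) \<le> B" using power_exp_bounded[OF assms] by blast
  show thesis
  proof
    show "B \<ge> 0" using B by simp
    fix t :: real assume "t > 1"
    then show "exp (- (\<kappa> * t)) \<le> B * t powr (- real L)"
      using B(2)[of t] by (simp add: powr_minus powr_realpow field_simps)
  qed
qed

context cutoff_lattice begin

lemma countable_punctured_lattice: "countable punctured_lattice" using countable_lattice_of by blast

lemma sigma_finite_punctured_lattice: "sigma_finite_measure (count_space punctured_lattice)"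
  by (rule sigma_finite_measure_count_space_countable[OF countable_punctured_lattice])

lemma measurable_theta_sum [measurable]: "theta_sum \<beta> \<in> borel_measurable borel"
proof -
  interpret sigma_finite_measure "count_space punctured_lattice" by (rule sigma_finite_punctured_lattice)
  have "(\<lambda>(z, t). cutoff_gauss \<beta> t z) \<in> borel_measurable (count_space punctured_lattice \<Otimes>\<^sub>M borel)"
    by (rule measurable_pair_measure_countable1[OF countable_punctured_lattice]) (simp add: cutoff_gauss_def)
  from measurable_pair_swap[OF this] have "(\<lambda>(t, z). cutoff_gauss \<beta> t z) \<in> borel_measurable (borel \<Otimes>\<^sub>M count_space punctured_lattice)"
    by simp
  then show ?thesis unfolding theta_sum_def[abs_def] by (rule borel_measurable_lebesgue_integral)
qed

lemma measurable_theta_int [measurable]: "theta_int \<beta> \<in> borel_measurable borel"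
proof -
  have "(\<lambda>(t, z). cutoff_gauss \<beta> t z) \<in> borel_measurable (borel \<Otimes>\<^sub>M lborel)" unfolding cutoff_gauss_def by measurable
  then show ?thesis unfolding theta_int_def[abs_def] by (rule lborel.borel_measurable_lebesgue_integral)
qed

lemma measurable_theta_diff [measurable]: "theta_diff \<beta> \<in> borel_measurable borel"
  unfolding theta_diff_def[abs_def] by measurable

lemma theta_sum_tendsto: assumes "t > 0" shows "((\<lambda>\<beta>. theta_sum \<beta> t) \<longlongrightarrow> theta_sum 0 t) (at_right 0)"
  and theta_int_tendsto: "((\<lambda>\<beta>. theta_int \<beta> t) \<longlongrightarrow> theta_int 0 t) (at_right 0)"
proof -
  obtain B where B: "B > 0" "\<And>\<beta> z. norm (cutoff_gauss \<beta> t z) \<le> B * (1 + norm z) powr (- real (CARD('n) + 1))"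
    using cutoff_gauss_bound[OF assms] by blast
  have lim: "((\<lambda>\<beta>. cutoff_gauss \<beta> t z) \<longlongrightarrow> cutoff_gauss 0 t z) (at_right 0)" for z
    unfolding cutoff_gauss_def by (intro tendsto_intros cutoff_poly_tendsto)
  have i: "integrable (count_space punctured_lattice) (\<lambda>z. B * (1 + norm z) powr (- real (CARD('n) + 1)))"
    by (intro integrable_mult_right integrable_decay_punctured_lattice) simp
  show "((\<lambda>\<beta>. theta_sum \<beta> t) \<longlongrightarrow> theta_sum 0 t) (at_right 0)"
    unfolding theta_sum_def by (rule integral_dominated_convergence_within[OF _ _ i]) (use lim B(2) in auto)
  show "((\<lambda>\<beta>. theta_int \<beta> t) \<longlongrightarrow> theta_int 0 t) (at_right 0)"
    unfolding theta_int_def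
    by (rule integral_dominated_convergence_within[OF _ _ integrable_mult_right[OF integrable_decay[of "real (CARD('n) + 1)"], of B]])
      (use lim B(2) in auto)
qed

lemma theta_diff_tendsto: "t > 0 \<Longrightarrow> ((\<lambda>\<beta>. theta_diff \<beta> t) \<longlongrightarrow> theta_diff 0 t) (at_right 0)"
  unfolding theta_diff_def by (intro tendsto_intros theta_sum_tendsto theta_int_tendsto) (use V_pos in auto)

text \<open>A range of \<beta> chosen once and for all, so that it depends neither on the order L
  nor on \<nu>.\<close>

definition beta_max :: real where
  "beta_max = (SOME \<rho>. 0 < \<rho> \<and> \<rho> \<le> 1 \<and>
    (\<forall>L. \<exists>C\<ge>0. \<forall>\<beta> t. 0 \<le> \<beta> \<longrightarrow> \<beta> \<le> \<rho> \<longrightarrow> 0 < t \<longrightarrow> t \<le> 1 \<longrightarrow> norm (theta_diff \<beta> t) \<le> C * t ^ L))"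

lemma beta_max: "0 < beta_max" "beta_max \<le> 1"
  and beta_max_theta_diff: "\<exists>C\<ge>0. \<forall>\<beta> t. 0 \<le> \<beta> \<longrightarrow> \<beta> \<le> beta_max \<longrightarrow> 0 < t \<longrightarrow> t \<le> 1 \<longrightarrow> norm (theta_diff \<beta> t) \<le> C * t ^ L"
proof -
  have ex: "\<exists>\<rho>>0. \<rho> \<le> 1 \<and> (\<forall>L. \<exists>C\<ge>0. \<forall>\<beta> t. 0 \<le> \<beta> \<longrightarrow> \<beta> \<le> \<rho> \<longrightarrow> 0 < t \<longrightarrow> t \<le> 1 \<longrightarrow> norm (theta_diff \<beta> t) \<le> C * t ^ L)"
    by (rule theta_diff_bound) blast
 show "0 < beta_max" "beta_max \<le> 1" "\<exists>C\<ge>0. \<forall>\<beta> t. 0 \<le> \<beta> \<longrightarrow> \<beta> \<le> beta_max \<longrightarrow> 0 < t \<longrightarrow> t \<le> 1 \<longrightarrow> norm (theta_diff \<beta> t) \<le> C * t ^ L"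
    using someI_ex[OF ex, folded beta_max_def] by blast+
qed

lemma theta_diff_powr:
  obtains C where "\<And>\<beta> t. 0 \<le> \<beta> \<Longrightarrow> \<beta> \<le> beta_max \<Longrightarrow> t \<in> {0<..1} \<Longrightarrow> norm (theta_diff \<beta> t) \<le> C * t powr (- (- real L))"
proof -
  obtain C where "\<And>\<beta> t. 0 \<le> \<beta> \<Longrightarrow> \<beta> \<le> beta_max \<Longrightarrow> 0 < t \<Longrightarrow> t \<le> 1 \<Longrightarrow> norm (theta_diff \<beta> t) \<le> C * t ^ L" using beta_max_theta_diff[of L] by blast
  then show thesis by (intro that[of C]) (auto simp: powr_realpow)
qed

lemma theta_sum_powr:
  obtains C where "\<And>\<beta> t. t \<in> {1<..} \<Longrightarrow> norm (theta_sum \<beta> t) \<le> C * t powr (- real L)"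
proof -
  obtain C \<kappa> where C: "C \<ge> 0" "\<kappa> > 0" "\<And>\<beta> t. t \<ge> 1 \<Longrightarrow> norm (theta_sum \<beta> t) \<le> C * exp (- (\<kappa> * t))" using theta_sum_bound by blast
  obtain C' where C': "C' \<ge> 0" "\<And>t::real. t > 1 \<Longrightarrow> exp (- (\<kappa> * t)) \<le> C' * t powr (- real L)" using exp_decay_powr[OF C(2)] by blast
  have "norm (theta_sum \<beta> t) \<le> (C * C') * t powr (- real L)" if "t > 1" for \<beta> t
    using C(3)[of t \<beta>] mult_left_mono[OF C'(2)[OF that] C(1)] that by (simp add: mult_ac)
  then show thesis by (intro that) auto
qed

section \<open>The two Mellin integrals that are entire in the exponent\<close>

definition mellin_sum :: "real \<Rightarrow> complex \<Rightarrow> complex" where "mellin_sum \<beta> = mellin_on {1<..} (theta_sum \<beta>)"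
definition mellin_diff :: "real \<Rightarrow> complex \<Rightarrow> complex" where "mellin_diff \<beta> = mellin_on {0<..1} (theta_diff \<beta>)"

lemma mellin_sum_integrable: "integrable lborel (\<lambda>t. indicator {1<..} t *\<^sub>R (of_real t powr (\<nu> / 2 - 1) * theta_sum \<beta> t))"
proof -
  obtain C where C: "\<And>\<beta> t. t \<in> {1<..} \<Longrightarrow> norm (theta_sum \<beta> t) \<le> C * t powr (- real (nat \<lceil>\<bar>Re \<nu>\<bar>\<rceil> + 1))" using theta_sum_powr by blast
  have "Re \<nu> / 2 - real (nat \<lceil>\<bar>Re \<nu>\<bar>\<rceil> + 1) < 0" by linarith
  then show ?thesis by (intro mellin_on_integrable[OF _ _ _ C integrable_powr_interval(1)]) auto
qed

text \<open>Decay faster than every power provides a separate majorant on each half-plane, and the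
  half-planes exhaust the plane.\<close>

lemma mellin_sum_holomorphic: "mellin_sum \<beta> holomorphic_on UNIV"
proof -
  have "mellin_sum \<beta> holomorphic_on (\<Union>K. {\<nu>. Re \<nu> < real K})"
  proof (rule holomorphic_on_UN_open)
    fix K
    obtain C where C: "\<And>\<beta> t. t \<in> {1<..} \<Longrightarrow> norm (theta_sum \<beta> t) \<le> C * t powr (- real K)" using theta_sum_powr by blast
    show "mellin_sum \<beta> holomorphic_on {\<nu>. Re \<nu> < real K}"
      unfolding mellin_sum_def by (rule mellin_on_holomorphic[OF _ _ _ C open_halfspace_Re_lt integrable_powr_interval(1)]) auto
  qed (auto simp: open_halfspace_Re_lt)
  also have "(\<Union>K. {\<nu>. Re \<nu> < real K}) = UNIV" using reals_Archimedean2 by auto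
  finally show ?thesis .
qed

lemma mellin_sum_tendsto: "((\<lambda>\<beta>. mellin_sum \<beta> \<nu>) \<longlongrightarrow> mellin_sum 0 \<nu>) (at_right 0)"
proof -
  obtain C where C: "\<And>\<beta> t. t \<in> {1<..} \<Longrightarrow> norm (theta_sum \<beta> t) \<le> C * t powr (- real (nat \<lceil>\<bar>Re \<nu>\<bar>\<rceil> + 1))" using theta_sum_powr by blast
  have "Re \<nu> / 2 - real (nat \<lceil>\<bar>Re \<nu>\<bar>\<rceil> + 1) < 0" by linarith
  then show ?thesis unfolding mellin_sum_def
    by (intro mellin_on_tendsto[OF _ _ _ beta_max(1) C integrable_powr_interval(1)] theta_sum_tendsto) auto
qed

lemma mellin_diff_integrable:
  assumes "0 \<le> \<beta>" "\<beta> \<le> beta_max"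
  shows "integrable lborel (\<lambda>t. indicator {0<..1} t *\<^sub>R (of_real t powr (\<nu> / 2 - 1) * theta_diff \<beta> t))"
proof -
  obtain C where C: "\<And>\<beta> t. 0 \<le> \<beta> \<Longrightarrow> \<beta> \<le> beta_max \<Longrightarrow> t \<in> {0<..1} \<Longrightarrow> norm (theta_diff \<beta> t) \<le> C * t powr (- (- real (nat \<lceil>\<bar>Re \<nu>\<bar>\<rceil> + 1)))" using theta_diff_powr by blast
  have "Re \<nu> / 2 - (- real (nat \<lceil>\<bar>Re \<nu>\<bar>\<rceil> + 1)) > 0" by linarith
  then show ?thesis by (intro mellin_on_integrable[OF _ _ _ C[OF assms] integrable_powr_interval(2)]) auto
qed

lemma mellin_diff_holomorphic:
  assumes "0 \<le> \<beta>" "\<beta> \<le> beta_max"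
  shows "mellin_diff \<beta> holomorphic_on UNIV"
proof -
  have "mellin_diff \<beta> holomorphic_on (\<Union>K. {\<nu>. Re \<nu> > - real K})"
  proof (rule holomorphic_on_UN_open)
    fix K
    obtain C where C: "\<And>\<beta> t. 0 \<le> \<beta> \<Longrightarrow> \<beta> \<le> beta_max \<Longrightarrow> t \<in> {0<..1} \<Longrightarrow> norm (theta_diff \<beta> t) \<le> C * t powr (- (- real K))" using theta_diff_powr by blast
    show "mellin_diff \<beta> holomorphic_on {\<nu>. Re \<nu> > - real K}"
      unfolding mellin_diff_def by (rule mellin_on_holomorphic[OF _ _ _ C[OF assms] open_halfspace_Re_gt integrable_powr_interval(2)]) auto
  qed (auto simp: open_halfspace_Re_gt)
  also have "(\<Union>K. {\<nu>. Re \<nu> > - real K}) = UNIV"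
  proof -
    have "\<exists>K. Re \<nu> > - real K" for \<nu> using reals_Archimedean2[of "- Re \<nu>"] by (metis minus_less_iff)
    then show ?thesis by auto
  qed
  finally show ?thesis .
qed

lemma mellin_diff_tendsto: "((\<lambda>\<beta>. mellin_diff \<beta> \<nu>) \<longlongrightarrow> mellin_diff 0 \<nu>) (at_right 0)"
proof -
  obtain C where C: "\<And>\<beta> t. 0 \<le> \<beta> \<Longrightarrow> \<beta> \<le> beta_max \<Longrightarrow> t \<in> {0<..1} \<Longrightarrow> norm (theta_diff \<beta> t) \<le> C * t powr (- (- real (nat \<lceil>\<bar>Re \<nu>\<bar>\<rceil> + 1)))" using theta_diff_powr by blast
  have "Re \<nu> / 2 - (- real (nat \<lceil>\<bar>Re \<nu>\<bar>\<rceil> + 1)) > 0" by linarith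
  then show ?thesis unfolding mellin_diff_def
    by (intro mellin_on_tendsto[OF _ _ _ beta_max(1) C integrable_powr_interval(2)] theta_diff_tendsto) auto
qed

end

section \<open>Expansion at infinity\<close>

lemma exp_remainder_bound:
  fixes z :: complex
  shows "norm (exp z - (\<Sum>i<K. z ^ i / fact i)) \<le> exp \<bar>Re z\<bar> * norm z ^ K"
proof (cases K)
  case 0
  then show ?thesis by (simp add: norm_exp_eq_Re)
next
  case (Suc k)
  have "norm (exp z - (\<Sum>i\<le>k. z ^ i / fact i)) \<le> exp \<bar>Re z\<bar> * norm z ^ Suc k / fact k"
    by (rule Taylor_exp)
  also have "\<dots> \<le> exp \<bar>Re z\<bar> * norm z ^ Suc k / 1"
    by (intro divide_left_mono) (auto simp: fact_ge_1)
  finally show ?thesis by (simp add: Suc lessThan_Suc_atMost)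
qed

lemma has_integral_powr_above_1:
  assumes "Re s < 0"
  shows "has_bochner_integral lborel (\<lambda>t. indicator {1<..} t *\<^sub>R complex_of_real t powr (s - 1)) (1 / - s)"
proof -
  have "has_bochner_integral lborel (\<lambda>t. indicator {1..} t *\<^sub>R complex_of_real t powr (s - 1)) (1 / - s)"
    using integral_powr_at_top[OF assms, of 1] by simp
  also have "?this \<longleftrightarrow> ?thesis"
  proof (rule has_bochner_integral_cong_AE)
    have "AE t in lborel. t \<noteq> (1::real)" by (rule AE_lborel_singleton)
    then show "AE t in lborel. indicator {1..} t *\<^sub>R complex_of_real t powr (s - 1) = indicator {1<..} t *\<^sub>R complex_of_real t powr (s - 1)"
      by eventually_elim (auto simp: indicator_def)
  qed auto
  finally show ?thesis .
qed

lemma powr_half_nat_real: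
  assumes "t > (0::real)"
  shows "t powr - (real d / 2 + real n) = 1 / sqrt t ^ d * (1 / t) ^ n"
proof -
  have "sqrt t ^ d = t powr (real d / 2)"
    using assms by (simp add: powr_half_sqrt[symmetric] powr_realpow[symmetric] powr_powr)
  moreover have "t powr real n = t ^ n" using assms by (rule powr_realpow)
  moreover have "t powr - (real d / 2 + real n) = inverse (t powr (real d / 2)) * inverse (t powr real n)"
    by (simp only: powr_minus powr_add inverse_mult_distrib)
  ultimately show ?thesis
    by (simp only: power_one_over inverse_eq_divide)
qed

context cutoff_lattice begin

abbreviation "deg \<equiv> total_degree p"
abbreviation "gauss_coeff j y \<equiv> coeff (gauss_poly p y) j"

text \<open>A Cauchy product: the coefficient of the n-th power of s in exp(-pi |y|^2 s) times
  \<open>poly (gauss_poly p y) s\<close>. With s = 1/t this is \<open>gauss_transform\<close> up to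
  the power of t in front.\<close>

definition expansion_fun :: "nat \<Rightarrow> real^'n \<Rightarrow> complex" where
  "expansion_fun n y = (\<Sum>j\<in>{..deg} \<inter> {..n}. gauss_coeff j y * (of_real (- pi * (norm y)\<^sup>2) ^ (n - j) / fact (n - j)))"

lemma continuous_expansion_fun: "continuous_on UNIV (expansion_fun n)"
  unfolding expansion_fun_def[abs_def] by (intro continuous_intros continuous_on_gauss_poly) auto

lemma measurable_expansion_fun [measurable]: "expansion_fun n \<in> borel_measurable borel"
  by (rule borel_measurable_continuous_onI[OF continuous_expansion_fun])

lemma bounded_on_ball:
  fixes f :: "real^'n \<Rightarrow> complex"
  assumes "continuous_on UNIV f"
  obtains C where "C \<ge> 0" "\<And>y. norm y \<le> 1 \<Longrightarrow> norm (f y) \<le> C"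
proof -
  have "compact (f ` cball 0 1)"
    by (intro compact_continuous_image continuous_on_subset[OF assms]) auto
  then obtain C where C: "\<And>y. y \<in> cball 0 1 \<Longrightarrow> norm (f y) \<le> C"
    using compact_imp_bounded bounded_iff by (metis imageI)
  show thesis by (rule that[of C]) (use C order_trans[OF norm_ge_zero C[of 0]] in auto)
qed

lemma expansion_fun_sum:
  "(\<Sum>n<N. expansion_fun n y * s ^ n) = (\<Sum>j\<le>deg. gauss_coeff j y * s ^ j * (\<Sum>i<N - j. (of_real (- pi * (norm y)\<^sup>2) * s) ^ i / fact i))"
proof -
  let ?x = "complex_of_real (- pi * (norm y)\<^sup>2)"
  have "(\<Sum>n<N. expansion_fun n y * s ^ n) = (\<Sum>n<N. \<Sum>j\<le>deg. if j \<le> n then gauss_coeff j y * (?x ^ (n - j) / fact (n - j)) * s ^ n else 0)"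
    unfolding expansion_fun_def sum_distrib_right by (rule sum.cong[OF refl], rule sum.mono_neutral_cong_left) auto
  also have "\<dots> = (\<Sum>j\<le>deg. \<Sum>n<N. if j \<le> n then gauss_coeff j y * (?x ^ (n - j) / fact (n - j)) * s ^ n else 0)"
    by (rule sum.swap)
  also have "\<dots> = (\<Sum>j\<le>deg. gauss_coeff j y * s ^ j * (\<Sum>i<N - j. (?x * s) ^ i / fact i))"
  proof (intro sum.cong refl)
    fix j
    have "(\<Sum>n<N. if j \<le> n then gauss_coeff j y * (?x ^ (n - j) / fact (n - j)) * s ^ n else 0) =
      (\<Sum>n\<in>{j..<N}. gauss_coeff j y * (?x ^ (n - j) / fact (n - j)) * s ^ n)"
      by (intro sum.mono_neutral_cong_right) auto
    also have "\<dots> = (\<Sum>i<N - j. gauss_coeff j y * (?x ^ i / fact i) * s ^ (i + j))"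
      by (rule sum.reindex_bij_witness[of _ "\<lambda>i. i + j" "\<lambda>n. n - j"]) auto
    also have "\<dots> = gauss_coeff j y * s ^ j * (\<Sum>i<N - j. (?x * s) ^ i / fact i)"
      unfolding sum_distrib_left power_mult_distrib power_add by (rule sum.cong[OF refl]) (simp only: times_divide_eq_right times_divide_eq_left mult_ac)
    finally show "(\<Sum>n<N. if j \<le> n then gauss_coeff j y * (?x ^ (n - j) / fact (n - j)) * s ^ n else 0) =
      gauss_coeff j y * s ^ j * (\<Sum>i<N - j. (?x * s) ^ i / fact i)" .
  qed
  finally show ?thesis .
qed

text \<open>In the j-th term of the polynomial the exponential is truncated at order N - j. For |y|
  \<le> 1 and s \<le> 1 its argument has modulus at most pi, which is where the powers of pi and the
  factor exp(pi) come from.\<close>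

lemma expansion_fun_expansion:
  obtains C where "C \<ge> 0" "\<And>s y. 0 < s \<Longrightarrow> s \<le> 1 \<Longrightarrow> norm y \<le> 1 \<Longrightarrow>
    norm (of_real (exp (- pi * (norm y)\<^sup>2 * s)) * poly (gauss_poly p y) (of_real s) - (\<Sum>n<N. expansion_fun n y * of_real s ^ n)) \<le> C * s ^ N"
proof -
  have "\<exists>C\<ge>0. \<forall>y. norm y \<le> 1 \<longrightarrow> norm (gauss_coeff j y) \<le> C" for j
    using bounded_on_ball[OF continuous_on_gauss_poly[of UNIV p j]] by metis
  then obtain c where c: "\<And>j. c j \<ge> 0" "\<And>j y. norm y \<le> 1 \<Longrightarrow> norm (gauss_coeff j y) \<le> c j" by metis
  define C where "C = (\<Sum>j\<le>deg. c j * (exp pi * pi ^ (N - j)))"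
  show thesis
  proof (rule that[of C])
    show "C \<ge> 0" unfolding C_def by (intro sum_nonneg mult_nonneg_nonneg c) auto
    fix s :: real and y :: "real^'n" assume s: "0 < s" "s \<le> 1" and y: "norm y \<le> 1"
    define z where "z = complex_of_real (- pi * (norm y)\<^sup>2) * of_real s"
    have nz: "norm z \<le> pi * s"
    proof -
      have "(norm y)\<^sup>2 \<le> 1" using y by (simp add: power_le_one)
      then have "pi * (norm y)\<^sup>2 * s \<le> pi * 1 * s" using s by (intro mult_right_mono mult_left_mono) auto
      then show ?thesis using s by (simp only: z_def of_real_mult[symmetric] norm_of_real) (simp add: abs_mult)
    qed
    have rz: "\<bar>Re z\<bar> \<le> pi"
    proof -
      have "pi * s \<le> pi * 1" using s by (intro mult_left_mono) auto
      then show ?thesis using abs_Re_le_cmod[of z] nz by linarith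
    qed
    have "of_real (exp (- pi * (norm y)\<^sup>2 * s)) * poly (gauss_poly p y) (of_real s) - (\<Sum>n<N. expansion_fun n y * of_real s ^ n)
      = (\<Sum>j\<le>deg. gauss_coeff j y * of_real s ^ j * (exp z - (\<Sum>i<N - j. z ^ i / fact i)))"
      unfolding expansion_fun_sum z_def[symmetric] poly_gauss_poly
      by (simp add: right_diff_distrib sum_subtractf sum_distrib_left sum_distrib_right z_def exp_of_real[symmetric] mult_ac)
    also have "norm \<dots> \<le> (\<Sum>j\<le>deg. c j * (exp pi * pi ^ (N - j)) * s ^ N)"
    proof (rule sum_norm_le)
      fix j
      have "norm (exp z - (\<Sum>i<N - j. z ^ i / fact i)) \<le> exp \<bar>Re z\<bar> * norm z ^ (N - j)" by (rule exp_remainder_bound)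
      also have "\<dots> \<le> exp pi * (pi * s) ^ (N - j)"
        using rz nz by (intro mult_mono power_mono) auto
      finally have 1: "norm (exp z - (\<Sum>i<N - j. z ^ i / fact i)) \<le> exp pi * (pi * s) ^ (N - j)" .
      have "norm (gauss_coeff j y * of_real s ^ j * (exp z - (\<Sum>i<N - j. z ^ i / fact i))) =
        norm (gauss_coeff j y) * s ^ j * norm (exp z - (\<Sum>i<N - j. z ^ i / fact i))"
        using s by (simp add: norm_mult norm_power)
      also have "\<dots> \<le> c j * s ^ j * (exp pi * (pi * s) ^ (N - j))"
        by (rule mult_mono[OF mult_right_mono[OF c(2)[OF y]] 1]) (use s c in auto)
      also have "\<dots> = c j * (exp pi * pi ^ (N - j)) * s ^ (j + (N - j))"
        by (simp add: power_mult_distrib power_add mult_ac)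
      \<comment> \<open>The subtraction is truncated: for j \<ge> N the inner sum is empty and j +
        (N - j) is j. In every case the exponent is at least N.\<close>
      also have "\<dots> \<le> c j * (exp pi * pi ^ (N - j)) * s ^ N"
        using s c by (intro mult_left_mono power_decreasing) auto
      finally show "norm (gauss_coeff j y * of_real s ^ j * (exp z - (\<Sum>i<N - j. z ^ i / fact i))) \<le> c j * (exp pi * pi ^ (N - j)) * s ^ N" .
    qed
    finally show "norm (of_real (exp (- pi * (norm y)\<^sup>2 * s)) * poly (gauss_poly p y) (of_real s) - (\<Sum>n<N. expansion_fun n y * of_real s ^ n)) \<le> C * s ^ N"
      by (simp add: C_def sum_distrib_right)
  qed
qed

text \<open>As \<beta> tends to 0 the average concentrates at the origin, where the exponential
  contributes nothing and only the heat coefficient remains; see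
  \<open>expansion_coeff_0\<close>.\<close>

definition expansion_coeff :: "nat \<Rightarrow> real \<Rightarrow> complex" where
  "expansion_coeff n \<beta> = (\<integral>x. of_real (\<phi> x) * expansion_fun n (\<beta> *\<^sub>R x) \<partial>lborel)"

definition expansion_rem :: "nat \<Rightarrow> real \<Rightarrow> real \<Rightarrow> complex" where
  "expansion_rem N \<beta> t = theta_int \<beta> t - (\<Sum>n<N. expansion_coeff n \<beta> * of_real t powr - (of_nat CARD('n) / 2 + of_nat n))"

definition mellin_rem :: "nat \<Rightarrow> real \<Rightarrow> complex \<Rightarrow> complex" where "mellin_rem N \<beta> = mellin_on {1<..} (expansion_rem N \<beta>)"

lemma expansion_fun_0: "expansion_fun n 0 = gauss_coeff n 0"
proof -
  have "expansion_fun n 0 = (\<Sum>j\<in>{..deg} \<inter> {..n}. if j = n then gauss_coeff n 0 else 0)"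
    unfolding expansion_fun_def by (intro sum.cong refl) (auto simp: power_0_left)
  also have "\<dots> = gauss_coeff n 0"
    using degree_gauss_poly[of p 0] by (auto simp: coeff_eq_0)
  finally show ?thesis .
qed

lemma expansion_coeff_0: "expansion_coeff n 0 = gauss_coeff n 0"
proof -
  have "expansion_coeff n 0 = of_real (\<integral>x. \<phi> x \<partial>lborel) * gauss_coeff n 0"
    unfolding expansion_coeff_def by (simp add: expansion_fun_0 del: integral_complex_of_real add: integral_complex_of_real[symmetric])
  then show ?thesis using \<phi>_int by simp
qed

lemma expansion_coeff_0_eq_0: "deg < 2 * n \<Longrightarrow> expansion_coeff n 0 = 0"
  unfolding expansion_coeff_0 using degree_gauss_poly_0[of p] by (intro coeff_eq_0) linarith

lemma norm_scaleR_lt: "norm (x::real^'n) < 1 \<Longrightarrow> 0 \<le> \<beta> \<Longrightarrow> \<beta> \<le> 1 \<Longrightarrow> norm (\<beta> *\<^sub>R x) \<le> 1"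
  by (simp add: mult_le_one)

lemma expansion_fun_integrable:
  assumes "0 \<le> \<beta>" "\<beta> \<le> 1"
  shows "integrable lborel (\<lambda>x. of_real (\<phi> x) * expansion_fun n (\<beta> *\<^sub>R x))"
proof -
  obtain C where "C \<ge> 0" "\<And>y. norm y \<le> 1 \<Longrightarrow> norm (expansion_fun n y) \<le> C" using bounded_on_ball[OF continuous_expansion_fun] by metis
  then show ?thesis by (intro \<phi>_weighted(1)[of _ C]) (auto simp: norm_scaleR_lt assms simp del: norm_scaleR)
qed

lemma expansion_coeff_tendsto: "(expansion_coeff n \<longlongrightarrow> expansion_coeff n 0) (at_right 0)"
proof -
  obtain C where C: "C \<ge> 0" "\<And>y. norm y \<le> 1 \<Longrightarrow> norm (expansion_fun n y) \<le> C" using bounded_on_ball[OF continuous_expansion_fun] by metis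
  have r: "at_right 0 = at 0 within {0..1::real}" by (rule at_within_Icc_at_right[symmetric]) simp
  show ?thesis
    unfolding expansion_coeff_def r
  proof (rule integral_dominated_convergence_within[where w = "\<lambda>x. C * \<phi> x"])
    show "integrable lborel (\<lambda>x. C * \<phi> x)" using \<phi>_integrable by simp
    show "AE x in lborel. ((\<lambda>\<beta>. complex_of_real (\<phi> x) * expansion_fun n (\<beta> *\<^sub>R x)) \<longlongrightarrow> complex_of_real (\<phi> x) * expansion_fun n (0 *\<^sub>R x)) (at 0 within {0..1})"
    proof (intro AE_I2 tendsto_mult tendsto_const)
      fix x
      have "continuous_on UNIV (\<lambda>\<beta>. expansion_fun n (\<beta> *\<^sub>R x))"
        by (rule continuous_on_compose2[OF continuous_expansion_fun]) (auto intro!: continuous_intros)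
      then have "continuous_on {0..1} (\<lambda>\<beta>. expansion_fun n (\<beta> *\<^sub>R x))" by (rule continuous_on_subset) simp
      then show "((\<lambda>\<beta>. expansion_fun n (\<beta> *\<^sub>R x)) \<longlongrightarrow> expansion_fun n (0 *\<^sub>R x)) (at 0 within {0..1})"
        unfolding continuous_on_def by (rule bspec) simp
    qed
    fix \<beta> :: real assume \<beta>: "\<beta> \<in> {0..1} - {0}"
    show "AE x in lborel. norm (complex_of_real (\<phi> x) * expansion_fun n (\<beta> *\<^sub>R x)) \<le> C * \<phi> x"
    proof (rule AE_I2)
      fix x
      show "norm (complex_of_real (\<phi> x) * expansion_fun n (\<beta> *\<^sub>R x)) \<le> C * \<phi> x"
        using C(2)[OF norm_scaleR_lt[of x \<beta>]] \<beta> \<phi>_nonneg[of x] cc_smooth_supp[OF cc, of x]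
        by (cases "norm x < 1") (auto simp: norm_mult mult.commute[of C] intro!: mult_left_mono)
    qed
  qed auto
qed

lemma measurable_expansion_rem [measurable]: "expansion_rem N \<beta> \<in> borel_measurable borel"
  unfolding expansion_rem_def[abs_def] by measurable

lemma powr_half_nat:
  assumes "t > 0"
  shows "complex_of_real t powr - (of_nat CARD('n) / 2 + of_nat n) = of_real (1 / sqrt t ^ CARD('n)) * of_real (1 / t) ^ n"
proof -
  have "complex_of_real t powr - (of_nat CARD('n) / 2 + of_nat n) = of_real (t powr - (real CARD('n) / 2 + real n))"
    using assms by (simp add: powr_of_real[symmetric])
  also have "t powr - (real CARD('n) / 2 + real n) = 1 / sqrt t ^ CARD('n) * (1 / t) ^ n"
    by (rule powr_half_nat_real[OF assms])
  finally show ?thesis by simp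
qed

text \<open>The expansion is uniform for |y| \<le> 1, the points \<beta> x met by the average stay
  in that ball for \<beta> \<le> 1, and averaging preserves the bound.\<close>

lemma expansion_rem_bound:
  obtains C where "C \<ge> 0" "\<And>\<beta> t. 0 \<le> \<beta> \<Longrightarrow> \<beta> \<le> 1 \<Longrightarrow> t \<in> {1<..} \<Longrightarrow> norm (expansion_rem N \<beta> t) \<le> C * t powr - (real CARD('n) / 2 + real N)"
proof -
  obtain C where C: "C \<ge> 0" "\<And>s y. 0 < s \<Longrightarrow> s \<le> 1 \<Longrightarrow> norm y \<le> 1 \<Longrightarrow>
    norm (of_real (exp (- pi * (norm y)\<^sup>2 * s)) * poly (gauss_poly p y) (of_real s) - (\<Sum>n<N. expansion_fun n y * of_real s ^ n)) \<le> C * s ^ N"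
    using expansion_fun_expansion by blast
  have "norm (expansion_rem N \<beta> t) \<le> C * t powr - (real CARD('n) / 2 + real N)" if \<beta>: "0 \<le> \<beta>" "\<beta> \<le> 1" and t: "t > 1" for \<beta> t
  proof -
    let ?h = "\<lambda>y. gauss_transform t y - (\<Sum>n<N. expansion_fun n y * of_real t powr - (of_nat CARD('n) / 2 + of_nat n))"
    have t0: "t > 0" using t by simp
    have b: "norm (?h y) \<le> C * t powr - (real CARD('n) / 2 + real N)" if y: "norm y \<le> 1" for y
    proof -
      have "?h y = of_real (1 / sqrt t ^ CARD('n)) * (of_real (exp (- pi * (norm y)\<^sup>2 * (1 / t))) * poly (gauss_poly p y) (of_real (1 / t)) - (\<Sum>n<N. expansion_fun n y * of_real (1 / t) ^ n))"
        unfolding gauss_transform_def powr_half_nat[OF t0] by (simp add: sum_distrib_left right_diff_distrib mult_ac)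
      also have "norm \<dots> = 1 / sqrt t ^ CARD('n) * norm (of_real (exp (- pi * (norm y)\<^sup>2 * (1 / t))) * poly (gauss_poly p y) (of_real (1 / t)) - (\<Sum>n<N. expansion_fun n y * of_real (1 / t) ^ n))"
        unfolding norm_mult norm_of_real using t by simp
      also have "\<dots> \<le> 1 / sqrt t ^ CARD('n) * (C * (1 / t) ^ N)"
        using t y by (intro mult_left_mono C(2)) auto
      also have "\<dots> = C * t powr - (real CARD('n) / 2 + real N)"
        by (simp only: powr_half_nat_real[OF t0]) (simp add: mult_ac)
      finally show ?thesis .
    qed
    have "expansion_rem N \<beta> t = (\<integral>x. of_real (\<phi> x) * ?h (\<beta> *\<^sub>R x) \<partial>lborel)"
    proof -
      have s: "(\<integral>x. (\<Sum>n<N. (of_real (\<phi> x) * expansion_fun n (\<beta> *\<^sub>R x)) * of_real t powr - (of_nat CARD('n) / 2 + of_nat n)) \<partial>lborel) = (\<Sum>n<N. expansion_coeff n \<beta> * of_real t powr - (of_nat CARD('n) / 2 + of_nat n))"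
        unfolding expansion_coeff_def
        by (subst Bochner_Integration.integral_sum) (use expansion_fun_integrable[OF \<beta>] in auto)
      have si: "integrable lborel (\<lambda>x. (\<Sum>n<N. (of_real (\<phi> x) * expansion_fun n (\<beta> *\<^sub>R x)) * of_real t powr - (of_nat CARD('n) / 2 + of_nat n)))"
        using expansion_fun_integrable[OF \<beta>] by (intro Bochner_Integration.integrable_sum integrable_mult_left)
      have hi: "integrable lborel (\<lambda>x. of_real (\<phi> x) * ?h (\<beta> *\<^sub>R x))"
        by (rule \<phi>_weighted(1)[of _ "C * t powr - (real CARD('n) / 2 + real N)"]) (use b[OF norm_scaleR_lt[OF _ \<beta>]] in auto)
      have e: "of_real (\<phi> x) * gauss_transform t (\<beta> *\<^sub>R x) = of_real (\<phi> x) * ?h (\<beta> *\<^sub>R x) + (\<Sum>n<N. (of_real (\<phi> x) * expansion_fun n (\<beta> *\<^sub>R x)) * of_real t powr - (of_nat CARD('n) / 2 + of_nat n))" for x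
        by (simp add: right_diff_distrib sum_distrib_left mult_ac)
      show ?thesis
        unfolding expansion_rem_def theta_int_eq[OF t0] e Bochner_Integration.integral_add[OF hi si] s by simp
    qed
    also have "norm \<dots> \<le> C * t powr - (real CARD('n) / 2 + real N)"
      by (rule \<phi>_weighted(2)) (use b[OF norm_scaleR_lt[OF _ \<beta>]] in auto)
    finally show ?thesis .
  qed
  then show thesis using C(1) by (intro that) auto
qed

lemma expansion_rem_tendsto: "t > 0 \<Longrightarrow> ((\<lambda>\<beta>. expansion_rem N \<beta> t) \<longlongrightarrow> expansion_rem N 0 t) (at_right 0)"
  unfolding expansion_rem_def by (intro tendsto_intros theta_int_tendsto expansion_coeff_tendsto)

lemma mellin_rem_integrable:
  assumes "0 \<le> \<beta>" "\<beta> \<le> 1" "Re \<nu> < real (CARD('n) + 2 * N)"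
  shows "integrable lborel (\<lambda>t. indicator {1<..} t *\<^sub>R (of_real t powr (\<nu> / 2 - 1) * expansion_rem N \<beta> t))"
proof -
  obtain C where C: "C \<ge> 0" "\<And>\<beta> t. 0 \<le> \<beta> \<Longrightarrow> \<beta> \<le> 1 \<Longrightarrow> t \<in> {1<..} \<Longrightarrow> norm (expansion_rem N \<beta> t) \<le> C * t powr - (real CARD('n) / 2 + real N)"
    using expansion_rem_bound by blast
  have "Re \<nu> / 2 - (real CARD('n) / 2 + real N) < 0" using assms(3) by simp
  then show ?thesis by (intro mellin_on_integrable[OF _ _ _ C(2)[OF assms(1,2)] integrable_powr_interval(1)]) auto
qed

lemma mellin_rem_holomorphic:
  assumes "0 \<le> \<beta>" "\<beta> \<le> 1"
  shows "mellin_rem N \<beta> holomorphic_on {\<nu>. Re \<nu> < real (CARD('n) + 2 * N)}"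
proof -
  obtain C where C: "C \<ge> 0" "\<And>\<beta> t. 0 \<le> \<beta> \<Longrightarrow> \<beta> \<le> 1 \<Longrightarrow> t \<in> {1<..} \<Longrightarrow> norm (expansion_rem N \<beta> t) \<le> C * t powr - (real CARD('n) / 2 + real N)"
    using expansion_rem_bound by blast
  show ?thesis
    unfolding mellin_rem_def by (rule mellin_on_holomorphic[OF _ _ _ C(2)[OF assms] open_halfspace_Re_lt integrable_powr_interval(1)]) auto
qed

lemma mellin_rem_tendsto:
  assumes "Re \<nu> < real (CARD('n) + 2 * N)"
  shows "((\<lambda>\<beta>. mellin_rem N \<beta> \<nu>) \<longlongrightarrow> mellin_rem N 0 \<nu>) (at_right 0)"
proof -
  obtain C where C: "C \<ge> 0" "\<And>\<beta> t. 0 \<le> \<beta> \<Longrightarrow> \<beta> \<le> 1 \<Longrightarrow> t \<in> {1<..} \<Longrightarrow> norm (expansion_rem N \<beta> t) \<le> C * t powr - (real CARD('n) / 2 + real N)"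
    using expansion_rem_bound by blast
  have "Re \<nu> / 2 - (real CARD('n) / 2 + real N) < 0" using assms by simp
  then show ?thesis unfolding mellin_rem_def
    by (intro mellin_on_tendsto[OF _ _ _ _ C(2) integrable_powr_interval(1), where \<rho> = 1] expansion_rem_tendsto) auto
qed

text \<open>In Re \<nu> < d every power in the expansion is integrable over t > 1, the term n = 0
  being the critical one. The right-hand side remains meaningful up to Re \<nu> < d + 2N away from
  the poles, which is the continuation sought.\<close>

lemma theta_int_above_1:
  assumes \<beta>: "0 \<le> \<beta>" "\<beta> \<le> 1" and \<nu>: "Re \<nu> < real CARD('n)"
  shows "has_bochner_integral lborel (\<lambda>t. indicator {1<..} t *\<^sub>R (of_real t powr (\<nu> / 2 - 1) * theta_int \<beta> t))
    ((\<Sum>n<N. expansion_coeff n \<beta> / (of_nat CARD('n) / 2 + of_nat n - \<nu> / 2)) + mellin_rem N \<beta> \<nu>)"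
proof -
  let ?s = "\<lambda>n. \<nu> / 2 - (of_nat CARD('n) / 2 + of_nat n)"
  have h: "has_bochner_integral lborel (\<lambda>t. indicator {1<..} t *\<^sub>R of_real t powr (?s n - 1)) (1 / (of_nat CARD('n) / 2 + of_nat n - \<nu> / 2))" for n
    using has_integral_powr_above_1[of "?s n"] \<nu> unfolding minus_diff_eq by simp
  have "has_bochner_integral lborel (\<lambda>t. (\<Sum>n<N. (indicator {1<..} t *\<^sub>R of_real t powr (?s n - 1)) * expansion_coeff n \<beta>)
      + indicator {1<..} t *\<^sub>R (of_real t powr (\<nu> / 2 - 1) * expansion_rem N \<beta> t)) ((\<Sum>n<N. 1 / (of_nat CARD('n) / 2 + of_nat n - \<nu> / 2) * expansion_coeff n \<beta>) + mellin_rem N \<beta> \<nu>)"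
    unfolding mellin_rem_def mellin_on_def
    by (intro has_bochner_integral_add has_bochner_integral_sum has_bochner_integral_mult_left h has_bochner_integral_integrable mellin_rem_integrable \<beta>)
      (use \<nu> in auto)
  also have "(\<lambda>t. (\<Sum>n<N. (indicator {1<..} t *\<^sub>R of_real t powr (?s n - 1)) * expansion_coeff n \<beta>)
      + indicator {1<..} t *\<^sub>R (of_real t powr (\<nu> / 2 - 1) * expansion_rem N \<beta> t)) =
    (\<lambda>t. indicator {1<..} t *\<^sub>R (of_real t powr (\<nu> / 2 - 1) * theta_int \<beta> t))"
  proof
    fix t :: real
    have *: "of_real t powr (?s n - 1) = of_real t powr (\<nu> / 2 - 1) * of_real t powr - (of_nat CARD('n) / 2 + of_nat n)" if "t > 1" for n
      using that by (subst powr_add[symmetric]) (auto simp: algebra_simps)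
    show "(\<Sum>n<N. (indicator {1<..} t *\<^sub>R of_real t powr (?s n - 1)) * expansion_coeff n \<beta>)
      + indicator {1<..} t *\<^sub>R (of_real t powr (\<nu> / 2 - 1) * expansion_rem N \<beta> t) =
      indicator {1<..} t *\<^sub>R (of_real t powr (\<nu> / 2 - 1) * theta_int \<beta> t)"
    proof (cases "t > 1")
      case True
      show ?thesis unfolding *[OF True] using True
        by (simp add: expansion_rem_def right_diff_distrib sum_distrib_left mult_ac)
    qed simp
  qed
  finally show ?thesis by (simp only: times_divide_eq_left mult_1_left)
qed

text \<open>At \<beta> = 0 nothing is averaged and the Gaussian factor is evaluated at frequency 0,
  so the expansion is a finite exact formula. It therefore holds for small t as well, which is what
  the Dirichlet series needs.\<close>

lemma theta_int_0:
  assumes "t > 0" "deg < N"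
  shows "theta_int 0 t = (\<Sum>n<N. expansion_coeff n 0 * of_real t powr - (of_nat CARD('n) / 2 + of_nat n))"
proof -
  have "theta_int 0 t = of_real (\<integral>x. \<phi> x \<partial>lborel) * gauss_transform t 0"
    unfolding theta_int_eq[OF assms(1)] by (simp del: integral_complex_of_real add: integral_complex_of_real[symmetric])
  also have "\<dots> = of_real (1 / sqrt t ^ CARD('n)) * (\<Sum>j\<le>deg. gauss_coeff j 0 * of_real (1 / t) ^ j)"
    using \<phi>_int by (simp add: gauss_transform_def poly_gauss_poly)
  also have "(\<Sum>j\<le>deg. gauss_coeff j 0 * of_real (1 / t) ^ j) = (\<Sum>j<N. gauss_coeff j 0 * of_real (1 / t) ^ j)"
    using assms(2) degree_gauss_poly[of p 0] by (intro sum.mono_neutral_left) (auto simp: coeff_eq_0)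
  finally show ?thesis unfolding powr_half_nat[OF assms(1)] expansion_coeff_0 by (simp add: sum_distrib_left mult_ac)
qed

lemma mellin_rem_0:
  assumes "deg < N"
  shows "mellin_rem N 0 \<nu> = 0"
proof -
  have z: "indicator {1<..} t *\<^sub>R (of_real t powr (\<nu> / 2 - 1) * expansion_rem N 0 t) = 0" for t :: real
    by (cases "t > 1") (auto simp: expansion_rem_def theta_int_0[OF _ assms])
  show ?thesis unfolding mellin_rem_def mellin_on_def z by simp
qed

end

section \<open>Meromorphic continuation\<close>

text \<open>The first form is the one that extends to \<beta> = 0; the second exhibits the transform
  of a function of compact support, as required by \<open>taylor_class\<close>.\<close>

lemma fourier_scaled:
  fixes f :: "real^'n \<Rightarrow> real"
  assumes [measurable]: "f \<in> borel_measurable borel" and \<beta>: "\<beta> > 0"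
  shows "fourier (scaled f \<beta>) z = FT f (\<beta> *\<^sub>R z)"
    and "fourier (scaled f \<beta>) z = (\<integral>x. of_real (scaled f \<beta> x) * echar (- (z \<bullet> x)) \<partial>lborel)"
proof -
  define A :: "real^'n^'n" where "A = matrix ((*\<^sub>R) \<beta>)"
  have Av: "A *v x = \<beta> *\<^sub>R x" for x unfolding A_def by (simp add: matrix_works linear_scaleR)
  have dA: "det A = \<beta> ^ CARD('n)" unfolding A_def by (rule det_matrix_scaleR)
  have A: "invertible A" using \<beta> by (simp add: invertible_det_nz dA)
  have [measurable]: "scaled f \<beta> \<in> borel_measurable borel" unfolding scaled_def[abs_def] by measurable
  show e: "fourier (scaled f \<beta>) z = (\<integral>x. of_real (scaled f \<beta> x) * echar (- (z \<bullet> x)) \<partial>lborel)"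
    unfolding fourier_def
    by (rule Bochner_Integration.integral_cong[OF refl]) (simp add: echar_def cis_conv_exp mult_ac)
  also have "\<dots> = \<bar>det A\<bar> *\<^sub>R (\<integral>x. of_real (scaled f \<beta> (A *v x)) * echar (- (z \<bullet> (A *v x))) \<partial>lborel)"
    by (rule integral_lborel_linear[OF A]) measurable
  also have "\<dots> = (\<integral>x. \<bar>det A\<bar> *\<^sub>R (of_real (scaled f \<beta> (A *v x)) * echar (- (z \<bullet> (A *v x)))) \<partial>lborel)"
    by (rule integral_scaleR_right[symmetric])
  also have "\<dots> = FT f (\<beta> *\<^sub>R z)"
    unfolding FT_def
  proof (rule Bochner_Integration.integral_cong[OF refl])
    fix x :: "real^'n"
    have "r *\<^sub>R (of_real (a / r) * e) = of_real a * e" if "r \<noteq> 0" for r a and e :: complex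
      using that by (simp add: scaleR_conv_of_real)
    from this[of "\<beta> ^ CARD('n)" "f x" "echar (- (z \<bullet> (\<beta> *\<^sub>R x)))"]
    show "\<bar>det A\<bar> *\<^sub>R (of_real (scaled f \<beta> (A *v x)) * echar (- (z \<bullet> (A *v x)))) = of_real (f x) * echar (- ((\<beta> *\<^sub>R z) \<bullet> x))"
      using \<beta> by (simp add: Av dA scaled_def)
  qed
  finally show "fourier (scaled f \<beta>) z = FT f (\<beta> *\<^sub>R z)" .
qed

lemma integrable_count_space_imp_has_sum:
  fixes f :: "'a \<Rightarrow> complex"
  assumes "integrable (count_space A) f"
  shows "(f has_sum (\<integral>x. f x \<partial>count_space A)) A"
proof -
  have a: "Infinite_Set_Sum.abs_summable_on f A" using assms unfolding Infinite_Set_Sum.abs_summable_on_def .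
  then have "Infinite_Sum.abs_summable_on f A" using abs_summable_equivalent by blast
  then have "(f has_sum infsum f A) A" using abs_summable_summable has_sum_infsum by blast
  then show ?thesis using infsetsum_infsum[OF a] by (simp add: infsetsum_def)
qed

lemma taylor_class_mult_power: "taylor_class g \<Longrightarrow> taylor_class (\<lambda>z. of_real (z $ i) ^ k * g z)"
  by (induction k) (auto simp: mult.assoc intro: taylor_class.coord)

lemma taylor_class_mult_monomial:
  assumes "finite A" "taylor_class g"
  shows "taylor_class (\<lambda>z. (\<Prod>i\<in>A. of_real (z $ i) ^ \<alpha> i) * g z)"
  using assms by (induction A rule: finite_induct) (auto simp: mult.assoc intro: taylor_class_mult_power)

lemma taylor_class_mult_poly_fun:
  assumes "taylor_class g"
  shows "taylor_class (\<lambda>z. g z * poly_fun p z)"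
proof -
  have "taylor_class (\<lambda>z. \<Sum>\<alpha>\<in>Poly_Mapping.keys p. Poly_Mapping.lookup p \<alpha> * ((\<Prod>i\<in>UNIV. of_real (z $ i) ^ \<alpha> i) * g z))"
    by (intro taylor_class_sum taylor_class.cmult taylor_class_mult_monomial assms) auto
  then show ?thesis by (simp add: poly_fun_def sum_distrib_left sum_distrib_right mult_ac)
qed

lemma rapidly_decaying_integrable:
  fixes g :: "real^'n \<Rightarrow> complex"
  assumes g: "rapidly_decaying g" and m [measurable]: "g \<in> borel_measurable borel" and \<nu>: "Re \<nu> < real CARD('n)"
  shows "integrable lborel (\<lambda>z. g z / of_real (norm z) powr \<nu>)"
proof -
  have [measurable]: "ball (0::real^'n) 1 \<in> sets borel" by simp
  obtain C where C: "C \<ge> 0" "\<And>z. norm (g z) \<le> C * (1 + norm z) powr (- 0)" using rapidly_decayingD[OF g] by blast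
  have 1: "integrable lborel (\<lambda>z. indicator (ball 0 1) z *\<^sub>R (g z / of_real (norm z) powr \<nu>))"
  proof (rule Bochner_Integration.integrable_bound)
    have "- Re \<nu> + real CARD('n) > 0" using \<nu> by simp
    then show "integrable lborel (\<lambda>z::real^'n. C * (indicator (ball 0 1) z * norm z powr - Re \<nu>))"
      by (rule integrable_mult_right[OF integrable_norm_powr_ball])
    show "AE z in lborel. norm (indicator (ball 0 1) z *\<^sub>R (g z / of_real (norm z) powr \<nu>)) \<le> norm (C * (indicator (ball 0 1) z * norm z powr - Re \<nu>))"
      using AE_lborel_singleton[of "0::real^'n"]
    proof eventually_elim
      case (elim z)
      have "1 + norm z \<noteq> 0" using norm_ge_zero[of z] by linarith
      then have "norm (g z) \<le> C" using C(2)[of z] by simp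
      then have "norm (g z) * norm z powr - Re \<nu> \<le> C * norm z powr - Re \<nu>" by (intro mult_right_mono) auto
      then show ?case using elim C(1) by (auto simp: indicator_def norm_mult norm_divide norm_inverse norm_of_real_powr powr_minus divide_inverse)
    qed
  qed measurable
  have "integrable lborel (\<lambda>z. indicator (ball 0 1) z *\<^sub>R (g z / of_real (norm z) powr \<nu>) + indicator (- ball 0 1) z *\<^sub>R (g z / of_real (norm z) powr \<nu>))"
    by (rule Bochner_Integration.integrable_add[OF 1 integrable_outside_ball[OF g m]])
  also have "(\<lambda>z. indicator (ball 0 1) z *\<^sub>R (g z / of_real (norm z) powr \<nu>) + indicator (- ball 0 1) z *\<^sub>R (g z / of_real (norm z) powr \<nu>)) = (\<lambda>z. g z / of_real (norm z) powr \<nu>)"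
    by (rule ext) (simp add: indicator_def)
  finally show ?thesis .
qed

context cutoff_lattice begin

lemma cutoff_poly_eq_fourier: "\<beta> > 0 \<Longrightarrow> cutoff_poly \<beta> = (\<lambda>z. fourier (scaled \<phi> \<beta>) z * P z)"
  by (rule ext) (simp add: cutoff_poly_def fourier_scaled(1))

text \<open>For \<beta> \<le> 1 the scaled cutoff is still supported in the unit ball, so its
  transform is a base element of the class.\<close>

lemma taylor_class_cutoff_poly:
  assumes "0 < \<beta>" "\<beta> \<le> 1"
  shows "taylor_class (cutoff_poly \<beta>)"
proof -
  obtain B where B: "\<And>x. \<bar>\<phi> x\<bar> \<le> B" using cc_smooth_bounded[OF cc] by blast
  have "taylor_class (\<lambda>z. \<integral>x. of_real (scaled \<phi> \<beta> x) * echar (- (z \<bullet> x)) \<partial>lborel)"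
  proof (rule taylor_class.base)
    show "(\<lambda>x. complex_of_real (scaled \<phi> \<beta> x)) \<in> borel_measurable borel" unfolding scaled_def by measurable
    show "norm (complex_of_real (scaled \<phi> \<beta> x)) \<le> B / \<beta> ^ CARD('n)" for x
      unfolding norm_of_real scaled_def using B[of "x /\<^sub>R \<beta>"] assms by (simp add: divide_right_mono)
    fix x :: "real^'n" assume x: "1 \<le> norm x"
    have "1 \<le> norm (x /\<^sub>R \<beta>)" using x assms by (simp add: field_simps)
    then show "complex_of_real (scaled \<phi> \<beta> x) = 0" by (simp add: scaled_def cc_smooth_supp[OF cc])
  qed
  then show ?thesis
    unfolding cutoff_poly_eq_fourier[OF assms(1)] by (intro taylor_class_mult_poly_fun) (simp add: fourier_scaled(2) assms)
qed

text \<open>For \<beta> \<le> 1 one has \<beta> (1 + |z|) \<le> 1 + |\<beta> z|, so the decay of the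
  transform survives the dilation at the price of a power of 1/\<beta>; m further orders of decay
  absorb the polynomial.\<close>

lemma rapidly_decaying_cutoff_poly:
  assumes \<beta>: "0 < \<beta>" "\<beta> \<le> 1"
  shows "rapidly_decaying (cutoff_poly \<beta>)"
  unfolding rapidly_decaying_def
proof
  fix N
  obtain C where C: "C \<ge> 0" "\<And>z. norm (P z) \<le> C * (1 + norm z) ^ deg" using poly_fun_bound[of p] by blast
  obtain K where K: "\<And>z. norm (chi_hat z) * (1 + norm z) ^ (deg + N) \<le> K" using FT_decay[OF cc] by blast
  have "norm (cutoff_poly \<beta> z) * (1 + norm z) ^ N \<le> C * (K / \<beta> ^ (deg + N))" for z
  proof -
    have "\<beta> * (1 + norm z) \<le> 1 + norm (\<beta> *\<^sub>R z)" using \<beta> by (simp add: distrib_left)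
    then have "(\<beta> * (1 + norm z)) ^ (deg + N) \<le> (1 + norm (\<beta> *\<^sub>R z)) ^ (deg + N)"
      using \<beta> by (intro power_mono mult_nonneg_nonneg) auto
    then have "norm (chi_hat (\<beta> *\<^sub>R z)) * (\<beta> * (1 + norm z)) ^ (deg + N) \<le> K"
      by (intro order_trans[OF mult_left_mono K]) auto
    then have k: "norm (chi_hat (\<beta> *\<^sub>R z)) * (1 + norm z) ^ (deg + N) \<le> K / \<beta> ^ (deg + N)"
      using \<beta> by (simp only: power_mult_distrib pos_le_divide_eq zero_less_power) (simp add: mult_ac)
    have "norm (cutoff_poly \<beta> z) * (1 + norm z) ^ N = norm (chi_hat (\<beta> *\<^sub>R z)) * norm (P z) * (1 + norm z) ^ N" by (simp add: cutoff_poly_def norm_mult)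
    also have "\<dots> \<le> norm (chi_hat (\<beta> *\<^sub>R z)) * (C * (1 + norm z) ^ deg) * (1 + norm z) ^ N"
      by (intro mult_right_mono mult_left_mono C) auto
    also have "\<dots> = C * (norm (chi_hat (\<beta> *\<^sub>R z)) * (1 + norm z) ^ (deg + N))" by (simp add: power_add mult_ac)
    also have "\<dots> \<le> C * (K / \<beta> ^ (deg + N))" by (intro mult_left_mono k C)
    finally show ?thesis .
  qed
  then show "\<exists>C. \<forall>z. norm (cutoff_poly \<beta> z) * (1 + norm z) ^ N \<le> C" by blast
qed

lemma lattice_sum_integrable:
  fixes f :: "real^'n \<Rightarrow> complex"
  assumes f: "\<And>z. norm (f z) \<le> C * (1 + norm z) powr (- (s + \<bar>Re \<nu>\<bar>))" "0 \<le> C" and s: "s > real CARD('n)"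
  shows "integrable (count_space punctured_lattice) (\<lambda>z. f z / of_real (norm z) powr \<nu>)"
proof -
  obtain c where c: "c > 0" "\<And>z. z \<in> lattice_of M \<Longrightarrow> z \<noteq> 0 \<Longrightarrow> c \<le> norm z" using lattice_of_norm_ge[OF M] by blast
  have i: "integrable (count_space punctured_lattice) (\<lambda>z. complex_of_real ((1 + norm z) powr (- s)))"
    by (rule integrable_decay_punctured_lattice(2)[OF s])
  show ?thesis
  proof (rule Bochner_Integration.integrable_bound[OF integrable_mult_right[OF i, of "of_real (C * (2 / min c 1) powr \<bar>Re \<nu>\<bar>)"]])
    show "AE z in count_space punctured_lattice. norm (f z / of_real (norm z) powr \<nu>) \<le> norm (complex_of_real (C * (2 / min c 1) powr \<bar>Re \<nu>\<bar>) * complex_of_real ((1 + norm z) powr (- s)))"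
    proof (rule AE_I2)
      fix z assume "z \<in> space (count_space punctured_lattice)"
      then have z: "min c 1 \<le> norm z" using c(2)[of z] by auto
      have "norm (f z / of_real (norm z) powr \<nu>) \<le> C * (2 / min c 1) powr \<bar>Re \<nu>\<bar> * (1 + norm z) powr (- s)"
        by (rule norm_divide_powr_le[OF _ _ z f]) (use c in auto)
      then show "norm (f z / of_real (norm z) powr \<nu>) \<le> norm (complex_of_real (C * (2 / min c 1) powr \<bar>Re \<nu>\<bar>) * complex_of_real ((1 + norm z) powr (- s)))"
        using f(2) by (simp add: norm_mult)
    qed
  qed simp
qed

definition cutoff_series :: "real \<Rightarrow> complex \<Rightarrow> complex" where
  "cutoff_series \<beta> \<nu> = (\<integral>z. cutoff_poly \<beta> z / of_real (norm z) powr \<nu> \<partial>count_space punctured_lattice)"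

lemma cutoff_series_integrable:
  assumes "0 < \<beta>" "\<beta> \<le> 1"
  shows "integrable (count_space punctured_lattice) (\<lambda>z. cutoff_poly \<beta> z / of_real (norm z) powr \<nu>)"
proof -
  obtain C where "C \<ge> 0" "\<And>z. norm (cutoff_poly \<beta> z) \<le> C * (1 + norm z) powr (- (real (CARD('n) + 1) + \<bar>Re \<nu>\<bar>))"
    using rapidly_decayingD[OF rapidly_decaying_cutoff_poly[OF assms]] by blast
  then show ?thesis by (intro lattice_sum_integrable[where s = "real (CARD('n) + 1)" and C = C]) simp_all
qed

lemma cutoff_series_0_integrable:
  assumes "Re \<nu> > real CARD('n) + real deg"
  shows "integrable (count_space punctured_lattice) (\<lambda>z. P z / of_real (norm z) powr \<nu>)"
proof -
  obtain C where C: "C \<ge> 0" "\<And>z. norm (P z) \<le> C * (1 + norm z) ^ deg" using poly_fun_bound[of p] by blast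
  obtain c where c: "c > 0" "\<And>z. z \<in> lattice_of M \<Longrightarrow> z \<noteq> 0 \<Longrightarrow> c \<le> norm z" using lattice_of_norm_ge[OF M] by blast
  define s where "s = Re \<nu> - real deg"
  have s: "s > real CARD('n)" using assms by (simp add: s_def)
  \<comment> \<open>Chosen so that 1 + |z| \<le> K |z| as soon as |z| \<ge> c.\<close>
  define K where "K = 1 + 1 / c"
  have K: "K \<ge> 1" using c by (simp add: K_def)
  have i: "integrable (count_space punctured_lattice) (\<lambda>z. complex_of_real ((1 + norm z) powr (- s)))"
    by (rule integrable_decay_punctured_lattice(2)[OF s])
  show ?thesis
  proof (rule Bochner_Integration.integrable_bound[OF integrable_mult_right[OF i, of "of_real (C * K powr Re \<nu>)"]])
    show "AE z in count_space punctured_lattice. norm (P z / of_real (norm z) powr \<nu>) \<le> norm (complex_of_real (C * K powr Re \<nu>) * complex_of_real ((1 + norm z) powr (- s)))"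
    proof (rule AE_I2)
      fix z assume "z \<in> space (count_space punctured_lattice)"
      then have z: "c \<le> norm z" "norm z > 0" using c(2)[of z] by auto
      have "1 + norm z \<le> K * norm z" using z c by (simp add: K_def field_simps)
      then have "norm z powr (- Re \<nu>) \<le> K powr Re \<nu> * (1 + norm z) powr (- Re \<nu>)"
        using K z assms by (intro powr_neg_le) (auto simp: add_pos_nonneg)
      then have "norm (P z) * norm z powr (- Re \<nu>) \<le> (C * (1 + norm z) ^ deg) * (K powr Re \<nu> * (1 + norm z) powr (- Re \<nu>))"
        using C by (intro mult_mono[OF C(2)]) auto
      also have "\<dots> = C * K powr Re \<nu> * (1 + norm z) powr (- s)"
        by (simp add: s_def powr_add[symmetric] powr_realpow[symmetric] add_pos_nonneg)
      finally show "norm (P z / of_real (norm z) powr \<nu>) \<le> norm (complex_of_real (C * K powr Re \<nu>) * complex_of_real ((1 + norm z) powr (- s)))"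
        using C(1) z by (simp add: norm_mult norm_divide norm_inverse norm_of_real_powr powr_minus divide_inverse)
    qed
  qed simp
qed

lemma cutoff_series_holomorphic:
  assumes \<beta>: "0 < \<beta>" "\<beta> \<le> 1"
  shows "cutoff_series \<beta> holomorphic_on UNIV"
proof -
  have e: "cutoff_poly \<beta> z / of_real (norm z) powr \<nu> = cutoff_poly \<beta> z * exp (\<nu> * of_real (- ln (norm z)))" if "z \<in> punctured_lattice" for z \<nu>
    using that by (simp add: of_real_powr_eq_exp exp_minus divide_inverse)
  have e1: "cutoff_series \<beta> = (\<lambda>\<nu>. \<integral>z. cutoff_poly \<beta> z * exp (\<nu> * of_real (- ln (norm z))) \<partial>count_space punctured_lattice)"
    unfolding cutoff_series_def[abs_def] by (intro ext Bochner_Integration.integral_cong refl) (simp add: e)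
  show ?thesis
    unfolding e1
  proof (rule holomorphic_on_integral_exp)
    fix \<nu>
    show "integrable (count_space punctured_lattice) (\<lambda>z. cutoff_poly \<beta> z * exp (\<nu> * of_real (- ln (norm z))))"
      using cutoff_series_integrable[OF \<beta>, of \<nu>] by (subst Bochner_Integration.integrable_cong[OF refl e[symmetric]]) auto
  qed auto
qed

lemma HSI_cutoff_poly:
  assumes "0 < \<beta>" "\<beta> \<le> 1"
  shows "HSI M \<nu> (cutoff_poly \<beta>) = cutoff_series \<beta> \<nu> - 1 / of_real V * fp_integral \<nu> (cutoff_poly \<beta>)"
  unfolding HSI_def cutoff_series_def using infsumI[OF integrable_count_space_imp_has_sum[OF cutoff_series_integrable[OF assms, of \<nu>]]] by simp

text \<open>The inverse of the factor produced by \<open>mellin_transform\<close>. The reciprocal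
  Gamma function makes it entire, so undoing the Mellin transform creates no new poles.\<close>

definition gamma_factor :: "complex \<Rightarrow> complex" where "gamma_factor \<nu> = of_real pi powr (\<nu> / 2) * rGamma (\<nu> / 2)"

lemma gamma_factor_holomorphic: "gamma_factor holomorphic_on A"
proof -
  have "(\<lambda>\<nu>. exp (\<nu> / 2 * of_real (ln pi)) * rGamma (\<nu> / 2)) holomorphic_on A" by (intro holomorphic_intros) auto
  then show ?thesis by (simp add: gamma_factor_def[abs_def] of_real_powr_eq_exp)
qed

lemma gamma_factor_Gamma:
  assumes "Re \<nu> > 0"
  shows "gamma_factor \<nu> * (Gamma (\<nu> / 2) * of_real pi powr (- \<nu> / 2) * x) = x"
proof -
  have "\<nu> / 2 \<notin> \<int>\<^sub>\<le>\<^sub>0" using assms by (auto elim!: nonpos_Ints_cases simp: complex_eq_iff)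
  then have "rGamma (\<nu> / 2) * Gamma (\<nu> / 2) = 1" by (simp add: rGamma_inverse_Gamma Gamma_eq_zero_iff)
  moreover have "complex_of_real pi powr (\<nu> / 2) * of_real pi powr (- \<nu> / 2) = 1"
    by (simp add: of_real_powr_eq_exp exp_add[symmetric])
  ultimately show ?thesis unfolding gamma_factor_def by algebra
qed

text \<open>The constant P(0) over (0,1] has the Mellin integral 2/\<nu>; multiplied by
  \<open>gamma_factor\<close> its pole at 0 cancels, and this is the resulting entire
  function.\<close>

definition gamma_factor_shift :: "complex \<Rightarrow> complex" where "gamma_factor_shift \<nu> = of_real pi powr (\<nu> / 2) * rGamma (\<nu> / 2 + 1)"

lemma gamma_factor_shift_holomorphic: "gamma_factor_shift holomorphic_on A"
proof -
  have "(\<lambda>\<nu>. exp (\<nu> / 2 * of_real (ln pi)) * rGamma (\<nu> / 2 + 1)) holomorphic_on A" by (intro holomorphic_intros) auto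
  then show ?thesis by (simp add: gamma_factor_shift_def[abs_def] of_real_powr_eq_exp)
qed

lemma gamma_factor_gamma_factor_shift: "\<nu> \<noteq> 0 \<Longrightarrow> gamma_factor \<nu> * (1 / (\<nu> / 2)) = gamma_factor_shift \<nu>"
  using rGamma_plus1[of "\<nu> / 2"] by (simp add: gamma_factor_def gamma_factor_shift_def field_simps)

text \<open>The integral J of \<open>theta_int\<close> over (0,1] is left to the caller because it
  is evaluated in two ways: for \<beta> > 0 as the full Mellin integral minus the part over t > 1,
  for \<beta> = 0 term by term from the exact formula \<open>theta_int_0\<close>.\<close>

lemma mellin_split:
  assumes \<beta>: "0 \<le> \<beta>" "\<beta> \<le> beta_max" and \<nu>: "Re \<nu> > 0"
    and int: "integrable (count_space punctured_lattice) (\<lambda>z. cutoff_poly \<beta> z / of_real (norm z) powr \<nu>)"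
    and J: "has_bochner_integral lborel (\<lambda>t. indicator {0<..1} t *\<^sub>R (of_real t powr (\<nu> / 2 - 1) * theta_int \<beta> t)) J"
  shows "cutoff_series \<beta> \<nu> = gamma_factor \<nu> * (mellin_sum \<beta> \<nu> + mellin_diff \<beta> \<nu>) - P 0 * gamma_factor_shift \<nu> + 1 / of_real V * (gamma_factor \<nu> * J)"
proof -
  let ?p = "\<lambda>t::real. complex_of_real t powr (\<nu> / 2 - 1)"
  have n0: "\<nu> \<noteq> 0" using \<nu> by auto
  have S: "has_bochner_integral lborel (\<lambda>t. indicator {0<..} t *\<^sub>R (?p t * theta_sum \<beta> t)) (Gamma (\<nu> / 2) * of_real pi powr (- \<nu> / 2) * cutoff_series \<beta> \<nu>)"
    using mellin_transform[OF sigma_finite_punctured_lattice _ _ _ \<nu> int] unfolding cutoff_series_def theta_sum_def cutoff_gauss_def by (auto simp: AE_count_space)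
  have p: "has_bochner_integral lborel (\<lambda>t. indicator {0<..1} t *\<^sub>R ?p t) (1 / (\<nu> / 2))"
    using \<nu> by (intro integral_powr_0_1) simp
  have A: "has_bochner_integral lborel (\<lambda>t. indicator {1<..} t *\<^sub>R (?p t * theta_sum \<beta> t)) (mellin_sum \<beta> \<nu>)"
    unfolding mellin_sum_def mellin_on_def by (rule has_bochner_integral_integrable[OF mellin_sum_integrable])
  have B: "has_bochner_integral lborel (\<lambda>t. indicator {0<..1} t *\<^sub>R (?p t * theta_diff \<beta> t)) (mellin_diff \<beta> \<nu>)"
    unfolding mellin_diff_def mellin_on_def by (rule has_bochner_integral_integrable[OF mellin_diff_integrable[OF \<beta>]])
  have "has_bochner_integral lborel (\<lambda>t. indicator {1<..} t *\<^sub>R (?p t * theta_sum \<beta> t) + (indicator {0<..1} t *\<^sub>R (?p t * theta_diff \<beta> t)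
     + 1 / of_real V * (indicator {0<..1} t *\<^sub>R (?p t * theta_int \<beta> t)) - P 0 * (indicator {0<..1} t *\<^sub>R ?p t)))
     (mellin_sum \<beta> \<nu> + (mellin_diff \<beta> \<nu> + 1 / of_real V * J - P 0 * (1 / (\<nu> / 2))))"
    by (intro has_bochner_integral_add has_bochner_integral_diff has_bochner_integral_mult_right A B J p)
  also have "(\<lambda>t. indicator {1<..} t *\<^sub>R (?p t * theta_sum \<beta> t) + (indicator {0<..1} t *\<^sub>R (?p t * theta_diff \<beta> t)
     + 1 / of_real V * (indicator {0<..1} t *\<^sub>R (?p t * theta_int \<beta> t)) - P 0 * (indicator {0<..1} t *\<^sub>R ?p t)))
     = (\<lambda>t. indicator {0<..} t *\<^sub>R (?p t * theta_sum \<beta> t))"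
    by (rule ext) (auto simp: indicator_def theta_diff_def algebra_simps diff_divide_distrib)
  finally have "mellin_sum \<beta> \<nu> + (mellin_diff \<beta> \<nu> + 1 / of_real V * J - P 0 * (1 / (\<nu> / 2))) = Gamma (\<nu> / 2) * of_real pi powr (- \<nu> / 2) * cutoff_series \<beta> \<nu>"
    using S has_bochner_integral_eq by blast
  then have "cutoff_series \<beta> \<nu> = gamma_factor \<nu> * (mellin_sum \<beta> \<nu> + (mellin_diff \<beta> \<nu> + 1 / of_real V * J - P 0 * (1 / (\<nu> / 2))))"
    using gamma_factor_Gamma[OF \<nu>] by metis
  also have "\<dots> = gamma_factor \<nu> * (mellin_sum \<beta> \<nu> + mellin_diff \<beta> \<nu>) - P 0 * (gamma_factor \<nu> * (1 / (\<nu> / 2))) + 1 / of_real V * (gamma_factor \<nu> * J)"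
    by (simp add: algebra_simps)
  finally show ?thesis unfolding gamma_factor_gamma_factor_shift[OF n0] .
qed

section \<open>One expression for the sum-integral and for the Dirichlet series\<close>

definition polar_sum :: "nat \<Rightarrow> real \<Rightarrow> complex \<Rightarrow> complex" where
  "polar_sum N \<beta> \<nu> = (\<Sum>n<N. expansion_coeff n \<beta> / (of_nat CARD('n) / 2 + of_nat n - \<nu> / 2))"

definition regular_part :: "nat \<Rightarrow> real \<Rightarrow> complex \<Rightarrow> complex" where
  "regular_part N \<beta> \<nu> = gamma_factor \<nu> * (mellin_sum \<beta> \<nu> + mellin_diff \<beta> \<nu>) - P 0 * gamma_factor_shift \<nu> - 1 / of_real V * (gamma_factor \<nu> * mellin_rem N \<beta> \<nu>)"

text \<open>For \<beta> > 0 meaningful in Re \<nu> < d + 2N. At \<beta> = 0 and N > m the remainder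
  integral is zero by \<open>mellin_rem_0\<close>, and the expression lives on the whole
  plane.\<close>

definition continuation :: "nat \<Rightarrow> real \<Rightarrow> complex \<Rightarrow> complex" where
  "continuation N \<beta> \<nu> = regular_part N \<beta> \<nu> - 1 / of_real V * (gamma_factor \<nu> * polar_sum N \<beta> \<nu>)"

text \<open>In this strip the Hadamard integral is an ordinary one. The factor
  \<open>gamma_factor\<close> turns its Mellin integral back into the integral itself, which cancels
  against the subtracted term of the sum-integral.\<close>

lemma HSI_eq_continuation:
  assumes \<beta>: "0 < \<beta>" "\<beta> \<le> beta_max" and \<nu>: "0 < Re \<nu>" "Re \<nu> < real CARD('n)"
  shows "HSI M \<nu> (cutoff_poly \<beta>) = continuation N \<beta> \<nu>"
proof -
  let ?p = "\<lambda>t::real. complex_of_real t powr (\<nu> / 2 - 1)"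
  let ?K = "\<integral>z. cutoff_poly \<beta> z / of_real (norm z) powr \<nu> \<partial>lborel"
  let ?c = "Gamma (\<nu> / 2) * of_real pi powr (- \<nu> / 2)"
  have \<beta>1: "0 \<le> \<beta>" "\<beta> \<le> 1" using \<beta> beta_max by auto
  have int: "integrable lborel (\<lambda>z. cutoff_poly \<beta> z / of_real (norm z) powr \<nu>)"
    by (rule rapidly_decaying_integrable[OF rapidly_decaying_cutoff_poly[OF \<beta>(1) \<beta>1(2)] measurable_cutoff_poly \<nu>(2)])
  have K: "has_bochner_integral lborel (\<lambda>t. indicator {0<..} t *\<^sub>R (?p t * theta_int \<beta> t)) (?c * ?K)"
    using mellin_transform[OF lborel.sigma_finite_measure_axioms _ _ _ \<nu>(1) int] AE_lborel_singleton[of "0::real^'n"]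
    unfolding theta_int_def cutoff_gauss_def by simp
  have "has_bochner_integral lborel (\<lambda>t. indicator {0<..} t *\<^sub>R (?p t * theta_int \<beta> t) - indicator {1<..} t *\<^sub>R (?p t * theta_int \<beta> t))
     (?c * ?K - (polar_sum N \<beta> \<nu> + mellin_rem N \<beta> \<nu>))"
    unfolding polar_sum_def by (rule has_bochner_integral_diff[OF K theta_int_above_1[OF \<beta>1 \<nu>(2)]])
  also have "(\<lambda>t. indicator {0<..} t *\<^sub>R (?p t * theta_int \<beta> t) - indicator {1<..} t *\<^sub>R (?p t * theta_int \<beta> t)) = (\<lambda>t. indicator {0<..1} t *\<^sub>R (?p t * theta_int \<beta> t))"
    by (rule ext) (auto simp: indicator_def)
  finally have J: "has_bochner_integral lborel (\<lambda>t. indicator {0<..1} t *\<^sub>R (?p t * theta_int \<beta> t)) (?c * ?K - (polar_sum N \<beta> \<nu> + mellin_rem N \<beta> \<nu>))" .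
  have "gamma_factor \<nu> * (?c * ?K - (polar_sum N \<beta> \<nu> + mellin_rem N \<beta> \<nu>)) = ?K - gamma_factor \<nu> * (polar_sum N \<beta> \<nu> + mellin_rem N \<beta> \<nu>)"
    by (simp only: right_diff_distrib gamma_factor_Gamma[OF \<nu>(1)])
  with mellin_split[OF \<beta>1(1) \<beta>(2) \<nu>(1) cutoff_series_integrable[OF \<beta>(1) \<beta>1(2)] J]
  have "cutoff_series \<beta> \<nu> = continuation N \<beta> \<nu> + 1 / of_real V * ?K"
    by (simp add: continuation_def regular_part_def algebra_simps diff_divide_distrib add_divide_distrib)
  then show ?thesis unfolding HSI_cutoff_poly[OF \<beta>(1) \<beta>1(2)] fp_integral_low[OF measurable_cutoff_poly \<nu>(2) int] by simp
qed

text \<open>Here the powers of t are integrated over (0,1] instead of (1,\<infinity>). The sign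
  change between the two integrals makes J the negative of \<open>polar_sum\<close>, so the same
  expression arises as in the strip.\<close>

lemma Dirichlet_eq_continuation:
  assumes \<nu>: "Re \<nu> > real CARD('n) + real deg"
  shows "((\<lambda>z. P z / of_real (norm z) powr \<nu>) has_sum continuation (Suc deg) 0 \<nu>) punctured_lattice"
proof -
  let ?p = "\<lambda>t::real. complex_of_real t powr (\<nu> / 2 - 1)"
  have \<nu>0: "Re \<nu> > 0" using \<nu> by linarith
  have "has_bochner_integral lborel (\<lambda>t. expansion_coeff n 0 * (indicator {0<..1} t *\<^sub>R of_real t powr ((\<nu> / 2 - (of_nat CARD('n) / 2 + of_nat n)) - 1)))
    (expansion_coeff n 0 * (1 / (\<nu> / 2 - (of_nat CARD('n) / 2 + of_nat n))))" for n
  \<comment> \<open>Beyond the degree the power of t need not be integrable at 0, but there the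
    coefficient vanishes; otherwise d + 2n \<le> d + m < Re \<nu>.\<close>
  proof (cases "deg < 2 * n")
    case True
    then show ?thesis by (simp add: expansion_coeff_0_eq_0 has_bochner_integral_zero)
  next
    case False
    then have "real CARD('n) / 2 + real n < Re \<nu> / 2" using \<nu> by simp
    then show ?thesis by (intro has_bochner_integral_mult_right integral_powr_0_1) simp
  qed
  then have "has_bochner_integral lborel (\<lambda>t. \<Sum>n<Suc deg. expansion_coeff n 0 * (indicator {0<..1} t *\<^sub>R of_real t powr ((\<nu> / 2 - (of_nat CARD('n) / 2 + of_nat n)) - 1)))
    (\<Sum>n<Suc deg. expansion_coeff n 0 * (1 / (\<nu> / 2 - (of_nat CARD('n) / 2 + of_nat n))))"
    by (intro has_bochner_integral_sum)
  also have "(\<lambda>t. \<Sum>n<Suc deg. expansion_coeff n 0 * (indicator {0<..1} t *\<^sub>R of_real t powr ((\<nu> / 2 - (of_nat CARD('n) / 2 + of_nat n)) - 1))) =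
    (\<lambda>t. indicator {0<..1} t *\<^sub>R (?p t * theta_int 0 t))"
  proof
    fix t :: real
    show "(\<Sum>n<Suc deg. expansion_coeff n 0 * (indicator {0<..1} t *\<^sub>R of_real t powr ((\<nu> / 2 - (of_nat CARD('n) / 2 + of_nat n)) - 1))) =
      indicator {0<..1} t *\<^sub>R (?p t * theta_int 0 t)"
    proof (cases "t \<in> {0<..1}")
      case True
      have *: "of_real t powr ((\<nu> / 2 - (of_nat CARD('n) / 2 + of_nat n)) - 1) = ?p t * of_real t powr - (of_nat CARD('n) / 2 + of_nat n)" for n
        by (subst powr_add[symmetric]) (simp add: algebra_simps)
      show ?thesis using True theta_int_0[of t "Suc deg"] unfolding * by (simp add: sum_distrib_left mult_ac del: sum.lessThan_Suc)
    qed simp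
  qed
  also have "(\<Sum>n<Suc deg. expansion_coeff n 0 * (1 / (\<nu> / 2 - (of_nat CARD('n) / 2 + of_nat n)))) = - polar_sum (Suc deg) 0 \<nu>"
    unfolding polar_sum_def sum_negf[symmetric]
    by (rule sum.cong[OF refl]) (simp only: times_divide_eq_right mult_1_right minus_divide_right minus_diff_eq)
  finally have J: "has_bochner_integral lborel (\<lambda>t. indicator {0<..1} t *\<^sub>R (?p t * theta_int 0 t)) (- polar_sum (Suc deg) 0 \<nu>)" .
  have "cutoff_series 0 \<nu> = continuation (Suc deg) 0 \<nu>"
    using mellin_split[OF _ _ \<nu>0 _ J] beta_max cutoff_series_0_integrable[OF \<nu>] by (simp add: continuation_def regular_part_def mellin_rem_0)
  then show ?thesis
    using integrable_count_space_imp_has_sum[OF cutoff_series_0_integrable[OF \<nu>]] by (simp add: cutoff_series_def)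
qed

end

text \<open>Multiplying by w - \<nu> and letting \<nu> tend to w gives a = c G(w). The polar terms
  then combine to -c times a difference quotient of G, whose limit is the derivative.\<close>

lemma simple_pole_compare:
  fixes f g G :: "complex \<Rightarrow> complex"
  assumes U: "open U" "w \<in> U" and f: "f holomorphic_on U" and g: "g holomorphic_on U" and G: "G holomorphic_on U"
    and eq: "\<And>\<nu>. \<nu> \<in> U \<Longrightarrow> \<nu> \<noteq> w \<Longrightarrow> f \<nu> + a / (w - \<nu>) = g \<nu> + G \<nu> * (c / (w - \<nu>))"
  shows "f w = g w - c * deriv G w"
proof -
  have tends: "h \<midarrow>w\<rightarrow> h w" if "h holomorphic_on U" for h
    using holomorphic_on_imp_continuous_on[OF that] U by (simp add: continuous_on_eq_continuous_at isCont_def)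
  have ev: "\<forall>\<^sub>F \<nu> in at w. \<nu> \<in> U \<and> \<nu> \<noteq> w"
    using eventually_at_in_open[OF U] by (auto elim: eventually_mono)
  have "((\<lambda>\<nu>. (f \<nu> - g \<nu>) * (w - \<nu>) + a - c * G \<nu>) \<longlongrightarrow> (f w - g w) * (w - w) + a - c * G w) (at w)"
    by (intro tendsto_intros tends f g G)
  moreover have "\<forall>\<^sub>F \<nu> in at w. (f \<nu> - g \<nu>) * (w - \<nu>) + a - c * G \<nu> = 0"
    using ev
  proof eventually_elim
    case (elim \<nu>)
    have "f \<nu> - g \<nu> = (c * G \<nu> - a) / (w - \<nu>)"
      using eq[of \<nu>] elim by (simp add: algebra_simps diff_divide_distrib)
    then show ?case using elim by auto
  qed
  ultimately have "((\<lambda>\<nu>. 0) \<longlongrightarrow> (f w - g w) * (w - w) + a - c * G w) (at w)"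
    by (rule Lim_transform_eventually)
  then have a: "a = c * G w" using tendsto_unique[OF trivial_limit_at tendsto_const] by fastforce
  have "((\<lambda>\<nu>. (G \<nu> - G w) / (\<nu> - w)) \<longlongrightarrow> deriv G w) (at w)"
    using holomorphic_derivI[OF G U] by (simp add: has_field_derivative_iff)
  then have "((\<lambda>\<nu>. g \<nu> - c * ((G \<nu> - G w) / (\<nu> - w))) \<longlongrightarrow> g w - c * deriv G w) (at w)"
    by (intro tendsto_intros tends g)
  moreover have "\<forall>\<^sub>F \<nu> in at w. g \<nu> - c * ((G \<nu> - G w) / (\<nu> - w)) = f \<nu>"
    using ev
  proof eventually_elim
    case (elim \<nu>)
    have "f \<nu> = g \<nu> + (G \<nu> * (c / (w - \<nu>)) - a / (w - \<nu>))" using eq[of \<nu>] elim by (simp add: algebra_simps)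
    also have "G \<nu> * (c / (w - \<nu>)) - a / (w - \<nu>) = - (c * ((G \<nu> - G w) / (\<nu> - w)))"
      using elim unfolding a by (simp add: divide_simps) (simp add: algebra_simps)
    finally show ?case by simp
  qed
  ultimately have "(f \<longlongrightarrow> g w - c * deriv G w) (at w)" by (rule Lim_transform_eventually)
  with tends[OF f] show ?thesis using tendsto_unique[OF trivial_limit_at] by blast
qed

text \<open>Off the poles this is the identity theorem on \<open>U\<close> minus a finite set, which
  is still connected. At a pole the sums omit the term with zero denominator, so both sides are
  finite parts, and \<open>simple_pole_compare\<close> yields their difference.\<close>

lemma simple_pole_sums_compare:
  fixes F W G :: "complex \<Rightarrow> complex" and a c x :: "nat \<Rightarrow> complex"
  assumes U: "open U" "connected U" and F: "F holomorphic_on U" and W: "W holomorphic_on U" and G: "G holomorphic_on U"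
    and K: "finite K" "inj_on x K" and Y: "open Y" "Y \<noteq> {}" "Y \<subseteq> U - x ` K"
    and eq: "\<And>\<nu>. \<nu> \<in> Y \<Longrightarrow> F \<nu> + (\<Sum>k\<in>K. a k / (x k - \<nu>)) = W \<nu> + G \<nu> * (\<Sum>k\<in>K. c k / (x k - \<nu>))"
    and \<nu>: "\<nu> \<in> U"
  shows "F \<nu> + (\<Sum>k\<in>K. a k / (x k - \<nu>)) = W \<nu> + G \<nu> * (\<Sum>k\<in>K. c k / (x k - \<nu>)) - (\<Sum>k\<in>K. if \<nu> = x k then c k * deriv G \<nu> else 0)"
proof -
  have op: "open (V - x ` K')" if "open V" "K' \<subseteq> K" for V K'
    using that finite_subset[OF that(2) K(1)] by (intro open_Diff finite_imp_closed) auto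
  have hol: "(\<lambda>\<nu>. \<Sum>k\<in>K'. b k / (x k - \<nu>)) holomorphic_on V - x ` K'" for b V and K' :: "nat set"
    by (intro holomorphic_intros) auto
  have off: "F \<nu> + (\<Sum>k\<in>K. a k / (x k - \<nu>)) = W \<nu> + G \<nu> * (\<Sum>k\<in>K. c k / (x k - \<nu>))" if "\<nu> \<in> U - x ` K" for \<nu>
  proof (rule analytic_continuation_open[OF Y(1) _ Y(2) _ Y(3) _ _ eq that])
    show "open (U - x ` K)" by (rule op[OF U(1)]) simp
    show "connected (U - x ` K)"
      by (rule connected_open_diff_countable[OF _ U]) (use K in \<open>auto intro: countable_finite\<close>)
    show "(\<lambda>\<nu>. F \<nu> + (\<Sum>k\<in>K. a k / (x k - \<nu>))) holomorphic_on U - x ` K"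
      "(\<lambda>\<nu>. W \<nu> + G \<nu> * (\<Sum>k\<in>K. c k / (x k - \<nu>))) holomorphic_on U - x ` K"
      by (intro holomorphic_on_add holomorphic_on_mult hol; use F W G in \<open>auto intro: holomorphic_on_subset\<close>)+
  qed auto
  show ?thesis
  proof (cases "\<nu> \<in> x ` K")
    case False
    then show ?thesis using off[of \<nu>] \<nu> by (auto intro!: sum.neutral)
  next
    case True
    then obtain k where k: "k \<in> K" "\<nu> = x k" by auto
    define V where "V = U - x ` (K - {k})"
    have nk: "x k \<notin> x ` (K - {k})" using K(2) k by (auto simp: inj_on_def)
    have V: "open V" "x k \<in> V" using op[OF U(1), of "K - {k}"] nk \<nu> k by (auto simp: V_def)
    have sp: "(\<Sum>j\<in>K. b j / (x j - w)) = b k / (x k - w) + (\<Sum>j\<in>K - {k}. b j / (x j - w))" for b w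
      by (rule sum.remove[OF K(1) k(1)])
    have VU: "V \<subseteq> U" by (auto simp: V_def)
    have "F (x k) + (\<Sum>j\<in>K - {k}. a j / (x j - x k)) = W (x k) + G (x k) * (\<Sum>j\<in>K - {k}. c j / (x j - x k)) - c k * deriv G (x k)"
    proof (rule simple_pole_compare[OF V])
      show "(\<lambda>\<nu>. F \<nu> + (\<Sum>j\<in>K - {k}. a j / (x j - \<nu>))) holomorphic_on V"
        "(\<lambda>\<nu>. W \<nu> + G \<nu> * (\<Sum>j\<in>K - {k}. c j / (x j - \<nu>))) holomorphic_on V"
        unfolding V_def
        by (intro holomorphic_on_add holomorphic_on_mult hol; use F W G in \<open>auto intro: holomorphic_on_subset\<close>)+
      show "G holomorphic_on V" using G VU by (rule holomorphic_on_subset)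
      fix w assume w: "w \<in> V" "w \<noteq> x k"
      then have "w \<in> U - x ` K" by (auto simp: V_def)
      from off[OF this] show "F w + (\<Sum>j\<in>K - {k}. a j / (x j - w)) + a k / (x k - w) =
        W w + G w * (\<Sum>j\<in>K - {k}. c j / (x j - w)) + G w * (c k / (x k - w))"
        unfolding sp by (simp add: algebra_simps)
    qed
    moreover have "(\<Sum>j\<in>K. if \<nu> = x j then c j * deriv G \<nu> else 0) = (\<Sum>j\<in>K. if j = k then c k * deriv G (x k) else 0)"
      using K(2) k by (intro sum.cong refl) (auto simp: inj_on_def)
    ultimately show ?thesis using K(1) k unfolding k(2) sp by simp
  qed
qed

text \<open>The surface area is d times the volume of the unit ball; the functional equation of
  Gamma removes the factor d/2.\<close>

lemma measure_sphere_measure: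
  "measure (sphere_measure :: (real^'n) measure) UNIV = 2 * pi powr (real CARD('n) / 2) / Gamma (real CARD('n) / 2)"
proof -
  let ?d = "real CARD('n)"
  have g: "Gamma (?d / 2 + 1) = ?d / 2 * Gamma (?d / 2)" by (rule Gamma_plus1) (auto dest: nonpos_Ints_nonpos)
  have "emeasure (sphere_measure :: (real^'n) measure) UNIV = of_nat CARD('n) * emeasure lborel {y::real^'n. 0 < norm y \<and> norm y < 1 \<and> sgn y \<in> UNIV}"
    by (rule emeasure_sphere_measure) simp
  also have "{y::real^'n. 0 < norm y \<and> norm y < 1 \<and> sgn y \<in> UNIV} = ball 0 1 - {0}" by auto
  also have "emeasure lborel (ball 0 1 - {0::real^'n}) = emeasure lborel (ball (0::real^'n) 1)"
    by (rule emeasure_Diff_null_set) auto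
  also have "\<dots> = ennreal (unit_ball_vol ?d)" by (simp add: emeasure_ball)
  finally have "measure (sphere_measure :: (real^'n) measure) UNIV = ?d * unit_ball_vol ?d"
    unfolding measure_def by (simp add: enn2real_mult)
  also have "?d * unit_ball_vol ?d = 2 * pi powr (?d / 2) / Gamma (?d / 2)" unfolding unit_ball_vol_def g by simp
  finally show ?thesis .
qed

context cutoff_lattice begin

section \<open>The sum-integral at all exponents and its limit\<close>

lemma regular_part_holomorphic:
  assumes "0 \<le> \<beta>" "\<beta> \<le> beta_max"
  shows "regular_part N \<beta> holomorphic_on {\<nu>. Re \<nu> < real (CARD('n) + 2 * N)}"
proof -
  have "\<beta> \<le> 1" using assms beta_max by simp
  have "mellin_sum \<beta> holomorphic_on {\<nu>. Re \<nu> < real (CARD('n) + 2 * N)}" "mellin_diff \<beta> holomorphic_on {\<nu>. Re \<nu> < real (CARD('n) + 2 * N)}"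
    using mellin_sum_holomorphic mellin_diff_holomorphic[OF assms] by (auto intro: holomorphic_on_subset)
  then show ?thesis
    unfolding regular_part_def[abs_def] using mellin_rem_holomorphic[OF assms(1) \<open>\<beta> \<le> 1\<close>]
    by (intro holomorphic_intros gamma_factor_holomorphic gamma_factor_shift_holomorphic)
qed

text \<open>Indexed like the Hadamard side, with poles at all d + k; odd k contribute nothing. The
  factor 2 comes from d/2 + n - \<nu>/2 = (d + 2n - \<nu>)/2, the factor -1/V from the
  sum-integral.\<close>

definition polar_coeff :: "real \<Rightarrow> nat \<Rightarrow> complex" where
  "polar_coeff \<beta> k = (if even k then - (2 / of_real V) * expansion_coeff (k div 2) \<beta> else 0)"

lemma continuation_eq_sum: "continuation N \<beta> \<nu> = regular_part N \<beta> \<nu> + gamma_factor \<nu> * (\<Sum>k<2*N. polar_coeff \<beta> k / (of_nat (CARD('n) + k) - \<nu>))"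
proof -
  have "(\<Sum>k<2*N. polar_coeff \<beta> k / (of_nat (CARD('n) + k) - \<nu>)) = (\<Sum>k\<in>(\<lambda>n. 2 * n) ` {..<N}. polar_coeff \<beta> k / (of_nat (CARD('n) + k) - \<nu>))"
    by (rule sum.mono_neutral_right) (auto simp: polar_coeff_def elim!: evenE)
  also have "\<dots> = (\<Sum>n<N. polar_coeff \<beta> (2 * n) / (of_nat (CARD('n) + 2 * n) - \<nu>))"
    by (subst sum.reindex) (auto simp: inj_on_def)
  also have "\<dots> = (\<Sum>n<N. - (1 / of_real V) * (expansion_coeff n \<beta> / (of_nat CARD('n) / 2 + of_nat n - \<nu> / 2)))"
  proof (rule sum.cong[OF refl])
    fix n
    have *: "- (2 / v) * b / (2 * D) = - (1 / v) * (b / D)" for v b D :: complex by simp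
    have two_nat_ne: "(2::nat) \<noteq> 0" by simp
    have "complex_of_nat (CARD('n) + 2 * n) - \<nu> = 2 * (of_nat CARD('n) / 2 + of_nat n - \<nu> / 2)" by simp
    then show "polar_coeff \<beta> (2 * n) / (of_nat (CARD('n) + 2 * n) - \<nu>) = - (1 / of_real V) * (expansion_coeff n \<beta> / (of_nat CARD('n) / 2 + of_nat n - \<nu> / 2))"
      by (simp only: polar_coeff_def dvd_triv_left if_True nonzero_mult_div_cancel_left[OF two_nat_ne] *)
  qed
  also have "\<dots> = - (1 / of_real V) * polar_sum N \<beta> \<nu>" unfolding polar_sum_def sum_distrib_left ..
  finally show ?thesis by (simp add: continuation_def)
qed

text \<open>\<open>fp_integral_eq\<close> and \<open>continuation\<close> both have the form of a
  holomorphic function plus simple poles, and they agree in the strip 0 < Re \<nu> < d. The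
  comparison of finite parts extends this to the half-plane, poles included. The Taylor order is 2N
  - 1, so N \<ge> 1 is what makes the two pole lists coincide.\<close>

lemma HSI_eq:
  assumes \<beta>: "0 < \<beta>" "\<beta> \<le> beta_max" and N: "N \<ge> 1" and \<nu>: "Re \<nu> < real (CARD('n) + 2 * N)"
  shows "HSI M \<nu> (cutoff_poly \<beta>) = continuation N \<beta> \<nu> - (\<Sum>k<2*N. if \<nu> = of_nat (CARD('n) + k) then polar_coeff \<beta> k * deriv gamma_factor \<nu> else 0)"
proof -
  let ?U = "{\<nu>. Re \<nu> < real (CARD('n) + 2 * N)}"
  let ?Y = "{\<nu>. 0 < Re \<nu>} \<inter> {\<nu>. Re \<nu> < real CARD('n)}"
  let ?x = "\<lambda>k. complex_of_nat (CARD('n) + k)"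
  have \<beta>1: "\<beta> \<le> 1" using \<beta> beta_max by simp
  define F where "F \<nu> = cutoff_series \<beta> \<nu> - 1 / of_real V * fp_regular (cutoff_poly \<beta>) (2 * N - 1) \<nu>" for \<nu>
  define a where "a k = - (1 / of_real V) * sphere_moment (cutoff_poly \<beta>) k" for k
  have SN: "Suc (2 * N - 1) = 2 * N" using N by simp
  have fp: "fp_integral \<nu> (cutoff_poly \<beta>) = fp_regular (cutoff_poly \<beta>) (2 * N - 1) \<nu> + (\<Sum>k<2*N. sphere_moment (cutoff_poly \<beta>) k / (?x k - \<nu>))" if "\<nu> \<in> ?U" for \<nu>
    using fp_integral_eq[OF taylor_class_cutoff_poly[OF \<beta>(1) \<beta>1] rapidly_decaying_cutoff_poly[OF \<beta>(1) \<beta>1] measurable_cutoff_poly, of \<nu> "2 * N - 1"] that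
    unfolding SN lessThan_Suc_atMost[of "2 * N - 1", unfolded SN, symmetric] by blast
  have HSI: "HSI M \<nu> (cutoff_poly \<beta>) = F \<nu> + (\<Sum>k<2*N. a k / (?x k - \<nu>))" if "\<nu> \<in> ?U" for \<nu>
  proof -
    have "(\<Sum>k<2*N. a k / (?x k - \<nu>)) = - (1 / of_real V) * (\<Sum>k<2*N. sphere_moment (cutoff_poly \<beta>) k / (?x k - \<nu>))"
      unfolding sum_distrib_left a_def by (rule sum.cong[OF refl]) (simp only: times_divide_eq_right)
    then show ?thesis unfolding HSI_cutoff_poly[OF \<beta>(1) \<beta>1] fp[OF that] F_def by (simp add: algebra_simps)
  qed
  have "F \<nu> + (\<Sum>k<2*N. a k / (?x k - \<nu>)) = regular_part N \<beta> \<nu> + gamma_factor \<nu> * (\<Sum>k<2*N. polar_coeff \<beta> k / (?x k - \<nu>))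
    - (\<Sum>k<2*N. if \<nu> = ?x k then polar_coeff \<beta> k * deriv gamma_factor \<nu> else 0)"
  proof (rule simple_pole_sums_compare[where U = ?U and Y = ?Y])
    show "connected ?U" by (intro convex_connected convex_halfspace_Re_lt)
    show "F holomorphic_on ?U"
      unfolding F_def using holomorphic_fp_regular[OF taylor_class_cutoff_poly[OF \<beta>(1) \<beta>1] rapidly_decaying_cutoff_poly[OF \<beta>(1) \<beta>1] measurable_cutoff_poly, of "2 * N - 1"]
      unfolding SN by (intro holomorphic_intros holomorphic_on_subset[OF cutoff_series_holomorphic[OF \<beta>(1) \<beta>1]]) auto
    show "regular_part N \<beta> holomorphic_on ?U" using \<beta> by (intro regular_part_holomorphic) auto
    have "of_real (real CARD('n) / 2) \<in> ?Y" by simp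
    then show "?Y \<noteq> {}" by blast
    show "?Y \<subseteq> ?U - ?x ` {..<2*N}" by auto
    show "F w + (\<Sum>k<2*N. a k / (?x k - w)) = regular_part N \<beta> w + gamma_factor w * (\<Sum>k<2*N. polar_coeff \<beta> k / (?x k - w))" if "w \<in> ?Y" for w
      using HSI_eq_continuation[OF \<beta>, of w N] HSI[of w] that unfolding continuation_eq_sum by auto
  qed (use \<nu> in \<open>auto intro: gamma_factor_holomorphic open_halfspace_Re_lt open_halfspace_Re_gt open_Int simp: inj_on_def\<close>)
  then show ?thesis using HSI[of \<nu>] \<nu> unfolding continuation_eq_sum by simp
qed

lemma continuation_stable:
  assumes "N \<ge> Suc deg"
  shows "continuation N 0 \<nu> = continuation (Suc deg) 0 \<nu>"
proof -
  have "polar_sum N 0 \<nu> = polar_sum (Suc deg) 0 \<nu>"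
    unfolding polar_sum_def by (rule sum.mono_neutral_right) (use assms in \<open>auto simp: expansion_coeff_0_eq_0\<close>)
  then show ?thesis using assms by (simp add: continuation_def regular_part_def mellin_rem_0)
qed

lemma gamma_factor_ne_0: "Re \<nu> > 0 \<Longrightarrow> gamma_factor \<nu> \<noteq> 0"
  using gamma_factor_Gamma[of \<nu> 1] by auto

text \<open>The duplication formula for (2k)! cancels the Pochhammer symbol at 1/2, and the
  Pochhammer symbol at d/2 moves the Gamma value in the surface area from d/2 to d/2 + k.\<close>

lemma dirichlet_residue_eq:
  "dirichlet_residue M P k = 2 / of_real V * (gamma_factor (of_nat (CARD('n) + 2 * k)) * expansion_coeff k 0)"
proof -
  let ?d = "real CARD('n)"
  have d: "?d / 2 \<notin> \<int>\<^sub>\<le>\<^sub>0" by (auto dest: nonpos_Ints_nonpos)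
  have G: "Gamma (?d / 2) > 0" "Gamma (?d / 2 + real k) > 0" by (auto intro!: Gamma_real_pos add_pos_nonneg)
  have p: "pi powr (?d / 2 + real k) = pi powr (?d / 2) * pi ^ k" by (simp add: powr_add powr_realpow)
  have four: "(2::real) ^ (2 * k) = 4 ^ k" by (simp add: power_mult)
  have "measure (sphere_measure :: (real^'n) measure) UNIV / V * (pochhammer (1/2) k / (fact (2 * k) * pochhammer (?d / 2) k)) =
    2 / V * (pi powr (?d / 2) / Gamma (?d / 2 + real k)) / (fact k * 4 ^ k)"
    unfolding measure_sphere_measure pochhammer_Gamma[OF d] fact_double four
    using G V_pos by (simp add: field_simps pochhammer_pos less_imp_neq[symmetric])
  also have "\<dots> = 2 / V * (pi powr (?d / 2 + real k) * rGamma (?d / 2 + real k)) / (fact k * (4 * pi) ^ k)"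
    unfolding p by (simp add: power_mult_distrib rGamma_inverse_Gamma field_simps)
  finally have r: "measure (sphere_measure :: (real^'n) measure) UNIV / V * (pochhammer (1/2) k / (fact (2 * k) * pochhammer (?d / 2) k)) =
    2 / V * (pi powr (?d / 2 + real k) * rGamma (?d / 2 + real k)) / (fact k * (4 * pi) ^ k)" .
  have h: "complex_of_nat (CARD('n) + 2 * k) / 2 = of_real (?d / 2 + real k)" by (simp add: field_simps)
  have GGr: "gamma_factor (of_nat (CARD('n) + 2 * k)) = of_real (pi powr (?d / 2 + real k) * rGamma (?d / 2 + real k))"
    unfolding gamma_factor_def h by (simp only: of_real_mult rGamma_complex_of_real powr_of_real[OF pi_ge_zero])
  have "dirichlet_residue M P k = of_real (measure (sphere_measure :: (real^'n) measure) UNIV / V * (pochhammer (1/2) k / (fact (2 * k) * pochhammer (?d / 2) k))) * (laplacian ^^ k) P 0"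
    unfolding dirichlet_residue_def of_real_mult ..
  also have "\<dots> = 2 / of_real V * (gamma_factor (of_nat (CARD('n) + 2 * k)) * expansion_coeff k 0)"
    unfolding r GGr expansion_coeff_0 coeff_gauss_poly_0 by simp
  finally show ?thesis .
qed

lemma dirichlet_residue_eq_0_iff: "dirichlet_residue M P k = 0 \<longleftrightarrow> expansion_coeff k 0 = 0"
proof -
  have "0 < Re (of_nat (CARD('n) + 2 * k))" by (simp add: add_pos_nonneg)
  from gamma_factor_ne_0[OF this] show ?thesis unfolding dirichlet_residue_eq using V_pos by simp
qed

text \<open>All constituents of \<open>continuation\<close> converge for fixed \<nu>. The
  finite-part correction may be non-zero for every \<beta> > 0, but at a point without residue its
  coefficient tends to zero.\<close>

lemma HSI_tendsto:
  assumes "\<nu> \<notin> {of_nat (CARD('n) + 2 * k) | k. dirichlet_residue M P k \<noteq> 0}"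
  shows "((\<lambda>\<beta>. HSI M \<nu> (cutoff_poly \<beta>)) \<longlongrightarrow> continuation (Suc deg) 0 \<nu>) (at_right 0)"
proof -
  obtain K where K: "Re \<nu> < real K" using reals_Archimedean2 by blast
  \<comment> \<open>Large enough both for \<nu> to lie in the half-plane of \<open>HSI_eq\<close>
    and for the remainder at \<beta> = 0 to vanish.\<close>
  define N where "N = Suc deg + K"
  have N: "N \<ge> Suc deg" "N \<ge> 1" by (simp_all add: N_def)
  have "real K \<le> real (CARD('n) + 2 * N)" unfolding N_def of_nat_le_iff by simp
  with K have N3: "Re \<nu> < real (CARD('n) + 2 * N)" by linarith
  have "((\<lambda>\<beta>. continuation N \<beta> \<nu> - (\<Sum>k<2*N. if \<nu> = of_nat (CARD('n) + k) then polar_coeff \<beta> k * deriv gamma_factor \<nu> else 0)) \<longlongrightarrow> continuation N 0 \<nu> - (\<Sum>k<2*N. 0)) (at_right 0)"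
  proof (intro tendsto_diff tendsto_sum)
    have "((\<lambda>\<beta>. polar_sum N \<beta> \<nu>) \<longlongrightarrow> polar_sum N 0 \<nu>) (at_right 0)"
      unfolding polar_sum_def divide_inverse by (intro tendsto_intros expansion_coeff_tendsto)
    then show "((\<lambda>\<beta>. continuation N \<beta> \<nu>) \<longlongrightarrow> continuation N 0 \<nu>) (at_right 0)"
      unfolding continuation_def regular_part_def by (intro tendsto_intros mellin_sum_tendsto mellin_diff_tendsto mellin_rem_tendsto N3)
    fix k
    show "((\<lambda>\<beta>. if \<nu> = of_nat (CARD('n) + k) then polar_coeff \<beta> k * deriv gamma_factor \<nu> else 0) \<longlongrightarrow> 0) (at_right 0)"
    proof (cases "\<nu> = of_nat (CARD('n) + k) \<and> even k")
      case True
      then obtain n where n: "k = 2 * n" by (auto elim: evenE)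
      then have "expansion_coeff n 0 = 0" using assms True dirichlet_residue_eq_0_iff[of n] by blast
      then have "((\<lambda>\<beta>. - (2 / of_real V) * expansion_coeff n \<beta> * deriv gamma_factor \<nu>) \<longlongrightarrow> - (2 / of_real V) * 0 * deriv gamma_factor \<nu>) (at_right 0)"
        using expansion_coeff_tendsto[of n] by (intro tendsto_intros) simp
      then show ?thesis using True n by (simp add: polar_coeff_def)
    next
      case False
      then have "(if \<nu> = of_nat (CARD('n) + k) then polar_coeff \<beta> k * deriv gamma_factor \<nu> else 0) = 0" for \<beta>
        by (auto simp: polar_coeff_def)
      then show ?thesis by simp
    qed
  qed
  then have "((\<lambda>\<beta>. continuation N \<beta> \<nu> - (\<Sum>k<2*N. if \<nu> = of_nat (CARD('n) + k) then polar_coeff \<beta> k * deriv gamma_factor \<nu> else 0)) \<longlongrightarrow> continuation (Suc deg) 0 \<nu>) (at_right 0)"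
    using continuation_stable[OF N(1), of \<nu>] by simp
  moreover have "\<forall>\<^sub>F \<beta> in at_right 0. \<beta> \<in> {0<..<beta_max}" using beta_max by (intro eventually_at_right_real)
  then have "\<forall>\<^sub>F \<beta> in at_right 0. continuation N \<beta> \<nu> - (\<Sum>k<2*N. if \<nu> = of_nat (CARD('n) + k) then polar_coeff \<beta> k * deriv gamma_factor \<nu> else 0) = HSI M \<nu> (cutoff_poly \<beta>)"
    by eventually_elim (subst HSI_eq, use N N3 in auto)
  ultimately show ?thesis by (rule Lim_transform_eventually)
qed

lemma HSI_fourier_tendsto:
  assumes "\<nu> \<notin> {of_nat (CARD('n) + 2 * k) | k. dirichlet_residue M P k \<noteq> 0}"
  shows "((\<lambda>\<beta>. HSI M \<nu> (\<lambda>z. fourier (scaled \<phi> \<beta>) z * P z)) \<longlongrightarrow> continuation (Suc deg) 0 \<nu>) (at_right 0)"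
proof (rule Lim_transform_eventually[OF HSI_tendsto[OF assms]])
  have "\<forall>\<^sub>F \<beta>::real in at_right 0. \<beta> \<in> {0<..<1}" by (intro eventually_at_right_real) simp
  then show "\<forall>\<^sub>F \<beta> in at_right 0. HSI M \<nu> (cutoff_poly \<beta>) = HSI M \<nu> (\<lambda>z. fourier (scaled \<phi> \<beta>) z * P z)"
    by eventually_elim (simp add: cutoff_poly_eq_fourier)
qed

section \<open>Poles and residues of the limit\<close>

definition entire_part :: "complex \<Rightarrow> complex" where "entire_part \<nu> = gamma_factor \<nu> * (mellin_sum 0 \<nu> + mellin_diff 0 \<nu>) - P 0 * gamma_factor_shift \<nu>"

lemma entire_part_holomorphic: "entire_part holomorphic_on A"
proof -
  have "mellin_sum 0 holomorphic_on A" "mellin_diff 0 holomorphic_on A"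
    using mellin_sum_holomorphic mellin_diff_holomorphic[of 0] beta_max by (auto intro: holomorphic_on_subset)
  then show ?thesis unfolding entire_part_def[abs_def] by (intro holomorphic_intros gamma_factor_holomorphic gamma_factor_shift_holomorphic)
qed

definition polar_numerator :: "nat \<Rightarrow> complex \<Rightarrow> complex" where "polar_numerator n \<nu> = 2 / of_real V * (gamma_factor \<nu> * expansion_coeff n 0)"

lemma continuation_0: "continuation (Suc deg) 0 \<nu> = entire_part \<nu> + (\<Sum>n<Suc deg. polar_numerator n \<nu> / (\<nu> - of_nat (CARD('n) + 2 * n)))"
proof -
  have "- (1 / of_real V) * (gamma_factor \<nu> * (expansion_coeff n 0 / (of_nat CARD('n) / 2 + of_nat n - \<nu> / 2))) = polar_numerator n \<nu> / (\<nu> - of_nat (CARD('n) + 2 * n))" for n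
  proof -
    have "of_nat CARD('n) / 2 + of_nat n - \<nu> / 2 = - ((\<nu> - of_nat (CARD('n) + 2 * n)) / 2)" by (simp add: field_simps)
    then show ?thesis by (simp only:) (simp add: polar_numerator_def)
  qed
  then have "- (1 / of_real V) * (gamma_factor \<nu> * polar_sum (Suc deg) 0 \<nu>) = (\<Sum>n<Suc deg. polar_numerator n \<nu> / (\<nu> - of_nat (CARD('n) + 2 * n)))"
    unfolding polar_sum_def sum_distrib_left by simp
  then show ?thesis by (simp add: continuation_def regular_part_def entire_part_def mellin_rem_0)
qed

lemma polar_numerator_holomorphic: "polar_numerator n holomorphic_on A"
  unfolding polar_numerator_def[abs_def] by (intro holomorphic_intros gamma_factor_holomorphic)

lemma continuation_0_meromorphic: "continuation (Suc deg) 0 meromorphic_on UNIV"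
proof -
  have "(\<lambda>\<nu>. entire_part \<nu> + (\<Sum>n<Suc deg. polar_numerator n \<nu> / (\<nu> - of_nat (CARD('n) + 2 * n)))) meromorphic_on UNIV"
    using entire_part_holomorphic[of UNIV] polar_numerator_holomorphic[of _ UNIV]
    by (intro meromorphic_intros analytic_on_imp_meromorphic_on) (simp_all only: analytic_on_open open_UNIV)
  then show ?thesis by (simp only: continuation_0[abs_def])
qed

lemma continuation_0_holomorphic: "continuation (Suc deg) 0 holomorphic_on - {of_nat (CARD('n) + 2 * k) | k. dirichlet_residue M P k \<noteq> 0}"
proof -
  have "(\<lambda>\<nu>. polar_numerator n \<nu> / (\<nu> - of_nat (CARD('n) + 2 * n))) holomorphic_on - {of_nat (CARD('n) + 2 * k) | k. dirichlet_residue M P k \<noteq> 0}" for n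
  proof (cases "expansion_coeff n 0 = 0")
    case True
    then show ?thesis by (simp add: polar_numerator_def)
  next
    case False
    then show ?thesis by (intro holomorphic_intros polar_numerator_holomorphic) (use dirichlet_residue_eq_0_iff[of n] in auto)
  qed
  then have "(\<lambda>\<nu>. entire_part \<nu> + (\<Sum>n<Suc deg. polar_numerator n \<nu> / (\<nu> - of_nat (CARD('n) + 2 * n)))) holomorphic_on - {of_nat (CARD('n) + 2 * k) | k. dirichlet_residue M P k \<noteq> 0}"
    by (intro holomorphic_on_add holomorphic_on_sum entire_part_holomorphic)
  then show ?thesis by (simp only: continuation_0[abs_def])
qed

text \<open>The other polar terms are regular near the point, and the whole is brought over the
  common denominator. Points with vanishing residue are included; there g has a zero.\<close>

lemma continuation_0_near_pole:
  obtains S g where "open S" "of_nat (CARD('n) + 2 * k) \<in> S" "g holomorphic_on S"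
    "g (of_nat (CARD('n) + 2 * k)) = dirichlet_residue M P k"
    "\<And>\<nu>. \<nu> \<in> S \<Longrightarrow> \<nu> \<noteq> of_nat (CARD('n) + 2 * k) \<Longrightarrow> continuation (Suc deg) 0 \<nu> = g \<nu> / (\<nu> - of_nat (CARD('n) + 2 * k))"
proof -
  let ?x = "\<lambda>k. complex_of_nat (CARD('n) + 2 * k)"
  define S where "S = - ?x ` ({..<Suc deg} - {k})"
  define h where "h \<nu> = entire_part \<nu> + (\<Sum>n\<in>{..<Suc deg} - {k}. polar_numerator n \<nu> / (\<nu> - ?x n))" for \<nu>
  define g where "g \<nu> = h \<nu> * (\<nu> - ?x k) + polar_numerator k \<nu>" for \<nu>
  show thesis
  proof (rule that[of S g])
    show "open S" unfolding S_def by (intro open_Compl finite_imp_closed) auto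
    show "?x k \<in> S" by (auto simp: S_def simp del: of_nat_add)
    have "h holomorphic_on S"
      unfolding h_def by (intro holomorphic_intros entire_part_holomorphic polar_numerator_holomorphic) (auto simp: S_def)
    then show "g holomorphic_on S" unfolding g_def[abs_def] by (intro holomorphic_intros polar_numerator_holomorphic)
    show "g (?x k) = dirichlet_residue M P k" by (simp add: g_def polar_numerator_def dirichlet_residue_eq)
    fix \<nu> assume \<nu>: "\<nu> \<in> S" "\<nu> \<noteq> ?x k"
    have "(\<Sum>n<Suc deg. polar_numerator n \<nu> / (\<nu> - ?x n)) = polar_numerator k \<nu> / (\<nu> - ?x k) + (\<Sum>n\<in>{..<Suc deg} - {k}. polar_numerator n \<nu> / (\<nu> - ?x n))"
    proof (cases "k < Suc deg")
      case True
      then show ?thesis by (intro sum.remove) auto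
    next
      case False
      \<comment> \<open>Beyond the summation range no term is removed, and the numerator added for k
        is identically zero.\<close>
      then have "{..<Suc deg} - {k} = {..<Suc deg}" "polar_numerator k \<nu> = 0" by (auto simp: polar_numerator_def expansion_coeff_0_eq_0)
      then show ?thesis by simp
    qed
    then show "continuation (Suc deg) 0 \<nu> = g \<nu> / (\<nu> - ?x k)"
      using \<nu>(2) unfolding continuation_0 g_def h_def add_divide_distrib by simp
  qed
qed

lemma continuation_0_residue: "residue (continuation (Suc deg) 0) (of_nat (CARD('n) + 2 * k)) = dirichlet_residue M P k"
  and continuation_0_pole: "dirichlet_residue M P k \<noteq> 0 \<Longrightarrow> is_pole (continuation (Suc deg) 0) (of_nat (CARD('n) + 2 * k))"
  and continuation_0_zorder: "dirichlet_residue M P k \<noteq> 0 \<Longrightarrow> zorder (continuation (Suc deg) 0) (of_nat (CARD('n) + 2 * k)) = -1"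
proof -
  let ?x = "complex_of_nat (CARD('n) + 2 * k)"
  obtain S g where g: "open S" "?x \<in> S" "g holomorphic_on S" "g ?x = dirichlet_residue M P k"
    "\<And>\<nu>. \<nu> \<in> S \<Longrightarrow> \<nu> \<noteq> ?x \<Longrightarrow> continuation (Suc deg) 0 \<nu> = g \<nu> / (\<nu> - ?x)" using continuation_0_near_pole[of k] by blast
  have ev: "\<forall>\<^sub>F \<nu> in at ?x. continuation (Suc deg) 0 \<nu> = g \<nu> / (\<nu> - ?x)"
    using eventually_at_in_open[OF g(1,2)] by eventually_elim (use g(5) in auto)
  show "residue (continuation (Suc deg) 0) ?x = dirichlet_residue M P k"
    unfolding residue_cong[OF ev refl] residue_simple[OF g(1-3)] by (rule g(4))
  assume r: "dirichlet_residue M P k \<noteq> 0"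
  show "is_pole (continuation (Suc deg) 0) ?x"
    unfolding is_pole_cong[OF ev refl] using is_pole_basic[OF g(3,1,2), of 1] g(4) r by simp
  show "zorder (continuation (Suc deg) 0) ?x = -1"
    by (rule zorder_eqI[OF g(1-3)]) (use g(4,5) r in \<open>simp_all add: divide_inverse power_int_minus\<close>)
qed

end

theorem theorem5p6:
  fixes M :: "real^'n^'n"
    and \<phi> :: "real^'n \<Rightarrow> real"
    and p :: "('n \<Rightarrow> nat) \<Rightarrow>\<^sub>0 complex"
    and P :: "real^'n \<Rightarrow> complex"
    and m :: nat
  assumes "invertible M"
    and "smooth_cutoff \<phi>"
    and "P = poly_fun p"
    and "m = total_degree p"
  shows "\<exists>Z :: complex \<Rightarrow> complex.
      (\<forall>\<nu>. Re \<nu> > real CARD('n) + real m \<longrightarrow>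
         ((\<lambda>z. P z / of_real (norm z) powr \<nu>) has_sum Z \<nu>) (lattice_of M - {0})) \<and>
      (\<forall>\<nu>. \<nu> \<notin> {of_nat (CARD('n) + 2 * k) | k. dirichlet_residue M P k \<noteq> 0} \<longrightarrow>
         ((\<lambda>\<beta>. HSI M \<nu> (\<lambda>z. fourier (scaled \<phi> \<beta>) z * P z)) \<longlongrightarrow> Z \<nu>) (at_right 0)) \<and>
      (\<forall>\<nu>. Re \<nu> > real CARD('n) + real m \<longrightarrow>
         ((\<lambda>\<beta>. HSI M \<nu> (\<lambda>z. fourier (scaled \<phi> \<beta>) z * P z)) \<longlongrightarrow> Z \<nu>) (at_right 0)) \<and>
      Z meromorphic_on UNIV \<and>
      Z holomorphic_on - {of_nat (CARD('n) + 2 * k) | k. dirichlet_residue M P k \<noteq> 0} \<and>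
      (\<forall>k. residue Z (of_nat (CARD('n) + 2 * k)) = dirichlet_residue M P k) \<and>
      (\<forall>k. dirichlet_residue M P k \<noteq> 0 \<longrightarrow>
         is_pole Z (of_nat (CARD('n) + 2 * k)) \<and> zorder Z (of_nat (CARD('n) + 2 * k)) = -1)"
proof -
  interpret cutoff_lattice M \<phi> p by unfold_locales (fact assms)+
  let ?Z = "continuation (Suc (total_degree p)) 0"
  \<comment> \<open>A candidate pole to the right of d + m would have 2k > m, and then the residue
    vanishes by the degree bound at frequency 0.\<close>
  have no_pole: "\<nu> \<notin> {of_nat (CARD('n) + 2 * k) | k. dirichlet_residue M (poly_fun p) k \<noteq> 0}"
    if \<nu>: "Re \<nu> > real CARD('n) + real (total_degree p)" for \<nu>
  proof clarify
    fix k assume k: "\<nu> = of_nat (CARD('n) + 2 * k)" "dirichlet_residue M (poly_fun p) k \<noteq> 0"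
    then have "total_degree p < 2 * k" using \<nu> by simp
    then show False using k(2) dirichlet_residue_eq_0_iff expansion_coeff_0_eq_0 by blast
  qed
  show ?thesis
    unfolding assms(3,4)
    using Dirichlet_eq_continuation HSI_fourier_tendsto HSI_fourier_tendsto[OF no_pole] continuation_0_meromorphic continuation_0_holomorphic
      continuation_0_residue continuation_0_pole continuation_0_zorder
    by (intro exI[of _ ?Z] conjI allI impI)
qed

end
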